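(* Let $d\ge 3$ and let $D$ be the closure of a smooth bounded domain, or of an open sup-norm ball, of $\mathbb{R}^d$ that contains $0$. Suppose that $u_0\in(0,u_* )$ is such that $\theta_0$ is $C^1$ on a neighborhood of $[0,u_0]$ (in $[0,\infty)$). Then for any $u\in(0,u_0)$ there are positive constants $c_1(u,u_0,D)<\theta_0(u_* )-\theta_0(u)$ and $c_2(u,u_0,D)>0$ such that for every $\nu\in[\theta_0(u),\theta_0(u)+c_1]$, any minimizer $\varphi$ of $$\min\Big\{\frac{1}{2d}\int_{\mathbb{R}^d}|\nabla\varphi|^2\,dz;\ \varphi\ge 0,\ \varphi\in D^1(\mathbb{R}^d),\ \frac{1}{|D|}\int_D\overline{\theta}_0\big((\sqrt{u}+\varphi)^2\big)\,dz\ge\nu\Big\}$$ is $C^{1,\alpha}$ for all $0<\alpha<1$ and satisfies $$0\le\varphi\le\big\{c_2\,(\nu-\theta_0(u))\big\}\wedge(\sqrt{u_0}-\sqrt{u})\quad(<\sqrt{u_*}-\sqrt{u}).$$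
   Context: Let $d\ge 3$. For finite $K\subset\mathbb{Z}^d$, $\mathrm{cap}(K)$ denotes the capacity of $K$ for the simple random walk on $\mathbb{Z}^d$, normalized so that $\mathrm{cap}(\{0\})=1/g(0,0)$, where $g(\cdot,\cdot)$ is the Green function of the simple random walk on $\mathbb{Z}^d$. Under the probability $\mathbb{P}$, $\mathcal{I}^u$, $u\ge 0$, denotes the random interlacements at level $u$ on $\mathbb{Z}^d$ (increasing in $u$), and $\mathcal{V}^u=\mathbb{Z}^d\setminus\mathcal{I}^u$ the vacant set at level $u$; the law of $\mathcal{V}^u$ is characterized by $\mathbb{P}[K\subset\mathcal{V}^u]=e^{-u\,\mathrm{cap}(K)}$ for all finite $K\subset\mathbb{Z}^d$. Connectivity is nearest-neighbor connectivity in $\mathbb{Z}^d$. The percolation function is $\theta_0(u)=\mathbb{P}[0 \text{ does not belong to an infinite cluster of }\mathcal{V}^u]$, $u\ge 0$. The critical level $u_*\in(0,\infty)$ is such that $\theta_0=1$ on $(u_*,\infty)$ and $\theta_0<1$ on $(0,u_* )$ (it is known that such a $u_*$ exists). The function $\theta_0$ is known to be non-decreasing, left-continuous, and continuous except maybe at $u_*$. Its right-continuous modification is $\overline{\theta}_0(u)=\theta_0(u)$ for $0\le u<u_*$ and $\overline{\theta}_0(u)=1$ for $u\ge u_*$. $D^1(\mathbb{R}^d)$ is the space of locally integrable functions $f$ on $\mathbb{R}^d$ with finite Dirichlet energy (i.e. with distributional gradient in $L^2$) that decay at infinity, in the sense that $\{|f|>a\}$ has finite Lebesgue measure for all $a>0$;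 functions equal a.e. are identified. $|D|$ is the Lebesgue measure of $D$. $C^{1,\alpha}$ stands for the $C^1$-functions on $\mathbb{R}^d$ with $\alpha$-Hölder continuous partial derivatives. Constants may also depend on the dimension $d$. *)

theory Defs
  imports "HOL-Probability.Probability"
begin

text \<open>The lattice $Z^d$ is the type \<open>int ^ 'n\<close> and $R^d$ is the type \<open>real ^ 'n\<close>,
  with \<open>d = CARD('n)\<close>.\<close>

section \<open>Simple random walk and capacity\<close>

definition lattice_adj :: "int ^ 'n \<Rightarrow> int ^ 'n \<Rightarrow> bool" where
  "lattice_adj x y \<longleftrightarrow> (\<Sum>i\<in>UNIV. \<bar>x $ i - y $ i\<bar>) = 1"

definition srw_steps :: "(nat \<Rightarrow> int ^ 'n) measure" where
  "srw_steps = (\<Pi>\<^sub>M k\<in>UNIV. measure_pmf (pmf_of_set {e. lattice_adj 0 e}))"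

definition walk :: "int ^ 'n \<Rightarrow> nat \<Rightarrow> (nat \<Rightarrow> int ^ 'n) \<Rightarrow> int ^ 'n" where
  "walk x n \<omega> = x + (\<Sum>k<n. \<omega> k)"

text \<open>The capacity of a finite set is the total mass of its equilibrium measure
  $e_K(x) = P_x[X_n \notin K \mbox{ for all } n \ge 1]$, $x \in K$. In particular the capacity
  of $\{0\}$ is the escape probability of the walk, that is $1/g(0,0)$ for
  $g(x,y) = \sum_{n \ge 0} P_x[X_n = y]$, which is the normalization in use here.\<close>

definition escape_prob :: "(int ^ 'n) set \<Rightarrow> int ^ 'n \<Rightarrow> real" where
  "escape_prob K x =
     measure srw_steps {\<omega> \<in> space srw_steps. \<forall>n\<ge>1. walk x n \<omega> \<notin> K}"

definition capacity :: "(int ^ 'n) set \<Rightarrow> real" where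
  "capacity K = (\<Sum>x\<in>K. escape_prob K x)"

section \<open>Random interlacements and percolation of the vacant set\<close>

text \<open>\<open>\<I> u \<omega>\<close> is the interlacement set at level \<open>u\<close>, and \<open>- \<I> u \<omega>\<close> is the vacant set.
  The last clause determines the law of the vacant set at each single level. The joint law over
  several levels is constrained only through monotonicity; the percolation function and the
  critical level depend on the single-level laws only.\<close>

definition random_interlacements :: "'a measure \<Rightarrow> (real \<Rightarrow> 'a \<Rightarrow> (int ^ 'n) set) \<Rightarrow> bool" where
  "random_interlacements M \<I> \<longleftrightarrow>
     prob_space M \<and>
     (\<forall>u\<ge>0. \<forall>x. {\<omega> \<in> space M. x \<in> \<I> u \<omega>} \<in> sets M) \<and>
     (\<forall>\<omega>\<in>space M. \<forall>u\<ge>0. \<forall>v\<ge>u. \<I> u \<omega> \<subseteq> \<I> v \<omega>) \<and>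
     (\<forall>u\<ge>0. \<forall>K. finite K \<longrightarrow>
        measure M {\<omega> \<in> space M. K \<subseteq> - \<I> u \<omega>} = exp (- u * capacity K))"

definition cluster :: "(int ^ 'n) set \<Rightarrow> int ^ 'n \<Rightarrow> (int ^ 'n) set" where
  "cluster S x =
     (if x \<in> S then {y. (x, y) \<in> {(a, b). a \<in> S \<and> b \<in> S \<and> lattice_adj a b}\<^sup>*} else {})"

definition perc_fun :: "'a measure \<Rightarrow> (real \<Rightarrow> 'a \<Rightarrow> (int ^ 'n) set) \<Rightarrow> real \<Rightarrow> real" where
  "perc_fun M \<I> u = measure M {\<omega> \<in> space M. \<not> infinite (cluster (- \<I> u \<omega>) 0)}"

definition is_critical_level :: "(real \<Rightarrow> real) \<Rightarrow> real \<Rightarrow> bool" where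
  "is_critical_level \<theta> us \<longleftrightarrow>
     0 < us \<and> (\<forall>u>us. \<theta> u = 1) \<and> (\<forall>u. 0 < u \<and> u < us \<longrightarrow> \<theta> u < 1)"

definition right_cont_mod :: "(real \<Rightarrow> real) \<Rightarrow> real \<Rightarrow> real \<Rightarrow> real" where
  "right_cont_mod \<theta> us u = (if u < us then \<theta> u else 1)"

text \<open>Differentiability within \<open>S\<close>: one-sided at the end point \<open>0\<close> of \<open>{0..}\<close>.\<close>

definition C1_real_on :: "real set \<Rightarrow> (real \<Rightarrow> real) \<Rightarrow> bool" where
  "C1_real_on S f \<longleftrightarrow>
     (\<exists>f'. (\<forall>x\<in>S. (f has_real_derivative f' x) (at x within S)) \<and> continuous_on S f')"

section \<open>Smooth functions and smooth domains\<close>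

text \<open>\<open>Ck_on\<close> and \<open>smooth_on\<close> are meant for open \<open>S\<close>.\<close>

fun Ck_on :: "nat \<Rightarrow> (real ^ 'n) set \<Rightarrow> (real ^ 'n \<Rightarrow> real) \<Rightarrow> bool" where
  "Ck_on 0 S f = continuous_on S f"
| "Ck_on (Suc k) S f =
     (\<exists>g. (\<forall>x\<in>S. GDERIV f x :> g x) \<and> (\<forall>i. Ck_on k S (\<lambda>x. g x $ i)))"

definition smooth_on :: "(real ^ 'n) set \<Rightarrow> (real ^ 'n \<Rightarrow> real) \<Rightarrow> bool" where
  "smooth_on S f \<longleftrightarrow> (\<forall>k. Ck_on k S f)"

text \<open>The boundary is smooth: near each of its points the domain is a strict sublevel set of a
  smooth function with non-vanishing gradient.\<close>

definition smooth_bounded_domain :: "(real ^ 'n) set \<Rightarrow> bool" where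
  "smooth_bounded_domain U \<longleftrightarrow>
     open U \<and> connected U \<and> U \<noteq> {} \<and> bounded U \<and>
     (\<forall>p\<in>frontier U. \<exists>W \<rho>. open W \<and> p \<in> W \<and> smooth_on W \<rho> \<and>
        (\<forall>x\<in>W. \<not> (GDERIV \<rho> x :> 0)) \<and> U \<inter> W = {x \<in> W. \<rho> x < 0})"

definition open_sup_ball :: "(real ^ 'n) set \<Rightarrow> bool" where
  "open_sup_ball U \<longleftrightarrow> (\<exists>c r. 0 < r \<and> U = {x. infnorm (x - c) < r})"

definition C1_holder :: "real \<Rightarrow> (real ^ 'n \<Rightarrow> real) \<Rightarrow> bool" where
  "C1_holder \<alpha> f \<longleftrightarrow>
     (\<exists>g. (\<forall>x. GDERIV f x :> g x) \<and> continuous_on UNIV g \<and>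
       (\<forall>i. \<exists>C. \<forall>x y. \<bar>g x $ i - g y $ i\<bar> \<le> C * dist x y powr \<alpha>))"

section \<open>The space $D^1$ and the Dirichlet energy\<close>

text \<open>Elements of $D^1$ are represented by Lebesgue measurable functions; the notions below are
  invariant under modification on null sets.\<close>

definition locally_integrable :: "(real ^ 'n \<Rightarrow> 'b::euclidean_space) \<Rightarrow> bool" where
  "locally_integrable f \<longleftrightarrow>
     f \<in> borel_measurable lebesgue \<and> (\<forall>K. compact K \<longrightarrow> set_integrable lebesgue K f)"

definition test_function :: "(real ^ 'n \<Rightarrow> real) \<Rightarrow> bool" where
  "test_function \<psi> \<longleftrightarrow> smooth_on UNIV \<psi> \<and> (\<exists>K. compact K \<and> (\<forall>x. x \<notin> K \<longrightarrow> \<psi> x = 0))"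

definition is_weak_gradient :: "(real ^ 'n \<Rightarrow> real) \<Rightarrow> (real ^ 'n \<Rightarrow> real ^ 'n) \<Rightarrow> bool" where
  "is_weak_gradient f G \<longleftrightarrow>
     locally_integrable G \<and>
     (\<forall>\<psi> i. test_function \<psi> \<longrightarrow>
        (LINT x|lebesgue. f x * frechet_derivative \<psi> (at x) (axis i 1)) =
        - (LINT x|lebesgue. G x $ i * \<psi> x))"

definition weak_gradient :: "(real ^ 'n \<Rightarrow> real) \<Rightarrow> real ^ 'n \<Rightarrow> real ^ 'n" where
  "weak_gradient f = (SOME G. is_weak_gradient f G)"

definition D1_space :: "(real ^ 'n \<Rightarrow> real) set" where
  "D1_space = {f. locally_integrable f \<and>
     (\<exists>G. is_weak_gradient f G \<and> integrable lebesgue (\<lambda>x. (norm (G x))\<^sup>2)) \<and>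
     (\<forall>a>0. emeasure lebesgue {x. \<bar>f x\<bar> > a} < \<infinity>)}"

definition dirichlet_energy :: "(real ^ 'n \<Rightarrow> real) \<Rightarrow> real" where
  "dirichlet_energy f =
     1 / (2 * real CARD('n)) * (LINT x|lebesgue. (norm (weak_gradient f x))\<^sup>2)"

section \<open>The variational problem\<close>

definition admissible ::
  "(real \<Rightarrow> real) \<Rightarrow> real \<Rightarrow> (real ^ 'n) set \<Rightarrow> real \<Rightarrow> (real ^ 'n \<Rightarrow> real) set" where
  "admissible \<theta> u D \<nu> = {\<phi> \<in> D1_space. (AE z in lebesgue. 0 \<le> \<phi> z) \<and>
     1 / measure lebesgue D * (LINT z:D|lebesgue. \<theta> ((sqrt u + \<phi> z)\<^sup>2)) \<ge> \<nu>}"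

definition is_minimizer ::
  "(real \<Rightarrow> real) \<Rightarrow> real \<Rightarrow> (real ^ 'n) set \<Rightarrow> real \<Rightarrow> (real ^ 'n \<Rightarrow> real) \<Rightarrow> bool" where
  "is_minimizer \<theta> u D \<nu> \<phi> \<longleftrightarrow> \<phi> \<in> admissible \<theta> u D \<nu> \<and>
     (\<forall>\<psi>\<in>admissible \<theta> u D \<nu>. dirichlet_energy \<phi> \<le> dirichlet_energy \<psi>)"

end

theory Submission
  imports Defs
begin

text \<open>The law of the vacant set at level \<open>a + b\<close> is that of the intersection of independent vacant sets at
  levels \<open>a\<close> and \<open>b\<close>. Hence \<open>1 - \<theta> (a + b) \<le> (1 - \<theta> a) exp (- b cap {0})\<close>, and \<open>\<theta>\<close> has positive
  derivative below the critical level. Transience is not needed as an input: if \<open>cap {0}\<close> vanished, the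
  vacant set would be the whole lattice at every level.

  Let \<open>\<eta> s = \<theta> ((\<surd>u + s)\<^sup>2)\<close> and \<open>\<delta> = \<nu> - \<theta> u\<close>, and let \<open>\<chi>\<close> be the bubble \<open>(\<bar>x\<bar>\<^sup>2 + 1) powr (1 - d / 2)\<close>,
  which is superharmonic. Comparison with a multiple of \<open>\<chi>\<close> bounds the energy of a minimizer \<open>\<phi>\<close> by a
  multiple of \<open>\<delta>\<^sup>2\<close>. Truncating \<open>\<phi>\<close> at \<open>K \<delta> \<chi>\<close> and repairing the constraint by adding a small multiple of
  \<open>\<chi>\<close> lowers the energy unless \<open>\<phi> \<le> K \<delta> \<chi>\<close>; this also avoids any regularity of \<open>\<theta>\<close> beyond \<open>u\<^sub>0\<close>. So \<open>\<phi>\<close>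
  stays where \<open>\<eta>\<close> is \<open>C\<^sup>1\<close>, and the Euler-Lagrange equation says that \<open>- \<Delta> \<phi>\<close> is a bounded function supported
  in \<open>D\<close>. Testing it with bubbles of vanishing width identifies \<open>\<phi>\<close> with a Newtonian potential, for which
  the \<open>C\<^sup>1\<^sup>,\<^sup>\<alpha>\<close> estimate follows from pointwise kernel inequalities.\<close>

section \<open>Strict monotonicity of the percolation function\<close>

text \<open>The obstacle is a circle. The Euler-Lagrange equation needs \<theta> to be
  differentiable along the values of (sqrt u + \<phi>)^2, yet beyond \<open>u0\<close> only
  monotonicity and the bound by 1 are available, and a jump at \<open>us\<close> is possible. An
  upper bound on \<phi> therefore has to come from comparing energies alone. This succeeds because
  \<chi> has finite energy, is bounded below on D, and has a negative Laplacian bounded below on D: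
  the pairing of its gradient with that of any g \<ge> 0 dominates a multiple of the integral of g
  over D. Let J be the integral over D of the excess of \<phi> over K \<delta> \<chi>. Cutting off
  the excess saves energy at least of order K \<delta> J. It lowers the constraint by at most a
  multiple of J, also where \<phi> passes the jump, since there the excess has a fixed minimal size
  while \<theta> changes by at most 1. The repair is thus a multiple of J, and it costs energy of
  order \<delta> J because the gradient of \<phi> is of order \<delta>. Saving and cost are both
  linear in \<delta> J, so a constant K that does not depend on \<nu> decides the
  comparison.\<close>

definition cylinders :: "'b set measure" where
  "cylinders = sigma UNIV {{S. K \<subseteq> S} | K. finite K}"

lemma space_cylinders [simp]: "space cylinders = UNIV"
  by (simp add: cylinders_def space_measure_of_conv)

lemma UNIV_sets_cylinders [simp]: "UNIV \<in> sets cylinders"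
  using sets.top[of cylinders] by simp

lemma sets_cylinders: "sets cylinders = sigma_sets UNIV {{S. K \<subseteq> S} | K. finite K}"
  by (simp add: cylinders_def)

lemma member_sets_cylinders [measurable]: "{S. x \<in> S} \<in> sets cylinders"
proof -
  have "{S. {x} \<subseteq> S} \<in> sets cylinders"
    unfolding sets_cylinders by (rule sigma_sets.Basic) blast
  then show ?thesis by simp
qed

lemma measurable_cylinders:
  fixes f :: "'a \<Rightarrow> 'b set"
  assumes "\<And>x. {\<omega> \<in> space M. x \<in> f \<omega>} \<in> sets M"
  shows "f \<in> measurable M cylinders"
  unfolding cylinders_def
proof (rule measurable_measure_of)
  fix B :: "'b set set" assume "B \<in> {{S. K \<subseteq> S} |K. finite K}"
  then obtain K where K: "finite K" "B = {S. K \<subseteq> S}" by blast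
  have "f -` B \<inter> space M = {\<omega> \<in> space M. \<forall>x\<in>K. x \<in> f \<omega>}" using K by blast
  also have "\<dots> \<in> sets M"
    using K(1) assms by (intro sets.sets_Collect_finite_All) auto
  finally show "f -` B \<inter> space M \<in> sets M" .
qed auto

text \<open>The generating events are exactly those whose probabilities
  \<open>random_interlacements\<close> prescribes, and they are closed under intersection,
  \<open>K\<close> and \<open>L\<close> giving \<open>K \<union> L\<close>.\<close>

lemma measure_cylinders_eqI:
  fixes P Q :: "'a set measure"
  assumes "prob_space P" "prob_space Q" "sets P = sets cylinders" "sets Q = sets cylinders"
    and eq: "\<And>K. finite K \<Longrightarrow> measure P {S. K \<subseteq> S} = measure Q {S. K \<subseteq> S}"
  shows "P = Q"
proof -
  let ?E = "{{S :: 'a set. K \<subseteq> S} | K. finite K}"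
  interpret P: prob_space P by fact
  interpret Q: prob_space Q by fact
  show ?thesis
  proof (rule measure_eqI_generator_eq[where E = ?E and \<Omega> = UNIV
        and A = "\<lambda>_. UNIV"])
    show "Int_stable ?E"
    proof (rule Int_stableI)
      fix a b :: "'a set set" assume "a \<in> ?E" "b \<in> ?E"
      then obtain K L where "finite K" "finite L" "a = {S. K \<subseteq> S}" "b = {S. L \<subseteq> S}" by blast
      then have "a \<inter> b = {S. K \<union> L \<subseteq> S}" "finite (K \<union> L)" by auto
      then show "a \<inter> b \<in> ?E" by blast
    qed
  next
    fix X assume "X \<in> ?E"
    then show "emeasure P X = emeasure Q X"
      using eq by (auto simp: P.emeasure_eq_measure Q.emeasure_eq_measure)
  next
    show "range (\<lambda>_. UNIV) \<subseteq> ?E"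
      by (force intro: exI[of _ "{}"])
  qed (use assms in \<open>auto simp: sets_cylinders\<close>)
qed

text \<open>The vertex before the last ranges over a countable type, so connections of length
  \<open>Suc n\<close> form a countable union. A connection of length 0 imposes nothing on
  \<open>S\<close>, which is why \<open>cluster_member_measurable\<close> intersects with the event
  that \<open>x\<close> lies in \<open>S\<close>.\<close>

lemma relpow_cluster_measurable:
  fixes R :: "'b::countable \<Rightarrow> 'b \<Rightarrow> bool"
  shows "{S. (x, y) \<in> {(a, b). a \<in> S \<and> b \<in> S \<and> R a b} ^^ n} \<in> sets cylinders"
proof (induction n arbitrary: y)
  case 0
  show ?case by (cases "x = y") auto
next
  case (Suc n)
  have "{S. (x, y) \<in> {(a, b). a \<in> S \<and> b \<in> S \<and> R a b} ^^ Suc n} =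
    (\<Union>z\<in>{z. R z y}. {S. (x, z) \<in> {(a, b). a \<in> S \<and> b \<in> S \<and> R a b} ^^ n} \<inter>
        {S. z \<in> S} \<inter> {S. y \<in> S})"
    by (auto simp: relcomp_unfold)
  also have "\<dots> \<in> sets cylinders"
    by (intro sets.countable_UN'' sets.Int Suc.IH member_sets_cylinders) auto
  finally show ?case .
qed

lemma cluster_member_measurable:
  fixes x y :: "int ^ 'n"
  shows "{S. y \<in> cluster S x} \<in> sets cylinders"
proof -
  have "{S. y \<in> cluster S x} = {S. x \<in> S} \<inter>
      (\<Union>n. {S. (x, y) \<in> {(a, b). a \<in> S \<and> b \<in> S \<and> lattice_adj a b} ^^ n})"
    by (auto simp: cluster_def rtrancl_power)
  also have "\<dots> \<in> sets cylinders"
    by (intro sets.Int sets.countable_UN'' relpow_cluster_measurable member_sets_cylinders) auto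
  finally show ?thesis .
qed

lemma infinite_cluster_measurable:
  fixes x :: "int ^ 'n"
  shows "{S. infinite (cluster S x)} \<in> sets cylinders"
proof -
  \<comment> \<open>A set is infinite iff it leaves every finite set, and a countable type has only
    countably many finite subsets; this keeps the intersection below countable.\<close>
  have *: "infinite A \<longleftrightarrow> (\<forall>F\<in>{F. finite F}. \<exists>y\<in>-F. y \<in> A)" for A :: "(int ^ 'n) set"
    by (auto dest: ex_new_if_finite finite_subset)
       (metis finite_subset subset_iff ComplI)+
  have "{S. infinite (cluster S x)} = (\<Inter>F\<in>{F. finite F}. \<Union>y\<in>-F. {S. y \<in> cluster S x})"
    by (subst *) blast
  also have "\<dots> \<in> sets cylinders"
    by (intro sets.countable_INT'' sets.countable_UN'' cluster_member_measurable)
       (auto intro: countable_Collect_finite)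
  finally show ?thesis .
qed

lemma cluster_mono: "S \<subseteq> T \<Longrightarrow> cluster S x \<subseteq> cluster T x"
  unfolding cluster_def by (auto elim!: rtrancl_mono[THEN subsetD, rotated])

text \<open>A ray along one coordinate axis suffices. This provides the contradiction in
  \<open>capacity_pos\<close>.\<close>

lemma infinite_cluster_UNIV: "infinite (cluster UNIV (0 :: int ^ 'n))"
proof -
  fix i :: 'n
  define f :: "nat \<Rightarrow> int ^ 'n" where "f k = axis i (int k)" for k
  have adj: "lattice_adj (f k) (f (Suc k))" for k
  proof -
    have "(\<Sum>j\<in>UNIV. \<bar>f k $ j - f (Suc k) $ j\<bar>) = (\<Sum>j\<in>UNIV. if j = i then 1 else 0)"
      by (intro sum.cong) (auto simp: f_def axis_def)
    then show ?thesis by (simp add: lattice_adj_def)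
  qed
  have "(0, f k) \<in> {(a, b). a \<in> UNIV \<and> b \<in> UNIV \<and> lattice_adj a b}\<^sup>*" for k
  proof (induction k)
    case 0
    have "f 0 = 0" by (auto simp: f_def axis_def vec_eq_iff)
    then show ?case by simp
  next
    case (Suc k)
    then show ?case by (rule rtrancl_into_rtrancl) (simp add: adj)
  qed
  then have "range f \<subseteq> cluster UNIV 0" by (auto simp: cluster_def)
  moreover have "inj f" by (rule injI) (auto simp: f_def axis_eq_axis)
  ultimately show ?thesis
    by (meson finite_imageD finite_subset infinite_UNIV_nat)
qed

lemma escape_prob_singleton: "escape_prob {x :: int ^ 'n} x = escape_prob {0} (0 :: int ^ 'n)"
  by (simp add: escape_prob_def walk_def)

lemma capacity_nonneg: "capacity K \<ge> 0"
  by (auto simp: capacity_def escape_prob_def intro!: sum_nonneg)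

locale interlacements =
  fixes M :: "'a measure" and \<I> :: "real \<Rightarrow> 'a \<Rightarrow> (int ^ 'n) set"
  assumes ri: "random_interlacements M \<I>"
begin

sublocale prob_space M
  using ri by (simp add: random_interlacements_def)

lemma vacant_measurable:
  assumes "u \<ge> 0"
  shows "(\<lambda>\<omega>. - \<I> u \<omega>) \<in> measurable M cylinders"
proof (rule measurable_cylinders)
  fix x
  have "{\<omega> \<in> space M. x \<in> \<I> u \<omega>} \<in> sets M"
    using ri assms by (simp add: random_interlacements_def)
  then have "space M - {\<omega> \<in> space M. x \<in> \<I> u \<omega>} \<in> sets M" by (rule sets.compl_sets)
  moreover have "space M - {\<omega> \<in> space M. x \<in> \<I> u \<omega>} = {\<omega> \<in> space M. x \<in> - \<I> u \<omega>}" by auto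
  ultimately show "{\<omega> \<in> space M. x \<in> - \<I> u \<omega>} \<in> sets M" by simp
qed

lemma prob_vacant:
  assumes "u \<ge> 0" "finite K"
  shows "prob {\<omega> \<in> space M. K \<subseteq> - \<I> u \<omega>} = exp (- u * capacity K)"
  using ri assms by (simp add: random_interlacements_def)

lemma infinite_cluster_event:
  assumes "u \<ge> 0"
  shows "{\<omega> \<in> space M. infinite (cluster (- \<I> u \<omega>) 0)} \<in> events"
  using measurable_sets[OF vacant_measurable[OF assms] infinite_cluster_measurable[of 0]]
  by (simp add: vimage_def Int_def conj_commute)

lemma perc_fun_eq:
  assumes "u \<ge> 0"
  shows "1 - perc_fun M \<I> u = prob {\<omega> \<in> space M. infinite (cluster (- \<I> u \<omega>) 0)}"
proof -
  have "prob {\<omega> \<in> space M. \<not> infinite (cluster (- \<I> u \<omega>) 0)} =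
      1 - prob {\<omega> \<in> space M. infinite (cluster (- \<I> u \<omega>) 0)}"
    using infinite_cluster_event[OF assms] by (intro prob_neg) auto
  then show ?thesis by (simp add: perc_fun_def)
qed

lemma vacant_inter_measurable:
  assumes "a \<ge> 0" "b \<ge> 0"
  shows "(\<lambda>(\<omega>, \<omega>'). - \<I> a \<omega> \<inter> - \<I> b \<omega>') \<in> measurable (M \<Otimes>\<^sub>M M) cylinders"
proof (rule measurable_cylinders)
  fix x
  have ev: "{\<omega> \<in> space M. x \<in> - \<I> u \<omega>} \<in> sets M" if "u \<ge> 0" for u
    using measurable_sets[OF vacant_measurable[OF that] member_sets_cylinders[of x]]
    by (simp add: vimage_def Int_def conj_commute)
  have "{\<omega> \<in> space (M \<Otimes>\<^sub>M M). x \<in> (case \<omega> of (\<omega>, \<omega>') \<Rightarrow> - \<I> a \<omega> \<inter> - \<I> b \<omega>')} =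
    {\<omega> \<in> space M. x \<in> - \<I> a \<omega>} \<times> {\<omega> \<in> space M. x \<in> - \<I> b \<omega>}"
    by (auto simp: space_pair_measure)
  also have "\<dots> \<in> sets (M \<Otimes>\<^sub>M M)" by (intro pair_measureI ev assms)
  finally show "{\<omega> \<in> space (M \<Otimes>\<^sub>M M). x \<in> (case \<omega> of (\<omega>, \<omega>') \<Rightarrow> - \<I> a \<omega> \<inter> - \<I> b \<omega>')}
    \<in> sets (M \<Otimes>\<^sub>M M)" .
qed

text \<open>Both laws agree on cylinder events since the exponent is linear in the level.\<close>

lemma vacant_add_law:
  assumes "a \<ge> 0" "b \<ge> 0"
  shows "distr M cylinders (\<lambda>\<omega>. - \<I> (a + b) \<omega>) =
    distr (M \<Otimes>\<^sub>M M) cylinders (\<lambda>(\<omega>, \<omega>'). - \<I> a \<omega> \<inter> - \<I> b \<omega>')"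
proof -
  interpret P: pair_prob_space M M ..
  note meas = vacant_inter_measurable[OF assms]
  show ?thesis
  proof (rule measure_cylinders_eqI)
    show "prob_space (distr M cylinders (\<lambda>\<omega>. - \<I> (a + b) \<omega>))"
      by (rule prob_space_distr) (use vacant_measurable assms in auto)
    show "prob_space (distr (M \<Otimes>\<^sub>M M) cylinders (\<lambda>(\<omega>, \<omega>'). - \<I> a \<omega> \<inter> - \<I> b \<omega>'))"
      by (rule P.prob_space_distr[OF meas])
  next
    fix K :: "(int ^ 'n) set" assume K: "finite K"
    have KS: "{S. K \<subseteq> S} \<in> sets cylinders"
      unfolding sets_cylinders using K by (intro sigma_sets.Basic) blast
    have ev: "{\<omega> \<in> space M. K \<subseteq> - \<I> u \<omega>} \<in> sets M" if "u \<ge> 0" for u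
      using measurable_sets[OF vacant_measurable[OF that] KS]
      by (simp add: vimage_def Int_def conj_commute)
    have "measure (distr M cylinders (\<lambda>\<omega>. - \<I> (a + b) \<omega>)) {S. K \<subseteq> S} =
        prob {\<omega> \<in> space M. K \<subseteq> - \<I> (a + b) \<omega>}"
      using vacant_measurable assms KS
      by (subst measure_distr) (auto intro!: arg_cong[where f = prob])
    also have "\<dots> = exp (- a * capacity K) * exp (- b * capacity K)"
      using prob_vacant[of "a + b" K] K assms by (simp add: algebra_simps flip: exp_add)
    also have "\<dots> = prob {\<omega> \<in> space M. K \<subseteq> - \<I> a \<omega>} * prob {\<omega> \<in> space M. K \<subseteq> - \<I> b \<omega>}"
      using prob_vacant K assms by simp
    also have "\<dots> = measure (M \<Otimes>\<^sub>M M)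
        ({\<omega> \<in> space M. K \<subseteq> - \<I> a \<omega>} \<times> {\<omega> \<in> space M. K \<subseteq> - \<I> b \<omega>})"
      using ev assms by (simp add: measure_def emeasure_pair_measure_Times enn2real_mult)
    also have "{\<omega> \<in> space M. K \<subseteq> - \<I> a \<omega>} \<times> {\<omega> \<in> space M. K \<subseteq> - \<I> b \<omega>} =
        (\<lambda>(\<omega>, \<omega>'). - \<I> a \<omega> \<inter> - \<I> b \<omega>') -` {S. K \<subseteq> S} \<inter> space (M \<Otimes>\<^sub>M M)"
      by (auto simp: space_pair_measure)
    also have "measure (M \<Otimes>\<^sub>M M) \<dots> =
        measure (distr (M \<Otimes>\<^sub>M M) cylinders (\<lambda>(\<omega>, \<omega>'). - \<I> a \<omega> \<inter> - \<I> b \<omega>')) {S. K \<subseteq> S}"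
      by (rule measure_distr[OF meas KS, symmetric])
    finally show "measure (distr M cylinders (\<lambda>\<omega>. - \<I> (a + b) \<omega>)) {S. K \<subseteq> S} =
      measure (distr (M \<Otimes>\<^sub>M M) cylinders (\<lambda>(\<omega>, \<omega>'). - \<I> a \<omega> \<inter> - \<I> b \<omega>')) {S. K \<subseteq> S}" .
  qed auto
qed

text \<open>If the intersection of two sets percolates from the origin, then so does the first set,
  and the origin belongs to the second. Independence turns the latter condition into the exponential
  factor.\<close>

lemma perc_fun_add:
  assumes "a \<ge> 0" "b \<ge> 0"
  shows "1 - perc_fun M \<I> (a + b) \<le> (1 - perc_fun M \<I> a) * exp (- b * capacity {0 :: int ^ 'n})"
proof -
  interpret P: pair_prob_space M M ..
  note meas = vacant_inter_measurable[OF assms]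
  let ?I = "{S. infinite (cluster S (0 :: int ^ 'n))}"
  let ?A = "{\<omega> \<in> space M. infinite (cluster (- \<I> a \<omega>) 0)}"
  let ?B = "{\<omega> \<in> space M. {0} \<subseteq> - \<I> b \<omega>}"
  have evB: "?B \<in> events"
    using measurable_sets[OF vacant_measurable[OF assms(2)] member_sets_cylinders[of 0]]
    by (simp add: vimage_def Int_def conj_commute)
  have "1 - perc_fun M \<I> (a + b) = measure (distr M cylinders (\<lambda>\<omega>. - \<I> (a + b) \<omega>)) ?I"
    using vacant_measurable[of "a + b"] infinite_cluster_measurable[of 0] assms
    by (subst measure_distr) (auto simp: perc_fun_eq intro!: arg_cong[where f = prob])
  also have "\<dots> = measure (M \<Otimes>\<^sub>M M)
      ((\<lambda>(\<omega>, \<omega>'). - \<I> a \<omega> \<inter> - \<I> b \<omega>') -` ?I \<inter> space (M \<Otimes>\<^sub>M M))"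
    unfolding vacant_add_law[OF assms] by (rule measure_distr[OF meas infinite_cluster_measurable])
  also have "\<dots> \<le> measure (M \<Otimes>\<^sub>M M) (?A \<times> ?B)"
  proof (rule P.finite_measure_mono)
    show "?A \<times> ?B \<in> sets (M \<Otimes>\<^sub>M M)"
      using infinite_cluster_event[OF assms(1)] evB by (rule pair_measureI)
    have "infinite (cluster S 0)" if "infinite (cluster (S \<inter> T) 0)" for S T :: "(int ^ 'n) set"
      using that cluster_mono[of "S \<inter> T" S 0] by (meson Int_lower1 finite_subset)
    moreover have "0 \<in> T" if "infinite (cluster (S \<inter> T) 0)" for S T :: "(int ^ 'n) set"
      using that by (auto simp: cluster_def split: if_splits)
    ultimately show "(\<lambda>(\<omega>, \<omega>'). - \<I> a \<omega> \<inter> - \<I> b \<omega>') -` ?I \<inter> space (M \<Otimes>\<^sub>M M) \<subseteq> ?A \<times> ?B"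
      by (force simp: space_pair_measure)
  qed
  also have "\<dots> = prob ?A * prob ?B"
    using infinite_cluster_event[OF assms(1)] evB by (simp add: measure_def emeasure_pair_measure_Times enn2real_mult)
  also have "\<dots> = (1 - perc_fun M \<I> a) * exp (- b * capacity {0 :: int ^ 'n})"
    using prob_vacant[OF assms(2), of "{0 :: int ^ 'n}"] perc_fun_eq[OF assms(1)] by simp
  finally show ?thesis .
qed

lemma capacity_pos:
  assumes "u \<ge> 0" "perc_fun M \<I> u = 1"
  shows "capacity {0 :: int ^ 'n} > 0"
proof (rule ccontr)
  assume "\<not> ?thesis"
  then have "escape_prob {0} (0 :: int ^ 'n) = 0"
    using capacity_nonneg[of "{0 :: int ^ 'n}"] by (simp add: capacity_def)
  \<comment> \<open>Translation invariance carries the vanishing escape probability from the origin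
    to every site; countably many almost sure events then hold simultaneously.\<close>
  then have "prob {\<omega> \<in> space M. {x} \<subseteq> - \<I> u \<omega>} = 1" for x
    using prob_vacant[of u "{x}"] assms(1) escape_prob_singleton[of x] by (simp add: capacity_def)
  moreover have "{\<omega> \<in> space M. x \<in> - \<I> u \<omega>} \<in> events" for x
    using measurable_sets[OF vacant_measurable[OF assms(1)] member_sets_cylinders[of x]]
    by (simp add: vimage_def Int_def conj_commute)
  ultimately have "AE \<omega> in M. x \<in> - \<I> u \<omega>" for x
    using AE_in_set_eq_1[of "{\<omega> \<in> space M. x \<in> - \<I> u \<omega>}"] by simp
  then have "AE \<omega> in M. \<forall>x. x \<in> - \<I> u \<omega>"
    unfolding AE_all_countable by blast
  then have "AE \<omega> in M. infinite (cluster (- \<I> u \<omega>) 0)"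
  proof (eventually_elim)
    case (elim \<omega>)
    then have "- \<I> u \<omega> = UNIV" by blast
    then show ?case by (simp only: infinite_cluster_UNIV not_False_eq_True)
  qed
  then have "prob {\<omega> \<in> space M. infinite (cluster (- \<I> u \<omega>) 0)} = 1"
    using infinite_cluster_event[OF assms(1)] by (subst prob_Collect_eq_1) auto
  then show False using perc_fun_eq[OF assms(1)] assms(2) by simp
qed

lemma perc_fun_le_1: "perc_fun M \<I> u \<le> 1" and perc_fun_nonneg: "perc_fun M \<I> u \<ge> 0"
  by (simp_all add: perc_fun_def)

lemma perc_fun_mono:
  assumes "0 \<le> a" "a \<le> b"
  shows "perc_fun M \<I> a \<le> perc_fun M \<I> b"
proof -
  have "1 - perc_fun M \<I> b \<le> (1 - perc_fun M \<I> a) * exp (- (b - a) * capacity {0 :: int ^ 'n})"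
    using perc_fun_add[of a "b - a"] assms by simp
  also have "\<dots> \<le> (1 - perc_fun M \<I> a) * 1"
    using perc_fun_le_1[of a] assms capacity_nonneg[of "{0 :: int ^ 'n}"]
    by (intro mult_left_mono) (auto intro: mult_nonpos_nonneg)
  finally show ?thesis by simp
qed

text \<open>By \<open>perc_fun_add\<close> the increment over \<open>[x, x + h]\<close> is at least
  p (1 - exp (- h c)), whose slope at h = 0 is p c > 0. The comparison concerns h > 0, so it is made
  for the right limits of the difference quotients.\<close>

lemma perc_fun_deriv_pos:
  assumes "is_critical_level (perc_fun M \<I>) us" "0 < x" "x < us"
    and D: "(perc_fun M \<I> has_real_derivative D) (at x)"
  shows "D > 0"
proof -
  define c where "c = capacity {0 :: int ^ 'n}"
  \<comment> \<open>\<open>capacity_pos\<close> asks for a level without percolation; any level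
    above \<open>us\<close> qualifies.\<close>
  have "c > 0"
    unfolding c_def using assms by (intro capacity_pos[of "us + 1"]) (auto simp: is_critical_level_def)
  define p where "p = 1 - perc_fun M \<I> x"
  have "p > 0" using assms by (auto simp: is_critical_level_def p_def)
  let ?F = "\<lambda>h. (perc_fun M \<I> (x + h) - perc_fun M \<I> x) / h"
  let ?G = "\<lambda>h. p * (1 - exp (- h * c)) / h"
  have F: "(?F \<longlongrightarrow> D) (at_right 0)"
    using D unfolding DERIV_def by (rule filterlim_mono) (auto simp: at_le)
  have "((\<lambda>h. p * (1 - exp (- h * c))) has_real_derivative p * c) (at 0)"
    by (auto intro!: derivative_eq_intros)
  then have "(?G \<longlongrightarrow> p * c) (at 0)" unfolding DERIV_def by simp
  then have G: "(?G \<longlongrightarrow> p * c) (at_right 0)" by (rule filterlim_mono) (auto simp: at_le)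
  have "eventually (\<lambda>h. ?G h \<le> ?F h) (at_right 0)"
    using eventually_at_right_less[of 0]
  proof eventually_elim
    case (elim h)
    have "1 - perc_fun M \<I> (x + h) \<le> p * exp (- h * c)"
      using perc_fun_add[of x h] elim assms by (simp add: p_def c_def)
    then show ?case using elim by (intro divide_right_mono) (auto simp: p_def algebra_simps)
  qed
  then have "p * c \<le> D" using tendsto_le[OF _ F G] by simp
  then show ?thesis using \<open>p > 0\<close> \<open>c > 0\<close> by (meson mult_pos_pos less_le_trans)
qed

end

section \<open>Smooth functions\<close>

lemma GDERIV_has_derivative: "GDERIV f x :> D \<longleftrightarrow> (f has_derivative (\<lambda>h. h \<bullet> D)) (at x)"
  by (simp add: gderiv_def)

lemma Ck_on_const [simp]: "Ck_on k S (\<lambda>_. c)"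
proof (induction k arbitrary: c)
  case (Suc k)
  show ?case
    by (auto intro!: exI[of _ "\<lambda>_. 0"] Suc simp: GDERIV_const)
qed auto

lemma Ck_on_SucD:
  assumes "Ck_on (Suc k) S f"
  shows "Ck_on k S f"
  using assms
proof (induction k arbitrary: f)
  case 0
  then obtain g where "\<forall>x\<in>S. GDERIV f x :> g x" by auto
  then have "isCont f x" if "x \<in> S" for x
    using that unfolding GDERIV_has_derivative by (blast intro: has_derivative_continuous)
  then show ?case by (simp add: continuous_at_imp_continuous_on)
next
  case (Suc k)
  from Suc.prems obtain g where g: "\<forall>x\<in>S. GDERIV f x :> g x" "\<forall>i. Ck_on (Suc k) S (\<lambda>x. g x $ i)"
    by (subst (asm) Ck_on.simps) blast
  then have "\<forall>i. Ck_on k S (\<lambda>x. g x $ i)" using Suc.IH by blast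
  with g show ?case by (subst Ck_on.simps) blast
qed

lemma Ck_on_add:
  assumes "Ck_on k S f" "Ck_on k S g"
  shows "Ck_on k S (\<lambda>x. f x + g x)"
  using assms
proof (induction k arbitrary: f g)
  case 0
  then show ?case by (auto intro: continuous_intros)
next
  case (Suc k)
  then obtain f' g' where "\<forall>x\<in>S. GDERIV f x :> f' x" "\<forall>i. Ck_on k S (\<lambda>x. f' x $ i)"
    "\<forall>x\<in>S. GDERIV g x :> g' x" "\<forall>i. Ck_on k S (\<lambda>x. g' x $ i)" by auto
  then show ?case using Suc.IH
    by (auto intro!: exI[of _ "\<lambda>x. f' x + g' x"] GDERIV_add)
qed

lemma Ck_on_mult:
  assumes "Ck_on k S f" "Ck_on k S g"
  shows "Ck_on k S (\<lambda>x. f x * g x)"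
  using assms
proof (induction k arbitrary: f g)
  case 0
  then show ?case by (auto intro: continuous_intros)
next
  case (Suc k)
  then obtain f' g' where *: "\<forall>x\<in>S. GDERIV f x :> f' x" "\<forall>i. Ck_on k S (\<lambda>x. f' x $ i)"
    "\<forall>x\<in>S. GDERIV g x :> g' x" "\<forall>i. Ck_on k S (\<lambda>x. g' x $ i)" by auto
  note Suc.prems[THEN Ck_on_SucD]
  with * show ?case using Suc.IH
    by (auto intro!: exI[of _ "\<lambda>x. f x *\<^sub>R g' x + g x *\<^sub>R f' x"] GDERIV_mult Ck_on_add)
qed

lemma Ck_on_sum:
  assumes "\<And>j. j \<in> J \<Longrightarrow> Ck_on k S (f j)"
  shows "Ck_on k S (\<lambda>x. \<Sum>j\<in>J. f j x)"
  using assms by (induction J rule: infinite_finite_induct) (auto intro: Ck_on_add)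

lemma Ck_on_component: "Ck_on k S (\<lambda>x. x $ i)"
proof (cases k)
  case 0
  then show ?thesis by (auto intro: continuous_intros)
next
  case (Suc m)
  have "GDERIV (\<lambda>x. x $ i) x :> axis i 1" for x :: "real ^ 'a"
    unfolding GDERIV_has_derivative inner_axis inner_real_def mult_1_right
    by (rule bounded_linear.has_derivative[OF bounded_linear_vec_nth has_derivative_ident])
  with Suc show ?thesis by (auto intro!: exI[of _ "\<lambda>_. axis i 1"])
qed

lemma Ck_on_power2_norm: "Ck_on k S (\<lambda>x. (norm x)\<^sup>2)"
proof -
  have "Ck_on k S (\<lambda>x. \<Sum>i\<in>UNIV. x $ i * x $ i)"
    by (intro Ck_on_sum Ck_on_mult Ck_on_component)
  then show ?thesis by (simp add: power2_norm_eq_inner inner_vec_def)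
qed

text \<open>\<open>F\<close> lists the successive derivatives of the outer function, so the
  induction on the order can pass from \<open>F j\<close> to \<open>F (Suc j)\<close> by the chain
  rule.\<close>

lemma Ck_on_compose_real:
  assumes F: "\<And>j x. x \<in> S \<Longrightarrow> (F j has_real_derivative F (Suc j) (f x)) (at (f x))"
    and f: "Ck_on k S f"
  shows "Ck_on k S (\<lambda>x. F j (f x))"
  using f
proof (induction k arbitrary: j)
  case 0
  have "continuous_on (f ` S) (F j)"
    using F by (intro continuous_at_imp_continuous_on) (auto intro: DERIV_isCont)
  then show ?case
    using 0 by (auto intro: continuous_on_compose2)
next
  case (Suc k)
  then obtain f' where *: "\<forall>x\<in>S. GDERIV f x :> f' x" "\<forall>i. Ck_on k S (\<lambda>x. f' x $ i)" by auto
  have "GDERIV (\<lambda>x. F j (f x)) x :> F (Suc j) (f x) *\<^sub>R f' x" if "x \<in> S" for x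
    using GDERIV_DERIV_compose[OF bspec[OF *(1) that] F[OF that, of j]] .
  moreover have "Ck_on k S (\<lambda>x. (F (Suc j) (f x) *\<^sub>R f' x) $ i)" for i
    using Suc.IH[OF Ck_on_SucD[OF Suc.prems], of "Suc j"] * by (auto intro: Ck_on_mult)
  ultimately show ?case by (auto intro!: exI[of _ "\<lambda>x. F (Suc j) (f x) *\<^sub>R f' x"])
qed

lemma Ck_on_affine:
  assumes "Ck_on k UNIV f"
  shows "Ck_on k UNIV (\<lambda>y. f (a + c *\<^sub>R y))"
  using assms
proof (induction k arbitrary: f)
  case 0
  then show ?case by (auto intro!: continuous_on_compose2[of UNIV f] continuous_intros)
next
  case (Suc k)
  then obtain f' where *: "\<forall>x. GDERIV f x :> f' x" "\<forall>i. Ck_on k UNIV (\<lambda>x. f' x $ i)" by auto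
  have "GDERIV (\<lambda>y. f (a + c *\<^sub>R y)) x :> c *\<^sub>R f' (a + c *\<^sub>R x)" for x
  proof -
    have "((\<lambda>y. a + c *\<^sub>R y) has_derivative (\<lambda>h. c *\<^sub>R h)) (at x)"
      by (auto intro!: derivative_eq_intros)
    moreover have "(f has_derivative (\<lambda>h. h \<bullet> f' (a + c *\<^sub>R x))) (at (a + c *\<^sub>R x))"
      using * by (simp add: GDERIV_has_derivative)
    ultimately show ?thesis
      unfolding GDERIV_has_derivative by (auto dest: has_derivative_compose)
  qed
  moreover have "Ck_on k UNIV (\<lambda>y. (c *\<^sub>R f' (a + c *\<^sub>R y)) $ i)" for i
    using Suc.IH[of "\<lambda>x. f' x $ i"] * by (auto intro: Ck_on_mult)
  ultimately show ?case by (auto intro!: exI[of _ "\<lambda>x. c *\<^sub>R f' (a + c *\<^sub>R x)"])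
qed

lemma smooth_on_const [simp]: "smooth_on S (\<lambda>_. c)"
  by (simp add: smooth_on_def)

lemma smooth_on_add: "smooth_on S f \<Longrightarrow> smooth_on S g \<Longrightarrow> smooth_on S (\<lambda>x. f x + g x)"
  by (simp add: smooth_on_def Ck_on_add)

lemma smooth_on_mult: "smooth_on S f \<Longrightarrow> smooth_on S g \<Longrightarrow> smooth_on S (\<lambda>x. f x * g x)"
  by (simp add: smooth_on_def Ck_on_mult)

lemma smooth_on_power2_norm: "smooth_on S (\<lambda>x. (norm x)\<^sup>2)"
  by (simp add: smooth_on_def Ck_on_power2_norm)

lemma smooth_on_affine: "smooth_on UNIV f \<Longrightarrow> smooth_on UNIV (\<lambda>y. f (a + c *\<^sub>R y))"
  by (simp add: smooth_on_def Ck_on_affine)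

lemma smooth_on_compose_real:
  assumes "\<And>j x. x \<in> S \<Longrightarrow> (F j has_real_derivative F (Suc j) (f x)) (at (f x))"
    and "smooth_on S f"
  shows "smooth_on S (\<lambda>x. F j (f x))"
  using assms unfolding smooth_on_def by (blast intro: Ck_on_compose_real)

lemma smooth_on_powr:
  assumes "smooth_on S f" "\<And>x. x \<in> S \<Longrightarrow> f x > 0"
  shows "smooth_on S (\<lambda>x. f x powr a)"
proof -
  \<comment> \<open>The j-th derivative of the power, with the falling factorial that j
    differentiations produce.\<close>
  define F where "F j t = (\<Prod>i<j. a - real i) * t powr (a - real j)" for j and t :: real
  have "(F j has_real_derivative F (Suc j) t) (at t)" if "t > 0" for j t
    unfolding F_def
    using DERIV_cmult[OF has_real_derivative_powr[OF that, of "a - real j"], of "\<Prod>i<j. a - real i"]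
    by (simp add: algebra_simps)
  then have "smooth_on S (\<lambda>x. F 0 (f x))"
    using assms by (intro smooth_on_compose_real[where F = F and f = f and j = 0]) auto
  then show ?thesis by (simp add: F_def)
qed

lemma smooth_on_divide:
  assumes "smooth_on UNIV f" "smooth_on UNIV g" "\<And>x. g x > 0"
  shows "smooth_on UNIV (\<lambda>x. f x / g x)"
proof -
  have "smooth_on UNIV (\<lambda>x. f x * g x powr (-1))"
    using assms by (intro smooth_on_mult smooth_on_powr) auto
  moreover have "(\<lambda>x. f x * g x powr (-1)) = (\<lambda>x. f x / g x)"
    using assms(3) by (auto simp: powr_minus_divide less_imp_le fun_eq_iff abs_of_pos)
  ultimately show ?thesis by (simp only:)
qed

text \<open>With s = 1 / t one has ds/dt = - s^2. Differentiating p(s) exp (- s) in t therefore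
  replaces the polynomial p by s^2 (p - p').\<close>

fun flat_poly :: "nat \<Rightarrow> real poly" where
  "flat_poly 0 = 1"
| "flat_poly (Suc k) = [:0, 0, 1:] * (flat_poly k - pderiv (flat_poly k))"

text \<open>The \<open>k\<close>-th derivative of \<open>exp (- 1 / t)\<close>, extended by \<open>0\<close> to \<open>t \<le> 0\<close>.\<close>

definition flat :: "nat \<Rightarrow> real \<Rightarrow> real" where
  "flat k t = (if t > 0 then poly (flat_poly k) (1 / t) * exp (- 1 / t) else 0)"

lemma poly_div_exp_tendsto_0: "((\<lambda>s :: real. poly p s / exp s) \<longlongrightarrow> 0) at_top"
proof -
  have "((\<lambda>s. \<Sum>i\<le>degree p. coeff p i * (s ^ i / exp s)) \<longlongrightarrow> (\<Sum>i\<le>degree p. coeff p i * 0)) at_top"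
    by (intro tendsto_intros tendsto_power_div_exp_0)
  then show ?thesis by (simp add: poly_altdef sum_divide_distrib)
qed

lemma flat_DERIV: "(flat k has_real_derivative flat (Suc k) t) (at t)"
proof -
  consider "t > 0" | "t < 0" | "t = 0" by linarith
  then show ?thesis
  proof cases
    case 1
    have "((\<lambda>t. 1 / t) has_real_derivative - (1 / t\<^sup>2)) (at t)"
      using 1 by (auto intro!: derivative_eq_intros simp: power2_eq_square)
    note P = DERIV_chain2[OF poly_DERIV this, of "flat_poly k"]
    have "((\<lambda>t. exp (- 1 / t)) has_real_derivative exp (- 1 / t) * (1 / t\<^sup>2)) (at t)"
      using 1 by (auto intro!: derivative_eq_intros simp: power2_eq_square)
    note DERIV_mult[OF P this]
    moreover have "poly (pderiv (flat_poly k)) (1 / t) * - (1 / t\<^sup>2) * exp (- 1 / t) +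
        exp (- 1 / t) * (1 / t\<^sup>2) * poly (flat_poly k) (1 / t) = flat (Suc k) t"
      using 1 by (simp add: flat_def power2_eq_square algebra_simps)
    ultimately have "((\<lambda>t. poly (flat_poly k) (1 / t) * exp (- 1 / t)) has_real_derivative flat (Suc k) t) (at t)"
      by (simp only:)
    moreover have "eventually (\<lambda>s. flat k s = poly (flat_poly k) (1 / s) * exp (- 1 / s)) (nhds t)"
      using 1 by (auto simp: flat_def eventually_nhds intro!: exI[of _ "{0<..}"])
    ultimately show ?thesis by (subst DERIV_cong_ev[OF refl _ refl]) auto
  next
    case 2
    have "eventually (\<lambda>s. flat k s = 0) (nhds t)"
      using 2 by (auto simp: flat_def eventually_nhds intro!: exI[of _ "{..<0}"])
    then show ?thesis using 2 by (subst DERIV_cong_ev[OF refl _ refl]) (auto simp: flat_def)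
  next
    case 3
    \<comment> \<open>The extra factor \<open>[:0, 1:]\<close> is the 1 / h of the difference
      quotient at the origin; exponential decay in 1 / h absorbs it.\<close>
    have "((\<lambda>s. poly ([:0, 1:] * flat_poly k) s / exp s) \<longlongrightarrow> 0) at_top"
      by (rule poly_div_exp_tendsto_0)
    then have "((\<lambda>h. poly ([:0, 1:] * flat_poly k) (inverse h) / exp (inverse h)) \<longlongrightarrow> 0) (at_right 0)"
      by (rule filterlim_compose) (rule filterlim_inverse_at_top_right)
    moreover have "eventually (\<lambda>h. poly ([:0, 1:] * flat_poly k) (inverse h) / exp (inverse h) =
        (flat k (0 + h) - flat k 0) / h) (at_right 0)"
      using eventually_at_right_less[of 0]
      by eventually_elim (auto simp: flat_def exp_minus field_simps)
    ultimately have "((\<lambda>h. (flat k (0 + h) - flat k 0) / h) \<longlongrightarrow> 0) (at_right 0)"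
      using tendsto_cong by fast
    moreover have "((\<lambda>h. (flat k (0 + h) - flat k 0) / h) \<longlongrightarrow> 0) (at_left 0)"
      by (rule tendsto_eventually)
         (auto simp: flat_def eventually_at_left_field intro!: exI[of _ "-1"])
    ultimately have "((\<lambda>h. (flat k (0 + h) - flat k 0) / h) \<longlongrightarrow> 0) (at 0)"
      by (simp add: filterlim_at_split)
    then show ?thesis using 3 by (simp add: DERIV_def flat_def)
  qed
qed

lemma flat_0_pos: "flat 0 t > 0 \<longleftrightarrow> t > 0" and flat_0_nonneg: "flat 0 t \<ge> 0"
  by (auto simp: flat_def)

lemma smooth_on_flat: "smooth_on S f \<Longrightarrow> smooth_on S (\<lambda>x. flat 0 (f x))"
  by (rule smooth_on_compose_real[where F = flat and f = f and j = 0]) (auto intro: flat_DERIV)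

section \<open>Affine changes of variables and integration of derivatives\<close>

lemma lborel_affine_integrable:
  fixes f :: "'a::euclidean_space \<Rightarrow> 'b::{banach, second_countable_topology}"
  assumes "integrable lborel f" "c \<noteq> 0"
  shows "integrable lborel (\<lambda>x. f (t + c *\<^sub>R x))"
proof -
  have f [measurable]: "f \<in> borel_measurable borel"
    using borel_measurable_integrable[OF assms(1)] by simp
  have "integrable (density (distr lborel borel (\<lambda>x. t + c *\<^sub>R x)) (\<lambda>_. ennreal (\<bar>c\<bar> ^ DIM('a)))) f"
    using assms lborel_affine[OF assms(2), of t] by metis
  then have "integrable (distr lborel borel (\<lambda>x. t + c *\<^sub>R x)) (\<lambda>x. \<bar>c\<bar> ^ DIM('a) *\<^sub>R f x)"
    by (subst (asm) integrable_density) auto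
  then have "integrable lborel (\<lambda>x. \<bar>c\<bar> ^ DIM('a) *\<^sub>R f (t + c *\<^sub>R x))"
    by (subst (asm) integrable_distr_eq) auto
  from integrable_scaleR_right[OF this, of "1 / \<bar>c\<bar> ^ DIM('a)"] show ?thesis using assms(2) by simp
qed

lemma lborel_affine_integral:
  fixes f :: "'a::euclidean_space \<Rightarrow> 'b::{banach, second_countable_topology}"
  assumes [measurable]: "f \<in> borel_measurable borel" and "c \<noteq> 0"
  shows "integral\<^sup>L lborel f = \<bar>c\<bar> ^ DIM('a) *\<^sub>R (LINT x|lborel. f (t + c *\<^sub>R x))"
proof -
  have "integral\<^sup>L lborel f =
    integral\<^sup>L (density (distr lborel borel (\<lambda>x. t + c *\<^sub>R x)) (\<lambda>_. ennreal (\<bar>c\<bar> ^ DIM('a)))) f"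
    using lborel_affine[OF assms(2), of t] by metis
  also have "\<dots> = (LINT x|distr lborel borel (\<lambda>x. t + c *\<^sub>R x). \<bar>c\<bar> ^ DIM('a) *\<^sub>R f x)"
    by (rule integral_density) auto
  also have "\<dots> = (LINT x|lborel. \<bar>c\<bar> ^ DIM('a) *\<^sub>R f (t + c *\<^sub>R x))"
    by (rule integral_distr) auto
  finally show ?thesis by simp
qed

lemma lborel_integral_translate:
  fixes f :: "'a::euclidean_space \<Rightarrow> 'b::{banach, second_countable_topology}"
  assumes "f \<in> borel_measurable borel"
  shows "(LINT x|lborel. f (x + a)) = integral\<^sup>L lborel f"
  using lborel_affine_integral[OF assms, of 1 a] by (simp add: add.commute)

lemma lborel_integral_reflect:
  fixes f :: "'a::euclidean_space \<Rightarrow> 'b::{banach, second_countable_topology}"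
  assumes "f \<in> borel_measurable borel"
  shows "(LINT x|lborel. f (a - x)) = integral\<^sup>L lborel f"
  using lborel_affine_integral[OF assms, of "-1" a] by simp

lemma lborel_integrable_translate:
  fixes f :: "'a::euclidean_space \<Rightarrow> 'b::{banach, second_countable_topology}"
  assumes "integrable lborel f"
  shows "integrable lborel (\<lambda>x. f (x + a))"
  using lborel_affine_integrable[OF assms, of 1 a] by (simp add: add.commute)

lemma lborel_integrable_reflect:
  fixes f :: "'a::euclidean_space \<Rightarrow> 'b::{banach, second_countable_topology}"
  assumes "integrable lborel f"
  shows "integrable lborel (\<lambda>x. f (a - x))"
  using lborel_affine_integrable[OF assms, of "-1" a] by simp

lemma integrable_bounded_support:
  fixes f :: "'a::euclidean_space \<Rightarrow> 'b::{banach, second_countable_topology}"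
  assumes "f \<in> borel_measurable borel" "\<And>x. norm (f x) \<le> B" "\<And>x. norm x > R \<Longrightarrow> f x = 0"
  shows "integrable lborel f"
proof (rule Bochner_Integration.integrable_bound)
  show "integrable lborel (\<lambda>x::'a. B * indicator (cball 0 R) x)"
    by (intro integrable_mult_right integrable_real_indicator emeasure_bounded_finite) auto
  have "B \<ge> 0" using order_trans[OF norm_ge_zero assms(2)] .
  then show "AE x in lborel. norm (f x) \<le> norm (B * indicator (cball 0 R) x)"
    using assms(2,3) by (intro AE_I2) (auto simp: indicator_def not_le)
qed (use assms in auto)

text \<open>The divergence theorem for compact support: difference quotients have integral zero by
  translation invariance.\<close>

lemma integral_directional_derivative_0:
  fixes h h' :: "'a::euclidean_space \<Rightarrow> real"
  assumes [measurable]: "h \<in> borel_measurable borel" "h' \<in> borel_measurable borel"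
    and deriv: "\<And>x t. ((\<lambda>t. h (x + t *\<^sub>R e)) has_real_derivative h' (x + t *\<^sub>R e)) (at t)"
    and B: "\<And>x. \<bar>h' x\<bar> \<le> B" and R: "\<And>x. norm x > R \<Longrightarrow> h x = 0"
    and hB: "\<And>x. \<bar>h x\<bar> \<le> B'"
  shows "integral\<^sup>L lborel h' = 0"
proof -
  define q where "q n x = (h (x + (1 / real (Suc n)) *\<^sub>R e) - h x) / (1 / real (Suc n))" for n x
  have h: "integrable lborel h"
    using hB R by (intro integrable_bounded_support) auto
  have "integral\<^sup>L lborel (q n) = 0" for n
    unfolding q_def using h lborel_integrable_translate[OF h] lborel_integral_translate[of h]
    by simp
  moreover have "(\<lambda>n. integral\<^sup>L lborel (q n)) \<longlonglongrightarrow> integral\<^sup>L lborel h'"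
  proof (rule integral_dominated_convergence[where w = "\<lambda>x. B * indicator (cball 0 (R + norm e)) x"])
    show "integrable lborel (\<lambda>x::'a. B * indicator (cball 0 (R + norm e)) x)"
      by (intro integrable_mult_right integrable_real_indicator emeasure_bounded_finite) auto
    have lim: "(\<lambda>n. q n x) \<longlonglongrightarrow> h' x" for x
    proof -
      have "(\<lambda>n. 1 / real (Suc n)) \<longlonglongrightarrow> 0" by (rule LIMSEQ_Suc[OF lim_const_over_n])
      then have "filterlim (\<lambda>n. 1 / real (Suc n)) (at 0) sequentially"
        by (auto simp: filterlim_at)
      moreover have "((\<lambda>t. (h (x + t *\<^sub>R e) - h x) / t) \<longlongrightarrow> h' x) (at 0)"
        using deriv[of x 0] by (simp add: DERIV_def)
      ultimately show ?thesis unfolding q_def by (rule filterlim_compose[rotated])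
    qed
    then show "AE x in lborel. (\<lambda>n. q n x) \<longlonglongrightarrow> h' x" by simp
    show "AE x in lborel. norm (q n x) \<le> B * indicator (cball 0 (R + norm e)) x" for n
    proof (intro AE_I2)
      fix x
      have "B \<ge> 0" using order_trans[OF abs_ge_zero B] .
      define s where "s = 1 / real (Suc n)"
      have s: "0 < s" "s \<le> 1" by (auto simp: s_def)
      \<comment> \<open>The mean value theorem bounds the quotient by the bound on
        \<open>h'\<close>. Since the step is at most 1, the supports grow by at most
        \<open>norm e\<close>, so a single ball serves for the domination.\<close>
      obtain z where "h (x + s *\<^sub>R e) - h (x + 0 *\<^sub>R e) = (s - 0) * h' (x + z *\<^sub>R e)"
        using MVT2[of 0 s "\<lambda>t. h (x + t *\<^sub>R e)" "\<lambda>t. h' (x + t *\<^sub>R e)"] deriv s by blast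
      moreover have q: "q n x = (h (x + s *\<^sub>R e) - h x) / s" by (simp only: q_def s_def)
      ultimately have "q n x = h' (x + z *\<^sub>R e)" using s by simp
      then have "\<bar>q n x\<bar> \<le> B" using B by simp
      moreover have "q n x = 0" if "norm x > R + norm e"
      proof -
        have "norm (s *\<^sub>R e) \<le> norm e" using s by (simp add: mult_left_le_one_le)
        then have "norm (x + s *\<^sub>R e) > R" using that norm_diff_ineq[of x "s *\<^sub>R e"] by linarith
        moreover have "norm x > R" using that norm_ge_zero[of e] by linarith
        ultimately show ?thesis using R by (simp add: q)
      qed
      ultimately show "norm (q n x) \<le> B * indicator (cball 0 (R + norm e)) x"
        using \<open>B \<ge> 0\<close> by (auto simp: indicator_def not_le)
    qed
  next
    show "q n \<in> borel_measurable lborel" for n unfolding q_def by simp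
  qed auto
  ultimately show ?thesis by (simp add: LIMSEQ_const_iff)
qed

section \<open>Test functions\<close>

text \<open>The same expression through which \<open>is_weak_gradient\<close> refers to partial
  derivatives of test functions.\<close>

definition pd :: "'n \<Rightarrow> (real ^ 'n \<Rightarrow> real) \<Rightarrow> real ^ 'n \<Rightarrow> real" where
  "pd i f x = frechet_derivative f (at x) (axis i 1)"

lemma pd_eqI: "GDERIV f x :> g \<Longrightarrow> pd i f x = g $ i"
  unfolding pd_def GDERIV_has_derivative
  by (subst frechet_derivative_at[symmetric], assumption) (simp add: inner_commute[of _ g] inner_axis)

lemma smooth_GDERIV:
  assumes "smooth_on UNIV f"
  shows "GDERIV f x :> (\<chi> i. pd i f x)"
proof -
  obtain g where "\<forall>x. GDERIV f x :> g x"
    using assms[unfolded smooth_on_def, THEN spec[of _ "Suc 0"]] by auto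
  moreover from this have "(\<chi> i. pd i f x) = g x" by (simp add: vec_eq_iff pd_eqI)
  ultimately show ?thesis by simp
qed

lemma smooth_pd:
  assumes "smooth_on UNIV f"
  shows "smooth_on UNIV (pd i f)"
  unfolding smooth_on_def
proof
  fix k
  obtain g where "\<forall>x. GDERIV f x :> g x" "\<forall>i. Ck_on k UNIV (\<lambda>x. g x $ i)"
    using assms[unfolded smooth_on_def, THEN spec[of _ "Suc k"]] by auto
  moreover from this have "pd i f = (\<lambda>x. g x $ i)" by (simp add: fun_eq_iff pd_eqI)
  ultimately show "Ck_on k UNIV (pd i f)" by simp
qed

lemma smooth_continuous: "smooth_on UNIV f \<Longrightarrow> continuous_on UNIV f"
  using Ck_on.simps(1) unfolding smooth_on_def by blast

lemma smooth_borel [measurable_dest]: "smooth_on UNIV f \<Longrightarrow> f \<in> borel_measurable borel"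
  by (rule borel_measurable_continuous_onI[OF smooth_continuous])

lemma smooth_line_deriv:
  assumes "smooth_on UNIV f"
  shows "((\<lambda>t. f (x + t *\<^sub>R axis i 1)) has_real_derivative pd i f (x + t *\<^sub>R axis i 1)) (at t)"
proof -
  have "((\<lambda>t. x + t *\<^sub>R axis i 1) has_derivative (\<lambda>s. s *\<^sub>R axis i 1)) (at t)"
    by (auto intro!: derivative_eq_intros)
  moreover have "(f has_derivative (\<lambda>h. h \<bullet> (\<chi> j. pd j f (x + t *\<^sub>R axis i 1))))
      (at (x + t *\<^sub>R axis i 1))"
    using smooth_GDERIV[OF assms] by (simp add: GDERIV_has_derivative)
  ultimately have "((\<lambda>t. f (x + t *\<^sub>R axis i 1)) has_derivative
      (\<lambda>s. (s *\<^sub>R axis i 1) \<bullet> (\<chi> j. pd j f (x + t *\<^sub>R axis i 1)))) (at t)"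
    by (rule has_derivative_compose)
  then show ?thesis
    by (rule has_derivative_imp_has_field_derivative) (simp add: inner_axis')
qed

lemma pd_mult:
  assumes "smooth_on UNIV f" "smooth_on UNIV g"
  shows "pd i (\<lambda>x. f x * g x) x = f x * pd i g x + pd i f x * g x"
  using GDERIV_mult[OF smooth_GDERIV[OF assms(1)] smooth_GDERIV[OF assms(2)], THEN pd_eqI]
  by (simp add: mult.commute)

lemma pd_affine:
  assumes "smooth_on UNIV f"
  shows "pd i (\<lambda>y. f (a + c *\<^sub>R y)) x = c * pd i f (a + c *\<^sub>R x)"
proof -
  have "((\<lambda>y. a + c *\<^sub>R y) has_derivative (\<lambda>h. c *\<^sub>R h)) (at x)"
    by (auto intro!: derivative_eq_intros)
  moreover have "(f has_derivative (\<lambda>h. h \<bullet> (\<chi> j. pd j f (a + c *\<^sub>R x)))) (at (a + c *\<^sub>R x))"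
    using smooth_GDERIV[OF assms] by (simp add: GDERIV_has_derivative)
  ultimately have "GDERIV (\<lambda>y. f (a + c *\<^sub>R y)) x :> c *\<^sub>R (\<chi> j. pd j f (a + c *\<^sub>R x))"
    unfolding GDERIV_has_derivative by (auto dest: has_derivative_compose)
  then show ?thesis by (simp add: pd_eqI)
qed

lemma test_functionI:
  "smooth_on UNIV \<psi> \<Longrightarrow> (\<And>x. norm x > R \<Longrightarrow> \<psi> x = 0) \<Longrightarrow> test_function \<psi>"
  unfolding test_function_def by (auto intro!: exI[of _ "cball 0 R"])

lemma test_smooth: "test_function \<psi> \<Longrightarrow> smooth_on UNIV \<psi>"
  by (simp add: test_function_def)

lemma test_support:
  assumes "test_function \<psi>"
  obtains R where "R > 0" "\<And>x. norm x > R \<Longrightarrow> \<psi> x = 0"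
proof -
  obtain K where K: "compact K" "\<And>x. x \<notin> K \<Longrightarrow> \<psi> x = 0"
    using assms by (auto simp: test_function_def)
  obtain R where "R > 0" "\<forall>x\<in>K. norm x \<le> R"
    using compact_imp_bounded[OF K(1)] bounded_pos by blast
  with K(2) that show ?thesis by (meson not_le)
qed

lemma pd_support:
  assumes "\<And>x. norm x > R \<Longrightarrow> \<psi> x = 0" "norm x > R"
  shows "pd i \<psi> x = 0"
proof -
  have "open {x :: real ^ 'a. norm x > R}" by (intro open_Collect_less continuous_intros)
  then have "(\<psi> has_derivative (\<lambda>_. 0)) (at x)"
    using assms by (intro has_derivative_transform_within_open[OF has_derivative_const, of _ _ 0]) auto
  then have "GDERIV \<psi> x :> 0" by (simp add: GDERIV_has_derivative)
  then show ?thesis by (simp add: pd_eqI)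
qed

lemma test_pd:
  assumes "test_function \<psi>"
  shows "test_function (pd i \<psi>)"
proof -
  obtain R where "\<And>x. norm x > R \<Longrightarrow> \<psi> x = 0" using test_support[OF assms] by blast
  then show ?thesis
    using test_functionI[OF smooth_pd[OF test_smooth[OF assms]], of R i] pd_support[of R \<psi> _ i] by blast
qed

lemma test_bounded:
  assumes "test_function \<psi>"
  obtains B where "B > 0" "\<And>x. \<bar>\<psi> x\<bar> \<le> B"
proof -
  obtain R where R: "R > 0" "\<And>x. norm x > R \<Longrightarrow> \<psi> x = 0" using test_support[OF assms] by blast
  have "compact (\<psi> ` cball 0 R)"
    using smooth_continuous[OF test_smooth[OF assms]]
    by (intro compact_continuous_image) (auto intro: continuous_on_subset)
  then obtain B where "B > 0" "\<forall>y\<in>\<psi> ` cball 0 R. norm y \<le> B"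
    using compact_imp_bounded bounded_pos by metis
  moreover from this R have "\<bar>\<psi> x\<bar> \<le> B" for x
    by (cases "norm x > R") auto
  ultimately show ?thesis using that by blast
qed

lemma test_integrable:
  assumes "test_function \<psi>"
  shows "integrable lborel \<psi>"
  by (rule test_support[OF assms], rule test_bounded[OF assms], rule integrable_bounded_support)
     (use smooth_borel[OF test_smooth[OF assms]] in auto)

lemma test_lipschitz:
  assumes "test_function \<psi>"
  obtains L where "L > 0" "\<And>x y. \<bar>\<psi> x - \<psi> y\<bar> \<le> L * norm (x - y)"
proof -
  have "\<forall>i. \<exists>B>0. \<forall>x. \<bar>pd i \<psi> x\<bar> \<le> B" using test_bounded[OF test_pd[OF assms]] by metis
  then obtain B where B: "\<And>i. B i > 0" "\<And>i x. \<bar>pd i \<psi> x\<bar> \<le> B i" by metis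
  define L where "L = (\<Sum>i\<in>UNIV. B i)"
  have "L > 0" using B unfolding L_def by (intro sum_pos) auto
  moreover have "norm (\<psi> x - \<psi> y) \<le> L * norm (x - y)" for x y
  proof (rule differentiable_bound[of UNIV])
    fix z
    show "(\<psi> has_derivative (\<lambda>h. h \<bullet> (\<chi> i. pd i \<psi> z))) (at z within UNIV)"
      using smooth_GDERIV[OF test_smooth[OF assms]] by (simp add: GDERIV_has_derivative)
    have "norm (\<chi> i. pd i \<psi> z) \<le> (\<Sum>i\<in>UNIV. \<bar>pd i \<psi> z\<bar>)"
      using norm_le_l1_cart[of "\<chi> i. pd i \<psi> z"] by simp
    also have "\<dots> \<le> L" unfolding L_def using B by (intro sum_mono)
    finally have "norm (\<chi> i. pd i \<psi> z) \<le> L" .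
    then show "onorm (\<lambda>h. h \<bullet> (\<chi> i. pd i \<psi> z)) \<le> L"
      using \<open>L > 0\<close> order_trans[OF Cauchy_Schwarz_ineq2 mult_left_mono[OF _ norm_ge_zero]]
      by (intro onorm_bound) (auto simp: mult.commute[of L])
  qed auto
  ultimately show ?thesis using that by (metis real_norm_def)
qed

text \<open>The remainder is uniform in the base point. This allows differentiating a convolution
  with a function that is merely locally integrable.\<close>

lemma test_taylor:
  assumes "test_function \<psi>"
  obtains L where "L > 0"
    "\<And>x t. \<bar>\<psi> (x + t *\<^sub>R axis i 1) - \<psi> x - t * pd i \<psi> x\<bar> \<le> L * t\<^sup>2"
proof -
  obtain L where L: "L > 0" "\<And>x y. \<bar>pd i \<psi> x - pd i \<psi> y\<bar> \<le> L * norm (x - y)"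
    using test_lipschitz[OF test_pd[OF assms]] by metis
  have "\<bar>\<psi> (x + t *\<^sub>R axis i 1) - \<psi> x - t * pd i \<psi> x\<bar> \<le> L * t\<^sup>2" for x t
  proof -
    let ?f = "\<lambda>t. \<psi> (x + t *\<^sub>R axis i 1) - t * pd i \<psi> x"
    have "norm (?f t - ?f 0) \<le> (L * \<bar>t\<bar>) * norm (t - 0)"
    proof (rule field_differentiable_bound[where S = "cball 0 \<bar>t\<bar>"])
      fix s :: real assume s: "s \<in> cball 0 \<bar>t\<bar>"
      show "(?f has_real_derivative pd i \<psi> (x + s *\<^sub>R axis i 1) - pd i \<psi> x) (at s within cball 0 \<bar>t\<bar>)"
        by (rule has_field_derivative_at_within)
           (auto intro!: derivative_eq_intros smooth_line_deriv[OF test_smooth[OF assms]])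
      have "\<bar>pd i \<psi> (x + s *\<^sub>R axis i 1) - pd i \<psi> x\<bar> \<le> L * \<bar>s\<bar>"
        using L(2)[of "x + s *\<^sub>R axis i 1" x] by simp
      also have "\<dots> \<le> L * \<bar>t\<bar>" using s L(1) by (simp add: dist_norm)
      finally show "norm (pd i \<psi> (x + s *\<^sub>R axis i 1) - pd i \<psi> x) \<le> L * \<bar>t\<bar>" by simp
    qed auto
    then show ?thesis by (simp add: power2_eq_square algebra_simps abs_mult_self_eq)
  qed
  with L(1) that show ?thesis by blast
qed

lemma test_affine:
  assumes "test_function \<psi>" "c \<noteq> 0"
  shows "test_function (\<lambda>y. \<psi> (a + c *\<^sub>R y))"
proof -
  obtain R where R: "R > 0" "\<And>x. norm x > R \<Longrightarrow> \<psi> x = 0" using test_support[OF assms(1)] by blast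
  show ?thesis
  proof (rule test_functionI[of _ "(R + norm a) / \<bar>c\<bar>"])
    fix y :: "real ^ 'a" assume "norm y > (R + norm a) / \<bar>c\<bar>"
    then have "norm (c *\<^sub>R y) > R + norm a" using assms(2) by (simp add: field_simps)
    then have "norm (a + c *\<^sub>R y) > R" using norm_diff_ineq[of "c *\<^sub>R y" a] by (simp add: add.commute)
    then show "\<psi> (a + c *\<^sub>R y) = 0" by (rule R)
  qed (intro smooth_on_affine test_smooth assms)
qed

lemma test_mult:
  assumes "smooth_on UNIV f" "test_function \<psi>"
  shows "test_function (\<lambda>x. f x * \<psi> x)"
proof -
  obtain R where "R > 0" "\<And>x. norm x > R \<Longrightarrow> \<psi> x = 0" using test_support[OF assms(2)] by blast
  then show ?thesis using assms test_smooth by (intro test_functionI[of _ R] smooth_on_mult) auto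
qed

text \<open>One profile is rescaled by R, so \<open>C\<close> does not depend on R. The derivative
  is of size 1 / R and lives on the shell between R and 2 R, as the cutoff error in Green's formula
  requires.\<close>

lemma cutoff_functions:
  obtains C :: real and \<zeta> :: "real \<Rightarrow> real ^ 'n \<Rightarrow> real" where "C > 0"
    "\<And>R. R > 0 \<Longrightarrow> test_function (\<zeta> R)" "\<And>R x. 0 \<le> \<zeta> R x" "\<And>R x. \<zeta> R x \<le> 1"
    "\<And>R x. R > 0 \<Longrightarrow> norm x \<le> R \<Longrightarrow> \<zeta> R x = 1"
    "\<And>R x i. R > 0 \<Longrightarrow> \<bar>pd i (\<zeta> R) x\<bar> \<le> C / R" "\<And>R x i. R > 0 \<Longrightarrow> norm x > 2 * R \<Longrightarrow> pd i (\<zeta> R) x = 0"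
    "\<And>R x i. R > 0 \<Longrightarrow> norm x < R \<Longrightarrow> pd i (\<zeta> R) x = 0"
proof -
  \<comment> \<open>\<open>a\<close> is positive exactly for norm less than 2 and \<open>b\<close>
    exactly for norm greater than 1. Their sum has no zeros, and \<open>a / (a + b)\<close> is 1 on
    the unit ball and 0 outside the ball of radius 2.\<close>
  define a where "a x = flat 0 (4 + (-1) * (norm x)\<^sup>2)" for x :: "real ^ 'n"
  define b where "b x = flat 0 ((norm x)\<^sup>2 + (-1))" for x :: "real ^ 'n"
  have sm: "smooth_on UNIV a" "smooth_on UNIV b"
    unfolding a_def b_def
    by (intro smooth_on_flat smooth_on_add smooth_on_mult smooth_on_const smooth_on_power2_norm)+
  have nn: "a x \<ge> 0" "b x \<ge> 0" for x by (simp_all add: a_def b_def flat_0_nonneg)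
  have pos: "a x + b x > 0" for x
  proof (cases "(norm x)\<^sup>2 < 4")
    case True
    then show ?thesis using nn(2)[of x] flat_0_pos[of "4 + (-1) * (norm x)\<^sup>2"] by (simp add: a_def)
  next
    case False
    then show ?thesis using nn(1)[of x] flat_0_pos[of "(norm x)\<^sup>2 + (-1)"] by (simp add: b_def)
  qed
  define h where "h x = a x / (a x + b x)" for x
  have h1: "h x = 1" if "norm x \<le> 1" for x
    using that pos[of x] power_mono[OF that, of 2] by (simp add: h_def b_def flat_def)
  have h0: "h x = 0" if "norm x > 2" for x
    using power_strict_mono[OF that, of 2] by (simp add: h_def a_def flat_def)
  have test: "test_function h"
    unfolding h_def using h0 sm pos
    by (intro test_functionI[of _ 2] smooth_on_divide smooth_on_add) (auto simp: h_def)
  have hbd: "0 \<le> h x" "h x \<le> 1" for x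
    using nn[of x] pos[of x] by (auto simp: h_def)
  have "\<forall>i. \<exists>B>0. \<forall>x. \<bar>pd i h x\<bar> \<le> B" using test_bounded[OF test_pd[OF test]] by metis
  then obtain B where B: "\<And>i. B i > 0" "\<And>i x. \<bar>pd i h x\<bar> \<le> B i" by metis
  define C where "C = (\<Sum>i\<in>UNIV. B i)"
  have C: "C > 0" using B unfolding C_def by (intro sum_pos) auto
  have BC: "B i \<le> C" for i unfolding C_def using B(1) by (intro member_le_sum) (auto intro: less_imp_le)
  define \<zeta> where "\<zeta> R x = h (0 + (1 / R) *\<^sub>R x)" for R x
  have pd: "pd i (\<zeta> R) x = (1 / R) * pd i h (0 + (1 / R) *\<^sub>R x)" for i R x
    unfolding \<zeta>_def by (rule pd_affine[OF test_smooth[OF test]])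
  have z1: "\<zeta> R x = 1" if "R > 0" "norm x \<le> R" for R x
    using that unfolding \<zeta>_def by (intro h1) auto
  have z0: "\<zeta> R x = 0" if "R > 0" "norm x > 2 * R" for R x
    using that unfolding \<zeta>_def by (intro h0) (auto simp: field_simps)
  have pd1: "pd i (\<zeta> R) x = 0" if "R > 0" "norm x < R" for i R x
  proof -
    have "open (ball 0 R :: (real ^ 'n) set)" by simp
    then have "((\<zeta> R) has_derivative (\<lambda>_. 0)) (at x)"
      using that z1
      by (intro has_derivative_transform_within_open[OF has_derivative_const[of 1] \<open>open (ball 0 R)\<close>]) auto
    then have "GDERIV (\<zeta> R) x :> 0" by (simp add: GDERIV_has_derivative)
    then show ?thesis by (simp add: pd_eqI)
  qed
  show ?thesis
  proof (rule that[of C \<zeta>])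
    show "\<bar>pd i (\<zeta> R) x\<bar> \<le> C / R" if "R > 0" for R x i
      using that B(2)[of i "0 + (1 / R) *\<^sub>R x"] BC[of i] by (simp add: pd abs_mult divide_right_mono)
    show "test_function (\<zeta> R)" if "R > 0" for R
      unfolding \<zeta>_def using that by (intro test_affine test) auto
    show "pd i (\<zeta> R) x = 0" if "R > 0" "norm x > 2 * R" for R x i
      using z0 that by (intro pd_support[of "2 * R"]) auto
  qed (use C hbd z1 z0 pd1 in \<open>auto simp: \<zeta>_def\<close>)
qed

lemma mollifier:
  assumes "r > 0"
  obtains \<rho> :: "real ^ 'n \<Rightarrow> real" where "test_function \<rho>" "\<And>x. \<rho> x \<ge> 0"
    "\<And>x. norm x > r \<Longrightarrow> \<rho> x = 0" "integral\<^sup>L lborel \<rho> = 1"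
proof -
  define a where "a x = flat 0 (r\<^sup>2 + (-1) * (norm x)\<^sup>2)" for x :: "real ^ 'n"
  have sm: "smooth_on UNIV a"
    unfolding a_def
    by (intro smooth_on_flat smooth_on_add smooth_on_mult smooth_on_const smooth_on_power2_norm)
  have a0: "a x = 0" if "norm x > r" for x
    using power_strict_mono[OF that, of 2] assms by (simp add: a_def flat_def)
  have test: "test_function a" by (rule test_functionI[OF sm a0])
  have nn: "a x \<ge> 0" for x by (simp add: a_def flat_0_nonneg)
  have pos: "a x > 0" if "x \<in> ball 0 r" for x
    using that power_strict_mono[of "norm x" r 2] by (simp add: a_def flat_0_pos)
  have "integral\<^sup>L lborel a \<noteq> 0"
  proof
    assume "integral\<^sup>L lborel a = 0"
    then have "AE x in lborel. a x = 0"
      using integral_nonneg_eq_0_iff_AE[OF test_integrable[OF test]] nn by simp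
    then have "AE x in lborel. x \<notin> ball (0 :: real ^ 'n) r"
      by (rule eventually_mono) (use pos in force)
    then have "ball 0 r \<in> null_sets (lborel :: (real ^ 'n) measure)"
      by (simp add: AE_iff_null_sets)
    then have "measure lborel (ball (0 :: real ^ 'n) r) = 0" by (simp add: measure_def null_sets_def)
    then show False using content_ball_pos[OF assms, of "0 :: real ^ 'n"] by simp
  qed
  then have I: "integral\<^sup>L lborel a > 0"
    using nn integral_nonneg_AE[of a lborel] by (simp add: less_le)
  show ?thesis
  proof (rule that[of "\<lambda>x. (1 / integral\<^sup>L lborel a) * a x"])
    show "test_function (\<lambda>x. (1 / integral\<^sup>L lborel a) * a x)"
      by (intro test_mult test smooth_on_const)
  qed (use I nn a0 in auto)
qed

section \<open>Translations and approximate identities\<close>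

lemma cball_measurable [measurable]: "cball (x :: 'a::euclidean_space) r \<in> sets borel"
  by simp

text \<open>Openness gives pointwise convergence of the product of the indicator with its translate,
  and the absolute difference of two indicators is their sum minus twice their product.\<close>

lemma L1_translation_open:
  fixes U :: "'a::euclidean_space set"
  assumes "open U" "emeasure lborel U < \<infinity>" "h \<longlonglongrightarrow> 0"
  shows "(\<lambda>n. LINT x|lborel. \<bar>indicator U (x + h n) - indicator U x :: real\<bar>) \<longlonglongrightarrow> 0"
proof -
  have [measurable]: "U \<in> sets borel" using assms(1) by simp
  let ?i = "indicator U :: 'a \<Rightarrow> real"
  have i: "integrable lborel ?i" using assms(2) by (intro integrable_real_indicator) auto
  have it: "integrable lborel (\<lambda>x. ?i (x + h n))" for n by (rule lborel_integrable_translate[OF i])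
  have ip: "integrable lborel (\<lambda>x. ?i x * ?i (x + h n))" for n
    by (rule Bochner_Integration.integrable_bound[OF i]) (auto simp: indicator_def)
  have "(\<lambda>n. LINT x|lborel. ?i x * ?i (x + h n)) \<longlonglongrightarrow> (LINT x|lborel. ?i x)"
  proof (rule integral_dominated_convergence[where w = ?i])
    show "AE x in lborel. (\<lambda>n. ?i x * ?i (x + h n)) \<longlonglongrightarrow> ?i x"
    proof (intro AE_I2)
      fix x
      have "(\<lambda>n. x + h n) \<longlonglongrightarrow> x + 0" by (intro tendsto_intros assms)
      then have "eventually (\<lambda>n. x + h n \<in> U) sequentially" if "x \<in> U"
        using assms(1) that by (auto intro: topological_tendstoD)
      then have "eventually (\<lambda>n. ?i x * ?i (x + h n) = ?i x) sequentially"
        by (cases "x \<in> U") (auto elim!: eventually_mono)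
      then show "(\<lambda>n. ?i x * ?i (x + h n)) \<longlonglongrightarrow> ?i x" by (rule tendsto_eventually)
    qed
  qed (use i in \<open>auto simp: indicator_def\<close>)
  then have "(\<lambda>n. 2 * (LINT x|lborel. ?i x) - 2 * (LINT x|lborel. ?i x * ?i (x + h n)))
      \<longlonglongrightarrow> 2 * (LINT x|lborel. ?i x) - 2 * (LINT x|lborel. ?i x)"
    by (intro tendsto_intros)
  moreover have "(LINT x|lborel. \<bar>?i (x + h n) - ?i x\<bar>) =
      2 * (LINT x|lborel. ?i x) - 2 * (LINT x|lborel. ?i x * ?i (x + h n))" for n
  proof -
    have "(LINT x|lborel. \<bar>?i (x + h n) - ?i x\<bar>) =
        (LINT x|lborel. ?i (x + h n) + ?i x - 2 * (?i x * ?i (x + h n)))"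
      by (intro Bochner_Integration.integral_cong) (auto simp: indicator_def)
    also have "\<dots> = (LINT x|lborel. ?i (x + h n)) + (LINT x|lborel. ?i x) - 2 * (LINT x|lborel. ?i x * ?i (x + h n))"
      using i it ip by simp
    finally show ?thesis using lborel_integral_translate[of ?i "h n"] by simp
  qed
  ultimately show ?thesis by simp
qed

lemma L1_translation:
  fixes f :: "'a::euclidean_space \<Rightarrow> real"
  assumes "integrable lborel f" "h \<longlonglongrightarrow> 0"
  shows "(\<lambda>n. LINT x|lborel. \<bar>f (x + h n) - f x\<bar>) \<longlonglongrightarrow> 0"
proof -
  \<comment> \<open>The set of functions with the claimed property is closed in L1, because a
    translation preserves the L1 distance. This serves both the case of a set and the limit case of
    the induction.\<close>
  have approx: "(\<lambda>n. LINT x|lborel. \<bar>f (x + h n) - f x\<bar>) \<longlonglongrightarrow> 0"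
    if f: "integrable lborel f" and ex: "\<And>e. e > 0 \<Longrightarrow> \<exists>g. integrable lborel g \<and>
      (LINT x|lborel. \<bar>f x - g x\<bar>) < e \<and> (\<lambda>n. LINT x|lborel. \<bar>g (x + h n) - g x\<bar>) \<longlonglongrightarrow> 0"
    for f :: "'a \<Rightarrow> real"
  proof (rule LIMSEQ_I)
    fix r :: real assume "r > 0"
    obtain g where g: "integrable lborel g" "(LINT x|lborel. \<bar>f x - g x\<bar>) < r / 3"
      "(\<lambda>n. LINT x|lborel. \<bar>g (x + h n) - g x\<bar>) \<longlonglongrightarrow> 0"
      using ex[of "r / 3"] \<open>r > 0\<close> by auto
    obtain N where N: "\<And>n. n \<ge> N \<Longrightarrow> (LINT x|lborel. \<bar>g (x + h n) - g x\<bar>) < r / 3"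
      using LIMSEQ_D[OF g(3), of "r / 3"] \<open>r > 0\<close> by auto
    have "norm ((LINT x|lborel. \<bar>f (x + h n) - f x\<bar>) - 0) < r" if "n \<ge> N" for n
    proof -
      note [simp] = f g(1) lborel_integrable_translate[OF f, of "h n"]
        lborel_integrable_translate[OF g(1), of "h n"]
      have d: "integrable lborel (\<lambda>x. f x - g x)" by simp
      have dt: "integrable lborel (\<lambda>x. \<bar>f (x + h n) - g (x + h n)\<bar>)" by simp
      have "(LINT x|lborel. \<bar>f (x + h n) - f x\<bar>) \<le> (LINT x|lborel. \<bar>f (x + h n) - g (x + h n)\<bar> +
          \<bar>g (x + h n) - g x\<bar> + \<bar>f x - g x\<bar>)"
        by (rule integral_mono) auto
      also have "\<dots> = (LINT x|lborel. \<bar>f (x + h n) - g (x + h n)\<bar>) +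
          (LINT x|lborel. \<bar>g (x + h n) - g x\<bar>) + (LINT x|lborel. \<bar>f x - g x\<bar>)"
        by simp
      also have "(LINT x|lborel. \<bar>f (x + h n) - g (x + h n)\<bar>) = (LINT x|lborel. \<bar>f x - g x\<bar>)"
        using borel_measurable_integrable[OF d]
        by (intro lborel_integral_translate[of "\<lambda>x. \<bar>f x - g x\<bar>"]) auto
      finally show ?thesis using N[OF that] g(2) by simp
    qed
    then show "\<exists>N. \<forall>n\<ge>N. norm ((LINT x|lborel. \<bar>f (x + h n) - f x\<bar>) - 0) < r" by blast
  qed
  show ?thesis using assms(1)
  proof (induction rule: integrable_induct)
    case (base A c)
    have A [measurable]: "A \<in> sets borel" using base by simp
    have "(\<lambda>n. LINT x|lborel. \<bar>indicator A (x + h n) - indicator A x :: real\<bar>) \<longlonglongrightarrow> 0"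
    proof (rule approx)
      show "integrable lborel (indicator A :: 'a \<Rightarrow> real)"
        using base by (intro integrable_real_indicator) auto
      fix e :: real assume "e > 0"
      \<comment> \<open>Outer regularity reduces a set of finite measure to an open one, for which
        the claim is \<open>L1_translation_open\<close>.\<close>
      obtain U where U: "open U" "A \<subseteq> U" "emeasure lborel (U - A) < e"
        using outer_regular_lborel[OF A \<open>e > 0\<close>] by blast
      have [measurable]: "U \<in> sets borel" using U by simp
      have "emeasure lborel ((U - A) \<union> A) \<le> emeasure lborel (U - A) + emeasure lborel A"
        by (rule emeasure_subadditive) auto
      moreover have "(U - A) \<union> A = U" using U(2) by blast
      moreover have fin': "emeasure lborel (U - A) < \<infinity>" using U(3) by (rule less_trans) simp
      ultimately have fin: "emeasure lborel U < \<infinity>"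
        using base by (auto elim!: le_less_trans simp: ennreal_add_less_top)
      have "(LINT x|lborel. \<bar>indicator A x - indicator U x :: real\<bar>) = (LINT x|lborel. indicator (U - A) x)"
        using U(2) by (intro Bochner_Integration.integral_cong) (auto simp: indicator_def)
      also have "\<dots> < e"
        using U(3) fin' \<open>e > 0\<close> by (simp add: emeasure_eq_ennreal_measure ennreal_less_iff)
      finally show "\<exists>g. integrable lborel g \<and> (LINT x|lborel. \<bar>indicator A x - g x\<bar>) < e \<and>
          (\<lambda>n. LINT x|lborel. \<bar>g (x + h n) - g x\<bar>) \<longlonglongrightarrow> 0"
        using L1_translation_open[OF U(1) fin assms(2)] fin
        by (intro exI[of _ "indicator U"]) (auto intro!: integrable_real_indicator)
    qed
    from tendsto_mult_left[OF this, of "\<bar>c\<bar>"] show ?case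
      by (simp add: abs_mult[symmetric] right_diff_distrib mult.commute flip: integral_mult_right_zero)
  next
    case (add f g)
    note [simp] = add.hyps lborel_integrable_translate[OF add.hyps(1)]
        lborel_integrable_translate[OF add.hyps(2)]
    have "(\<lambda>n. (LINT x|lborel. \<bar>f (x + h n) - f x\<bar>) + (LINT x|lborel. \<bar>g (x + h n) - g x\<bar>)) \<longlonglongrightarrow> 0 + 0"
      by (intro tendsto_add add.IH)
    then have lim: "(\<lambda>n. (LINT x|lborel. \<bar>f (x + h n) - f x\<bar>) + (LINT x|lborel. \<bar>g (x + h n) - g x\<bar>)) \<longlonglongrightarrow> 0"
      by simp
    show ?case
    proof (rule tendsto_sandwich[OF _ _ tendsto_const lim])
      have "(LINT x|lborel. \<bar>f (x + h n) + g (x + h n) - (f x + g x)\<bar>) \<le>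
        (LINT x|lborel. \<bar>f (x + h n) - f x\<bar> + \<bar>g (x + h n) - g x\<bar>)" for n
        by (rule integral_mono) auto
      then show "eventually (\<lambda>n. (LINT x|lborel. \<bar>f (x + h n) + g (x + h n) - (f x + g x)\<bar>) \<le>
        (LINT x|lborel. \<bar>f (x + h n) - f x\<bar>) + (LINT x|lborel. \<bar>g (x + h n) - g x\<bar>)) sequentially"
        by (intro always_eventually) simp
    qed (auto intro!: always_eventually integral_nonneg_AE)
  next
    case (lim f s)
    show ?case
    proof (rule approx)
      show f: "integrable lborel f" by (rule lim)
      fix e :: real assume "e > 0"
      have "(\<lambda>i. LINT x|lborel. \<bar>f x - s i x\<bar>) \<longlonglongrightarrow> integral\<^sup>L lborel (\<lambda>_ :: 'a. 0 :: real)"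
      proof (rule integral_dominated_convergence[where w = "\<lambda>x. 3 * \<bar>f x\<bar>"])
        show "AE x in lborel. (\<lambda>i. \<bar>f x - s i x\<bar>) \<longlonglongrightarrow> 0"
        proof (intro AE_I2)
          fix x :: 'a
          have "(\<lambda>i. \<bar>f x - s i x\<bar>) \<longlonglongrightarrow> \<bar>f x - f x\<bar>"
            by (intro tendsto_intros lim) simp
          then show "(\<lambda>i. \<bar>f x - s i x\<bar>) \<longlonglongrightarrow> 0" by simp
        qed
        show "AE x in lborel. norm \<bar>f x - s i x\<bar> \<le> 3 * \<bar>f x\<bar>" for i
        proof (intro AE_I2)
          fix x :: 'a
          have "\<bar>s i x\<bar> \<le> 2 * \<bar>f x\<bar>" using lim(3)[of x i] by simp
          then show "norm \<bar>f x - s i x\<bar> \<le> 3 * \<bar>f x\<bar>" by simp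
        qed
      qed (use f lim(1) in \<open>auto dest: borel_measurable_integrable\<close>)
      then obtain i where "(LINT x|lborel. \<bar>f x - s i x\<bar>) < e"
        using LIMSEQ_D[OF _ \<open>e > 0\<close>] by fastforce
      then show "\<exists>g. integrable lborel g \<and> (LINT x|lborel. \<bar>f x - g x\<bar>) < e \<and>
          (\<lambda>n. LINT x|lborel. \<bar>g (x + h n) - g x\<bar>) \<longlonglongrightarrow> 0"
        using lim by blast
    qed
  qed
qed

text \<open>Stated with Borel measurability and \<open>lborel\<close>, where composition with Borel
  functions and Fubini's theorem apply. The Lebesgue measurable \<open>locally_integrable\<close>
  functions are related to this class by their representatives.\<close>

definition loc_int :: "('a::euclidean_space \<Rightarrow> real) \<Rightarrow> bool" where
  "loc_int f \<longleftrightarrow> f \<in> borel_measurable borel \<and> (\<forall>R. integrable lborel (\<lambda>x. indicator (cball 0 R) x * f x))"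

lemma loc_int_borel [measurable_dest]: "loc_int f \<Longrightarrow> f \<in> borel_measurable borel"
  by (simp add: loc_int_def)

lemma loc_intD: "loc_int f \<Longrightarrow> integrable lborel (\<lambda>x. indicator (cball 0 R) x * f x)"
  by (simp add: loc_int_def)

lemma loc_int_translation:
  assumes "loc_int g" "e > 0"
  obtains d where "d > 0" "d \<le> 1" "\<And>z. norm z \<le> d \<Longrightarrow>
    (\<integral>\<^sup>+x. indicator (cball 0 R) x * ennreal \<bar>g (x - z) - g x\<bar> \<partial>lborel) \<le> ennreal e"
proof -
  \<comment> \<open>The radius \<open>R + 1\<close> leaves room for \<open>x - z\<close> when z has
    norm at most 1.\<close>
  define G where "G x = indicator (cball 0 (R + 1)) x * g x" for x
  have G: "integrable lborel G" unfolding G_def by (rule loc_intD[OF assms(1)])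
  note [measurable] = loc_int_borel[OF assms(1)]
  have "eventually (\<lambda>z. (LINT x|lborel. \<bar>G (x + z) - G x\<bar>) < e) (at 0)"
  proof (rule sequentially_imp_eventually_at, safe)
    fix h :: "nat \<Rightarrow> 'a" assume "h \<longlonglongrightarrow> 0"
    from L1_translation[OF G this] show "eventually (\<lambda>n. (LINT x|lborel. \<bar>G (x + h n) - G x\<bar>) < e) sequentially"
      using assms(2) by (rule order_tendstoD)
  qed
  then obtain d0 where d0: "d0 > 0" "\<And>z. z \<noteq> 0 \<Longrightarrow> norm z < d0 \<Longrightarrow> (LINT x|lborel. \<bar>G (x + z) - G x\<bar>) < e"
    by (auto simp: eventually_at)
  define d where "d = min 1 (d0 / 2)"
  have "(\<integral>\<^sup>+x. indicator (cball 0 R) x * ennreal \<bar>g (x - z) - g x\<bar> \<partial>lborel) \<le> ennreal e" if "norm z \<le> d" for z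
  proof -
    have lt: "(LINT x|lborel. \<bar>G (x + (- z)) - G x\<bar>) \<le> e"
      using d0(2)[of "- z"] that d0(1) assms(2) by (cases "z = 0") (auto simp: d_def)
    have "(\<integral>\<^sup>+x. indicator (cball 0 R) x * ennreal \<bar>g (x - z) - g x\<bar> \<partial>lborel) \<le>
        (\<integral>\<^sup>+x. ennreal \<bar>G (x + (- z)) - G x\<bar> \<partial>lborel)"
    proof (rule nn_integral_mono)
      fix x :: 'a
      have "norm (x - z) \<le> R + 1" if "norm x \<le> R"
        using norm_triangle_ineq4[of x z] that \<open>norm z \<le> d\<close> by (simp add: d_def)
      then show "indicator (cball 0 R) x * ennreal \<bar>g (x - z) - g x\<bar> \<le> ennreal \<bar>G (x + (- z)) - G x\<bar>"
        by (cases "norm x \<le> R") (auto simp: G_def)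
    qed
    also have "\<dots> = ennreal (LINT x|lborel. \<bar>G (x + (- z)) - G x\<bar>)"
      using G lborel_integrable_translate[OF G, of "- z"]
      by (intro nn_integral_eq_integral) auto
    also have "\<dots> \<le> ennreal e" using lt by (rule ennreal_leI)
    finally show ?thesis .
  qed
  moreover have "d > 0" "d \<le> 1" using d0(1) by (auto simp: d_def)
  ultimately show ?thesis using that by blast
qed

text \<open>By Fubini the error is at most the integral of J(z) k(z), where J(z) is the L1 distance
  on the ball between g and its translate by z. J is small near 0, and elsewhere it is at most
  \<open>M\<close> while the mass of the kernel vanishes. The bound is asked only where the kernel
  is nonzero: mollifiers have bounded displacements and a general g, bubbles have all displacements
  and a bounded g.\<close>

lemma approximate_identity:
  fixes g :: "'a::euclidean_space \<Rightarrow> real" and k :: "nat \<Rightarrow> 'a \<Rightarrow> real"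
  assumes g: "loc_int g"
    and k: "\<And>n. integrable lborel (k n)" "\<And>n z. k n z \<ge> 0" "\<And>n. integral\<^sup>L lborel (k n) = a"
    and tail: "\<And>r. r > 0 \<Longrightarrow> (\<lambda>n. LINT z|lborel. indicator {z. norm z > r} z * k n z) \<longlonglongrightarrow> 0"
    and int: "\<And>n x. integrable lborel (\<lambda>z. g (x - z) * k n z)"
    and M: "\<And>n z. k n z \<noteq> 0 \<Longrightarrow>
      (\<integral>\<^sup>+x. indicator (cball 0 R) x * ennreal \<bar>g (x - z) - g x\<bar> \<partial>lborel) \<le> ennreal M"
  shows "(\<lambda>n. \<integral>\<^sup>+x. indicator (cball 0 R) x * ennreal \<bar>(LINT z|lborel. g (x - z) * k n z) - a * g x\<bar> \<partial>lborel)
    \<longlonglongrightarrow> 0"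
proof -
  note [measurable] = loc_int_borel[OF g] borel_measurable_integrable[OF k(1), simplified]
  define J where "J z = (\<integral>\<^sup>+x. indicator (cball 0 R) x * ennreal \<bar>g (x - z) - g x\<bar> \<partial>lborel)" for z
  define t where "t r n = (LINT z|lborel. indicator {z. norm z > r} z * k n z)" for r n
  have a: "a \<ge> 0" using k(2) k(3)[of 0] integral_nonneg_AE[of "k 0" lborel] by simp
  have JM: "J z \<le> ennreal (max M 0)" if "k n z \<noteq> 0" for n z
    using M[OF that] order_trans[OF _ ennreal_leI[of M "max M 0"]] by (simp add: J_def)
  have ti: "integrable lborel (\<lambda>z. indicator {z. norm z > r} z * k n z)" for r n
    by (rule Bochner_Integration.integrable_bound[OF k(1)[of n]]) (use k(2) in \<open>auto simp: indicator_def\<close>)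
  have bound: "(\<integral>\<^sup>+x. indicator (cball 0 R) x * ennreal \<bar>(LINT z|lborel. g (x - z) * k n z) - a * g x\<bar> \<partial>lborel)
      \<le> ennreal (e * a + max M 0 * t r n)"
    if e: "e > 0" and J: "\<And>z. norm z \<le> r \<Longrightarrow> J z \<le> ennreal e" for e r n
  proof -
    have "(\<integral>\<^sup>+x. indicator (cball 0 R) x * ennreal \<bar>(LINT z|lborel. g (x - z) * k n z) - a * g x\<bar> \<partial>lborel)
        \<le> (\<integral>\<^sup>+x. (\<integral>\<^sup>+z. indicator (cball 0 R) x * (ennreal \<bar>g (x - z) - g x\<bar> * ennreal (k n z)) \<partial>lborel) \<partial>lborel)"
    proof (rule nn_integral_mono)
      fix x :: 'a
      have i: "integrable lborel (\<lambda>z. g (x - z) * k n z - k n z * g x)" using int k(1) by simp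
      have "(LINT z|lborel. g (x - z) * k n z) - a * g x = (LINT z|lborel. g (x - z) * k n z - k n z * g x)"
        using int k(1,3) by simp
      then have "ennreal \<bar>(LINT z|lborel. g (x - z) * k n z) - a * g x\<bar> \<le>
          ennreal (LINT z|lborel. \<bar>g (x - z) * k n z - k n z * g x\<bar>)"
        using integral_abs_bound by (intro ennreal_leI) simp
      also have "\<dots> = (\<integral>\<^sup>+z. ennreal \<bar>g (x - z) * k n z - k n z * g x\<bar> \<partial>lborel)"
        using i by (intro nn_integral_eq_integral[symmetric]) auto
      also have "\<dots> = (\<integral>\<^sup>+z. ennreal \<bar>g (x - z) - g x\<bar> * ennreal (k n z) \<partial>lborel)"
      proof (rule nn_integral_cong)
        fix z
        have "g (x - z) * k n z - k n z * g x = (g (x - z) - g x) * k n z" by (simp add: algebra_simps)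
        then show "ennreal \<bar>g (x - z) * k n z - k n z * g x\<bar> = ennreal \<bar>g (x - z) - g x\<bar> * ennreal (k n z)"
          using k(2)[of n z] by (simp add: abs_mult ennreal_mult')
      qed
      finally show "indicator (cball 0 R) x * ennreal \<bar>(LINT z|lborel. g (x - z) * k n z) - a * g x\<bar> \<le>
        (\<integral>\<^sup>+z. indicator (cball 0 R) x * (ennreal \<bar>g (x - z) - g x\<bar> * ennreal (k n z)) \<partial>lborel)"
        by (auto simp: indicator_def)
    qed
    also have "\<dots> = (\<integral>\<^sup>+z. (\<integral>\<^sup>+x. indicator (cball 0 R) x * (ennreal \<bar>g (x - z) - g x\<bar> * ennreal (k n z)) \<partial>lborel) \<partial>lborel)"
    proof (rule lborel_pair.Fubini')
      have [measurable]: "k n \<in> borel_measurable borel" "g \<in> borel_measurable borel" "cball (0 :: 'a) R \<in> sets borel"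
        using borel_measurable_integrable[OF k(1)] loc_int_borel[OF g] by auto
      have "(\<lambda>(z, x). indicator (cball 0 R) x * (ennreal \<bar>g (x - z) - g x\<bar> * ennreal (k n z)))
          \<in> borel_measurable (borel \<Otimes>\<^sub>M borel)" by measurable
      then show "(\<lambda>(z, x). indicator (cball 0 R) x * (ennreal \<bar>g (x - z) - g x\<bar> * ennreal (k n z)))
          \<in> borel_measurable (lborel \<Otimes>\<^sub>M lborel)" by (simp cong: measurable_cong_sets)
    qed
    also have "\<dots> = (\<integral>\<^sup>+z. J z * ennreal (k n z) \<partial>lborel)"
      unfolding J_def
    proof (intro nn_integral_cong)
      fix z
      have [measurable]: "g \<in> borel_measurable borel" "cball (0 :: 'a) R \<in> sets borel"
        using loc_int_borel[OF g] by auto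
      show "(\<integral>\<^sup>+x. indicator (cball 0 R) x * (ennreal \<bar>g (x - z) - g x\<bar> * ennreal (k n z)) \<partial>lborel) =
          (\<integral>\<^sup>+x. indicator (cball 0 R) x * ennreal \<bar>g (x - z) - g x\<bar> \<partial>lborel) * ennreal (k n z)"
        by (subst nn_integral_multc[symmetric]) (measurable, simp add: mult.assoc)
    qed
    also have "\<dots> \<le> (\<integral>\<^sup>+z. ennreal (e * k n z + max M 0 * (indicator {z. norm z > r} z * k n z)) \<partial>lborel)"
    proof (rule nn_integral_mono)
      fix z
      show "J z * ennreal (k n z) \<le> ennreal (e * k n z + max M 0 * (indicator {z. norm z > r} z * k n z))"
      proof (cases "norm z \<le> r")
        case True
        then have "J z * ennreal (k n z) \<le> ennreal e * ennreal (k n z)"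
          by (intro mult_right_mono J) auto
        also have "\<dots> \<le> ennreal (e * k n z + max M 0 * (indicator {z. norm z > r} z * k n z))"
          using True e k(2)[of n z] by (simp add: ennreal_mult')
        finally show ?thesis .
      next
        case False
        show ?thesis
        proof (cases "k n z = 0")
          case True
          then show ?thesis by simp
        next
          case nz: False
          have "J z * ennreal (k n z) \<le> ennreal (max M 0) * ennreal (k n z)"
            by (intro mult_right_mono JM[OF nz]) auto
          also have "\<dots> = ennreal (max M 0 * k n z)" using k(2)[of n z] by (simp add: ennreal_mult')
          also have "\<dots> \<le> ennreal (e * k n z + max M 0 * (indicator {z. norm z > r} z * k n z))"
            using False e k(2)[of n z] by (intro ennreal_leI) (simp add: not_le)
          finally show ?thesis .
        qed
      qed
    qed
    also have "\<dots> = ennreal (LINT z|lborel. e * k n z + max M 0 * (indicator {z. norm z > r} z * k n z))"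
      using k(1,2) ti e by (intro nn_integral_eq_integral) (auto intro!: AE_I2 add_nonneg_nonneg mult_nonneg_nonneg)
    also have "(LINT z|lborel. e * k n z + max M 0 * (indicator {z. norm z > r} z * k n z)) = e * a + max M 0 * t r n"
      using k(1,3) ti by (simp add: t_def)
    finally show ?thesis .
  qed
  show ?thesis
  proof (rule order_tendstoI)
    fix y :: ennreal assume "y > 0"
    obtain \<epsilon> :: real where \<epsilon>: "\<epsilon> > 0" "ennreal \<epsilon> < y"
      using \<open>y > 0\<close> by (metis ennreal_0 dense ennreal_cases ennreal_less_zero_iff le_less_trans less_top_ennreal top_greatest less_le not_less_zero zero_less_iff_neq_zero)
    define e where "e = \<epsilon> / (2 * (a + 1))"
    have e: "e > 0" "e * a \<le> \<epsilon> / 2" using \<epsilon> a by (auto simp: e_def field_simps)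
    obtain d where d: "d > 0" "\<And>z. norm z \<le> d \<Longrightarrow> J z \<le> ennreal e"
      using loc_int_translation[OF g \<open>e > 0\<close>, of R] unfolding J_def by blast
    have "(\<lambda>n. max M 0 * t d n) \<longlonglongrightarrow> max M 0 * 0"
      unfolding t_def by (intro tendsto_intros tail d)
    then have "eventually (\<lambda>n. max M 0 * t d n < \<epsilon> / 2) sequentially"
      using \<epsilon>(1) by (intro order_tendstoD(2)) auto
    then show "eventually (\<lambda>n. (\<integral>\<^sup>+x. indicator (cball 0 R) x *
        ennreal \<bar>(LINT z|lborel. g (x - z) * k n z) - a * g x\<bar> \<partial>lborel) < y) sequentially"
    proof eventually_elim
      case (elim n)
      have "e * a + max M 0 * t d n \<le> \<epsilon>" using elim e(2) by linarith
      then show ?case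
        using bound[OF e(1) d(2), where n = n and r = d] \<epsilon>(2) by (meson ennreal_leI le_less_trans)
    qed
  qed auto
qed

section \<open>Mollification\<close>

lemma loc_int_mult_bounded:
  assumes "loc_int f" and [measurable]: "b \<in> borel_measurable borel" and "\<And>x. \<bar>b x\<bar> \<le> B"
  shows "loc_int (\<lambda>x. b x * f x)"
  unfolding loc_int_def
proof (intro conjI allI)
  note [measurable] = loc_int_borel[OF assms(1)]
  show "(\<lambda>x. b x * f x) \<in> borel_measurable borel" by measurable
  fix R
  have "B \<ge> 0" using order_trans[OF abs_ge_zero assms(3)] .
  show "integrable lborel (\<lambda>x. indicator (cball 0 R) x * (b x * f x))"
  proof (rule Bochner_Integration.integrable_bound)
    show "integrable lborel (\<lambda>x. B * (indicator (cball 0 R) x * f x))"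
      using loc_intD[OF assms(1)] by simp
    show "AE x in lborel. norm (indicator (cball 0 R) x * (b x * f x)) \<le> norm (B * (indicator (cball 0 R) x * f x))"
      using assms(3) \<open>B \<ge> 0\<close> by (intro AE_I2) (auto simp: abs_mult indicator_def intro!: mult_right_mono)
  qed simp
qed

lemma loc_int_add: "loc_int f \<Longrightarrow> loc_int g \<Longrightarrow> loc_int (\<lambda>x. f x + g x)"
  by (auto simp: loc_int_def distrib_left)

lemma loc_int_cmult: "loc_int f \<Longrightarrow> loc_int (\<lambda>x. c * f x)"
  using loc_int_mult_bounded[of f "\<lambda>_. c" "\<bar>c\<bar>"] by simp

lemma loc_intI_bounded:
  fixes f :: "'a::euclidean_space \<Rightarrow> real"
  assumes [measurable]: "f \<in> borel_measurable borel" and "\<And>R. \<exists>B. \<forall>x. norm x \<le> R \<longrightarrow> \<bar>f x\<bar> \<le> B"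
  shows "loc_int f"
  unfolding loc_int_def
proof (intro conjI allI)
  fix R
  obtain B where "\<forall>x. norm x \<le> R \<longrightarrow> \<bar>f x\<bar> \<le> B" using assms(2) by blast
  then show "integrable lborel (\<lambda>x. indicator (cball 0 R) x * f x)"
    by (intro integrable_bounded_support[of _ "max B 0" R]) (auto simp: indicator_def le_max_iff_disj)
qed simp

lemma loc_int_continuous:
  fixes f :: "'a::euclidean_space \<Rightarrow> real"
  assumes "continuous_on UNIV f"
  shows "loc_int f"
proof (rule loc_intI_bounded)
  fix R
  have "compact (f ` cball 0 R)"
    using assms by (intro compact_continuous_image) (auto intro: continuous_on_subset)
  then obtain B where "\<forall>y\<in>f ` cball 0 R. norm y \<le> B"
    using compact_imp_bounded bounded_iff by metis
  then show "\<exists>B. \<forall>x. norm x \<le> R \<longrightarrow> \<bar>f x\<bar> \<le> B" by (intro exI[of _ B]) auto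
qed (rule borel_measurable_continuous_onI[OF assms])

lemma loc_int_abs: "loc_int f \<Longrightarrow> loc_int (\<lambda>x. \<bar>f x\<bar>)"
proof -
  assume f: "loc_int f"
  note [measurable] = loc_int_borel[OF f]
  have "loc_int (\<lambda>x. sgn (f x) * f x)"
    by (rule loc_int_mult_bounded[OF f, of _ 1]) (auto simp: sgn_real_def)
  then show ?thesis by (simp add: abs_sgn mult.commute)
qed

lemma loc_int_mono:
  assumes "loc_int g" and [measurable]: "f \<in> borel_measurable borel" and "\<And>x. \<bar>f x\<bar> \<le> \<bar>g x\<bar>"
  shows "loc_int f"
  unfolding loc_int_def
proof (intro conjI allI)
  fix R
  show "integrable lborel (\<lambda>x. indicator (cball 0 R) x * f x)"
    by (rule Bochner_Integration.integrable_bound[OF loc_intD[OF assms(1), of R]])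
       (use assms(3) in \<open>auto simp: indicator_def\<close>)
qed simp

lemma loc_int_test_integrable:
  assumes "loc_int f" "test_function \<psi>"
  shows "integrable lborel (\<lambda>x. f x * \<psi> x)"
proof -
  note [measurable] = loc_int_borel[OF assms(1)] smooth_borel[OF test_smooth[OF assms(2)]]
  obtain R where R: "\<And>x. norm x > R \<Longrightarrow> \<psi> x = 0" using test_support[OF assms(2)] by blast
  obtain B where B: "B > 0" "\<And>x. \<bar>\<psi> x\<bar> \<le> B" using test_bounded[OF assms(2)] by blast
  show ?thesis
  proof (rule Bochner_Integration.integrable_bound)
    show "integrable lborel (\<lambda>x. B * (indicator (cball 0 R) x * f x))"
      using loc_intD[OF assms(1)] by simp
    have "\<bar>f x\<bar> * \<bar>\<psi> x\<bar> \<le> B * \<bar>f x\<bar>" for x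
      using mult_left_mono[OF B(2)[of x], of "\<bar>f x\<bar>"] by (simp add: mult.commute)
    then show "AE x in lborel. norm (f x * \<psi> x) \<le> norm (B * (indicator (cball 0 R) x * f x))"
      using B(1) R by (intro AE_I2) (auto simp: abs_mult indicator_def not_le)
  qed simp
qed

section \<open>Convolutions with test functions\<close>

definition conv :: "('a::euclidean_space \<Rightarrow> real) \<Rightarrow> ('a \<Rightarrow> real) \<Rightarrow> 'a \<Rightarrow> real" where
  "conv f k x = (LINT y|lborel. f y * k (x - y))"

lemma conv_reflect:
  assumes [measurable]: "f \<in> borel_measurable borel" "k \<in> borel_measurable borel"
  shows "conv f k x = (LINT z|lborel. f (x - z) * k z)"
proof -
  have "(LINT z|lborel. (\<lambda>y. f y * k (x - y)) (x - z)) = (LINT y|lborel. f y * k (x - y))"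
    by (rule lborel_integral_reflect) measurable
  then show ?thesis by (simp add: conv_def)
qed

lemma conv_borel:
  assumes [measurable]: "f \<in> borel_measurable borel" "k \<in> borel_measurable borel"
  shows "conv f k \<in> borel_measurable borel"
  unfolding conv_def[abs_def] by measurable

lemma test_reflect:
  assumes "test_function k"
  shows "test_function (\<lambda>y. k (x - y))" "pd i (\<lambda>y. k (x - y)) y = - pd i k (x - y)"
  using test_affine[OF assms, of "-1" x] pd_affine[OF test_smooth[OF assms], of i x "-1" y] by simp_all

lemma conv_integrable: "loc_int f \<Longrightarrow> test_function k \<Longrightarrow> integrable lborel (\<lambda>y. f y * k (x - y))"
  by (intro loc_int_test_integrable test_reflect)

text \<open>One estimate for two purposes: local boundedness of a convolution, and the remainder of
  its first order expansion.\<close>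

lemma conv_bound:
  assumes f: "loc_int f" and [measurable]: "k \<in> borel_measurable borel"
    and B: "\<And>y. norm y \<le> R \<Longrightarrow> \<bar>k y\<bar> \<le> B" and R: "\<And>y. norm y > R \<Longrightarrow> k y = 0" and "B \<ge> 0"
  shows "\<bar>LINT y|lborel. f y * k y\<bar> \<le> B * (LINT y|lborel. \<bar>indicator (cball 0 R) y * f y\<bar>)"
proof -
  note [measurable] = loc_int_borel[OF f]
  have i: "integrable lborel (\<lambda>y. B * \<bar>indicator (cball 0 R) y * f y\<bar>)"
    using loc_intD[OF f] by simp
  have le: "\<bar>f y * k y\<bar> \<le> B * \<bar>indicator (cball 0 R) y * f y\<bar>" for y
    using mult_left_mono[OF B[of y], of "\<bar>f y\<bar>"] R[of y]
    by (cases "norm y \<le> R") (auto simp: abs_mult mult.commute)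
  have i': "integrable lborel (\<lambda>y. f y * k y)"
    by (rule Bochner_Integration.integrable_bound[OF i]) (use le \<open>B \<ge> 0\<close> in \<open>auto simp: abs_mult\<close>)
  have "\<bar>LINT y|lborel. f y * k y\<bar> \<le> (LINT y|lborel. \<bar>f y * k y\<bar>)" by (rule integral_abs_bound)
  also have "\<dots> \<le> (LINT y|lborel. B * \<bar>indicator (cball 0 R) y * f y\<bar>)"
    using i i' le by (intro integral_mono) auto
  finally show ?thesis by simp
qed

lemma conv_bounded:
  assumes f: "loc_int f" and k: "test_function k"
  shows "\<exists>B. \<forall>x. norm x \<le> R \<longrightarrow> \<bar>conv f k x\<bar> \<le> B"
proof -
  obtain r where r: "r > 0" "\<And>x. norm x > r \<Longrightarrow> k x = 0" using test_support[OF k] by blast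
  obtain B where B: "B > 0" "\<And>x. \<bar>k x\<bar> \<le> B" using test_bounded[OF k] by blast
  note [measurable] = smooth_borel[OF test_smooth[OF k]]
  have "\<bar>conv f k x\<bar> \<le> B * (LINT y|lborel. \<bar>indicator (cball 0 (R + r)) y * f y\<bar>)" if "norm x \<le> R" for x
    unfolding conv_def
  proof (rule conv_bound[OF f])
    fix y :: "real ^ 'a" assume "norm y > R + r"
    then have "norm (x - y) > r" using that norm_triangle_ineq2[of y x] by (simp add: norm_minus_commute)
    then show "k (x - y) = 0" by (rule r)
  qed (use B in auto)
  then show ?thesis by blast
qed

lemma conv_loc_int: "loc_int f \<Longrightarrow> test_function k \<Longrightarrow> loc_int (conv f k)"
  using conv_borel[OF loc_int_borel smooth_borel[OF test_smooth]] conv_bounded by (intro loc_intI_bounded)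

lemma DERIV_quadratic_remainder:
  fixes \<phi> :: "real \<Rightarrow> real"
  assumes "\<And>t. \<bar>t\<bar> \<le> 1 \<Longrightarrow> \<bar>\<phi> t - \<phi> 0 - t * D\<bar> \<le> C * t\<^sup>2"
  shows "(\<phi> has_real_derivative D) (at 0)"
proof -
  have "((\<lambda>t. (\<phi> t - \<phi> 0) / t - D) \<longlongrightarrow> 0) (at 0)"
  proof (rule Lim_null_comparison)
    show "eventually (\<lambda>t. norm ((\<phi> t - \<phi> 0) / t - D) \<le> C * \<bar>t\<bar>) (at 0)"
      unfolding eventually_at
    proof (intro exI[of _ 1] conjI ballI impI)
      fix t :: real assume t: "t \<noteq> 0 \<and> dist t 0 < 1"
      have "(\<phi> t - \<phi> 0) / t - D = (\<phi> t - \<phi> 0 - t * D) / t" using t by (simp add: field_simps)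
      then have "norm ((\<phi> t - \<phi> 0) / t - D) = \<bar>\<phi> t - \<phi> 0 - t * D\<bar> / \<bar>t\<bar>" by (simp add: abs_divide)
      also have "\<dots> \<le> C * t\<^sup>2 / \<bar>t\<bar>" using assms[of t] t by (intro divide_right_mono) auto
      also have "\<dots> = C * \<bar>t\<bar>" using t by (simp add: power2_eq_square abs_mult_self_eq[symmetric, of t] del: abs_mult_self_eq)
      finally show "norm ((\<phi> t - \<phi> 0) / t - D) \<le> C * \<bar>t\<bar>" .
    qed simp
    show "((\<lambda>t. C * \<bar>t\<bar>) \<longlongrightarrow> 0) (at 0)" by (auto intro!: tendsto_eq_intros)
  qed
  then have "((\<lambda>t. (\<phi> t - \<phi> 0) / t) \<longlongrightarrow> D) (at 0)" by (rule LIM_zero_cancel)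
  then show ?thesis by (simp add: DERIV_def)
qed

lemma conv_line_deriv:
  assumes f: "loc_int f" and k: "test_function k"
  shows "((\<lambda>t. conv f k (x + t *\<^sub>R axis i 1)) has_real_derivative
    conv f (pd i k) (x + t *\<^sub>R axis i 1)) (at t)"
proof -
  obtain r where r: "r > 0" "\<And>x. norm x > r \<Longrightarrow> k x = 0" using test_support[OF k] by blast
  obtain L where L: "L > 0" "\<And>x t. \<bar>k (x + t *\<^sub>R axis i 1) - k x - t * pd i k x\<bar> \<le> L * t\<^sup>2"
    using test_taylor[OF k] by metis
  note [measurable] = smooth_borel[OF test_smooth[OF k]] smooth_borel[OF test_smooth[OF test_pd[OF k]]]
  \<comment> \<open>The derivative at parameter 0 for every base point is enough; a general
    parameter moves the base point.\<close>
  have at0: "((\<lambda>t. conv f k (x + t *\<^sub>R axis i 1)) has_real_derivative conv f (pd i k) x) (at 0)" for x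
  proof (rule DERIV_quadratic_remainder)
    fix t :: real assume t: "\<bar>t\<bar> \<le> 1"
    let ?k = "\<lambda>y. k (x + t *\<^sub>R axis i 1 - y) - k (x - y) - t * pd i k (x - y)"
    \<comment> \<open>A radius beyond which all three terms of the remainder kernel vanish, for
      every \<open>\<bar>t\<bar> \<le> 1\<close>.\<close>
    let ?R = "norm x + 1 + r"
    have "conv f k (x + t *\<^sub>R axis i 1) - conv f k (x + 0 *\<^sub>R axis i 1) - t * conv f (pd i k) x =
        (LINT y|lborel. f y * k (x + t *\<^sub>R axis i 1 - y)) - (LINT y|lborel. f y * k (x - y)) -
        (LINT y|lborel. t * (f y * pd i k (x - y)))"
      by (simp add: conv_def)
    also have "\<dots> = (LINT y|lborel. f y * ?k y)"
      using conv_integrable[OF f k] conv_integrable[OF f test_pd[OF k]]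
      by (simp add: right_diff_distrib mult.left_commute)
    finally have eq: "conv f k (x + t *\<^sub>R axis i 1) - conv f k (x + 0 *\<^sub>R axis i 1) - t * conv f (pd i k) x =
      (LINT y|lborel. f y * ?k y)" .
    have "\<bar>LINT y|lborel. f y * ?k y\<bar> \<le> (L * t\<^sup>2) * (LINT y|lborel. \<bar>indicator (cball 0 ?R) y * f y\<bar>)"
    proof (rule conv_bound[OF f])
      fix y
      show "\<bar>?k y\<bar> \<le> L * t\<^sup>2" using L(2)[of "x - y" t] by (simp add: algebra_simps)
    next
      fix y :: "real ^ 'a" assume y: "norm y > ?R"
      have "norm (x - y) \<ge> norm y - norm x" using norm_triangle_ineq2[of y x] by (simp add: norm_minus_commute)
      then have 1: "norm (x - y) > r" using y by linarith
      have "norm (t *\<^sub>R axis i (1 :: real)) \<le> 1" using t by simp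
      then have "norm (x + t *\<^sub>R axis i 1) \<le> norm x + 1"
        using norm_triangle_ineq[of x "t *\<^sub>R axis i 1"] by linarith
      moreover have "norm (x + t *\<^sub>R axis i 1 - y) \<ge> norm y - norm (x + t *\<^sub>R axis i 1)"
        using norm_triangle_ineq2[of y "x + t *\<^sub>R axis i 1"] by (simp add: norm_minus_commute)
      ultimately have 2: "norm (x + t *\<^sub>R axis i 1 - y) > r" using y by linarith
      show "?k y = 0" using r(2)[OF 1] r(2)[OF 2] pd_support[where i = i and R = r and \<psi> = k, OF r(2) 1] by simp
    qed (use L in auto)
    then show "\<bar>conv f k (x + t *\<^sub>R axis i 1) - conv f k (x + 0 *\<^sub>R axis i 1) - t * conv f (pd i k) x\<bar>
      \<le> (L * (LINT y|lborel. \<bar>indicator (cball 0 ?R) y * f y\<bar>)) * t\<^sup>2"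
      unfolding eq by (simp add: mult_ac)
  qed
  have "((\<lambda>s. conv f k (x + t *\<^sub>R axis i 1 + s *\<^sub>R axis i 1)) has_real_derivative
      conv f (pd i k) (x + t *\<^sub>R axis i 1)) (at (t - t))"
    using at0[of "x + t *\<^sub>R axis i 1"] by simp
  from DERIV_shift[THEN iffD1, of "\<lambda>s. conv f k (x + t *\<^sub>R axis i 1 + s *\<^sub>R axis i 1)" _ 0] this
  have "((\<lambda>s. conv f k (x + t *\<^sub>R axis i 1 + (s + - t) *\<^sub>R axis i 1)) has_real_derivative
      conv f (pd i k) (x + t *\<^sub>R axis i 1)) (at t)"
    using DERIV_shift[of "\<lambda>s. conv f k (x + t *\<^sub>R axis i 1 + s *\<^sub>R axis i 1)" _ t "- t"] by simp
  then show ?thesis by (simp add: algebra_simps)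
qed

definition moll :: "nat \<Rightarrow> real ^ 'n \<Rightarrow> real" where
  "moll n = (SOME \<rho>. test_function \<rho> \<and> (\<forall>x. \<rho> x \<ge> 0) \<and>
    (\<forall>x. norm x > 1 / real (Suc n) \<longrightarrow> \<rho> x = 0) \<and> integral\<^sup>L lborel \<rho> = 1)"

lemma moll: "test_function (moll n)" "moll n x \<ge> 0" "norm x > 1 / real (Suc n) \<Longrightarrow> moll n x = 0"
  "integral\<^sup>L lborel (moll n) = 1"
proof -
  have "\<exists>\<rho> :: real ^ 'n \<Rightarrow> real. test_function \<rho> \<and> (\<forall>x. \<rho> x \<ge> 0) \<and>
      (\<forall>x. norm x > 1 / real (Suc n) \<longrightarrow> \<rho> x = 0) \<and> integral\<^sup>L lborel \<rho> = 1"
    by (rule mollifier[of "1 / real (Suc n)"]) auto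
  from someI_ex[OF this, folded moll_def]
  show "test_function (moll n)" "moll n x \<ge> 0" "norm x > 1 / real (Suc n) \<Longrightarrow> moll n x = 0"
    "integral\<^sup>L lborel (moll n) = 1" for x :: "real ^ 'n" by blast+
qed

lemma moll_tendsto:
  fixes g :: "real ^ 'a \<Rightarrow> real"
  assumes g: "loc_int g"
  shows "(\<lambda>n. \<integral>\<^sup>+x. indicator (cball 0 R) x * ennreal \<bar>conv g (moll n) x - g x\<bar> \<partial>lborel) \<longlonglongrightarrow> 0"
proof -
  note [measurable] = loc_int_borel[OF g] smooth_borel[OF test_smooth[OF moll(1)]]
  have "(\<lambda>n. \<integral>\<^sup>+x. indicator (cball 0 R) x *
      ennreal \<bar>(LINT z|lborel. g (x - z) * moll n z) - 1 * g x\<bar> \<partial>lborel) \<longlonglongrightarrow> 0"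
  proof (rule approximate_identity[OF g])
    show "integrable lborel (\<lambda>z. g (x - z) * moll n z)" for n x
      using lborel_integrable_reflect[OF conv_integrable[OF g moll(1)[of n], of x], of x] by simp
    show "(\<lambda>n. LINT z|lborel. indicator {z :: real ^ 'a. norm z > r} z * moll n z) \<longlonglongrightarrow> 0" if "r > 0" for r
    proof (rule tendsto_eventually)
      have "eventually (\<lambda>n. 1 / real (Suc n) < r) sequentially"
        using order_tendstoD(2)[OF LIMSEQ_Suc[OF lim_const_over_n] that, of 1] by simp
      then show "eventually (\<lambda>n. (LINT z|lborel. indicator {z :: real ^ 'a. norm z > r} z * moll n z) = 0) sequentially"
      proof eventually_elim
        case (elim n)
        have *: "indicator {z. norm z > r} z * moll n z = 0" for z :: "real ^ 'a"
          using moll(3)[of n z] elim by (auto simp: indicator_def)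
        show ?case unfolding * by simp
      qed
    qed
    \<comment> \<open>Displacements are at most 1, so g and its translate each contribute at most
      the L1 norm of g on the ball of radius \<open>R + 1\<close>.\<close>
    define M where "M = 2 * (LINT x|lborel. \<bar>indicator (cball 0 (R + 1)) x * g x\<bar>)"
    fix n and z :: "real ^ 'a" assume "moll n z \<noteq> 0"
    then have "norm z \<le> 1 / real (Suc n)" using moll(3)[of n z] by force
    also have "\<dots> \<le> 1" by simp
    finally have z: "norm z \<le> 1" .
    let ?G = "\<lambda>x. \<bar>indicator (cball 0 (R + 1)) x * g x\<bar>"
    have G: "integrable lborel ?G" using loc_intD[OF g] by simp
    have Gt: "integrable lborel (\<lambda>x. ?G (x + (- z)))" by (rule lborel_integrable_translate[OF G])
    have "(\<integral>\<^sup>+x. indicator (cball 0 R) x * ennreal \<bar>g (x - z) - g x\<bar> \<partial>lborel)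
      \<le> (\<integral>\<^sup>+x. ennreal (?G (x + (- z)) + ?G x) \<partial>lborel)"
    proof (rule nn_integral_mono)
      fix x :: "real ^ 'a"
      have "norm (x - z) \<le> R + 1" if "norm x \<le> R" using norm_triangle_ineq4[of x z] that z by simp
      then show "indicator (cball 0 R) x * ennreal \<bar>g (x - z) - g x\<bar> \<le> ennreal (?G (x + (- z)) + ?G x)"
        by (cases "norm x \<le> R") (auto intro!: ennreal_leI simp flip: ennreal_plus)
    qed
    also have "\<dots> = ennreal (LINT x|lborel. ?G (x + (- z)) + ?G x)"
      using G Gt by (intro nn_integral_eq_integral) auto
    also have "(LINT x|lborel. ?G (x + (- z)) + ?G x) = M"
      using G Gt lborel_integral_translate[of ?G "- z"] by (simp add: M_def)
    finally show "(\<integral>\<^sup>+x. indicator (cball 0 R) x * ennreal \<bar>g (x - z) - g x\<bar> \<partial>lborel) \<le> ennreal M" .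
  qed (use moll test_integrable[OF moll(1)] in auto)
  then show ?thesis by (simp add: conv_reflect[symmetric])
qed

lemma moll_tendsto_L1:
  assumes g: "loc_int g"
  shows "integrable lborel (\<lambda>x. indicator (cball 0 R) x * (conv g (moll n) x - g x))"
    and "(\<lambda>n. LINT x|lborel. \<bar>indicator (cball 0 R) x * (conv g (moll n) x - g x)\<bar>) \<longlonglongrightarrow> 0"
proof -
  show i: "integrable lborel (\<lambda>x. indicator (cball 0 R) x * (conv g (moll n) x - g x))" for n
    using loc_intD[OF g, of R] loc_intD[OF conv_loc_int[OF g moll(1)[of n]], of R] by (simp add: right_diff_distrib)
  have "(\<integral>\<^sup>+x. indicator (cball 0 R) x * ennreal \<bar>conv g (moll n) x - g x\<bar> \<partial>lborel) =
      ennreal (LINT x|lborel. \<bar>indicator (cball 0 R) x * (conv g (moll n) x - g x)\<bar>)" for n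
    using i[of n] by (subst nn_integral_eq_integral[symmetric])
      (auto intro!: nn_integral_cong simp: indicator_def)
  with moll_tendsto[OF g, of R] show "(\<lambda>n. LINT x|lborel. \<bar>indicator (cball 0 R) x * (conv g (moll n) x - g x)\<bar>) \<longlonglongrightarrow> 0"
    by (simp add: tendsto_ennreal_iff[of "\<lambda>n. LINT x|lborel. \<bar>indicator (cball 0 R) x * (conv g (moll n) x - g x)\<bar>" _ 0, simplified])
qed

text \<open>Reflected translates of a mollifier are test functions, so every mollification of g
  vanishes identically, while the mollifications converge to g in L1 on each ball.\<close>

lemma fundamental_lemma:
  assumes g: "loc_int g" and 0: "\<And>\<psi>. test_function \<psi> \<Longrightarrow> (LINT x|lborel. g x * \<psi> x) = 0"
  shows "AE x in lborel. g x = 0"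
proof -
  have "conv g (moll n) x = 0" for n x
    unfolding conv_def by (intro 0 test_reflect moll)
  then have "(\<lambda>n. LINT x|lborel. \<bar>indicator (cball 0 R) x * g x\<bar>) \<longlonglongrightarrow> 0" for R
    using moll_tendsto_L1(2)[OF g, of R] by simp
  then have "(LINT x|lborel. \<bar>indicator (cball 0 R) x * g x\<bar>) = 0" for R
    by (simp add: LIMSEQ_const_iff)
  then have "AE x in lborel. indicator (cball 0 R) x * g x = 0" for R
    using integral_nonneg_eq_0_iff_AE[OF integrable_abs[OF loc_intD[OF g, of R]]] by auto
  then have "AE x in lborel. \<forall>n::nat. indicator (cball 0 (real n)) x * g x = 0"
    by (simp only: AE_all_countable) simp
  then show ?thesis
  proof eventually_elim
    case (elim x)
    obtain n :: nat where "norm x \<le> real n" using real_arch_simple by blast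
    then show ?case using elim[THEN spec, of n] by simp
  qed
qed

section \<open>Weak gradients\<close>

text \<open>The Borel version of \<open>is_weak_gradient\<close>; in addition the function itself is
  locally integrable, so that it can be mollified.\<close>

definition wgrad :: "(real ^ 'n \<Rightarrow> real) \<Rightarrow> (real ^ 'n \<Rightarrow> real ^ 'n) \<Rightarrow> bool" where
  "wgrad f G \<longleftrightarrow> loc_int f \<and> (\<forall>i. loc_int (\<lambda>x. G x $ i)) \<and>
    (\<forall>\<psi> i. test_function \<psi> \<longrightarrow>
      (LINT x|lborel. f x * pd i \<psi> x) = - (LINT x|lborel. G x $ i * \<psi> x))"

lemma wgradI:
  assumes "loc_int f" "\<And>i. loc_int (\<lambda>x. G x $ i)"
    "\<And>\<psi> i. test_function \<psi> \<Longrightarrow> (LINT x|lborel. f x * pd i \<psi> x) = - (LINT x|lborel. G x $ i * \<psi> x)"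
  shows "wgrad f G"
  using assms by (simp add: wgrad_def)

lemma wgrad_loc_int: "wgrad f G \<Longrightarrow> loc_int f" "wgrad f G \<Longrightarrow> loc_int (\<lambda>x. G x $ i)"
  by (auto simp: wgrad_def)

lemma wgrad_eq:
  "wgrad f G \<Longrightarrow> test_function \<psi> \<Longrightarrow> (LINT x|lborel. f x * pd i \<psi> x) = - (LINT x|lborel. G x $ i * \<psi> x)"
  by (auto simp: wgrad_def)

lemma vec_borel_measurable:
  fixes G :: "'a \<Rightarrow> real ^ 'n"
  assumes "\<And>i. (\<lambda>x. G x $ i) \<in> borel_measurable M"
  shows "G \<in> borel_measurable M"
proof (rule borel_measurable_euclidean_space[THEN iffD2], safe)
  fix b :: "real ^ 'n" assume "b \<in> Basis"
  then obtain i where "b = axis i 1" by (auto simp: Basis_vec_def)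
  then show "(\<lambda>x. G x \<bullet> b) \<in> borel_measurable M" using assms by (simp add: inner_axis)
qed

lemma wgrad_borel: "wgrad f G \<Longrightarrow> f \<in> borel_measurable borel" "wgrad f G \<Longrightarrow> G \<in> borel_measurable borel"
  by (auto intro!: vec_borel_measurable loc_int_borel wgrad_loc_int)

lemma wgrad_unique:
  assumes "wgrad f G" "wgrad f G'"
  shows "AE x in lborel. G x = G' x"
proof -
  have "AE x in lborel. G x $ i + (-1) * G' x $ i = 0" for i
  proof (rule fundamental_lemma)
    show "loc_int (\<lambda>x. G x $ i + (-1) * G' x $ i)"
      using assms by (intro loc_int_add loc_int_cmult wgrad_loc_int)
    fix \<psi> :: "real ^ 'a \<Rightarrow> real" assume \<psi>: "test_function \<psi>"
    have "(LINT x|lborel. (G x $ i + (-1) * G' x $ i) * \<psi> x) =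
      (LINT x|lborel. G x $ i * \<psi> x) - (LINT x|lborel. G' x $ i * \<psi> x)"
      using loc_int_test_integrable[OF wgrad_loc_int(2)[OF assms(1)] \<psi>, of i]
        loc_int_test_integrable[OF wgrad_loc_int(2)[OF assms(2)] \<psi>, of i]
      by (simp add: left_diff_distrib)
    then show "(LINT x|lborel. (G x $ i + (-1) * G' x $ i) * \<psi> x) = 0"
      using wgrad_eq[OF assms(1) \<psi>, of i] wgrad_eq[OF assms(2) \<psi>, of i] by simp
  qed
  then have "AE x in lborel. \<forall>i\<in>UNIV. G x $ i + (-1) * G' x $ i = 0"
    by (intro AE_ball_countable[THEN iffD2] countable_finite) auto
  then show ?thesis by eventually_elim (auto simp: vec_eq_iff)
qed

lemma wgrad_add:
  assumes "wgrad f F" "wgrad g G"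
  shows "wgrad (\<lambda>x. f x + g x) (\<lambda>x. F x + G x)"
proof (rule wgradI)
  fix \<psi> :: "real ^ 'a \<Rightarrow> real" and i assume \<psi>: "test_function \<psi>"
  note [simp] = loc_int_test_integrable[OF wgrad_loc_int(2)[OF assms(1)] \<psi>, of i]
    loc_int_test_integrable[OF wgrad_loc_int(2)[OF assms(2)] \<psi>, of i]
    loc_int_test_integrable[OF wgrad_loc_int(1)[OF assms(1)] test_pd[OF \<psi>], of i]
    loc_int_test_integrable[OF wgrad_loc_int(1)[OF assms(2)] test_pd[OF \<psi>], of i]
  show "(LINT x|lborel. (f x + g x) * pd i \<psi> x) = - (LINT x|lborel. (F x + G x) $ i * \<psi> x)"
    using wgrad_eq[OF assms(1) \<psi>, of i] wgrad_eq[OF assms(2) \<psi>, of i] by (simp add: distrib_right)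
qed (use assms in \<open>auto intro!: loc_int_add intro: wgrad_loc_int\<close>)

lemma wgrad_cmult:
  assumes "wgrad f F"
  shows "wgrad (\<lambda>x. c * f x) (\<lambda>x. c *\<^sub>R F x)"
proof (rule wgradI)
  fix \<psi> :: "real ^ 'a \<Rightarrow> real" and i assume \<psi>: "test_function \<psi>"
  show "(LINT x|lborel. c * f x * pd i \<psi> x) = - (LINT x|lborel. (c *\<^sub>R F x) $ i * \<psi> x)"
    using wgrad_eq[OF assms(1) \<psi>, of i] by (simp add: mult.assoc)
qed (use assms in \<open>auto intro!: loc_int_cmult intro: wgrad_loc_int\<close>)

lemma wgrad_diff:
  assumes "wgrad f F" "wgrad g G"
  shows "wgrad (\<lambda>x. f x - g x) (\<lambda>x. F x - G x)"
  using wgrad_add[OF assms(1) wgrad_cmult[OF assms(2), of "-1"]] by simp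

lemma integral_pd_0:
  assumes "test_function \<psi>"
  shows "(LINT x|lborel. pd i \<psi> x) = 0"
proof -
  obtain R where R: "\<And>x. norm x > R \<Longrightarrow> \<psi> x = 0" using test_support[OF assms] by blast
  obtain B where B: "\<And>x. \<bar>\<psi> x\<bar> \<le> B" using test_bounded[OF assms] by blast
  obtain B' where B': "\<And>x. \<bar>pd i \<psi> x\<bar> \<le> B'" using test_bounded[OF test_pd[OF assms, of i]] by blast
  show ?thesis
    by (rule integral_directional_derivative_0[where h = \<psi> and e = "axis i 1", OF _ _ _ B' R B])
       (auto intro: smooth_borel smooth_line_deriv test_smooth[OF assms] test_smooth[OF test_pd[OF assms]])
qed

lemma wgrad_smooth:
  assumes "smooth_on UNIV f"
  shows "wgrad f (\<lambda>x. \<chi> i. pd i f x)"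
proof (rule wgradI)
  show f: "loc_int f" by (rule loc_int_continuous[OF smooth_continuous[OF assms]])
  show f': "loc_int (\<lambda>x. (\<chi> i. pd i f x) $ i)" for i
    using loc_int_continuous[OF smooth_continuous[OF smooth_pd[OF assms]]] by simp
  fix \<psi> :: "real ^ 'a \<Rightarrow> real" and i assume \<psi>: "test_function \<psi>"
  have "(LINT x|lborel. f x * pd i \<psi> x + pd i f x * \<psi> x) = 0"
    using integral_pd_0[OF test_mult[OF assms \<psi>], of i] by (simp add: pd_mult[OF assms test_smooth[OF \<psi>]])
  then show "(LINT x|lborel. f x * pd i \<psi> x) = - (LINT x|lborel. (\<chi> i. pd i f x) $ i * \<psi> x)"
    using loc_int_test_integrable[OF f test_pd[OF \<psi>, of i]] loc_int_test_integrable[OF f' \<psi>, of i] by simp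
qed

lemma wgrad_const: "wgrad (\<lambda>_ :: real ^ 'a. c) (\<lambda>_. 0)"
proof -
  have "pd i (\<lambda>_. c) x = 0" for i and x :: "real ^ 'a"
    using pd_eqI[of "\<lambda>_. c" x 0 i] by (simp add: GDERIV_const)
  then have "(\<lambda>x. \<chi> i. pd i (\<lambda>_. c) x) = (\<lambda>_. 0 :: real ^ 'a)" by (simp add: fun_eq_iff vec_eq_iff)
  with wgrad_smooth[OF smooth_on_const[of "UNIV :: (real ^ 'a) set" c]] show ?thesis by (simp only:)
qed

text \<open>The definition of the weak gradient applied to a translated kernel: mollification
  commutes with weak differentiation, so the classical partial derivatives of the mollified function
  are mollified weak ones.\<close>

lemma conv_wgrad:
  assumes f: "wgrad f G" and k: "test_function k"
  shows "conv f (pd i k) x = conv (\<lambda>x. G x $ i) k x"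
  using wgrad_eq[OF f test_reflect(1)[OF k, of x], of i] by (simp add: conv_def test_reflect(2)[OF k])

text \<open>The chain rule holds classically for the mollified functions; the \<open>L\<^sup>1\<close> limit is taken along a
  subsequence that also converges almost everywhere, as needed in \<open>S'\<close>.\<close>

lemma wgrad_chain:
  assumes f: "wgrad f G"
    and S: "\<And>t. (S has_real_derivative S' t) (at t)" "continuous_on UNIV S'" "\<And>t. \<bar>S' t\<bar> \<le> 1"
  shows "wgrad (\<lambda>x. S (f x)) (\<lambda>x. S' (f x) *\<^sub>R G x)"
proof (rule wgradI)
  note lf = wgrad_loc_int(1)[OF f] and lG = wgrad_loc_int(2)[OF f]
  note bf [measurable] = loc_int_borel[OF lf] and bG [measurable] = loc_int_borel[OF lG]
  have Sc: "continuous_on UNIV S"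
    using S(1) by (intro continuous_at_imp_continuous_on) (auto intro: DERIV_isCont)
  have bS [measurable]: "S \<in> borel_measurable borel" "S' \<in> borel_measurable borel"
    using Sc S(2) by (auto intro: borel_measurable_continuous_onI)
  have SL: "\<bar>S a - S b\<bar> \<le> \<bar>a - b\<bar>" for a b
    using field_differentiable_bound[of UNIV S S' 1 a b] S(1,3) by simp
  show "loc_int (\<lambda>x. S (f x))"
  proof (rule loc_int_mono)
    show "loc_int (\<lambda>x. \<bar>f x\<bar> + \<bar>S 0\<bar>)"
      by (intro loc_int_add loc_int_abs lf loc_int_continuous continuous_on_const)
    show "\<bar>S (f x)\<bar> \<le> \<bar>\<bar>f x\<bar> + \<bar>S 0\<bar>\<bar>" for x using SL[of "f x" 0] by simp
  qed measurable
  show "loc_int (\<lambda>x. (S' (f x) *\<^sub>R G x) $ i)" for i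
    using loc_int_mult_bounded[OF lG[of i], of "\<lambda>x. S' (f x)" 1] S(3) by simp
  fix \<psi> :: "real ^ 'a \<Rightarrow> real" and i assume \<psi>: "test_function \<psi>"
  obtain R where R: "R > 0" "\<And>x. norm x > R \<Longrightarrow> \<psi> x = 0" using test_support[OF \<psi>] by blast
  obtain B where B: "B > 0" "\<And>x. \<bar>\<psi> x\<bar> \<le> B" using test_bounded[OF \<psi>] by blast
  obtain B' where B': "B' > 0" "\<And>x. \<bar>pd i \<psi> x\<bar> \<le> B'" using test_bounded[OF test_pd[OF \<psi>]] by metis
  note b\<psi> [measurable] = smooth_borel[OF test_smooth[OF \<psi>]] smooth_borel[OF test_smooth[OF test_pd[OF \<psi>]]]
  define F where "F n = conv f (moll n)" for n
  define H where "H n = conv (\<lambda>x. G x $ i) (moll n)" for n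
  have lF: "loc_int (F n)" and lH: "loc_int (H n)" for n
    unfolding F_def H_def by (intro conv_loc_int lf lG moll)+
  note bF [measurable] = loc_int_borel[OF lF] and bH [measurable] = loc_int_borel[OF lH]
  have dF: "((\<lambda>t. F n (x + t *\<^sub>R axis i 1)) has_real_derivative H n (x + t *\<^sub>R axis i 1)) (at t)" for n x t
    using conv_line_deriv[OF lf moll(1)[of n], of x i t] conv_wgrad[OF f moll(1)[of n]]
    by (simp add: F_def H_def)
  have iSF: "integrable lborel (\<lambda>x. S (F n x) * pd i \<psi> x)" and iSH: "integrable lborel (\<lambda>x. S' (F n x) * H n x * \<psi> x)" for n
  proof -
    have "loc_int (\<lambda>x. S (F n x))"
    proof (rule loc_int_mono)
      show "loc_int (\<lambda>x. \<bar>F n x\<bar> + \<bar>S 0\<bar>)"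
        by (intro loc_int_add loc_int_abs lF loc_int_continuous continuous_on_const)
      show "\<bar>S (F n x)\<bar> \<le> \<bar>\<bar>F n x\<bar> + \<bar>S 0\<bar>\<bar>" for x using SL[of "F n x" 0] by simp
    qed measurable
    then show "integrable lborel (\<lambda>x. S (F n x) * pd i \<psi> x)" by (rule loc_int_test_integrable[OF _ test_pd[OF \<psi>]])
    have "loc_int (\<lambda>x. S' (F n x) * H n x)"
      by (rule loc_int_mult_bounded[OF lH, of _ 1]) (use S(3) in auto)
    then show "integrable lborel (\<lambda>x. S' (F n x) * H n x * \<psi> x)" by (rule loc_int_test_integrable[OF _ \<psi>])
  qed
  \<comment> \<open>For the mollified function, the product of \<open>S (F n)\<close> and the test
    function has a classical derivative along the axis and compact support, so the integral of that
    derivative vanishes.\<close>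
  have zero: "(LINT x|lborel. S (F n x) * pd i \<psi> x) = - (LINT x|lborel. S' (F n x) * H n x * \<psi> x)" for n
  proof -
    obtain BF where BF: "\<And>x. norm x \<le> R \<Longrightarrow> \<bar>F n x\<bar> \<le> BF"
      using conv_bounded[OF lf moll(1)[of n], of R] by (auto simp: F_def)
    obtain BH where BH: "\<And>x. norm x \<le> R \<Longrightarrow> \<bar>H n x\<bar> \<le> BH"
      using conv_bounded[OF lG moll(1)[of n], of R i] by (auto simp: H_def)
    have BF0: "BF \<ge> 0" "BH \<ge> 0"
      using BF[of 0] BH[of 0] R(1) abs_ge_zero[of "F n 0"] abs_ge_zero[of "H n 0"] by auto
    have SB: "\<bar>S (F n x)\<bar> \<le> BF + \<bar>S 0\<bar>" if "norm x \<le> R" for x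
      using SL[of "F n x" 0] BF[OF that] by simp
    have "(LINT x|lborel. S (F n x) * pd i \<psi> x + S' (F n x) * H n x * \<psi> x) = 0"
    proof (rule integral_directional_derivative_0[where h = "\<lambda>x. S (F n x) * \<psi> x" and e = "axis i 1"
          and B = "(BF + \<bar>S 0\<bar>) * B' + BH * B" and B' = "(BF + \<bar>S 0\<bar>) * B" and R = R])
      show "((\<lambda>t. S (F n (x + t *\<^sub>R axis i 1)) * \<psi> (x + t *\<^sub>R axis i 1)) has_real_derivative
        S (F n (x + t *\<^sub>R axis i 1)) * pd i \<psi> (x + t *\<^sub>R axis i 1) +
        S' (F n (x + t *\<^sub>R axis i 1)) * H n (x + t *\<^sub>R axis i 1) * \<psi> (x + t *\<^sub>R axis i 1)) (at t)" for x t
        using DERIV_mult[OF DERIV_chain2[OF S(1) dF[of n x t]] smooth_line_deriv[OF test_smooth[OF \<psi>], of x i t]]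
        by (simp add: algebra_simps)
      show "\<bar>S (F n x) * pd i \<psi> x + S' (F n x) * H n x * \<psi> x\<bar> \<le> (BF + \<bar>S 0\<bar>) * B' + BH * B" for x
      proof (cases "norm x \<le> R")
        case True
        have "\<bar>S (F n x) * pd i \<psi> x\<bar> \<le> (BF + \<bar>S 0\<bar>) * B'"
          unfolding abs_mult using SB[OF True] B' BF0 by (intro mult_mono) auto
        moreover have "\<bar>S' (F n x) * H n x\<bar> \<le> 1 * BH"
          unfolding abs_mult using S(3) BH[OF True] by (intro mult_mono) auto
        then have "\<bar>S' (F n x) * H n x * \<psi> x\<bar> \<le> BH * B"
          unfolding abs_mult[of _ "\<psi> x"] using B BF0 by (intro mult_mono) auto
        ultimately show ?thesis by linarith
      next
        case False
        then show ?thesis using R(2)[of x] pd_support[where R = R and \<psi> = \<psi> and x = x and i = i] R(2) BF0 B B'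
          by (auto intro!: add_nonneg_nonneg mult_nonneg_nonneg)
      qed
      show "\<bar>S (F n x) * \<psi> x\<bar> \<le> (BF + \<bar>S 0\<bar>) * B" for x
      proof (cases "norm x \<le> R")
        case True
        then show ?thesis unfolding abs_mult using SB[OF True] B BF0 by (intro mult_mono) auto
      next
        case False
        then show ?thesis using R(2)[of x] BF0 B by auto
      qed
    qed (use R in auto)
    then show ?thesis using iSF[of n] iSH[of n] by simp
  qed
  let ?u = "\<lambda>n x. indicator (cball 0 R) x * (F n x - f x)"
  have u: "integrable lborel (?u n)" "(\<lambda>n. LINT x|lborel. norm (?u n x)) \<longlonglongrightarrow> 0" for n
    using moll_tendsto_L1[OF lf, of R] by (simp_all add: F_def)
  let ?v = "\<lambda>n x. indicator (cball 0 R) x * (H n x - G x $ i)"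
  have v: "integrable lborel (?v n)" "(\<lambda>n. LINT x|lborel. norm (?v n x)) \<longlonglongrightarrow> 0" for n
    using moll_tendsto_L1[OF lG[of i], of R] by (simp_all add: H_def)
  obtain r where r: "strict_mono r" "AE x in lborel. (\<lambda>n. ?u (r n) x) \<longlonglongrightarrow> 0"
    using tendsto_L1_AE_subseq[of lborel ?u] u by auto
  have iS: "integrable lborel (\<lambda>x. S (f x) * pd i \<psi> x)"
    by (rule loc_int_test_integrable[OF \<open>loc_int (\<lambda>x. S (f x))\<close> test_pd[OF \<psi>]])
  have iSG: "integrable lborel (\<lambda>x. S' (f x) * G x $ i * \<psi> x)"
    using loc_int_test_integrable[OF \<open>\<And>i. loc_int (\<lambda>x. (S' (f x) *\<^sub>R G x) $ i)\<close>[of i] \<psi>] by simp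
  have "(\<lambda>n. (LINT x|lborel. S (F (r n) x) * pd i \<psi> x) - (LINT x|lborel. S (f x) * pd i \<psi> x)) \<longlonglongrightarrow> 0"
  proof (rule Lim_null_comparison)
    have "norm ((LINT x|lborel. S (F n x) * pd i \<psi> x) - (LINT x|lborel. S (f x) * pd i \<psi> x)) \<le>
        B' * (LINT x|lborel. norm (?u n x))" for n
    proof -
      have "norm ((LINT x|lborel. S (F n x) * pd i \<psi> x) - (LINT x|lborel. S (f x) * pd i \<psi> x)) =
          \<bar>LINT x|lborel. S (F n x) * pd i \<psi> x - S (f x) * pd i \<psi> x\<bar>"
        using iSF iS by simp
      also have "\<dots> \<le> (LINT x|lborel. \<bar>S (F n x) * pd i \<psi> x - S (f x) * pd i \<psi> x\<bar>)"
        by (rule integral_abs_bound)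
      also have "\<dots> \<le> (LINT x|lborel. B' * norm (?u n x))"
      proof (rule integral_mono)
        fix x
        show "\<bar>S (F n x) * pd i \<psi> x - S (f x) * pd i \<psi> x\<bar> \<le> B' * norm (?u n x)"
        proof (cases "norm x \<le> R")
          case True
          have "\<bar>S (F n x) * pd i \<psi> x - S (f x) * pd i \<psi> x\<bar> = \<bar>S (F n x) - S (f x)\<bar> * \<bar>pd i \<psi> x\<bar>"
            by (simp add: abs_mult flip: left_diff_distrib)
          also have "\<dots> \<le> \<bar>F n x - f x\<bar> * B'" using SL B' by (intro mult_mono) auto
          finally show ?thesis using True by (simp add: mult.commute)
        next
          case False
          then show ?thesis using pd_support[where R = R and \<psi> = \<psi> and x = x and i = i] R(2) by simp
        qed
      qed (use iSF iS u(1) in auto)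
      finally show ?thesis by simp
    qed
    then show "eventually (\<lambda>n. norm ((LINT x|lborel. S (F (r n) x) * pd i \<psi> x) -
      (LINT x|lborel. S (f x) * pd i \<psi> x)) \<le> B' * (LINT x|lborel. norm (?u (r n) x))) sequentially"
      by simp
    show "(\<lambda>n. B' * (LINT x|lborel. norm (?u (r n) x))) \<longlonglongrightarrow> 0"
      using tendsto_mult_right_zero[OF LIMSEQ_subseq_LIMSEQ[OF u(2) r(1)], of B'] by (simp add: o_def)
  qed
  then have lim1: "(\<lambda>n. LINT x|lborel. S (F (r n) x) * pd i \<psi> x) \<longlonglongrightarrow> (LINT x|lborel. S (f x) * pd i \<psi> x)"
    by (rule LIM_zero_cancel)
  have iSFG: "integrable lborel (\<lambda>x. S' (F n x) * (G x $ i * \<psi> x))" for n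
    by (rule Bochner_Integration.integrable_bound[OF loc_int_test_integrable[OF lG[of i] \<psi>]])
       (use S(3) in \<open>auto simp: abs_mult intro!: mult_left_le_one_le\<close>)
  \<comment> \<open>The factors of \<open>S' (F n) * H n\<close> converge in different senses. First
    \<open>G\<close> is held fixed and the bounded factor converges almost everywhere along the
    subsequence; afterwards \<open>H n\<close> is exchanged for \<open>G\<close> in L1, where only
    the bound on \<open>S'\<close> matters.\<close>
  have limA: "(\<lambda>n. LINT x|lborel. S' (F (r n) x) * (G x $ i * \<psi> x)) \<longlonglongrightarrow>
      (LINT x|lborel. S' (f x) * (G x $ i * \<psi> x))"
  proof (rule integral_dominated_convergence[where w = "\<lambda>x. \<bar>G x $ i * \<psi> x\<bar>"])
    show "AE x in lborel. (\<lambda>n. S' (F (r n) x) * (G x $ i * \<psi> x)) \<longlonglongrightarrow> S' (f x) * (G x $ i * \<psi> x)"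
      using r(2)
    proof eventually_elim
      case (elim x)
      show ?case
      proof (cases "norm x \<le> R")
        case True
        with elim have "(\<lambda>n. F (r n) x) \<longlonglongrightarrow> f x" by (auto intro: LIM_zero_cancel)
        then have "(\<lambda>n. S' (F (r n) x)) \<longlonglongrightarrow> S' (f x)"
          using S(2) by (intro isCont_tendsto_compose[of "f x" S']) (auto simp: continuous_on_eq_continuous_at)
        then show ?thesis by (intro tendsto_intros)
      next
        case False
        then show ?thesis using R(2)[of x] by simp
      qed
    qed
    show "AE x in lborel. norm (S' (F (r n) x) * (G x $ i * \<psi> x)) \<le> \<bar>G x $ i * \<psi> x\<bar>" for n
      using S(3) by (intro AE_I2) (auto simp: abs_mult intro!: mult_left_le_one_le)
  qed (use loc_int_test_integrable[OF lG[of i] \<psi>] in auto)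
  have "(\<lambda>n. (LINT x|lborel. S' (F (r n) x) * H (r n) x * \<psi> x) -
      (LINT x|lborel. S' (F (r n) x) * (G x $ i * \<psi> x))) \<longlonglongrightarrow> 0"
  proof (rule Lim_null_comparison)
    have "norm ((LINT x|lborel. S' (F n x) * H n x * \<psi> x) - (LINT x|lborel. S' (F n x) * (G x $ i * \<psi> x))) \<le>
        B * (LINT x|lborel. norm (?v n x))" for n
    proof -
      have "norm ((LINT x|lborel. S' (F n x) * H n x * \<psi> x) - (LINT x|lborel. S' (F n x) * (G x $ i * \<psi> x))) =
          \<bar>LINT x|lborel. S' (F n x) * H n x * \<psi> x - S' (F n x) * (G x $ i * \<psi> x)\<bar>"
        using iSH iSFG by simp
      also have "\<dots> \<le> (LINT x|lborel. \<bar>S' (F n x) * H n x * \<psi> x - S' (F n x) * (G x $ i * \<psi> x)\<bar>)"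
        by (rule integral_abs_bound)
      also have "\<dots> \<le> (LINT x|lborel. B * norm (?v n x))"
      proof (rule integral_mono)
        fix x
        show "\<bar>S' (F n x) * H n x * \<psi> x - S' (F n x) * (G x $ i * \<psi> x)\<bar> \<le> B * norm (?v n x)"
        proof (cases "norm x \<le> R")
          case True
          have "S' (F n x) * H n x * \<psi> x - S' (F n x) * (G x $ i * \<psi> x) = S' (F n x) * ((H n x - G x $ i) * \<psi> x)"
            by (simp add: algebra_simps)
          then have "\<bar>S' (F n x) * H n x * \<psi> x - S' (F n x) * (G x $ i * \<psi> x)\<bar> =
              \<bar>S' (F n x)\<bar> * (\<bar>H n x - G x $ i\<bar> * \<bar>\<psi> x\<bar>)" by (simp add: abs_mult)
          also have "\<dots> \<le> 1 * (\<bar>H n x - G x $ i\<bar> * B)"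
            using S(3) B by (intro mult_mono) auto
          finally show ?thesis using True by (simp add: mult.commute)
        next
          case False
          then show ?thesis using R(2)[of x] by simp
        qed
      qed (use iSH iSFG v(1) in auto)
      finally show ?thesis by simp
    qed
    then show "eventually (\<lambda>n. norm ((LINT x|lborel. S' (F (r n) x) * H (r n) x * \<psi> x) -
      (LINT x|lborel. S' (F (r n) x) * (G x $ i * \<psi> x))) \<le> B * (LINT x|lborel. norm (?v (r n) x))) sequentially"
      by simp
    show "(\<lambda>n. B * (LINT x|lborel. norm (?v (r n) x))) \<longlonglongrightarrow> 0"
      using tendsto_mult_right_zero[OF LIMSEQ_subseq_LIMSEQ[OF v(2) r(1)], of B] by (simp add: o_def)
  qed
  from tendsto_add[OF this limA]
  have "(\<lambda>n. - (LINT x|lborel. S' (F (r n) x) * H (r n) x * \<psi> x)) \<longlonglongrightarrow>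
      - (LINT x|lborel. S' (f x) * (G x $ i * \<psi> x))"
    by (intro tendsto_minus) simp
  with lim1 show "(LINT x|lborel. S (f x) * pd i \<psi> x) = - (LINT x|lborel. (S' (f x) *\<^sub>R G x) $ i * \<psi> x)"
    unfolding zero by (auto dest: LIMSEQ_unique simp: mult.assoc)
qed

text \<open>The absolute value is approximated by sqrt (t^2 + e), to which the chain rule applies.
  Its derivative t / sqrt (t^2 + e) vanishes at t = 0, so the limit is \<open>sgn\<close> with the
  value \<open>sgn 0 = 0\<close>.\<close>

lemma wgrad_abs:
  assumes f: "wgrad f G"
  shows "wgrad (\<lambda>x. \<bar>f x\<bar>) (\<lambda>x. sgn (f x) *\<^sub>R G x)"
proof (rule wgradI)
  note lf = wgrad_loc_int(1)[OF f] and lG = wgrad_loc_int(2)[OF f]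
  note bf [measurable] = loc_int_borel[OF lf] and bG [measurable] = loc_int_borel[OF lG]
  show "loc_int (\<lambda>x. \<bar>f x\<bar>)" by (rule loc_int_abs[OF lf])
  show "loc_int (\<lambda>x. (sgn (f x) *\<^sub>R G x) $ i)" for i
    using loc_int_mult_bounded[OF lG[of i], of "\<lambda>x. sgn (f x)" 1] by (simp add: abs_sgn_eq)
  fix \<psi> :: "real ^ 'a \<Rightarrow> real" and i assume \<psi>: "test_function \<psi>"
  note b\<psi> [measurable] = smooth_borel[OF test_smooth[OF \<psi>]] smooth_borel[OF test_smooth[OF test_pd[OF \<psi>]]]
  define e where "e n = (1 / real (Suc n))\<^sup>2" for n
  have e: "e n > 0" "e n \<le> 1" for n unfolding e_def by (simp, rule power_le_one) auto
  have elim: "e \<longlonglongrightarrow> 0"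
  proof -
    have "(\<lambda>n. (1 / real (Suc n))\<^sup>2) \<longlonglongrightarrow> 0\<^sup>2"
      by (intro tendsto_power LIMSEQ_Suc[OF lim_const_over_n])
    then show ?thesis unfolding e_def[abs_def] by (simp only: zero_power2)
  qed
  define S where "S n t = sqrt (t\<^sup>2 + e n)" for n t
  define S' where "S' n t = t / sqrt (t\<^sup>2 + e n)" for n t
  have pos: "t\<^sup>2 + e n > 0" for t n using e(1)[of n] by (simp add: add_nonneg_pos)
  have S'1: "\<bar>S' n t\<bar> \<le> 1" for n t
  proof -
    have "sqrt (t\<^sup>2) \<le> sqrt (t\<^sup>2 + e n)" using e(1)[of n] by (intro real_sqrt_le_mono) simp
    then show ?thesis using pos[of t n] by (simp add: S'_def abs_divide)
  qed
  have eq: "(LINT x|lborel. S n (f x) * pd i \<psi> x) = - (LINT x|lborel. S' n (f x) * (G x $ i * \<psi> x))" for n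
  proof -
    have "wgrad (\<lambda>x. S n (f x)) (\<lambda>x. S' n (f x) *\<^sub>R G x)"
    proof (rule wgrad_chain[OF f])
      show "(S n has_real_derivative S' n t) (at t)" for t
        unfolding S_def S'_def using pos[of t n]
        by (auto intro!: derivative_eq_intros simp: field_simps)
      show "continuous_on UNIV (S' n)"
        unfolding S'_def using pos[of _ n] by (auto intro!: continuous_intros simp: less_imp_neq[symmetric])
    qed (rule S'1)
    from wgrad_eq[OF this \<psi>, of i] show ?thesis by (simp add: mult.assoc)
  qed
  have bS [measurable]: "S n \<in> borel_measurable borel" "S' n \<in> borel_measurable borel" for n
    unfolding S_def[abs_def] S'_def[abs_def] by measurable
  have "(\<lambda>n. LINT x|lborel. S n (f x) * pd i \<psi> x) \<longlonglongrightarrow> (LINT x|lborel. \<bar>f x\<bar> * pd i \<psi> x)"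
  proof (rule integral_dominated_convergence[where w = "\<lambda>x. \<bar>(\<bar>f x\<bar> + 1) * pd i \<psi> x\<bar>"])
    show "AE x in lborel. (\<lambda>n. S n (f x) * pd i \<psi> x) \<longlonglongrightarrow> \<bar>f x\<bar> * pd i \<psi> x"
    proof (intro AE_I2 tendsto_mult_right)
      fix x
      have "(\<lambda>n. sqrt ((f x)\<^sup>2 + e n)) \<longlonglongrightarrow> sqrt ((f x)\<^sup>2 + 0)" by (intro tendsto_intros elim)
      then show "(\<lambda>n. S n (f x)) \<longlonglongrightarrow> \<bar>f x\<bar>" by (simp add: S_def)
    qed
    show "AE x in lborel. norm (S n (f x) * pd i \<psi> x) \<le> \<bar>(\<bar>f x\<bar> + 1) * pd i \<psi> x\<bar>" for n
    proof (intro AE_I2)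
      fix x
      have "S n (f x) \<le> sqrt ((\<bar>f x\<bar> + 1)\<^sup>2)"
        unfolding S_def using e(2)[of n] by (intro real_sqrt_le_mono) (simp add: power2_sum)
      then have "\<bar>S n (f x)\<bar> \<le> \<bar>f x\<bar> + 1" using pos[of "f x" n] by (simp add: S_def)
      then show "norm (S n (f x) * pd i \<psi> x) \<le> \<bar>(\<bar>f x\<bar> + 1) * pd i \<psi> x\<bar>"
        by (simp add: abs_mult mult_right_mono)
    qed
    have "loc_int (\<lambda>x. \<bar>f x\<bar> + 1)"
      by (intro loc_int_add loc_int_abs lf loc_int_continuous continuous_on_const)
    from loc_int_test_integrable[OF this test_pd[OF \<psi>, of i]]
    show "integrable lborel (\<lambda>x. \<bar>(\<bar>f x\<bar> + 1) * pd i \<psi> x\<bar>)" by simp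
  qed auto
  moreover have "(\<lambda>n. - (LINT x|lborel. S' n (f x) * (G x $ i * \<psi> x))) \<longlonglongrightarrow>
      - (LINT x|lborel. sgn (f x) * (G x $ i * \<psi> x))"
  proof (rule tendsto_minus, rule integral_dominated_convergence[where w = "\<lambda>x. \<bar>G x $ i * \<psi> x\<bar>"])
    show "AE x in lborel. (\<lambda>n. S' n (f x) * (G x $ i * \<psi> x)) \<longlonglongrightarrow> sgn (f x) * (G x $ i * \<psi> x)"
    proof (intro AE_I2 tendsto_mult_right)
      fix x
      show "(\<lambda>n. S' n (f x)) \<longlonglongrightarrow> sgn (f x)"
      proof (cases "f x = 0")
        case True
        then show ?thesis by (simp add: S'_def)
      next
        case False
        then have "(\<lambda>n. f x / sqrt ((f x)\<^sup>2 + e n)) \<longlonglongrightarrow> f x / sqrt ((f x)\<^sup>2 + 0)"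
          by (intro tendsto_intros elim) auto
        moreover have "f x / sqrt ((f x)\<^sup>2 + 0) = sgn (f x)" using False by (simp add: sgn_real_def)
        ultimately show ?thesis by (simp add: S'_def)
      qed
    qed
    show "AE x in lborel. norm (S' n (f x) * (G x $ i * \<psi> x)) \<le> \<bar>G x $ i * \<psi> x\<bar>" for n
      using S'1 by (intro AE_I2) (auto simp: abs_mult intro!: mult_left_le_one_le)
  qed (use loc_int_test_integrable[OF lG[of i] \<psi>] in auto)
  ultimately show "(LINT x|lborel. \<bar>f x\<bar> * pd i \<psi> x) = - (LINT x|lborel. (sgn (f x) *\<^sub>R G x) $ i * \<psi> x)"
    unfolding eq by (auto dest: LIMSEQ_unique simp: mult.assoc)
qed

section \<open>Square integrable fields and the space \<open>D\<^sup>1\<close>\<close>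

definition sqint :: "('a::euclidean_space \<Rightarrow> 'b::euclidean_space) \<Rightarrow> bool" where
  "sqint G \<longleftrightarrow> G \<in> borel_measurable borel \<and> integrable lborel (\<lambda>x. (norm (G x))\<^sup>2)"

definition energy :: "('a::euclidean_space \<Rightarrow> 'b::euclidean_space) \<Rightarrow> real" where
  "energy G = (LINT x|lborel. (norm (G x))\<^sup>2)"

definition ip :: "('a::euclidean_space \<Rightarrow> 'b::euclidean_space) \<Rightarrow> ('a \<Rightarrow> 'b) \<Rightarrow> real" where
  "ip G H = (LINT x|lborel. G x \<bullet> H x)"

lemma sqint_borel [measurable_dest]: "sqint G \<Longrightarrow> G \<in> borel_measurable borel"
  by (simp add: sqint_def)

lemma sqint_norm: "sqint G \<Longrightarrow> integrable lborel (\<lambda>x. (norm (G x))\<^sup>2)"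
  by (simp add: sqint_def)

lemma energy_nonneg: "energy G \<ge> 0"
  by (simp add: energy_def)

lemma sqint_inner:
  assumes "sqint G" "sqint H"
  shows "integrable lborel (\<lambda>x. G x \<bullet> H x)"
proof (rule Bochner_Integration.integrable_bound)
  note [measurable] = sqint_borel[OF assms(1)] sqint_borel[OF assms(2)]
  show "integrable lborel (\<lambda>x. (norm (G x))\<^sup>2 + (norm (H x))\<^sup>2)"
    using assms by (intro Bochner_Integration.integrable_add sqint_norm)
  have "\<bar>G x \<bullet> H x\<bar> \<le> (norm (G x))\<^sup>2 + (norm (H x))\<^sup>2" for x
  proof -
    have "\<bar>G x \<bullet> H x\<bar> \<le> norm (G x) * norm (H x)" by (rule Cauchy_Schwarz_ineq2)
    moreover have "2 * (norm (G x) * norm (H x)) \<le> (norm (G x))\<^sup>2 + (norm (H x))\<^sup>2"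
      using sum_squares_bound[of "norm (G x)" "norm (H x)"] by simp
    moreover have "norm (G x) * norm (H x) \<ge> 0" by simp
    ultimately show ?thesis by linarith
  qed
  then show "AE x in lborel. norm (G x \<bullet> H x) \<le> norm ((norm (G x))\<^sup>2 + (norm (H x))\<^sup>2)"
    by (intro AE_I2) simp
qed (use sqint_borel[OF assms(1)] sqint_borel[OF assms(2)] in simp)

lemma sqint_dominated:
  assumes "sqint G" and [measurable]: "H \<in> borel_measurable borel" and "\<And>x. norm (H x) \<le> norm (G x)"
  shows "sqint H" "energy H \<le> energy G"
proof -
  have le: "(norm (H x))\<^sup>2 \<le> (norm (G x))\<^sup>2" for x using assms(3) by (intro power_mono) auto
  have "integrable lborel (\<lambda>x. (norm (H x))\<^sup>2)"
    by (rule Bochner_Integration.integrable_bound[OF sqint_norm[OF assms(1)]]) (use le in auto)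
  then show "sqint H" by (simp add: sqint_def)
  then show "energy H \<le> energy G"
    unfolding energy_def using le by (intro integral_mono sqint_norm assms(1)) auto
qed

lemma sqint_scale: "sqint G \<Longrightarrow> sqint (\<lambda>x. c *\<^sub>R G x)"
  by (auto simp: sqint_def power_mult_distrib)

lemma norm_add_sq: "(norm (a + t *\<^sub>R b))\<^sup>2 = (norm a)\<^sup>2 + 2 * t * (a \<bullet> b) + t\<^sup>2 * (norm b)\<^sup>2"
  for a b :: "'a::real_inner"
  unfolding power2_norm_eq_inner
  by (simp add: inner_add_left inner_add_right inner_commute algebra_simps power2_eq_square)

lemma sqint_add_scale:
  assumes "sqint G" "sqint H"
  shows "sqint (\<lambda>x. G x + t *\<^sub>R H x)"
    and "energy (\<lambda>x. G x + t *\<^sub>R H x) = energy G + 2 * t * ip G H + t\<^sup>2 * energy H"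
proof -
  note [measurable] = sqint_borel[OF assms(1)] sqint_borel[OF assms(2)]
  note i = sqint_norm[OF assms(1)] sqint_norm[OF assms(2)] sqint_inner[OF assms]
  have "integrable lborel (\<lambda>x. (norm (G x))\<^sup>2 + 2 * t * (G x \<bullet> H x) + t\<^sup>2 * (norm (H x))\<^sup>2)"
    by (intro Bochner_Integration.integrable_add integrable_mult_right i)
  then show "sqint (\<lambda>x. G x + t *\<^sub>R H x)" unfolding sqint_def norm_add_sq by simp
  show "energy (\<lambda>x. G x + t *\<^sub>R H x) = energy G + 2 * t * ip G H + t\<^sup>2 * energy H"
    unfolding energy_def ip_def norm_add_sq using i by simp
qed

lemma sqint_add: "sqint G \<Longrightarrow> sqint H \<Longrightarrow> sqint (\<lambda>x. G x + H x)"
  using sqint_add_scale(1)[of G H 1] by simp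

lemma ip_add_right: "sqint F \<Longrightarrow> sqint G \<Longrightarrow> sqint H \<Longrightarrow> ip H (\<lambda>x. F x + c *\<^sub>R G x) = ip H F + c * ip H G"
  using sqint_inner[of H F] sqint_inner[of H G] by (simp add: ip_def inner_add_right)

text \<open>Cauchy-Schwarz without square roots, from the nonnegative energy of G - r H. The slack
  in r keeps it positive, so that one can divide by it also for s = 0; dividing the slack by
  \<open>energy H + 1\<close> makes the resulting error at most e.\<close>

lemma ip_le:
  assumes "sqint G" "sqint H" "energy G \<le> s\<^sup>2 * energy H" "s \<ge> 0"
  shows "ip G H \<le> s * energy H"
proof (rule field_le_epsilon)
  fix e :: real assume "e > 0"
  define r where "r = s + e / (energy H + 1)"
  have E: "energy H \<ge> 0" by (rule energy_nonneg)
  have r: "r > 0" "r \<ge> s" using \<open>e > 0\<close> assms(4) E by (auto simp: r_def add_nonneg_pos)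
  have "0 \<le> energy (\<lambda>x. G x + (- r) *\<^sub>R H x)" by (rule energy_nonneg)
  also have "\<dots> = energy G + 2 * (- r) * ip G H + (- r)\<^sup>2 * energy H" by (rule sqint_add_scale(2)[OF assms(1,2)])
  also have "energy G \<le> r\<^sup>2 * energy H"
    using assms(3) mult_right_mono[OF power_mono[OF r(2) assms(4), of 2] E] by linarith
  finally have "2 * r * ip G H \<le> 2 * r * (r * energy H)" by (simp add: power2_eq_square algebra_simps)
  then have "ip G H \<le> r * energy H" using r(1) by simp
  also have "\<dots> = s * energy H + e * (energy H / (energy H + 1))" by (simp add: r_def algebra_simps)
  also have "e * (energy H / (energy H + 1)) \<le> e * 1" using \<open>e > 0\<close> E by (intro mult_left_mono) auto
  finally show "ip G H \<le> s * energy H + e" by simp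
qed

text \<open>The gradient is carried along explicitly, so that energies of maxima, minima and linear
  combinations are computed from given fields instead of the choice made in
  \<open>weak_gradient\<close>.\<close>

definition D1_pair :: "(real ^ 'n \<Rightarrow> real) \<Rightarrow> (real ^ 'n \<Rightarrow> real ^ 'n) \<Rightarrow> bool" where
  "D1_pair f G \<longleftrightarrow> wgrad f G \<and> sqint G \<and> (\<forall>a>0. emeasure lborel {x. \<bar>f x\<bar> > a} < \<infinity>)"

lemma D1_pairD: "D1_pair f G \<Longrightarrow> wgrad f G" "D1_pair f G \<Longrightarrow> sqint G"
  "D1_pair f G \<Longrightarrow> a > 0 \<Longrightarrow> emeasure lborel {x. \<bar>f x\<bar> > a} < \<infinity>"
  by (auto simp: D1_pair_def)

lemma D1_pair_borel: "D1_pair f G \<Longrightarrow> f \<in> borel_measurable borel"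
  by (rule wgrad_borel(1)[OF D1_pairD(1)])

lemma D1_pair_superlevel_mono:
  assumes "D1_pair f F" and [measurable]: "g \<in> borel_measurable borel" and "\<And>x. \<bar>g x\<bar> \<le> \<bar>f x\<bar>" "a > 0"
  shows "emeasure lborel {x. \<bar>g x\<bar> > a} < \<infinity>"
proof -
  note [measurable] = D1_pair_borel[OF assms(1)]
  have "emeasure lborel {x. \<bar>g x\<bar> > a} \<le> emeasure lborel {x. \<bar>f x\<bar> > a}"
    using assms(3) by (intro emeasure_mono) (auto intro: less_le_trans)
  with D1_pairD(3)[OF assms(1,4)] show ?thesis by (rule le_less_trans[rotated])
qed

lemma D1_pair_add:
  assumes "D1_pair f F" "D1_pair g G"
  shows "D1_pair (\<lambda>x. f x + g x) (\<lambda>x. F x + G x)"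
  unfolding D1_pair_def
proof (intro conjI allI impI)
  note [measurable] = D1_pair_borel[OF assms(1)] D1_pair_borel[OF assms(2)]
  show "wgrad (\<lambda>x. f x + g x) (\<lambda>x. F x + G x)" using assms by (intro wgrad_add D1_pairD)
  show "sqint (\<lambda>x. F x + G x)" using assms by (intro sqint_add D1_pairD)
  fix a :: real assume "a > 0"
  have "emeasure lborel {x. \<bar>f x + g x\<bar> > a} \<le> emeasure lborel ({x. \<bar>f x\<bar> > a / 2} \<union> {x. \<bar>g x\<bar> > a / 2})"
    by (intro emeasure_mono) (auto simp: not_less)
  also have "\<dots> \<le> emeasure lborel {x. \<bar>f x\<bar> > a / 2} + emeasure lborel {x. \<bar>g x\<bar> > a / 2}"
    by (intro emeasure_subadditive) auto
  also have "\<dots> < \<infinity>"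
    using D1_pairD(3)[OF assms(1), of "a / 2"] D1_pairD(3)[OF assms(2), of "a / 2"] \<open>a > 0\<close>
    by (simp add: ennreal_add_less_top)
  finally show "emeasure lborel {x. \<bar>f x + g x\<bar> > a} < \<infinity>" .
qed

lemma D1_pair_cmult:
  assumes "D1_pair f F"
  shows "D1_pair (\<lambda>x. c * f x) (\<lambda>x. c *\<^sub>R F x)"
  unfolding D1_pair_def
proof (intro conjI allI impI)
  show "wgrad (\<lambda>x. c * f x) (\<lambda>x. c *\<^sub>R F x)" using assms by (intro wgrad_cmult D1_pairD)
  show "sqint (\<lambda>x. c *\<^sub>R F x)" using assms by (intro sqint_scale D1_pairD)
  fix a :: real assume "a > 0"
  show "emeasure lborel {x. \<bar>c * f x\<bar> > a} < \<infinity>"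
  proof (cases "c = 0")
    case True
    then show ?thesis using \<open>a > 0\<close> by simp
  next
    case False
    then have "{x. \<bar>c * f x\<bar> > a} = {x. \<bar>f x\<bar> > a / \<bar>c\<bar>}" by (auto simp: abs_mult field_simps)
    then show ?thesis using D1_pairD(3)[OF assms, of "a / \<bar>c\<bar>"] False \<open>a > 0\<close> by simp
  qed
qed

lemma D1_pair_diff:
  assumes "D1_pair f F" "D1_pair g G"
  shows "D1_pair (\<lambda>x. f x - g x) (\<lambda>x. F x - G x)"
  using D1_pair_add[OF assms(1) D1_pair_cmult[OF assms(2), of "-1"]] by simp

lemma D1_pair_abs:
  assumes "D1_pair f F"
  shows "D1_pair (\<lambda>x. \<bar>f x\<bar>) (\<lambda>x. sgn (f x) *\<^sub>R F x)" "energy (\<lambda>x. sgn (f x) *\<^sub>R F x) \<le> energy F"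
proof -
  note w = wgrad_abs[OF D1_pairD(1)[OF assms]]
  have n: "norm (sgn (f x) *\<^sub>R F x) \<le> norm (F x)" for x by (simp add: abs_sgn_eq)
  show "D1_pair (\<lambda>x. \<bar>f x\<bar>) (\<lambda>x. sgn (f x) *\<^sub>R F x)"
    using w sqint_dominated(1)[OF D1_pairD(2)[OF assms] wgrad_borel(2)[OF w] n] D1_pairD(3)[OF assms]
    by (auto simp: D1_pair_def)
  show "energy (\<lambda>x. sgn (f x) *\<^sub>R F x) \<le> energy F"
    by (rule sqint_dominated(2)[OF D1_pairD(2)[OF assms] wgrad_borel(2)[OF w] n])
qed

text \<open>Maximum and minimum are half of f + g plus or minus the absolute value of f - g.
  Pointwise, the parallelogram law is applied twice, and in between the field sgn (f - g) (F - G) is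
  bounded by F - G.\<close>

lemma D1_pair_max_min:
  assumes "D1_pair f F" "D1_pair g G"
  obtains P Q where "D1_pair (\<lambda>x. max (f x) (g x)) P" "D1_pair (\<lambda>x. min (f x) (g x)) Q"
    "energy P + energy Q \<le> energy F + energy G"
proof -
  let ?A = "\<lambda>x. sgn (f x - g x) *\<^sub>R (F x - G x)"
  let ?P = "\<lambda>x. (1/2) *\<^sub>R ((F x + G x) + ?A x)" and ?Q = "\<lambda>x. (1/2) *\<^sub>R ((F x + G x) - ?A x)"
  note s = D1_pair_add[OF assms] and d = D1_pair_diff[OF assms]
  note a = D1_pair_abs[OF d]
  have "D1_pair (\<lambda>x. (1/2) * ((f x + g x) + \<bar>f x - g x\<bar>)) ?P"
    by (intro D1_pair_cmult D1_pair_add s a)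
  moreover have "(1/2) * ((f x + g x) + \<bar>f x - g x\<bar>) = max (f x) (g x)" for x by (simp add: max_def field_simps)
  moreover have "D1_pair (\<lambda>x. (1/2) * ((f x + g x) - \<bar>f x - g x\<bar>)) ?Q"
    by (intro D1_pair_cmult D1_pair_diff s a)
  moreover have "(1/2) * ((f x + g x) - \<bar>f x - g x\<bar>) = min (f x) (g x)" for x by (simp add: min_def field_simps)
  moreover have "energy ?P + energy ?Q \<le> energy F + energy G"
  proof -
    have P: "sqint ?P" and Q: "sqint ?Q"
      using calculation by (auto intro: D1_pairD)
    have F: "sqint F" and G: "sqint G" using assms by (auto intro: D1_pairD)
    have "energy ?P + energy ?Q = (LINT x|lborel. (norm (?P x))\<^sup>2 + (norm (?Q x))\<^sup>2)"
      unfolding energy_def using sqint_norm[OF P] sqint_norm[OF Q] by simp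
    also have "\<dots> \<le> (LINT x|lborel. (norm (F x))\<^sup>2 + (norm (G x))\<^sup>2)"
    proof (rule integral_mono)
      fix x
      have par: "(norm ((1/2) *\<^sub>R (a + b)))\<^sup>2 + (norm ((1/2) *\<^sub>R (a - b)))\<^sup>2 = ((norm a)\<^sup>2 + (norm b)\<^sup>2) / 2"
        for a b :: "real ^ 'a"
        by (simp add: power2_norm_eq_inner inner_add_left inner_add_right inner_diff_left inner_diff_right
            inner_commute field_simps)
      have par2: "((norm (a + b))\<^sup>2 + (norm (a - b))\<^sup>2) / 2 = (norm a)\<^sup>2 + (norm b)\<^sup>2" for a b :: "real ^ 'a"
        by (simp add: power2_norm_eq_inner inner_add_left inner_add_right inner_diff_left inner_diff_right
            inner_commute field_simps)
      have "(norm (?P x))\<^sup>2 + (norm (?Q x))\<^sup>2 = ((norm (F x + G x))\<^sup>2 + (norm (?A x))\<^sup>2) / 2" by (rule par)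
      also have "\<dots> \<le> ((norm (F x + G x))\<^sup>2 + (norm (F x - G x))\<^sup>2) / 2"
        by (simp add: abs_sgn_eq)
      also have "\<dots> = (norm (F x))\<^sup>2 + (norm (G x))\<^sup>2" by (rule par2)
      finally show "(norm (?P x))\<^sup>2 + (norm (?Q x))\<^sup>2 \<le> (norm (F x))\<^sup>2 + (norm (G x))\<^sup>2" .
    qed (use sqint_norm[OF P] sqint_norm[OF Q] sqint_norm[OF F] sqint_norm[OF G] in auto)
    also have "\<dots> = energy F + energy G"
      unfolding energy_def using sqint_norm[OF F] sqint_norm[OF G] by simp
    finally show ?thesis .
  qed
  ultimately show ?thesis using that[of ?P ?Q] by simp
qed

text \<open>A positive constant violates the decay condition, so it cannot enter
  \<open>D1_pair_max_min\<close>. The same formula is applied to weak gradients, and the decay of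
  the minimum is inherited from f.\<close>

lemma D1_pair_truncate:
  assumes "D1_pair f F" "\<And>x. f x \<ge> 0" "k > 0"
  shows "D1_pair (\<lambda>x. min (f x) k) (\<lambda>x. (1/2) *\<^sub>R (F x - sgn (f x - k) *\<^sub>R F x))"
  unfolding D1_pair_def
proof (intro conjI allI impI)
  have "wgrad (\<lambda>x. (1/2) * ((f x + k) - \<bar>f x - k\<bar>)) (\<lambda>x. (1/2) *\<^sub>R ((F x + 0) - sgn (f x - k) *\<^sub>R (F x - 0)))"
    using D1_pairD(1)[OF assms(1)] by (intro wgrad_cmult wgrad_diff wgrad_add wgrad_abs wgrad_const)
  moreover have "(\<lambda>x. (1/2) * ((f x + k) - \<bar>f x - k\<bar>)) = (\<lambda>x. min (f x) k)"
    by (auto simp: min_def field_simps fun_eq_iff)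
  ultimately show w: "wgrad (\<lambda>x. min (f x) k) (\<lambda>x. (1/2) *\<^sub>R (F x - sgn (f x - k) *\<^sub>R F x))" by simp
  show "sqint (\<lambda>x. (1/2) *\<^sub>R (F x - sgn (f x - k) *\<^sub>R F x))"
  proof (rule sqint_dominated(1)[OF D1_pairD(2)[OF assms(1)] wgrad_borel(2)[OF w]])
    show "norm ((1/2) *\<^sub>R (F x - sgn (f x - k) *\<^sub>R F x)) \<le> norm (F x)" for x
      by (auto simp: sgn_real_def algebra_simps scaleR_2[symmetric])
  qed
  fix a :: real assume "a > 0"
  show "emeasure lborel {x. \<bar>min (f x) k\<bar> > a} < \<infinity>"
    by (rule D1_pair_superlevel_mono[OF assms(1) wgrad_borel(1)[OF w] _ \<open>a > 0\<close>]) (use assms(2,3) in \<open>auto simp: min_def\<close>)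
qed

text \<open>A function in \<open>D\<^sup>1\<close> with vanishing gradient is constant, and the decay condition excludes
  nonzero constants.\<close>

lemma D1_pair_energy_0:
  assumes "D1_pair f F" "energy F \<le> 0"
  shows "AE x in lborel. f x = 0"
proof -
  note lf = wgrad_loc_int(1)[OF D1_pairD(1)[OF assms(1)]]
  have "energy F = 0" using assms(2) energy_nonneg[of F] by simp
  then have F0: "AE x in lborel. F x = 0"
    unfolding energy_def using integral_nonneg_eq_0_iff_AE[OF sqint_norm[OF D1_pairD(2)[OF assms(1)]]] by simp
  have zero: "conv f (pd i (moll n)) x = 0" for i n x
  proof -
    have "conv f (pd i (moll n)) x = (LINT y|lborel. F y $ i * moll n (x - y))"
      using conv_wgrad[OF D1_pairD(1)[OF assms(1)] moll(1)[of n]] by (simp add: conv_def)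
    also have "\<dots> = 0"
      using F0 by (intro integral_eq_zero_AE) (auto elim: eventually_mono)
    finally show ?thesis .
  qed
  have line: "conv f (moll n) (x + t *\<^sub>R axis i 1) = conv f (moll n) x" for n x t and i :: 'a
    using DERIV_const_ratio_const[of 0 t "\<lambda>t. conv f (moll n) (x + t *\<^sub>R axis i 1)" 0]
      conv_line_deriv[OF lf moll(1)[of n], of x i] zero[of i n] by (cases "t = 0") auto
  have const: "conv f (moll n) x = conv f (moll n) 0" for n x
  proof -
    have "conv f (moll n) (\<Sum>i\<in>I. (x $ i) *\<^sub>R axis i 1) = conv f (moll n) 0" if "finite I" for I
      using that
    proof (induction I)
      case (insert i I)
      then show ?case using line[of n "\<Sum>i\<in>I. (x $ i) *\<^sub>R axis i 1" "x $ i" i] by (simp add: add.commute)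
    qed simp
    moreover have "(\<Sum>i\<in>UNIV. (x $ i) *\<^sub>R axis i 1) = x"
      by (simp add: vec_eq_iff axis_def if_distrib cong: if_cong)
    ultimately show ?thesis by (metis finite)
  qed
  define m where "m n = conv f (moll n) 0" for n
  \<comment> \<open>Every mollification is a constant function. On a ball these constants converge
    to f in L1, hence almost everywhere along a subsequence; at this stage the limit may still
    depend on the ball.\<close>
  have ball: "\<exists>c. AE x in lborel. norm x \<le> R \<longrightarrow> f x = c" for R
  proof -
    let ?u = "\<lambda>n x. indicator (cball 0 R) x * (m n - f x)"
    have u: "integrable lborel (?u n)" "(\<lambda>n. LINT x|lborel. norm (?u n x)) \<longlonglongrightarrow> 0" for n
      using moll_tendsto_L1[OF lf, of R] unfolding const[folded m_def] by simp_all
    obtain r where r: "strict_mono r" "AE x in lborel. (\<lambda>n. ?u (r n) x) \<longlonglongrightarrow> 0"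
      using tendsto_L1_AE_subseq[of lborel ?u] u by auto
    from r(2) have "AE x in lborel. norm x \<le> R \<longrightarrow> f x = lim (\<lambda>n. m (r n))"
    proof eventually_elim
      case (elim x)
      show ?case
      proof
        assume "norm x \<le> R"
        then have "(\<lambda>n. m (r n) - f x) \<longlonglongrightarrow> 0" using elim by simp
        then show "f x = lim (\<lambda>n. m (r n))" by (intro limI[symmetric]) (rule LIM_zero_cancel)
      qed
    qed
    then show ?thesis by blast
  qed
  have "AE x in lborel. \<bar>f x\<bar> \<le> a" if "a > 0" for a
  proof -
    note [measurable] = loc_int_borel[OF lf]
    \<comment> \<open>Large balls have more measure than the set where \<bar>f\<bar> exceeds a, so
      the constant on such a ball cannot exceed a in absolute value.\<close>
    have "(\<lambda>n. emeasure lborel (cball (0 :: real ^ 'a) (real n))) \<longlonglongrightarrow>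
        emeasure lborel (\<Union>n. cball (0 :: real ^ 'a) (real n))"
      by (rule Lim_emeasure_incseq) (auto simp: incseq_def)
    moreover have "(\<Union>n. cball (0 :: real ^ 'a) (real n)) = UNIV" using real_arch_simple by auto
    ultimately have "(\<lambda>n. emeasure lborel (cball (0 :: real ^ 'a) (real n))) \<longlonglongrightarrow> \<infinity>" by simp
    from order_tendstoD(1)[OF this D1_pairD(3)[OF assms(1) that]] obtain N where
      N: "\<And>n. n \<ge> N \<Longrightarrow> emeasure lborel {x. \<bar>f x\<bar> > a} < emeasure lborel (cball (0 :: real ^ 'a) (real n))"
      by (auto simp: eventually_sequentially)
    have "AE x in lborel. norm x \<le> real (N + n) \<longrightarrow> \<bar>f x\<bar> \<le> a" for n
    proof -
      obtain c where c: "AE x in lborel. norm x \<le> real (N + n) \<longrightarrow> f x = c" using ball by blast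
      have "\<bar>c\<bar> \<le> a"
      proof (rule ccontr)
        assume "\<not> ?thesis"
        then have "AE x in lborel. x \<in> cball (0 :: real ^ 'a) (real (N + n)) \<longrightarrow> x \<in> {x. \<bar>f x\<bar> > a}"
          using c by (auto elim: eventually_mono)
        then have "emeasure lborel (cball (0 :: real ^ 'a) (real (N + n))) \<le> emeasure lborel {x. \<bar>f x\<bar> > a}"
          by (rule emeasure_mono_AE) simp
        then show False using N[of "N + n"] by simp
      qed
      then show ?thesis using c by (auto elim: eventually_mono)
    qed
    then have "AE x in lborel. \<forall>n. norm x \<le> real (N + n) \<longrightarrow> \<bar>f x\<bar> \<le> a"
      unfolding AE_all_countable by simp
    then show ?thesis
    proof eventually_elim
      case (elim x)
      obtain n where "norm x \<le> real n" using real_arch_simple by blast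
      then show ?case using elim[THEN spec, of n] by simp
    qed
  qed
  then have "AE x in lborel. \<forall>n. \<bar>f x\<bar> \<le> 1 / real (Suc n)"
    unfolding AE_all_countable by simp
  then show ?thesis
  proof eventually_elim
    case (elim x)
    have "\<bar>f x\<bar> \<le> 0"
      using elim by (intro LIMSEQ_le_const[OF LIMSEQ_Suc[OF lim_const_over_n[of 1]]]) auto
    then show ?case by simp
  qed
qed

section \<open>Lebesgue measurable representatives\<close>

lemma LINT_lebesgue_borel:
  fixes f :: "real ^ 'n \<Rightarrow> real"
  assumes "f \<in> borel_measurable borel"
  shows "integral\<^sup>L lebesgue f = integral\<^sup>L lborel f"
  using assms by (intro integral_completion) simp

lemma integrable_lebesgue_borel:
  fixes f :: "real ^ 'n \<Rightarrow> 'b::euclidean_space"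
  assumes "f \<in> borel_measurable borel"
  shows "integrable lebesgue f \<longleftrightarrow> integrable lborel f"
  using assms by (intro integrable_completion) simp

lemma AE_lebesgue_iff: "(AE x in lebesgue. P x) \<longleftrightarrow> (AE x in lborel. P x)"
  by (rule AE_completion_iff)

lemma borel_imp_lebesgue:
  fixes f :: "'a::euclidean_space \<Rightarrow> 'b::topological_space"
  assumes "f \<in> borel_measurable borel"
  shows "f \<in> borel_measurable lebesgue"
proof (rule measurable_completion)
  show "f \<in> borel_measurable lborel" unfolding measurable_cong_sets[OF sets_lborel refl] by (rule assms)
qed

lemma borel_representative:
  fixes f :: "real ^ 'n \<Rightarrow> real"
  assumes "f \<in> borel_measurable lebesgue"
  obtains f0 where "f0 \<in> borel_measurable borel" "AE x in lborel. f x = f0 x"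
  using completion_ex_borel_measurable_real[OF assms] by auto

lemma loc_int_imp_locally_integrable:
  assumes "loc_int f"
  shows "locally_integrable f"
  unfolding locally_integrable_def
proof (intro conjI allI impI)
  note b = loc_int_borel[OF assms]
  show "f \<in> borel_measurable lebesgue" by (rule borel_imp_lebesgue[OF b])
  fix K :: "(real ^ 'a) set" assume K: "compact K"
  then obtain R where R: "\<forall>x\<in>K. norm x \<le> R" using compact_imp_bounded bounded_iff by metis
  have [measurable]: "K \<in> sets borel" using K by (simp add: compact_imp_closed)
  note [measurable] = b
  have "integrable lborel (\<lambda>x. indicator K x *\<^sub>R f x)"
    by (rule Bochner_Integration.integrable_bound[OF loc_intD[OF assms, of R]])
       (use R in \<open>auto simp: indicator_def\<close>)
  then show "set_integrable lebesgue K f"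
    unfolding set_integrable_def by (subst integrable_lebesgue_borel) auto
qed

lemma integrable_vec:
  fixes G :: "'a \<Rightarrow> real ^ 'n"
  assumes "\<And>i. integrable M (\<lambda>x. G x $ i)"
  shows "integrable M G"
proof (rule Bochner_Integration.integrable_bound)
  show "integrable M (\<lambda>x. \<Sum>i\<in>UNIV. \<bar>G x $ i\<bar>)"
    using assms by (intro Bochner_Integration.integrable_sum integrable_abs)
  show "G \<in> borel_measurable M" using assms by (intro vec_borel_measurable borel_measurable_integrable)
  show "AE x in M. norm (G x) \<le> norm (\<Sum>i\<in>UNIV. \<bar>G x $ i\<bar>)"
    by (intro AE_I2) (simp add: norm_le_l1_cart abs_of_nonneg sum_nonneg)
qed

lemma locally_integrable_vec:
  fixes G :: "real ^ 'n \<Rightarrow> real ^ 'n"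
  assumes "\<And>i. locally_integrable (\<lambda>x. G x $ i)"
  shows "locally_integrable G"
  unfolding locally_integrable_def
proof (intro conjI allI impI)
  show "G \<in> borel_measurable lebesgue"
    using assms by (intro vec_borel_measurable) (simp add: locally_integrable_def)
  fix K :: "(real ^ 'n) set" assume "compact K"
  then show "set_integrable lebesgue K G"
    using assms unfolding set_integrable_def locally_integrable_def by (intro integrable_vec) simp
qed

lemma locally_integrable_component:
  fixes G :: "real ^ 'n \<Rightarrow> real ^ 'n"
  assumes "locally_integrable G"
  shows "locally_integrable (\<lambda>x. G x $ i)"
  unfolding locally_integrable_def
proof (intro conjI allI impI)
  have c: "continuous_on UNIV (\<lambda>x :: real ^ 'n. x $ i)" by (intro continuous_intros)
  show "(\<lambda>x. G x $ i) \<in> borel_measurable lebesgue"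
    using assms measurable_compose[OF _ borel_measurable_continuous_onI[OF c]]
    unfolding locally_integrable_def by blast
  fix K :: "(real ^ 'n) set" assume "compact K"
  then have "integrable lebesgue (\<lambda>x. indicator K x *\<^sub>R G x)"
    using assms by (simp add: locally_integrable_def set_integrable_def)
  from integrable_bounded_linear[OF bounded_linear_vec_nth this, of i]
  show "set_integrable lebesgue K (\<lambda>x. G x $ i)" by (simp add: set_integrable_def)
qed

lemma locally_integrable_representative:
  fixes f :: "real ^ 'n \<Rightarrow> real"
  assumes "locally_integrable f"
  obtains f0 where "loc_int f0" "AE x in lborel. f x = f0 x"
proof -
  obtain f0 where f0: "f0 \<in> borel_measurable borel" "AE x in lborel. f x = f0 x"
    using assms borel_representative[of f] by (auto simp: locally_integrable_def)
  have "integrable lborel (\<lambda>x. indicator (cball 0 R) x * f0 x)" for R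
  proof -
    have "integrable lebesgue (\<lambda>x. indicator (cball 0 R) x *\<^sub>R f x)"
      using assms by (simp add: locally_integrable_def set_integrable_def)
    moreover have "AE x in lebesgue. indicator (cball 0 R) x *\<^sub>R f x = indicator (cball 0 R) x *\<^sub>R f0 x"
      using f0(2) unfolding AE_lebesgue_iff by (auto elim: eventually_mono)
    moreover have bm: "(\<lambda>x. indicator (cball 0 R) x *\<^sub>R f0 x) \<in> borel_measurable borel"
      using f0(1) by simp
    ultimately have "integrable lebesgue (\<lambda>x. indicator (cball 0 R) x *\<^sub>R f0 x)"
      using integrable_cong_AE_imp[OF _ borel_imp_lebesgue[OF bm]] by (auto elim: eventually_mono)
    then show ?thesis using bm by (simp add: integrable_lebesgue_borel)
  qed
  then have "loc_int f0" using f0(1) by (simp add: loc_int_def)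
  with f0(2) that show ?thesis by blast
qed

lemma wgrad_imp_weak_gradient:
  assumes "wgrad f G"
  shows "is_weak_gradient f G"
  unfolding is_weak_gradient_def
proof (intro conjI allI impI)
  show "locally_integrable G"
    by (intro locally_integrable_vec loc_int_imp_locally_integrable wgrad_loc_int(2)[OF assms])
  fix \<psi> :: "real ^ 'a \<Rightarrow> real" and i assume \<psi>: "test_function \<psi>"
  note [measurable] = wgrad_borel(1)[OF assms] loc_int_borel[OF wgrad_loc_int(2)[OF assms, of i]]
    smooth_borel[OF test_smooth[OF \<psi>]] smooth_borel[OF test_smooth[OF test_pd[OF \<psi>]]]
  have "(LINT x|lebesgue. f x * pd i \<psi> x) = - (LINT x|lebesgue. G x $ i * \<psi> x)"
    using wgrad_eq[OF assms \<psi>, of i] by (simp add: LINT_lebesgue_borel)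
  then show "(LINT x|lebesgue. f x * frechet_derivative \<psi> (at x) (axis i 1)) =
      - (LINT x|lebesgue. G x $ i * \<psi> x)" by (simp add: pd_def)
qed

text \<open>Both integrals in the definition are insensitive to null sets, so f and the components
  of G may be replaced by Borel functions one at a time.\<close>

lemma weak_gradient_imp_wgrad:
  assumes "is_weak_gradient f G" "loc_int f0" "AE x in lborel. f x = f0 x" "f \<in> borel_measurable lebesgue"
  obtains G0 where "wgrad f0 G0" "AE x in lborel. G x = G0 x"
proof -
  have lG: "locally_integrable (\<lambda>x. G x $ i)" for i
    using assms(1) by (intro locally_integrable_component) (simp add: is_weak_gradient_def)
  have "\<forall>i. \<exists>g. loc_int g \<and> (AE x in lborel. G x $ i = g x)"
    using locally_integrable_representative[OF lG] by metis
  then obtain g where g: "\<And>i. loc_int (g i)" "\<And>i. AE x in lborel. G x $ i = g i x" by metis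
  define G0 where "G0 x = (\<chi> i. g i x)" for x
  have "AE x in lborel. \<forall>i\<in>UNIV. G x $ i = g i x"
    using g(2) by (intro AE_ball_countable[THEN iffD2] countable_finite) auto
  then have eq: "AE x in lborel. G x = G0 x"
    by eventually_elim (simp add: G0_def vec_eq_iff)
  moreover have "wgrad f0 G0"
  proof (rule wgradI)
    show "loc_int f0" by fact
    show "loc_int (\<lambda>x. G0 x $ i)" for i using g(1) by (simp add: G0_def)
    fix \<psi> :: "real ^ 'a \<Rightarrow> real" and i assume \<psi>: "test_function \<psi>"
    note b\<psi> [measurable] = smooth_borel[OF test_smooth[OF \<psi>]] smooth_borel[OF test_smooth[OF test_pd[OF \<psi>]]]
    note [measurable] = loc_int_borel[OF assms(2)] loc_int_borel[OF g(1)]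
    have gl: "(\<lambda>x. G x $ i) \<in> borel_measurable lebesgue"
      using lG[of i] by (simp add: locally_integrable_def)
    have "(LINT x|lborel. f0 x * pd i \<psi> x) = (LINT x|lebesgue. f0 x * pd i \<psi> x)"
      by (simp add: LINT_lebesgue_borel)
    also have "\<dots> = (LINT x|lebesgue. f x * pd i \<psi> x)"
    proof (rule integral_cong_AE)
      show "AE x in lebesgue. f0 x * pd i \<psi> x = f x * pd i \<psi> x"
        using assms(3) unfolding AE_lebesgue_iff by (auto elim: eventually_mono)
    qed (intro borel_measurable_times assms(4) borel_imp_lebesgue b\<psi> loc_int_borel assms(2))+
    also have "\<dots> = - (LINT x|lebesgue. G x $ i * \<psi> x)"
      using assms(1) \<psi> by (simp add: is_weak_gradient_def pd_def)
    also have "(LINT x|lebesgue. G x $ i * \<psi> x) = (LINT x|lebesgue. g i x * \<psi> x)"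
    proof (rule integral_cong_AE)
      show "AE x in lebesgue. G x $ i * \<psi> x = g i x * \<psi> x"
        using g(2)[of i] unfolding AE_lebesgue_iff by (auto elim: eventually_mono)
    qed (intro borel_measurable_times gl borel_imp_lebesgue b\<psi> loc_int_borel g(1))+
    also have "\<dots> = (LINT x|lborel. G0 x $ i * \<psi> x)"
      by (simp add: LINT_lebesgue_borel G0_def)
    finally show "(LINT x|lborel. f0 x * pd i \<psi> x) = - (LINT x|lborel. G0 x $ i * \<psi> x)" .
  qed
  ultimately show ?thesis using that by blast
qed


text \<open>\<open>weak_gradient\<close> is an arbitrary choice; uniqueness almost everywhere makes
  the energy independent of it.\<close>

lemma dirichlet_energy_eq:
  fixes f :: "real ^ 'n \<Rightarrow> real"
  assumes "wgrad f0 G0" "AE x in lborel. f x = f0 x" "f \<in> borel_measurable lebesgue" "is_weak_gradient f G"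
  shows "dirichlet_energy f = 1 / (2 * real CARD('n)) * energy G0"
proof -
  have "is_weak_gradient f (weak_gradient f)"
    unfolding weak_gradient_def by (rule someI[of "is_weak_gradient f", OF assms(4)])
  then obtain H where H: "wgrad f0 H" "AE x in lborel. weak_gradient f x = H x"
    using weak_gradient_imp_wgrad[OF _ wgrad_loc_int(1)[OF assms(1)] assms(2,3)] by metis
  from wgrad_unique[OF H(1) assms(1)] H(2) have eq: "AE x in lborel. weak_gradient f x = G0 x"
    by eventually_elim simp
  have m: "weak_gradient f \<in> borel_measurable lebesgue"
    using \<open>is_weak_gradient f (weak_gradient f)\<close> by (simp add: is_weak_gradient_def locally_integrable_def)
  note [measurable] = wgrad_borel(2)[OF assms(1)]
  have "(LINT x|lebesgue. (norm (weak_gradient f x))\<^sup>2) = (LINT x|lebesgue. (norm (G0 x))\<^sup>2)"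
  proof (rule integral_cong_AE)
    show "AE x in lebesgue. (norm (weak_gradient f x))\<^sup>2 = (norm (G0 x))\<^sup>2"
      using eq unfolding AE_lebesgue_iff by (auto elim: eventually_mono)
    show "(\<lambda>x. (norm (weak_gradient f x))\<^sup>2) \<in> borel_measurable lebesgue"
      using m by simp
    show "(\<lambda>x. (norm (G0 x))\<^sup>2) \<in> borel_measurable lebesgue"
      by (rule borel_imp_lebesgue) simp
  qed
  also have "\<dots> = energy G0" unfolding energy_def by (rule LINT_lebesgue_borel) simp
  finally show ?thesis by (simp add: dirichlet_energy_def)
qed

lemma D1_pair_imp_D1_space:
  fixes f :: "real ^ 'n \<Rightarrow> real"
  assumes "D1_pair f G"
  shows "f \<in> D1_space" "dirichlet_energy f = 1 / (2 * real CARD('n)) * energy G"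
proof -
  note w = D1_pairD(1)[OF assms] and b [measurable] = D1_pair_borel[OF assms]
  note [measurable] = wgrad_borel(2)[OF w]
  have "integrable lebesgue (\<lambda>x. (norm (G x))\<^sup>2)"
    using sqint_norm[OF D1_pairD(2)[OF assms]] by (subst integrable_lebesgue_borel) auto
  moreover have "emeasure lebesgue {x. \<bar>f x\<bar> > a} < \<infinity>" if "a > 0" for a
    using D1_pairD(3)[OF assms that] by (simp add: main_part_sets)
  ultimately show "f \<in> D1_space"
    using wgrad_imp_weak_gradient[OF w] loc_int_imp_locally_integrable[OF wgrad_loc_int(1)[OF w]]
    by (auto simp: D1_space_def)
  show "dirichlet_energy f = 1 / (2 * real CARD('n)) * energy G"
    using wgrad_imp_weak_gradient[OF w] borel_imp_lebesgue[OF b] by (intro dirichlet_energy_eq[OF w]) auto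
qed

lemma D1_space_representative:
  fixes f :: "real ^ 'n \<Rightarrow> real"
  assumes "f \<in> D1_space"
  obtains f0 G where "D1_pair f0 G" "AE x in lborel. f x = f0 x"
    "dirichlet_energy f = 1 / (2 * real CARD('n)) * energy G"
proof -
  from assms obtain H where H: "locally_integrable f" "is_weak_gradient f H"
    "integrable lebesgue (\<lambda>x. (norm (H x))\<^sup>2)" "\<And>a. a > 0 \<Longrightarrow> emeasure lebesgue {x. \<bar>f x\<bar> > a} < \<infinity>"
    by (auto simp: D1_space_def)
  have f: "f \<in> borel_measurable lebesgue" using H(1) by (simp add: locally_integrable_def)
  obtain f0 where f0: "loc_int f0" "AE x in lborel. f x = f0 x"
    using locally_integrable_representative[OF H(1)] .
  obtain G where G: "wgrad f0 G" "AE x in lborel. H x = G x"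
    using weak_gradient_imp_wgrad[OF H(2) f0 f] .
  note [measurable] = loc_int_borel[OF f0(1)] wgrad_borel(2)[OF G(1)]
  have "integrable lebesgue (\<lambda>x. (norm (G x))\<^sup>2)"
  proof (rule integrable_cong_AE_imp[OF H(3)])
    show "(\<lambda>x. (norm (G x))\<^sup>2) \<in> borel_measurable lebesgue" by (rule borel_imp_lebesgue) simp
    show "AE x in lebesgue. (norm (H x))\<^sup>2 = (norm (G x))\<^sup>2"
      using G(2) unfolding AE_lebesgue_iff by (auto elim: eventually_mono)
  qed
  then have "sqint G" by (subst (asm) integrable_lebesgue_borel) (auto simp: sqint_def)
  moreover have "emeasure lborel {x. \<bar>f0 x\<bar> > a} < \<infinity>" if "a > 0" for a
  proof -
    have "emeasure lborel {x. \<bar>f0 x\<bar> > a} = emeasure lebesgue {x. \<bar>f0 x\<bar> > a}"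
      by (simp add: main_part_sets)
    also have "\<dots> = emeasure lebesgue {x. \<bar>f x\<bar> > a}"
    proof (rule emeasure_eq_AE)
      show "AE x in lebesgue. x \<in> {x. \<bar>f0 x\<bar> > a} \<longleftrightarrow> x \<in> {x. \<bar>f x\<bar> > a}"
        using f0(2) unfolding AE_lebesgue_iff by (auto elim: eventually_mono)
      show "{x. \<bar>f0 x\<bar> > a} \<in> sets lebesgue" by (intro sets_completionI_sets) simp
      have "{x \<in> space lebesgue. \<bar>f x\<bar> > a} \<in> sets lebesgue"
        using f by (intro borel_measurable_less borel_measurable_abs) auto
      then show "{x. \<bar>f x\<bar> > a} \<in> sets lebesgue" by simp
    qed
    finally show ?thesis using H(4)[OF that] by simp
  qed
  ultimately have "D1_pair f0 G" using G(1) by (simp add: D1_pair_def)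
  with that f0(2) dirichlet_energy_eq[OF G(1) f0(2) f H(2)] show ?thesis by blast
qed

section \<open>Newtonian potentials\<close>

text \<open>Dyadic balls take the role of polar coordinates: a radial bound is summed over shells,
  each estimated by the ball that contains it.\<close>

lemma nn_integral_dyadic_finite:
  fixes f :: "'a::euclidean_space \<Rightarrow> ennreal"
  assumes "\<And>z. f z \<le> (\<Sum>k. ennreal (c k) * indicator (cball 0 (r k)) z)"
    and "\<And>k. c k \<ge> 0" "\<And>k. r k \<ge> 0" "summable (\<lambda>k. c k * r k ^ DIM('a))"
  shows "(\<integral>\<^sup>+z. f z \<partial>lborel) < \<infinity>"
proof -
  have "(\<integral>\<^sup>+z. f z \<partial>lborel) \<le> (\<integral>\<^sup>+z. (\<Sum>k. ennreal (c k) * indicator (cball 0 (r k)) z) \<partial>(lborel :: 'a measure))"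
    by (rule nn_integral_mono) (rule assms(1))
  also have "\<dots> = (\<Sum>k. \<integral>\<^sup>+z. ennreal (c k) * indicator (cball 0 (r k)) z \<partial>(lborel :: 'a measure))"
    by (rule nn_integral_suminf) auto
  also have "\<dots> = (\<Sum>k. ennreal (unit_ball_vol (real DIM('a)) * (c k * r k ^ DIM('a))))"
    using assms(2,3)
    by (intro suminf_cong) (auto simp: nn_integral_cmult emeasure_cball ennreal_mult[symmetric] mult_ac)
  finally have le: "(\<integral>\<^sup>+z. f z \<partial>lborel) \<le> (\<Sum>k. ennreal (unit_ball_vol (real DIM('a)) * (c k * r k ^ DIM('a))))" .
  have "(\<Sum>k. ennreal (unit_ball_vol (real DIM('a)) * (c k * r k ^ DIM('a)))) \<noteq> top"
    by (intro ennreal_suminf_neq_top summable_mult assms mult_nonneg_nonneg unit_ball_vol_nonneg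
        zero_le_power) simp
  with le show ?thesis by (metis infinity_ennreal_def less_top top_unique)
qed

lemma ennreal_le_suminf: "f k \<le> (\<Sum>k. f k)" for f :: "nat \<Rightarrow> ennreal"
  using sum_le_suminf[of f "{k}"] by simp

lemma dyadic_shell:
  fixes x :: real
  assumes "x \<ge> 1"
  obtains k :: nat where "2 ^ k \<le> x" "x < 2 ^ Suc k"
proof -
  obtain n :: nat where n: "x < 2 ^ n" using real_arch_pow[of 2 x] by auto
  define m where "m = (LEAST n. x < 2 ^ n)"
  have m: "x < 2 ^ m" unfolding m_def by (rule LeastI[of "\<lambda>n. x < 2 ^ n", OF n])
  have "m \<noteq> 0" using m assms by (intro notI) simp
  then obtain k where k: "m = Suc k" using not0_implies_Suc by blast
  then have "\<not> x < 2 ^ k" unfolding m_def by (intro not_less_Least) (simp add: m_def)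
  with m k that[of k] show ?thesis by (simp add: not_less)
qed

lemma powr_two_power: "(2 ^ k) powr a = (2 powr a) ^ k" for a :: real
  by (simp add: powr_realpow[symmetric] powr_powr mult.commute)

lemma norm_powr_near_0_finite:
  assumes "0 \<le> \<beta>" "\<beta> < real DIM('a)"
  shows "(\<integral>\<^sup>+z. indicator (cball 0 1) z * ennreal (norm (z :: 'a::euclidean_space) powr - \<beta>) \<partial>lborel) < \<infinity>"
\<comment> \<open>Where 2^-(k+1) < \<bar>z\<bar> \<le> 2^-k, the power is at most 2^((k+1) \<beta>),
  against a volume of order 2^-(k d), d being the dimension. The series is geometric with ratio
  2^(\<beta> - d). At z = 0 the integrand is 0, since \<open>0 powr c = 0\<close>.\<close>
proof (rule nn_integral_dyadic_finite[where c = "\<lambda>k. 2 powr \<beta> * (2 powr \<beta>) ^ k" and r = "\<lambda>k. (1/2) ^ k"])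
  fix z :: 'a
  show "indicator (cball 0 1) z * ennreal (norm z powr - \<beta>) \<le>
    (\<Sum>k. ennreal (2 powr \<beta> * (2 powr \<beta>) ^ k) * indicator (cball 0 ((1/2) ^ k)) z)"
  proof (cases "z = 0 \<or> norm z > 1")
    case True
    then show ?thesis by auto
  next
    case False
    then have z: "z \<noteq> 0" "norm z \<le> 1" by auto
    then obtain k where k: "2 ^ k \<le> 1 / norm z" "1 / norm z < 2 ^ Suc k"
      using dyadic_shell[of "1 / norm z"] by (auto simp: field_simps)
    have "norm z \<le> (1/2) ^ k" using k(1) z by (simp add: field_simps)
    moreover have "norm z powr - \<beta> \<le> 2 powr \<beta> * (2 powr \<beta>) ^ k"
    proof -
      have "norm z powr - \<beta> = (1 / norm z) powr \<beta>" using z by (simp add: powr_minus_divide powr_divide)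
      also have "\<dots> \<le> (2 ^ Suc k) powr \<beta>" using k(2) assms(1) z by (intro powr_mono2) auto
      also have "\<dots> = 2 powr \<beta> * (2 powr \<beta>) ^ k" by (simp add: powr_two_power del: power_Suc) simp
      finally show ?thesis .
    qed
    ultimately have "indicator (cball 0 1) z * ennreal (norm z powr - \<beta>) \<le>
        ennreal (2 powr \<beta> * (2 powr \<beta>) ^ k) * indicator (cball 0 ((1/2) ^ k)) z"
      using z by (auto intro: ennreal_leI)
    also have "\<dots> \<le> (\<Sum>k. ennreal (2 powr \<beta> * (2 powr \<beta>) ^ k) * indicator (cball 0 ((1/2) ^ k)) z)"
      by (rule ennreal_le_suminf)
    finally show ?thesis .
  qed
next
  have eq: "2 powr \<beta> * (2 powr \<beta>) ^ k * ((1/2) ^ k) ^ DIM('a) = 2 powr \<beta> * (2 powr (\<beta> - real DIM('a))) ^ k" for k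
    by (simp add: powr_diff powr_realpow power_mult_distrib[symmetric] power_divide power_mult[symmetric] mult.commute[of k])
  moreover have "2 powr (\<beta> - real DIM('a)) < 1"
    using powr_less_mono[of "\<beta> - real DIM('a)" 0 2] assms by simp
  ultimately show "summable (\<lambda>k. 2 powr \<beta> * (2 powr \<beta>) ^ k * ((1/2) ^ k) ^ DIM('a))"
    unfolding eq by (intro summable_mult summable_geometric) simp
qed auto

lemma bessel_powr_integrable:
  assumes "\<beta> > real DIM('a)"
  shows "integrable lborel (\<lambda>z :: 'a::euclidean_space. (1 + (norm z)\<^sup>2) powr (- \<beta> / 2))"
proof (rule integrableI_bounded)
  \<comment> \<open>The index is shifted: \<open>c 0\<close> belongs to the unit ball, and
    \<open>c (Suc k)\<close> to the shell from 2^k to 2^(k+1), which lies in the ball of radius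
    \<open>2 ^ Suc k\<close>.\<close>
  define c where "c k = (case k of 0 \<Rightarrow> 1 | Suc k \<Rightarrow> (2 powr - \<beta>) ^ k)" for k
  show "(\<integral>\<^sup>+z. ennreal (norm ((1 + (norm z)\<^sup>2) powr (- \<beta> / 2))) \<partial>(lborel :: 'a measure)) < \<infinity>"
  proof (rule nn_integral_dyadic_finite[where c = c and r = "\<lambda>k. 2 ^ k"])
    fix z :: 'a
    have "\<exists>k. norm z \<le> 2 ^ k \<and> (1 + (norm z)\<^sup>2) powr (- \<beta> / 2) \<le> c k"
    proof (cases "norm z \<le> 1")
      case True
      have "(1 + (norm z)\<^sup>2) powr (- \<beta> / 2) \<le> (1 + (norm z)\<^sup>2) powr 0"
        using assms by (intro powr_mono) auto
      then show ?thesis using True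
        by (intro exI[of _ 0]) (simp add: c_def add_nonneg_eq_0_iff split: if_splits)
    next
      case False
      then obtain k where k: "2 ^ k \<le> norm z" "norm z < 2 ^ Suc k" using dyadic_shell[of "norm z"] by auto
      have "(1 + (norm z)\<^sup>2) powr (- \<beta> / 2) \<le> ((norm z)\<^sup>2) powr (- \<beta> / 2)"
        using assms False by (intro powr_mono2') auto
      also have "\<dots> = norm z powr - \<beta>"
        using False by (simp add: powr_powr flip: powr_numeral)
      also have "\<dots> \<le> (2 ^ k) powr - \<beta>" using k(1) assms by (intro powr_mono2') auto
      also have "\<dots> = c (Suc k)" by (simp add: c_def powr_two_power)
      finally show ?thesis using k(2) by (intro exI[of _ "Suc k"]) auto
    qed
    then obtain k where k: "norm z \<le> 2 ^ k" "(1 + (norm z)\<^sup>2) powr (- \<beta> / 2) \<le> c k" by blast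
    then have "ennreal (norm ((1 + (norm z)\<^sup>2) powr (- \<beta> / 2))) \<le> ennreal (c k) * indicator (cball 0 (2 ^ k)) z"
      by (auto intro: ennreal_leI)
    also have "\<dots> \<le> (\<Sum>k. ennreal (c k) * indicator (cball 0 (2 ^ k)) z)" by (rule ennreal_le_suminf)
    finally show "ennreal (norm ((1 + (norm z)\<^sup>2) powr (- \<beta> / 2))) \<le> (\<Sum>k. ennreal (c k) * indicator (cball 0 (2 ^ k)) z)" .
  next
    have eq: "c (Suc k) * (2 ^ Suc k) ^ DIM('a) = 2 ^ DIM('a) * (2 powr (real DIM('a) - \<beta>)) ^ k" for k
      by (simp add: c_def powr_diff powr_minus_divide powr_realpow power_mult_distrib power_divide mult.commute flip: power_mult)
    moreover have "2 powr (real DIM('a) - \<beta>) < 1"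
      using powr_less_mono[of "real DIM('a) - \<beta>" 0 2] assms by simp
    ultimately have "summable (\<lambda>k. c (Suc k) * (2 ^ Suc k) ^ DIM('a))"
      unfolding eq by (intro summable_mult summable_geometric) simp
    then show "summable (\<lambda>k. c k * (2 ^ k) ^ DIM('a))" by (subst (asm) summable_Suc_iff)
  qed (auto simp: c_def split: nat.splits)
qed measurable

text \<open>Within distance 1 of x the kernel has an integral that is independent of x by
  translation invariance; beyond, the kernel is at most 1 and the ball has finite measure. Hence the
  bound is uniform in x.\<close>

lemma riesz_potential_bound:
  fixes \<beta> \<rho> :: real
  assumes "0 \<le> \<beta>" "\<beta> < real DIM('a)"
  obtains C where "C \<ge> 0" "\<And>x :: 'a::euclidean_space. integrable lborel (\<lambda>y. indicator (cball 0 \<rho>) y * norm (x - y) powr - \<beta>)"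
    "\<And>x :: 'a. (LINT y|lborel. indicator (cball 0 \<rho>) y * norm (x - y) powr - \<beta>) \<le> C"
proof -
  define n1 where "n1 z = indicator (cball 0 1) z * norm z powr - \<beta>" for z :: 'a
  have i1: "integrable lborel n1"
  proof (rule integrableI_bounded)
    have eq: "ennreal (norm (n1 z)) = indicator (cball 0 1) z * ennreal (norm z powr - \<beta>)" for z
      by (simp add: n1_def indicator_def)
    show "(\<integral>\<^sup>+z. ennreal (norm (n1 z)) \<partial>lborel) < \<infinity>"
      unfolding eq by (rule norm_powr_near_0_finite[OF assms])
  qed (simp add: n1_def[abs_def])
  have i2: "integrable lborel (\<lambda>y :: 'a. indicator (cball 0 \<rho>) y :: real)"
    by (intro integrable_real_indicator emeasure_bounded_finite) auto
  have it: "integrable lborel (\<lambda>y. n1 (x - y) + indicator (cball 0 \<rho>) y)" for x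
    using lborel_integrable_reflect[OF i1, of x] i2 by simp
  have le: "indicator (cball 0 \<rho>) y * norm (x - y) powr - \<beta> \<le> n1 (x - y) + indicator (cball 0 \<rho>) y" for x y :: 'a
  proof (cases "norm (x - y) \<le> 1")
    case True
    then show ?thesis by (auto simp: n1_def indicator_def)
  next
    case False
    then have "norm (x - y) powr - \<beta> \<le> norm (x - y) powr 0" using assms by (intro powr_mono) auto
    then show ?thesis using False by (auto simp: n1_def indicator_def split: if_splits)
  qed
  define C where "C = (LINT y|lborel. n1 y) + (LINT y :: 'a|lborel. indicator (cball 0 \<rho>) y)"
  have int: "integrable lborel (\<lambda>y. indicator (cball 0 \<rho>) y * norm (x - y) powr - \<beta>)" for x :: 'a
    by (rule Bochner_Integration.integrable_bound[OF it[of x]])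
       (use le[of _ x] in \<open>auto simp: abs_mult intro!: AE_I2 order_trans[OF _ abs_ge_self]\<close>)
  moreover have "(LINT y|lborel. indicator (cball 0 \<rho>) y * norm (x - y) powr - \<beta>) \<le> C" for x :: 'a
  proof -
    have "(LINT y|lborel. indicator (cball 0 \<rho>) y * norm (x - y) powr - \<beta>) \<le>
        (LINT y|lborel. n1 (x - y) + indicator (cball 0 \<rho>) y)"
      by (rule integral_mono[OF int it le])
    also have "\<dots> = (LINT y|lborel. n1 (x - y)) + (LINT y :: 'a|lborel. indicator (cball 0 \<rho>) y)"
      using lborel_integrable_reflect[OF i1, of x] i2 by simp
    also have "(LINT y|lborel. n1 (x - y)) = (LINT y|lborel. n1 y)"
      using borel_measurable_integrable[OF i1] by (intro lborel_integral_reflect) simp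
    finally show ?thesis by (simp add: C_def)
  qed
  moreover have "C \<ge> 0" unfolding C_def n1_def by (intro add_nonneg_nonneg integral_nonneg_AE) auto
  ultimately show ?thesis using that by blast
qed

section \<open>Pointwise estimates for the Newtonian kernel and its gradient\<close>

lemma powr_split_le:
  fixes s t \<alpha> :: real
  assumes "0 < s" "s \<le> t" "0 \<le> \<alpha>"
  shows "s powr c \<le> t powr \<alpha> * s powr (c - \<alpha>)"
proof -
  have "s powr c = s powr \<alpha> * s powr (c - \<alpha>)" using assms by (simp flip: powr_add)
  also have "\<dots> \<le> t powr \<alpha> * s powr (c - \<alpha>)" using assms by (intro mult_right_mono powr_mono2) auto
  finally show ?thesis .
qed

lemma powr_minus_diff_le:
  fixes s t d :: real
  assumes "0 < s" "s \<le> t" "d \<ge> 0"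
  shows "s powr - d - t powr - d \<le> d * (t - s) * s powr (- d - 1)"
proof (cases "s = t")
  case False
  then have "s < t" using assms by simp
  have "\<exists>z>s. z < t \<and> t powr - d - s powr - d = (t - s) * (- d * z powr (- d - 1))"
  proof (rule MVT2[OF \<open>s < t\<close>])
    fix x assume "s \<le> x" "x \<le> t"
    then show "((\<lambda>z. z powr - d) has_real_derivative - d * x powr (- d - 1)) (at x)"
      using has_real_derivative_powr[of x "- d"] assms by simp
  qed
  then obtain z where z: "s < z" "t powr - d - s powr - d = (t - s) * (- d * z powr (- d - 1))" by blast
  have "z powr (- d - 1) \<le> s powr (- d - 1)" using z assms by (intro powr_mono2') auto
  then have "d * (t - s) * z powr (- d - 1) \<le> d * (t - s) * s powr (- d - 1)"
    using assms by (intro mult_left_mono) auto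
  then show ?thesis using z(2) by (simp add: algebra_simps)
qed simp

text \<open>Interpolation between the size of the kernel and its Lipschitz estimate. Since \<open>0 powr c = 0\<close>, the
  kernel vanishes at its singularity.\<close>

lemma riesz_kernel_holder:
  fixes a b :: "'a::real_inner"
  assumes \<alpha>: "0 < \<alpha>" "\<alpha> < 1" and d: "d \<ge> 1"
  defines "K z \<equiv> norm z powr - d *\<^sub>R z"
  shows "norm (K a - K b) \<le> (d + 2) * norm (a - b) powr \<alpha> *
    (norm a powr (1 - d - \<alpha>) + norm b powr (1 - d - \<alpha>))"
proof -
  have nK: "norm (K z) = norm z powr (1 - d)" for z
    by (cases "z = 0") (simp_all add: K_def powr_diff powr_minus_divide)
  have main: "norm (K a - K b) \<le> (d + 2) * norm (a - b) powr \<alpha> * norm a powr (1 - d - \<alpha>)"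
    if a: "a \<noteq> 0" and ab: "norm a \<le> norm b" for a b
  proof (cases "norm (a - b) \<le> norm a")
    case False
    have "norm b powr (1 - d) \<le> norm a powr (1 - d)" using a ab d by (intro powr_mono2') auto
    then have "norm (K a - K b) \<le> 2 * norm a powr (1 - d)"
      using norm_triangle_ineq4[of "K a" "K b"] by (simp add: nK)
    also have "norm a powr (1 - d) \<le> norm (a - b) powr \<alpha> * norm a powr (1 - d - \<alpha>)"
      using False a \<alpha> by (intro powr_split_le) auto
    finally have "norm (K a - K b) \<le> 2 * (norm (a - b) powr \<alpha> * norm a powr (1 - d - \<alpha>))" by simp
    also have "\<dots> \<le> (d + 2) * (norm (a - b) powr \<alpha> * norm a powr (1 - d - \<alpha>))"
      using d by (intro mult_right_mono) auto
    finally show ?thesis by (simp add: mult.assoc)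
  next
    case True
    \<comment> \<open>Separates the change of the vector from the change of the scalar factor. The
      weight is taken at \<open>norm b\<close> in the first term and is then enlarged to
      \<open>norm a\<close>, the smaller norm.\<close>
    have "K a - K b = norm b powr - d *\<^sub>R (a - b) + (norm a powr - d - norm b powr - d) *\<^sub>R a"
      by (simp add: K_def algebra_simps)
    then have "norm (K a - K b) \<le> norm b powr - d * norm (a - b) + \<bar>norm a powr - d - norm b powr - d\<bar> * norm a"
      using norm_triangle_ineq[of "norm b powr - d *\<^sub>R (a - b)" "(norm a powr - d - norm b powr - d) *\<^sub>R a"] by simp
    also have "\<dots> \<le> norm a powr - d * norm (a - b) + d * norm (a - b) * norm a powr (- d - 1) * norm a"
    proof (intro add_mono mult_right_mono)
      show m: "norm b powr - d \<le> norm a powr - d" using a ab d by (intro powr_mono2') auto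
      have "norm a powr - d - norm b powr - d \<le> d * (norm b - norm a) * norm a powr (- d - 1)"
        using a ab d by (intro powr_minus_diff_le) auto
      also have "\<dots> \<le> d * norm (a - b) * norm a powr (- d - 1)"
        using d norm_triangle_ineq2[of b a] by (intro mult_right_mono mult_left_mono) (auto simp: norm_minus_commute)
      finally show "\<bar>norm a powr - d - norm b powr - d\<bar> \<le> d * norm (a - b) * norm a powr (- d - 1)" using m by simp
    qed auto
    also have "\<dots> = (d + 1) * (norm (a - b) * norm a powr - d)"
      using a by (simp add: powr_diff algebra_simps)
    also have "norm (a - b) * norm a powr - d \<le> norm (a - b) powr \<alpha> * norm a powr (1 - d - \<alpha>)"
    proof (cases "a = b")
      case False
      have "norm (a - b) = norm (a - b) powr \<alpha> * norm (a - b) powr (1 - \<alpha>)"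
        using False by (simp flip: powr_add)
      also have "\<dots> \<le> norm (a - b) powr \<alpha> * norm a powr (1 - \<alpha>)"
        using True \<alpha> by (intro mult_left_mono powr_mono2) auto
      finally have "norm (a - b) * norm a powr - d \<le> norm (a - b) powr \<alpha> * norm a powr (1 - \<alpha>) * norm a powr - d"
        by (rule mult_right_mono) simp
      also have "\<dots> = norm (a - b) powr \<alpha> * norm a powr (1 - d - \<alpha>)"
        by (simp add: mult.assoc algebra_simps flip: powr_add)
      finally show ?thesis .
    qed simp
    finally have "norm (K a - K b) \<le> (d + 1) * (norm (a - b) powr \<alpha> * norm a powr (1 - d - \<alpha>))"
      using d by simp
    also have "\<dots> \<le> (d + 2) * (norm (a - b) powr \<alpha> * norm a powr (1 - d - \<alpha>))"
      by (intro mult_right_mono) auto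
    finally show ?thesis by (simp add: mult.assoc)
  qed
  \<comment> \<open>For a = 0 both \<open>K a\<close> and the weight of a vanish by the convention
    \<open>0 powr c = 0\<close>, so here the term with b has to carry the bound.\<close>
  have z: "norm (K a - K b) \<le> (d + 2) * norm (a - b) powr \<alpha> * norm b powr (1 - d - \<alpha>)" if "a = 0" for a b
  proof -
    have "norm (K a - K b) = norm b powr \<alpha> * norm b powr (1 - d - \<alpha>)"
      using that nK[of b] by (cases "b = 0") (simp_all add: K_def norm_minus_commute flip: powr_add)
    also have "\<dots> \<le> (d + 2) * (norm b powr \<alpha> * norm b powr (1 - d - \<alpha>))"
      using d mult_right_mono[of 1 "d + 2" "norm b powr \<alpha> * norm b powr (1 - d - \<alpha>)"] by simp
    finally show ?thesis using that by (simp add: mult.assoc)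
  qed
  have half: "norm (K a - K b) \<le> (d + 2) * norm (a - b) powr \<alpha> *
      (norm a powr (1 - d - \<alpha>) + norm b powr (1 - d - \<alpha>))" if "norm a \<le> norm b" for a b
  proof -
    have "norm (K a - K b) \<le> (d + 2) * norm (a - b) powr \<alpha> * norm a powr (1 - d - \<alpha>) \<or>
        norm (K a - K b) \<le> (d + 2) * norm (a - b) powr \<alpha> * norm b powr (1 - d - \<alpha>)"
      using main[OF _ that] z by blast
    moreover have "(d + 2) * norm (a - b) powr \<alpha> * norm a powr (1 - d - \<alpha>) \<ge> 0"
      "(d + 2) * norm (a - b) powr \<alpha> * norm b powr (1 - d - \<alpha>) \<ge> 0" using d by auto
    ultimately show ?thesis by (auto simp: distrib_left)
  qed
  show ?thesis
  proof (cases "norm a \<le> norm b")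
    case True
    then show ?thesis by (rule half)
  next
    case False
    then show ?thesis using half[of b a] by (simp add: norm_minus_commute add.commute)
  qed
qed

lemma DERIV_norm_powr_line:
  fixes b e :: "'a::real_inner"
  assumes "b + t *\<^sub>R e \<noteq> 0"
  shows "((\<lambda>t. norm (b + t *\<^sub>R e) powr p) has_real_derivative
    p * ((norm (b + t *\<^sub>R e) powr (p - 2) *\<^sub>R (b + t *\<^sub>R e)) \<bullet> e)) (at t)"
proof -
  let ?c = "b + t *\<^sub>R e"
  have "((\<lambda>t. b + t *\<^sub>R e) has_derivative (\<lambda>s. s *\<^sub>R e)) (at t)"
    by (auto intro!: derivative_eq_intros)
  moreover have "(norm has_derivative (\<lambda>h. h \<bullet> sgn ?c)) (at ?c)"
    using GDERIV_norm[OF assms] by (simp add: gderiv_def)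
  ultimately have "((\<lambda>t. norm (b + t *\<^sub>R e)) has_derivative (\<lambda>s. (s *\<^sub>R e) \<bullet> sgn ?c)) (at t)"
    by (rule has_derivative_compose)
  then have 1: "((\<lambda>t. norm (b + t *\<^sub>R e)) has_real_derivative e \<bullet> sgn ?c) (at t)"
    by (rule has_derivative_imp_has_field_derivative) simp
  have 2: "((\<lambda>s. s powr p) has_real_derivative p * norm ?c powr (p - 1)) (at (norm ?c))"
    using assms by (intro has_real_derivative_powr) simp
  have "p * norm ?c powr (p - 1) * (e \<bullet> sgn ?c) = p * ((norm ?c powr (p - 2) *\<^sub>R ?c) \<bullet> e)"
  proof -
    have "norm ?c powr (p - 1) = norm ?c powr (p - 2) * norm ?c"
      using assms powr_add[of "norm ?c" "p - 2" 1] by simp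
    then show ?thesis using assms by (simp add: sgn_div_norm inner_commute divide_simps)
  qed
  with DERIV_chain2[OF 2 1] show ?thesis by simp
qed

text \<open>If b is nonzero and \<bar>a - b\<bar> \<le> \<bar>b\<bar> / 2, the segment between them
  avoids the singularity, and the mean value theorem with the Hoelder bound for the gradient
  applies. Otherwise \<bar>a\<bar> and \<bar>b\<bar> are bounded by multiples of \<bar>a - b\<bar>,
  and each of the three terms is small by itself. The weights have exponent above minus the
  dimension for \<alpha> < 1, so that they can be integrated.\<close>

lemma newton_kernel_taylor:
  fixes \<alpha> d :: real
  assumes \<alpha>: "0 < \<alpha>" "\<alpha> < 1" and d: "d \<ge> 3"
  obtains C where "C \<ge> 0" "\<And>a b :: 'a::real_inner.
    \<bar>norm a powr (2 - d) - norm b powr (2 - d) - (2 - d) * ((norm b powr - d *\<^sub>R b) \<bullet> (a - b))\<bar> \<le>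
    C * norm (a - b) powr (1 + \<alpha>) * (norm a powr (1 - d - \<alpha>) + norm b powr (1 - d - \<alpha>))"
proof -
  define K where "K z = norm z powr - d *\<^sub>R z" for z :: 'a
  define N where "N z = norm z powr (2 - d)" for z :: 'a
  \<comment> \<open>\<open>h\<close> is the factor by which the weight can grow from b to a point of
    norm at least \<bar>b\<bar> / 2. The first summand of \<open>C\<close> covers the near case; 9 =
    3^2, 4 = 2^2 and the last summand cover the kernel at a, the kernel at b and the linear term in
    the far case.\<close>
  define h where "h = 2 powr (d + \<alpha> - 1)"
  define C where "C = (d - 2) * (d + 2) * (h + 1) + 9 + 4 + (d - 2) * 2 powr \<alpha>"
  have h0: "h \<ge> 0" by (simp add: h_def)
  have C0: "C \<ge> 0" using d h0 unfolding C_def by (intro add_nonneg_nonneg mult_nonneg_nonneg) auto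
  have nK: "norm (K z) = norm z powr (1 - d)" for z
    by (cases "z = 0") (simp_all add: K_def powr_diff powr_minus_divide)
  have "\<bar>N a - N b - (2 - d) * (K b \<bullet> (a - b))\<bar> \<le>
    C * norm (a - b) powr (1 + \<alpha>) * (norm a powr (1 - d - \<alpha>) + norm b powr (1 - d - \<alpha>))"
    (is "_ \<le> C * ?r * (?A + ?B)") for a b :: 'a
  proof (cases "b \<noteq> 0 \<and> norm (a - b) \<le> norm b / 2")
    case True
    define c where "c t = b + t *\<^sub>R (a - b)" for t :: real
    have cb: "norm (c t - b) \<le> norm (a - b)" "norm (c t) \<ge> norm b / 2" "c t \<noteq> 0" if "0 \<le> t" "t \<le> 1" for t
    proof -
      show 1: "norm (c t - b) \<le> norm (a - b)" using that by (simp add: c_def mult_left_le_one_le)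
      then show 2: "norm (c t) \<ge> norm b / 2"
        using True norm_triangle_ineq2[of b "c t"] by (simp add: norm_minus_commute)
      show "c t \<noteq> 0" using 2 True by auto
    qed
    have "\<exists>t>0. t < 1 \<and> N (c 1) - N (c 0) = (1 - 0) * ((2 - d) * (K (c t) \<bullet> (a - b)))"
    proof (rule MVT2)
      fix t :: real assume "0 \<le> t" "t \<le> 1"
      then show "((\<lambda>t. N (c t)) has_real_derivative (2 - d) * (K (c t) \<bullet> (a - b))) (at t)"
        using DERIV_norm_powr_line[of b t "a - b" "2 - d"] cb(3)[of t] by (simp add: N_def K_def c_def)
    qed simp
    then obtain t where t: "0 < t" "t < 1" "N a - N b = (2 - d) * (K (c t) \<bullet> (a - b))"
      by (auto simp: c_def)
    have "\<bar>N a - N b - (2 - d) * (K b \<bullet> (a - b))\<bar> = (d - 2) * \<bar>(K (c t) - K b) \<bullet> (a - b)\<bar>"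
    proof -
      have "N a - N b - (2 - d) * (K b \<bullet> (a - b)) = (2 - d) * ((K (c t) - K b) \<bullet> (a - b))"
        using t(3) by (simp add: inner_diff_left algebra_simps)
      then show ?thesis using d by (simp add: abs_mult)
    qed
    also have "\<dots> \<le> (d - 2) * (norm (K (c t) - K b) * norm (a - b))"
      using d by (intro mult_left_mono Cauchy_Schwarz_ineq2) auto
    also have "\<dots> \<le> (d - 2) * (((d + 2) * norm (a - b) powr \<alpha> * ((h + 1) * ?B)) * norm (a - b))"
    proof (intro mult_left_mono mult_right_mono)
      have "norm (K (c t) - K b) \<le> (d + 2) * norm (c t - b) powr \<alpha> * (norm (c t) powr (1 - d - \<alpha>) + ?B)"
        unfolding K_def using \<alpha> d by (intro riesz_kernel_holder) auto
      also have "\<dots> \<le> (d + 2) * norm (a - b) powr \<alpha> * ((h + 1) * ?B)"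
      proof (intro mult_mono)
        show "norm (c t - b) powr \<alpha> \<le> norm (a - b) powr \<alpha>"
          using cb(1)[of t] t \<alpha> by (intro powr_mono2) auto
        have "norm (c t) powr (1 - d - \<alpha>) \<le> (norm b / 2) powr (1 - d - \<alpha>)"
          using cb(2)[of t] t \<alpha> d True by (intro powr_mono2') auto
        also have "\<dots> = h * ?B"
          using True by (simp add: powr_divide h_def powr_diff powr_add powr_minus_divide field_simps)
        finally show "norm (c t) powr (1 - d - \<alpha>) + ?B \<le> (h + 1) * ?B" by (simp add: algebra_simps)
      qed (use d h0 in auto)
      finally show "norm (K (c t) - K b) \<le> (d + 2) * norm (a - b) powr \<alpha> * ((h + 1) * ?B)" .
    qed (use d in auto)
    also have "\<dots> = ((d - 2) * (d + 2) * (h + 1)) * (norm (a - b) powr \<alpha> * norm (a - b)) * ?B" by (simp add: mult_ac)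
    also have "norm (a - b) powr \<alpha> * norm (a - b) = ?r" by (cases "a = b") (simp_all add: powr_add)
    also have "((d - 2) * (d + 2) * (h + 1)) * ?r * ?B \<le> C * ?r * (?A + ?B)"
      using d h0 by (intro mult_mono) (auto simp: C_def intro!: add_nonneg_nonneg mult_nonneg_nonneg)
    finally show ?thesis .
  next
    case False
    then have far: "norm b \<le> 2 * norm (a - b)" by (auto simp: field_simps)
    have a3: "norm a \<le> 3 * norm (a - b)" using far norm_triangle_ineq2[of a b] by linarith
    \<comment> \<open>Part of the power is exchanged for \<bar>a - b\<bar> to the power 1 +
      \<alpha>; the factor k to the power 1 + \<alpha> is at most k^2 because \<alpha> < 1.\<close>
    have split: "norm z powr (2 - d) \<le> c * ?r * norm z powr (1 - d - \<alpha>)"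
      if z: "norm z \<le> k * norm (a - b)" and k: "k \<ge> 1" "k\<^sup>2 \<le> c" for z :: 'a and k c
    proof (cases "z = 0")
      case False
      have e: "2 - d - (1 + \<alpha>) = 1 - d - \<alpha>" by simp
      have "norm z powr (2 - d) \<le> (k * norm (a - b)) powr (1 + \<alpha>) * norm z powr (1 - d - \<alpha>)"
        unfolding e[symmetric] using False z \<alpha> by (intro powr_split_le) auto
      also have "(k * norm (a - b)) powr (1 + \<alpha>) \<le> c * ?r"
      proof -
        have "(k * norm (a - b)) powr (1 + \<alpha>) = k powr (1 + \<alpha>) * ?r" using k by (simp add: powr_mult)
        also have "k powr (1 + \<alpha>) \<le> k powr 2" using k \<alpha> by (intro powr_mono) auto
        also have "k powr 2 \<le> c" using k by simp
        finally show ?thesis by (simp add: mult_right_mono)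
      qed
      finally show ?thesis by (simp add: mult_right_mono)
    qed (use k in \<open>auto intro!: mult_nonneg_nonneg order_trans[OF zero_le_power2]\<close>)
    have "\<bar>N a\<bar> \<le> 9 * ?r * ?A" unfolding N_def using split[OF a3, of 9] by simp
    moreover have "\<bar>N b\<bar> \<le> 4 * ?r * ?B" unfolding N_def using split[OF far, of 4] by simp
    moreover have "\<bar>(2 - d) * (K b \<bullet> (a - b))\<bar> \<le> ((d - 2) * 2 powr \<alpha>) * ?r * ?B"
    proof (cases "b = 0")
      case True
      then show ?thesis using d by (auto simp: K_def)
    next
      case False
      then have ab: "norm (a - b) > 0" using far by auto
      have "\<bar>(2 - d) * (K b \<bullet> (a - b))\<bar> \<le> (d - 2) * (norm b powr (1 - d) * norm (a - b))"
        using d Cauchy_Schwarz_ineq2[of "K b" "a - b"] by (simp add: abs_mult nK mult_left_mono)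
      also have "norm b powr (1 - d) \<le> (2 * norm (a - b)) powr \<alpha> * norm b powr (1 - d - \<alpha>)"
        using False far \<alpha> by (intro powr_split_le) auto
      also have "(2 * norm (a - b)) powr \<alpha> = 2 powr \<alpha> * norm (a - b) powr \<alpha>" by (simp add: powr_mult)
      finally have "\<bar>(2 - d) * (K b \<bullet> (a - b))\<bar> \<le>
          (d - 2) * (2 powr \<alpha> * norm (a - b) powr \<alpha> * ?B * norm (a - b))" using d by (simp add: mult_left_mono mult_right_mono)
      also have "\<dots> = ((d - 2) * 2 powr \<alpha>) * ?r * ?B" using ab by (simp add: powr_add mult_ac)
      finally show ?thesis .
    qed
    moreover have "9 * ?r * ?A \<le> 9 * ?r * (?A + ?B)" "4 * ?r * ?B \<le> 4 * ?r * (?A + ?B)"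
      by (auto intro!: mult_left_mono)
    moreover have "((d - 2) * 2 powr \<alpha>) * ?r * ?B \<le> ((d - 2) * 2 powr \<alpha>) * ?r * (?A + ?B)"
      using d by (intro mult_left_mono) auto
    moreover have "9 * ?r * (?A + ?B) + 4 * ?r * (?A + ?B) + ((d - 2) * 2 powr \<alpha>) * ?r * (?A + ?B) \<le> C * ?r * (?A + ?B)"
    proof -
      have "9 * ?r * (?A + ?B) + 4 * ?r * (?A + ?B) + ((d - 2) * 2 powr \<alpha>) * ?r * (?A + ?B) =
          (9 + 4 + (d - 2) * 2 powr \<alpha>) * ?r * (?A + ?B)" by (simp add: algebra_simps)
      also have "\<dots> \<le> C * ?r * (?A + ?B)"
        using d h0 by (intro mult_right_mono) (auto simp: C_def)
      finally show ?thesis .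
    qed
    ultimately show ?thesis by linarith
  qed
  with C0 that[of C] show ?thesis unfolding N_def K_def by blast
qed

section \<open>The Newtonian potential of a bounded density with bounded support\<close>

locale newton_density =
  fixes f :: "real ^ 'n \<Rightarrow> real" and M \<rho> d :: real
  assumes dim: "d = real CARD('n)" "d \<ge> 3" and f_borel [measurable]: "f \<in> borel_measurable borel"
    and f_bound: "\<And>y. \<bar>f y\<bar> \<le> M" and f_support: "\<And>y. norm y > \<rho> \<Longrightarrow> f y = 0"
begin

definition newton :: "real ^ 'n \<Rightarrow> real" where
  "newton x = (LINT y|lborel. f y * norm (x - y) powr (2 - d))"

definition newton_field :: "real ^ 'n \<Rightarrow> real ^ 'n" where
  "newton_field x = (LINT y|lborel. f y *\<^sub>R (norm (x - y) powr - d *\<^sub>R (x - y)))"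

lemma M_nonneg: "M \<ge> 0"
  using order_trans[OF abs_ge_zero f_bound] .

lemma f_le: "\<bar>f y\<bar> \<le> M * indicator (cball 0 \<rho>) y"
  using f_bound[of y] f_support[of y] by (auto simp: indicator_def not_le)

lemma dominated:
  fixes F :: "real ^ 'n \<Rightarrow> real ^ 'n \<Rightarrow> 'b::euclidean_space"
  assumes \<beta>: "0 \<le> \<beta>" "\<beta> < d" and [measurable]: "\<And>x. F x \<in> borel_measurable borel"
    and F: "\<And>x y. norm (F x y) \<le> norm (x - y) powr - \<beta>"
  shows "integrable lborel (\<lambda>y. f y *\<^sub>R F x y)"
proof -
  obtain C where "\<And>x :: real ^ 'n. integrable lborel (\<lambda>y. indicator (cball 0 \<rho>) y * norm (x - y) powr - \<beta>)"
  proof -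
    have "\<beta> < real DIM(real ^ 'n)" using \<beta> dim by simp
    from \<beta>(1) this show thesis by (rule riesz_potential_bound[where \<rho> = \<rho>]) (blast intro: that)
  qed
  then have "integrable lborel (\<lambda>y. M * (indicator (cball 0 \<rho>) y * norm (x - y) powr - \<beta>))"
    by simp
  then show ?thesis
  proof (rule Bochner_Integration.integrable_bound)
    show "AE y in lborel. norm (f y *\<^sub>R F x y) \<le> norm (M * (indicator (cball 0 \<rho>) y * norm (x - y) powr - \<beta>))"
      using mult_mono[OF f_le F] M_nonneg by (intro AE_I2) (auto simp: abs_mult mult_ac)
  qed simp
qed

lemma newton_integrable: "integrable lborel (\<lambda>y. f y * norm (x - y) powr (2 - d))"
  using dominated[of "d - 2" "\<lambda>x y. norm (x - y) powr (2 - d)" x] dim by simp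

lemma field_integrable: "integrable lborel (\<lambda>y. f y *\<^sub>R (norm (x - y) powr - d *\<^sub>R (x - y)))"
proof (rule dominated[of "d - 1"])
  show "norm (norm (x - y) powr - d *\<^sub>R (x - y)) \<le> norm (x - y) powr - (d - 1)" for x y :: "real ^ 'n"
    by (cases "x = y") (simp_all add: powr_diff powr_minus_divide)
qed (use dim in auto)

text \<open>The step from kernel estimates to potentials: the weights have a locally integrable
  singularity since d - 1 + \<alpha> < d, with a bound uniform in the two base points. It is applied
  to the difference of the field at two points and to the Taylor remainder.\<close>

lemma holder_integral:
  assumes \<alpha>: "0 < \<alpha>" "\<alpha> < 1"
  obtains C where "C \<ge> 0"
    "\<And>(F :: real ^ 'n \<Rightarrow> 'b::euclidean_space) x x' c. integrable lborel (\<lambda>y. f y *\<^sub>R F y) \<Longrightarrow> c \<ge> 0 \<Longrightarrow>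
      (\<And>y. norm (F y) \<le> c * (norm (x - y) powr (1 - d - \<alpha>) + norm (x' - y) powr (1 - d - \<alpha>))) \<Longrightarrow>
      norm (LINT y|lborel. f y *\<^sub>R F y) \<le> c * C"
proof -
  obtain C where C: "C \<ge> 0" "\<And>x :: real ^ 'n. integrable lborel (\<lambda>y. indicator (cball 0 \<rho>) y * norm (x - y) powr - (d - 1 + \<alpha>))"
    "\<And>x :: real ^ 'n. (LINT y|lborel. indicator (cball 0 \<rho>) y * norm (x - y) powr - (d - 1 + \<alpha>)) \<le> C"
  proof -
    have "0 \<le> d - 1 + \<alpha>" "d - 1 + \<alpha> < real DIM(real ^ 'n)" using \<alpha> dim by simp_all
    then show thesis by (rule riesz_potential_bound[where \<rho> = \<rho>]) (blast intro: that)
  qed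
  have e: "- (d - 1 + \<alpha>) = 1 - d - \<alpha>" by simp
  note C = C[unfolded e]
  have *: "norm (LINT y|lborel. f y *\<^sub>R F y) \<le> c * (M * (2 * C))"
    if F: "integrable lborel (\<lambda>y. f y *\<^sub>R F y)" "c \<ge> 0"
      "\<And>y. norm (F y) \<le> c * (norm (x - y) powr (1 - d - \<alpha>) + norm (x' - y) powr (1 - d - \<alpha>))"
    for F :: "real ^ 'n \<Rightarrow> 'b" and x x' c
  proof -
    let ?i = "indicator (cball 0 \<rho>) :: real ^ 'n \<Rightarrow> real"
    have "norm (LINT y|lborel. f y *\<^sub>R F y) \<le> (LINT y|lborel. norm (f y *\<^sub>R F y))"
      by (rule integral_norm_bound)
    also have "\<dots> \<le> (LINT y|lborel. c * M * (?i y * norm (x - y) powr (1 - d - \<alpha>)) +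
        c * M * (?i y * norm (x' - y) powr (1 - d - \<alpha>)))"
    proof (rule integral_mono)
      fix y
      have "norm (f y *\<^sub>R F y) \<le> (M * ?i y) * (c * (norm (x - y) powr (1 - d - \<alpha>) + norm (x' - y) powr (1 - d - \<alpha>)))"
        using mult_mono[OF f_le F(3)] M_nonneg by simp
      then show "norm (f y *\<^sub>R F y) \<le> c * M * (?i y * norm (x - y) powr (1 - d - \<alpha>)) +
        c * M * (?i y * norm (x' - y) powr (1 - d - \<alpha>))" by (simp add: algebra_simps)
    qed (use integrable_norm[OF F(1)] C(2) in auto)
    also have "\<dots> = c * M * (LINT y|lborel. ?i y * norm (x - y) powr (1 - d - \<alpha>)) +
        c * M * (LINT y|lborel. ?i y * norm (x' - y) powr (1 - d - \<alpha>))"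
      using C(2) by simp
    also have "\<dots> \<le> c * M * C + c * M * C"
      using C(3) F(2) M_nonneg by (intro add_mono mult_left_mono) auto
    finally show ?thesis by (simp add: algebra_simps)
  qed
  show ?thesis
  proof (rule that[of "M * (2 * C)"])
    show "M * (2 * C) \<ge> 0" using C(1) M_nonneg by simp
  qed (rule *)
qed

lemma newton_field_holder:
  assumes "0 < \<alpha>" "\<alpha> < 1"
  obtains C where "C \<ge> 0" "\<And>x x'. norm (newton_field x - newton_field x') \<le> C * norm (x - x') powr \<alpha>"
proof -
  obtain C where C: "C \<ge> 0" "\<And>(F :: real ^ 'n \<Rightarrow> real ^ 'n) x x' c. integrable lborel (\<lambda>y. f y *\<^sub>R F y) \<Longrightarrow> c \<ge> 0 \<Longrightarrow>
      (\<And>y. norm (F y) \<le> c * (norm (x - y) powr (1 - d - \<alpha>) + norm (x' - y) powr (1 - d - \<alpha>))) \<Longrightarrow>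
      norm (LINT y|lborel. f y *\<^sub>R F y) \<le> c * C"
    using holder_integral[OF assms, where 'b = "real ^ 'n"] by blast
  have "norm (newton_field x - newton_field x') \<le> ((d + 2) * C) * norm (x - x') powr \<alpha>" for x x'
  proof -
    let ?F = "\<lambda>y. norm (x - y) powr - d *\<^sub>R (x - y) - norm (x' - y) powr - d *\<^sub>R (x' - y)"
    have eq: "newton_field x - newton_field x' = (LINT y|lborel. f y *\<^sub>R ?F y)"
      using field_integrable[of x] field_integrable[of x'] by (simp add: newton_field_def scaleR_right_diff_distrib)
    have "norm (LINT y|lborel. f y *\<^sub>R ?F y) \<le> ((d + 2) * norm (x - x') powr \<alpha>) * C"
    proof (rule C(2))
      show "integrable lborel (\<lambda>y. f y *\<^sub>R ?F y)"
        using field_integrable[of x] field_integrable[of x'] by (simp add: scaleR_right_diff_distrib)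
      show "norm (?F y) \<le> (d + 2) * norm (x - x') powr \<alpha> * (norm (x - y) powr (1 - d - \<alpha>) + norm (x' - y) powr (1 - d - \<alpha>))" for y
        using riesz_kernel_holder[OF assms, of d "x - y" "x' - y"] dim by simp
    qed (use dim in auto)
    then show ?thesis unfolding eq by (simp add: mult_ac)
  qed
  then show ?thesis using that[of "(d + 2) * C"] C(1) dim(2) by simp
qed

text \<open>The kernel remainder of order 1 + \<alpha> integrates to a remainder of the same order,
  which is o(\<bar>h\<bar>) for any \<alpha> > 0; the value 1/2 is a convenient choice in (0,
  1).\<close>

lemma newton_GDERIV: "GDERIV newton x :> (2 - d) *\<^sub>R newton_field x"
proof -
  obtain C where C: "C \<ge> 0" "\<And>(F :: real ^ 'n \<Rightarrow> real) x x' c. integrable lborel (\<lambda>y. f y *\<^sub>R F y) \<Longrightarrow> c \<ge> 0 \<Longrightarrow>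
      (\<And>y. norm (F y) \<le> c * (norm (x - y) powr (1 - d - 1/2) + norm (x' - y) powr (1 - d - 1/2))) \<Longrightarrow>
      norm (LINT y|lborel. f y *\<^sub>R F y) \<le> c * C"
    using holder_integral[of "1/2", where 'b = real] by auto
  obtain A where A: "A \<ge> 0" "\<And>a b :: real ^ 'n.
    \<bar>norm a powr (2 - d) - norm b powr (2 - d) - (2 - d) * ((norm b powr - d *\<^sub>R b) \<bullet> (a - b))\<bar> \<le>
    A * norm (a - b) powr (1 + 1/2) * (norm a powr (1 - d - 1/2) + norm b powr (1 - d - 1/2))"
    using newton_kernel_taylor[of "1/2" d] dim by auto
  have bound: "\<bar>newton (x + h) - newton x - h \<bullet> ((2 - d) *\<^sub>R newton_field x)\<bar> \<le> A * C * norm h powr (1 + 1/2)" for h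
  proof -
    let ?F = "\<lambda>y. norm (x + h - y) powr (2 - d) - norm (x - y) powr (2 - d) -
      (2 - d) * ((norm (x - y) powr - d *\<^sub>R (x - y)) \<bullet> h)"
    have ii: "integrable lborel (\<lambda>y. (f y *\<^sub>R (norm (x - y) powr - d *\<^sub>R (x - y))) \<bullet> h)"
      using field_integrable[of x] by (intro integrable_inner_left) auto
    have fF: "f y *\<^sub>R ?F y = f y * norm (x + h - y) powr (2 - d) - f y * norm (x - y) powr (2 - d) -
        (2 - d) * ((f y *\<^sub>R (norm (x - y) powr - d *\<^sub>R (x - y))) \<bullet> h)" for y
      by (simp add: algebra_simps)
    have int: "integrable lborel (\<lambda>y. f y *\<^sub>R ?F y)"
      unfolding fF using newton_integrable[of "x + h"] newton_integrable[of x] ii by simp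
    have "(LINT y|lborel. f y *\<^sub>R ?F y) = newton (x + h) - newton x -
        (2 - d) * (LINT y|lborel. (f y *\<^sub>R (norm (x - y) powr - d *\<^sub>R (x - y))) \<bullet> h)"
      unfolding fF newton_def using newton_integrable[of "x + h"] newton_integrable[of x] ii
      by (subst Bochner_Integration.integral_diff | simp)+
    also have "(LINT y|lborel. (f y *\<^sub>R (norm (x - y) powr - d *\<^sub>R (x - y))) \<bullet> h) = newton_field x \<bullet> h"
      unfolding newton_field_def using field_integrable[of x] by (intro integral_inner_left) auto
    finally have eq: "(LINT y|lborel. f y *\<^sub>R ?F y) = newton (x + h) - newton x - h \<bullet> ((2 - d) *\<^sub>R newton_field x)"
      by (simp add: inner_commute)
    have "norm (LINT y|lborel. f y *\<^sub>R ?F y) \<le> (A * norm h powr (1 + 1/2)) * C"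
    proof (rule C(2)[where x = "x + h" and x' = x])
      show "norm (?F y) \<le> A * norm h powr (1 + 1/2) * (norm (x + h - y) powr (1 - d - 1/2) + norm (x - y) powr (1 - d - 1/2))" for y
        using A(2)[of "x + h - y" "x - y"] by (simp add: algebra_simps)
    qed (use int A(1) in auto)
    then show ?thesis unfolding eq by (simp add: mult_ac)
  qed
  show ?thesis
    unfolding GDERIV_has_derivative has_derivative_at
  proof (intro conjI)
    show "bounded_linear (\<lambda>h. h \<bullet> ((2 - d) *\<^sub>R newton_field x))" by (rule bounded_linear_inner_left)
    show "((\<lambda>h. norm (newton (x + h) - newton x - h \<bullet> ((2 - d) *\<^sub>R newton_field x)) / norm h) \<longlongrightarrow> 0) (at 0)"
    proof (rule Lim_null_comparison)
      show "eventually (\<lambda>h. norm (norm (newton (x + h) - newton x - h \<bullet> ((2 - d) *\<^sub>R newton_field x)) / norm h) \<le>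
          A * C * norm h powr (1/2)) (at 0)"
      proof (rule eventually_at_topological[THEN iffD2], intro exI[of _ UNIV] conjI ballI impI)
        fix h :: "real ^ 'n" assume "h \<noteq> 0"
        then have "A * C * norm h powr (1 + 1/2) / norm h = A * C * norm h powr (1/2)"
          using powr_add[of "norm h" 1 "1/2"] by simp
        then show "norm (norm (newton (x + h) - newton x - h \<bullet> ((2 - d) *\<^sub>R newton_field x)) / norm h) \<le>
          A * C * norm h powr (1/2)"
          using divide_right_mono[OF bound[of h] norm_ge_zero[of h]] by simp
      qed auto
      have "((\<lambda>h :: real ^ 'n. A * C * norm h powr (1/2)) \<longlongrightarrow> A * C * 0 powr (1/2)) (at 0)"
        by (intro tendsto_intros tendsto_powr' tendsto_norm_zero) auto
      then show "((\<lambda>h :: real ^ 'n. A * C * norm h powr (1/2)) \<longlongrightarrow> 0) (at 0)" by simp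
    qed
  qed
qed

lemma newton_C1_holder:
  assumes "0 < \<alpha>" "\<alpha> < 1"
  shows "C1_holder \<alpha> (\<lambda>x. c * newton x)"
proof -
  let ?g = "\<lambda>x. (c * (2 - d)) *\<^sub>R newton_field x"
  have "GDERIV (\<lambda>x. c * newton x) x :> ?g x" for x
    using GDERIV_mult[OF GDERIV_const[of c x] newton_GDERIV[of x]] by simp
  moreover obtain C where C: "C \<ge> 0" "\<And>x x'. norm (newton_field x - newton_field x') \<le> C * norm (x - x') powr \<alpha>"
    using newton_field_holder[OF assms] by blast
  have g: "norm (?g x - ?g x') \<le> (\<bar>c * (2 - d)\<bar> * C) * dist x x' powr \<alpha>" for x x'
    using mult_left_mono[OF C(2)[of x x'], of "\<bar>c * (2 - d)\<bar>"]
    by (simp add: dist_norm mult.assoc flip: scaleR_right_diff_distrib)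
  have "continuous_on UNIV ?g"
    unfolding continuous_on_def
  proof
    fix x
    have "((\<lambda>x'. ?g x' - ?g x) \<longlongrightarrow> 0) (at x)"
    proof (rule Lim_null_comparison)
      show "eventually (\<lambda>x'. norm (?g x' - ?g x) \<le> (\<bar>c * (2 - d)\<bar> * C) * dist x' x powr \<alpha>) (at x)"
        using g by simp
      have "((\<lambda>x'. (\<bar>c * (2 - d)\<bar> * C) * dist x' x powr \<alpha>) \<longlongrightarrow> (\<bar>c * (2 - d)\<bar> * C) * (dist x x) powr \<alpha>) (at x)"
        using assms by (intro tendsto_intros tendsto_powr') auto
      then show "((\<lambda>x'. (\<bar>c * (2 - d)\<bar> * C) * dist x' x powr \<alpha>) \<longlongrightarrow> 0) (at x)" by simp
    qed
    then show "(?g \<longlongrightarrow> ?g x) (at x within UNIV)" by (rule LIM_zero_cancel)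
  qed
  moreover have "\<bar>?g x $ i - ?g y $ i\<bar> \<le> (\<bar>c * (2 - d)\<bar> * C) * dist x y powr \<alpha>" for i x y
    using order_trans[OF component_le_norm_cart[of "?g x - ?g y" i] g[of x y]] by simp
  ultimately show ?thesis
    unfolding C1_holder_def
    by (intro exI[of _ ?g] conjI allI exI[of _ "\<bar>c * (2 - d)\<bar> * C"]) blast+
qed

lemma newton_continuous: "continuous_on UNIV newton"
  using newton_GDERIV unfolding GDERIV_has_derivative
  by (intro continuous_at_imp_continuous_on ballI) (rule has_derivative_continuous)

end

section \<open>Bubbles\<close>

definition grad :: "(real ^ 'n \<Rightarrow> real) \<Rightarrow> real ^ 'n \<Rightarrow> real ^ 'n" where
  "grad w x = (\<chi> i. pd i w x)"

definition lap :: "(real ^ 'n \<Rightarrow> real) \<Rightarrow> real ^ 'n \<Rightarrow> real" where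
  "lap w x = (\<Sum>i\<in>UNIV. pd i (pd i w) x)"

lemma wgrad_grad: "smooth_on UNIV w \<Longrightarrow> wgrad w (grad w)"
  using wgrad_smooth unfolding grad_def[abs_def] .

text \<open>Where \<bar>g\<bar> \<le> a the mean is at most of order a. The remaining set has finite
  measure and g is bounded on it, so its contribution stays bounded and is killed by the
  normalization.\<close>

lemma mean_tendsto_0:
  fixes g :: "'a::euclidean_space \<Rightarrow> real"
  assumes [measurable]: "g \<in> borel_measurable borel" and B: "\<And>x. \<bar>g x\<bar> \<le> B"
    and lev: "\<And>a. a > 0 \<Longrightarrow> emeasure lborel {x. \<bar>g x\<bar> > a} < \<infinity>"
  shows "(\<lambda>n. (1 / real (Suc n)) ^ DIM('a) * (LINT x|lborel. indicator (cball 0 (2 * real (Suc n))) x * \<bar>g x\<bar>)) \<longlonglongrightarrow> 0"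
proof (rule LIMSEQ_I)
  fix e :: real assume "e > 0"
  let ?I = "\<lambda>n. LINT x|lborel. indicator (cball 0 (2 * real (Suc n))) x * \<bar>g x\<bar>"
  have B0: "B \<ge> 0" using order_trans[OF abs_ge_zero B] .
  define v where "v = unit_ball_vol (real DIM('a))"
  have v: "v > 0" by (simp add: v_def)
  \<comment> \<open>Chosen such that a times the normalized volume of the ball of radius 2 (n + 1)
    is exactly e / 2.\<close>
  define a where "a = e / (2 * (2 ^ DIM('a) * v))"
  have a: "a > 0" using \<open>e > 0\<close> v by (simp add: a_def)
  define m where "m = measure lborel {x. \<bar>g x\<bar> > a}"
  have il: "integrable lborel (\<lambda>x. indicator {x. \<bar>g x\<bar> > a} x :: real)"
    using lev[OF a] by (intro integrable_real_indicator) auto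
  have ic: "integrable lborel (\<lambda>x. indicator (cball 0 (2 * real (Suc n))) x :: real)" for n
    by (intro integrable_real_indicator emeasure_bounded_finite) auto
  have ig: "integrable lborel (\<lambda>x. indicator (cball 0 (2 * real (Suc n))) x * \<bar>g x\<bar>)" for n
    by (rule integrable_bounded_support[of _ B "2 * real (Suc n)"]) (use B B0 in \<open>auto simp: indicator_def\<close>)
  have bound: "?I n \<le> a * (v * (2 * real (Suc n)) ^ DIM('a)) + B * m" for n
  proof -
    have "?I n \<le> (LINT x|lborel. a * indicator (cball 0 (2 * real (Suc n))) x + B * indicator {x. \<bar>g x\<bar> > a} x)"
    proof (rule integral_mono[OF ig])
      show "integrable lborel (\<lambda>x. a * indicator (cball 0 (2 * real (Suc n))) x + B * indicator {x. \<bar>g x\<bar> > a} x)"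
        by (intro Bochner_Integration.integrable_add integrable_mult_right il ic)
      show "indicator (cball 0 (2 * real (Suc n))) x * \<bar>g x\<bar> \<le>
        a * indicator (cball 0 (2 * real (Suc n))) x + B * indicator {x. \<bar>g x\<bar> > a} x" for x
        using B[of x] a B0 by (auto simp: indicator_def intro: add_increasing)
    qed
    also have "\<dots> = (LINT x|lborel. a * indicator (cball (0 :: 'a) (2 * real (Suc n))) x) +
        (LINT x|lborel. B * indicator {x. \<bar>g x\<bar> > a} x)"
      by (intro Bochner_Integration.integral_add integrable_mult_right il ic)
    also have "\<dots> = a * measure lborel (cball (0 :: 'a) (2 * real (Suc n))) + B * m"
      by (simp add: m_def)
    also have "measure lborel (cball (0 :: 'a) (2 * real (Suc n))) = v * (2 * real (Suc n)) ^ DIM('a)"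
      by (simp add: content_cball v_def)
    finally show ?thesis .
  qed
  have "(\<lambda>n. B * m * (1 / real (Suc n)) ^ DIM('a)) \<longlonglongrightarrow> B * m * 0 ^ DIM('a)"
    by (intro tendsto_intros LIMSEQ_Suc[OF lim_const_over_n])
  then have "(\<lambda>n. B * m * (1 / real (Suc n)) ^ DIM('a)) \<longlonglongrightarrow> 0"
    by (simp only: zero_power[OF DIM_positive] mult_zero_right)
  from LIMSEQ_D[OF this, of "e / 2"] \<open>e > 0\<close> obtain N where
    N: "\<And>n. n \<ge> N \<Longrightarrow> \<bar>B * m * (1 / real (Suc n)) ^ DIM('a)\<bar> < e / 2" by auto
  show "\<exists>N. \<forall>n\<ge>N. norm ((1 / real (Suc n)) ^ DIM('a) * ?I n - 0) < e"
  proof (intro exI[of _ N] allI impI)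
    fix n assume "n \<ge> N"
    have "?I n \<ge> 0" by (intro integral_nonneg_AE) auto
    then have "norm ((1 / real (Suc n)) ^ DIM('a) * ?I n - 0) = (1 / real (Suc n)) ^ DIM('a) * ?I n" by simp
    also have "\<dots> \<le> (1 / real (Suc n)) ^ DIM('a) * (a * (v * (2 * real (Suc n)) ^ DIM('a)) + B * m)"
      by (intro mult_left_mono bound) auto
    also have "\<dots> = a * (v * 2 ^ DIM('a)) * ((1 / real (Suc n)) ^ DIM('a) * real (Suc n) ^ DIM('a)) +
        B * m * (1 / real (Suc n)) ^ DIM('a)"
      by (simp only: power_mult_distrib) (simp add: algebra_simps)
    also have "(1 / real (Suc n)) ^ DIM('a) * real (Suc n) ^ DIM('a) = 1"
      by (simp flip: power_mult_distrib)
    also have "a * (v * 2 ^ DIM('a)) * 1 = e / 2" using v by (simp add: a_def field_simps)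
    also have "e / 2 + B * m * (1 / real (Suc n)) ^ DIM('a) < e" using N[OF \<open>n \<ge> N\<close>] by simp
    finally show "norm ((1 / real (Suc n)) ^ DIM('a) * ?I n - 0) < e" .
  qed
qed

text \<open>Green's formula. The gradient decay of \<open>w\<close> makes the cutoff error a mean of \<open>g\<close> over a large
  ball, which tends to zero by the weak decay required in \<open>D\<^sup>1\<close>.\<close>

lemma green_bounded:
  fixes w :: "real ^ 'n \<Rightarrow> real"
  assumes g: "D1_pair g G" and B: "\<And>x. \<bar>g x\<bar> \<le> B"
    and w: "smooth_on UNIV w" "sqint (grad w)" "integrable lborel (lap w)"
    and decay: "\<And>x i. norm x \<ge> R0 \<Longrightarrow> \<bar>pd i w x\<bar> \<le> A * (1 / norm x) ^ (CARD('n) - 1)"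
  shows "ip G (grad w) = - (LINT x|lborel. g x * lap w x)"
proof -
  obtain C :: real and \<zeta> :: "real \<Rightarrow> real ^ 'n \<Rightarrow> real" where C: "C > 0"
    and \<zeta>: "\<And>R. R > 0 \<Longrightarrow> test_function (\<zeta> R)" "\<And>R x. 0 \<le> \<zeta> R x" "\<And>R x. \<zeta> R x \<le> 1"
    "\<And>R x. R > 0 \<Longrightarrow> norm x \<le> R \<Longrightarrow> \<zeta> R x = 1" "\<And>R x i. R > 0 \<Longrightarrow> \<bar>pd i (\<zeta> R) x\<bar> \<le> C / R"
    "\<And>R x i. R > 0 \<Longrightarrow> norm x > 2 * R \<Longrightarrow> pd i (\<zeta> R) x = 0"
    "\<And>R x i. R > 0 \<Longrightarrow> norm x < R \<Longrightarrow> pd i (\<zeta> R) x = 0"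
    by (rule cutoff_functions[where 'n = 'n], rule that)
  define z where "z n = \<zeta> (real (Suc n))" for n
  have zt: "test_function (z n)" and zs: "smooth_on UNIV (z n)" for n
    by (simp_all add: z_def \<zeta>(1) test_smooth)
  have wi: "smooth_on UNIV (pd i w)" "smooth_on UNIV (pd i (pd i w))" for i
    by (intro smooth_pd w)+
  note wg = D1_pairD(1)[OF g] and sG = D1_pairD(2)[OF g]
  note lg = wgrad_loc_int(1)[OF wg] and lG = wgrad_loc_int(2)[OF wg]
  note bg [measurable] = loc_int_borel[OF lg] and bG [measurable] = loc_int_borel[OF lG] and bGv [measurable] = sqint_borel[OF sG]
  note bw [measurable] = smooth_borel[OF wi(1)] smooth_borel[OF wi(2)] smooth_borel[OF zs] smooth_borel[OF smooth_pd[OF zs]]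
  have blap [measurable]: "lap w \<in> borel_measurable borel" using borel_measurable_integrable[OF w(3)] by simp
  have bgrad [measurable]: "grad w \<in> borel_measurable borel" by (rule sqint_borel[OF w(2)])
  have inn: "G x \<bullet> grad w x = (\<Sum>i\<in>UNIV. G x $ i * pd i w x)" for x
    by (simp add: inner_vec_def grad_def)
  \<comment> \<open>The weak gradient of g is tested with the cutoff times a partial derivative of
    w. This is a test function although w is not, and the product rule yields the second integral as
    the error term.\<close>
  have cut: "(LINT x|lborel. g x * (lap w x * z n x)) + (LINT x|lborel. g x * (\<Sum>i\<in>UNIV. pd i w x * pd i (z n) x)) =
      - (LINT x|lborel. z n x * (G x \<bullet> grad w x))" for n
  proof -
    have t: "test_function (\<lambda>x. pd i w x * z n x)" for i by (intro test_mult wi zt)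
    have i1: "integrable lborel (\<lambda>x. g x * (pd i (pd i w) x * z n x))" for i
      by (intro loc_int_test_integrable[OF lg] test_mult wi zt)
    have i2: "integrable lborel (\<lambda>x. g x * (pd i w x * pd i (z n) x))" for i
      by (intro loc_int_test_integrable[OF lg] test_mult wi test_pd zt)
    have i3: "integrable lborel (\<lambda>x. G x $ i * (pd i w x * z n x))" for i
      by (intro loc_int_test_integrable[OF lG] t)
    have e: "(LINT x|lborel. g x * (pd i (pd i w) x * z n x)) + (LINT x|lborel. g x * (pd i w x * pd i (z n) x)) =
        - (LINT x|lborel. G x $ i * (pd i w x * z n x))" for i
    proof -
      have "(LINT x|lborel. g x * (pd i (pd i w) x * z n x)) + (LINT x|lborel. g x * (pd i w x * pd i (z n) x)) =
          (LINT x|lborel. g x * (pd i (pd i w) x * z n x) + g x * (pd i w x * pd i (z n) x))"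
        using i1[of i] i2[of i] by simp
      also have "\<dots> = (LINT x|lborel. g x * pd i (\<lambda>x. pd i w x * z n x) x)"
        unfolding pd_mult[OF wi(1) zs] by (intro Bochner_Integration.integral_cong) (simp_all add: algebra_simps)
      also have "\<dots> = - (LINT x|lborel. G x $ i * (pd i w x * z n x))" by (rule wgrad_eq[OF wg t])
      finally show ?thesis .
    qed
    have "(LINT x|lborel. g x * (lap w x * z n x)) + (LINT x|lborel. g x * (\<Sum>i\<in>UNIV. pd i w x * pd i (z n) x)) =
        (LINT x|lborel. (\<Sum>i\<in>UNIV. g x * (pd i (pd i w) x * z n x))) + (LINT x|lborel. (\<Sum>i\<in>UNIV. g x * (pd i w x * pd i (z n) x)))"
      by (simp add: lap_def sum_distrib_left sum_distrib_right)
    also have "\<dots> = (\<Sum>i\<in>UNIV. (LINT x|lborel. g x * (pd i (pd i w) x * z n x)) + (LINT x|lborel. g x * (pd i w x * pd i (z n) x)))"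
      using i1 i2 by (simp add: sum.distrib)
    also have "\<dots> = - (\<Sum>i\<in>UNIV. LINT x|lborel. G x $ i * (pd i w x * z n x))"
      unfolding e by (simp add: sum_negf)
    also have "(\<Sum>i\<in>UNIV. LINT x|lborel. G x $ i * (pd i w x * z n x)) = (LINT x|lborel. (\<Sum>i\<in>UNIV. G x $ i * (pd i w x * z n x)))"
      using i3 by (intro Bochner_Integration.integral_sum[symmetric])
    also have "(\<lambda>x. \<Sum>i\<in>UNIV. G x $ i * (pd i w x * z n x)) = (\<lambda>x. z n x * (G x \<bullet> grad w x))"
      by (simp add: inn sum_distrib_left fun_eq_iff mult_ac)
    finally show ?thesis .
  qed
  have z1: "(\<lambda>n. z n x) \<longlonglongrightarrow> 1" for x
  proof (rule tendsto_eventually)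
    obtain N :: nat where "norm x \<le> real N" using real_arch_simple by blast
    then show "eventually (\<lambda>n. z n x = 1) sequentially"
      unfolding eventually_sequentially z_def by (intro exI[of _ N] allI impI \<zeta>(4)) auto
  qed
  have zb: "\<bar>z n x\<bar> \<le> 1" for n x using \<zeta>(2,3) by (simp add: z_def)
  have igl: "integrable lborel (\<lambda>x. B * lap w x)" using w(3) by simp
  have B0: "B \<ge> 0" using order_trans[OF abs_ge_zero B] .
  have lim1: "(\<lambda>n. LINT x|lborel. g x * (lap w x * z n x)) \<longlonglongrightarrow> (LINT x|lborel. g x * lap w x)"
  proof (rule integral_dominated_convergence[where w = "\<lambda>x. \<bar>B * lap w x\<bar>"])
    show "AE x in lborel. (\<lambda>n. g x * (lap w x * z n x)) \<longlonglongrightarrow> g x * lap w x"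
      using tendsto_mult_left[OF tendsto_mult_left[OF z1]] by (intro AE_I2) simp
    show "AE x in lborel. norm (g x * (lap w x * z n x)) \<le> \<bar>B * lap w x\<bar>" for n
    proof (intro AE_I2)
      fix x
      have "\<bar>g x\<bar> * (\<bar>lap w x\<bar> * \<bar>z n x\<bar>) \<le> B * (\<bar>lap w x\<bar> * 1)"
        using B zb B0 by (intro mult_mono) auto
      then show "norm (g x * (lap w x * z n x)) \<le> \<bar>B * lap w x\<bar>" using B0 by (simp add: abs_mult)
    qed
  qed (use igl in auto)
  have lim3: "(\<lambda>n. LINT x|lborel. z n x * (G x \<bullet> grad w x)) \<longlonglongrightarrow> (LINT x|lborel. G x \<bullet> grad w x)"
  proof (rule integral_dominated_convergence[where w = "\<lambda>x. \<bar>G x \<bullet> grad w x\<bar>"])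
    show "AE x in lborel. (\<lambda>n. z n x * (G x \<bullet> grad w x)) \<longlonglongrightarrow> G x \<bullet> grad w x"
      using tendsto_mult_right[OF z1] by (intro AE_I2) simp
    show "AE x in lborel. norm (z n x * (G x \<bullet> grad w x)) \<le> \<bar>G x \<bullet> grad w x\<bar>" for n
      using zb by (intro AE_I2) (simp add: abs_mult mult_left_le_one_le)
  qed (use sqint_inner[OF sG w(2)] in auto)
  let ?n = "real CARD('n)"
  let ?I = "\<lambda>n. LINT x|lborel. indicator (cball 0 (2 * real (Suc n))) x * \<bar>g x\<bar>"
  \<comment> \<open>On the shell the gradient of w is of order R^(1-d) and that of the cutoff of
    order 1 / R. Together they give exactly the normalization R^-d of a mean over the ball of radius
    2 R.\<close>
  have lim2: "(\<lambda>n. LINT x|lborel. g x * (\<Sum>i\<in>UNIV. pd i w x * pd i (z n) x)) \<longlonglongrightarrow> 0"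
  proof (rule Lim_null_comparison)
    have A': "A * (1 / norm x) ^ (CARD('n) - 1) \<le> max A 0 * (1 / R) ^ (CARD('n) - 1)" if "R > 0" "norm x \<ge> R" for R and x :: "real ^ 'n"
    proof -
      have "A * (1 / norm x) ^ (CARD('n) - 1) \<le> max A 0 * (1 / norm x) ^ (CARD('n) - 1)"
        by (intro mult_right_mono) auto
      also have "\<dots> \<le> max A 0 * (1 / R) ^ (CARD('n) - 1)"
        using that by (intro mult_left_mono power_mono frac_le) auto
      finally show ?thesis .
    qed
    have "norm (LINT x|lborel. g x * (\<Sum>i\<in>UNIV. pd i w x * pd i (z n) x)) \<le>
        (?n * max A 0 * C) * ((1 / real (Suc n)) ^ DIM(real ^ 'n) * ?I n)" if n: "real (Suc n) \<ge> R0" for n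
    proof -
      define R where "R = real (Suc n)"
      have R: "R > 0" by (simp add: R_def)
      have pw: "\<bar>\<Sum>i\<in>UNIV. pd i w x * pd i (z n) x\<bar> \<le>
          ?n * max A 0 * C * (1 / R) ^ CARD('n) * indicator (cball 0 (2 * R)) x" for x
      proof (cases "norm x < R \<or> norm x > 2 * R")
        case True
        then have "pd i (z n) x = 0" for i using \<zeta>(6,7) R by (auto simp: z_def R_def)
        then show ?thesis using C R by (auto intro!: mult_nonneg_nonneg)
      next
        case False
        have "\<bar>\<Sum>i\<in>UNIV. pd i w x * pd i (z n) x\<bar> \<le> (\<Sum>i\<in>UNIV. \<bar>pd i w x * pd i (z n) x\<bar>)" by (rule sum_abs)
        also have "\<dots> \<le> (\<Sum>i\<in>(UNIV :: 'n set). max A 0 * (1 / R) ^ (CARD('n) - 1) * (C / R))"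
        proof (rule sum_mono)
          fix i
          have "\<bar>pd i w x\<bar> \<le> max A 0 * (1 / R) ^ (CARD('n) - 1)"
            using decay[of x i] A'[of R x] False n R by (auto simp: R_def intro: order_trans)
          moreover have "\<bar>pd i (z n) x\<bar> \<le> C / R" using \<zeta>(5)[of R i x] R by (simp add: z_def R_def)
          ultimately show "\<bar>pd i w x * pd i (z n) x\<bar> \<le> max A 0 * (1 / R) ^ (CARD('n) - 1) * (C / R)"
            unfolding abs_mult using R by (intro mult_mono) auto
        qed
        also have "\<dots> = ?n * max A 0 * C * ((1 / R) ^ (CARD('n) - 1) * (1 / R))" by simp
        also have "(1 / R) ^ (CARD('n) - 1) * (1 / R) = (1 / R) ^ CARD('n)"
          using power_minus_mult[of "CARD('n)" "1 / R"] by simp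
        finally show ?thesis using False by simp
      qed
      have ig: "integrable lborel (\<lambda>x. indicator (cball 0 (2 * R)) x * \<bar>g x\<bar>)"
        using loc_intD[OF loc_int_abs[OF lg]] by simp
      have ii: "integrable lborel (\<lambda>x. g x * (\<Sum>i\<in>UNIV. pd i w x * pd i (z n) x))"
        unfolding sum_distrib_left
        by (intro Bochner_Integration.integrable_sum loc_int_test_integrable[OF lg] test_mult wi test_pd zt)
      have "norm (LINT x|lborel. g x * (\<Sum>i\<in>UNIV. pd i w x * pd i (z n) x)) \<le>
          (LINT x|lborel. \<bar>g x * (\<Sum>i\<in>UNIV. pd i w x * pd i (z n) x)\<bar>)"
        using integral_abs_bound by simp
      also have "\<dots> \<le> (LINT x|lborel. (?n * max A 0 * C * (1 / R) ^ CARD('n)) * (indicator (cball 0 (2 * R)) x * \<bar>g x\<bar>))"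
      proof (rule integral_mono)
        fix x
        have "\<bar>g x\<bar> * \<bar>\<Sum>i\<in>UNIV. pd i w x * pd i (z n) x\<bar> \<le>
            \<bar>g x\<bar> * (?n * max A 0 * C * (1 / R) ^ CARD('n) * indicator (cball 0 (2 * R)) x)"
          by (intro mult_left_mono pw) auto
        then show "\<bar>g x * (\<Sum>i\<in>UNIV. pd i w x * pd i (z n) x)\<bar> \<le>
          (?n * max A 0 * C * (1 / R) ^ CARD('n)) * (indicator (cball 0 (2 * R)) x * \<bar>g x\<bar>)"
          by (simp add: abs_mult mult_ac)
      qed (use ig ii in auto)
      also have "\<dots> = (?n * max A 0 * C) * ((1 / R) ^ CARD('n) * ?I n)"
        using ig by (simp add: R_def)
      finally show ?thesis by (simp add: R_def)
    qed
    moreover obtain N :: nat where "R0 \<le> real N" using real_arch_simple by blast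
    ultimately show "eventually (\<lambda>n. norm (LINT x|lborel. g x * (\<Sum>i\<in>UNIV. pd i w x * pd i (z n) x)) \<le>
        (?n * max A 0 * C) * ((1 / real (Suc n)) ^ DIM(real ^ 'n) * ?I n)) sequentially"
      unfolding eventually_sequentially by (intro exI[of _ N]) auto
    show "(\<lambda>n. (?n * max A 0 * C) * ((1 / real (Suc n)) ^ DIM(real ^ 'n) * ?I n)) \<longlonglongrightarrow> 0"
      by (intro tendsto_mult_right_zero mean_tendsto_0[OF bg B] D1_pairD(3)[OF g])
  qed
  from tendsto_add[OF lim1 lim2] have "(\<lambda>n. - (LINT x|lborel. z n x * (G x \<bullet> grad w x))) \<longlonglongrightarrow> (LINT x|lborel. g x * lap w x)"
    unfolding cut by simp
  with tendsto_minus[OF lim3] have "- (LINT x|lborel. G x \<bullet> grad w x) = (LINT x|lborel. g x * lap w x)"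
    by (intro LIMSEQ_unique)
  then show ?thesis by (simp add: ip_def)
qed

text \<open>Green's formula holds for the truncations of g at height n. The sign of the Laplacian
  makes the right sides monotone in n, so that integrability of the limit is part of the conclusion;
  on the left, the truncated gradients converge with domination.\<close>

lemma green_nonneg:
  fixes w :: "real ^ 'n \<Rightarrow> real"
  assumes g: "D1_pair g G" and g0: "\<And>x. g x \<ge> 0"
    and w: "smooth_on UNIV w" "sqint (grad w)" "integrable lborel (lap w)" "\<And>x. lap w x \<le> 0"
    and decay: "\<And>x i. norm x \<ge> R0 \<Longrightarrow> \<bar>pd i w x\<bar> \<le> A * (1 / norm x) ^ (CARD('n) - 1)"
  shows "integrable lborel (\<lambda>x. g x * lap w x)" "ip G (grad w) = - (LINT x|lborel. g x * lap w x)"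
proof -
  note sG = D1_pairD(2)[OF g]
  have bg [measurable]: "g \<in> borel_measurable borel" and bG [measurable]: "G \<in> borel_measurable borel"
    and bw [measurable]: "grad w \<in> borel_measurable borel"
    by (rule D1_pair_borel[OF g], rule sqint_borel[OF sG], rule sqint_borel[OF w(2)])
  have blap [measurable]: "lap w \<in> borel_measurable borel" using borel_measurable_integrable[OF w(3)] by simp
  let ?k = "\<lambda>n. real (Suc n)"
  let ?G = "\<lambda>n x. (1/2) *\<^sub>R (G x - sgn (g x - ?k n) *\<^sub>R G x)"
  have tr: "D1_pair (\<lambda>x. min (g x) (?k n)) (?G n)" for n
    by (rule D1_pair_truncate[OF g g0]) simp
  have gr: "ip (?G n) (grad w) = (LINT x|lborel. min (g x) (?k n) * - lap w x)" for n
    using green_bounded[OF tr[of n] _ w(1,2,3) decay, of "?k n"] g0 by (simp add: abs_of_nonneg)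
  have "(\<lambda>n. ip (?G n) (grad w)) \<longlonglongrightarrow> ip G (grad w)"
    unfolding ip_def
  proof (rule integral_dominated_convergence[where w = "\<lambda>x. \<bar>G x \<bullet> grad w x\<bar>"])
    show "AE x in lborel. (\<lambda>n. ?G n x \<bullet> grad w x) \<longlonglongrightarrow> G x \<bullet> grad w x"
    proof (intro AE_I2 tendsto_eventually)
      fix x
      obtain N :: nat where "g x \<le> real N" using real_arch_simple by blast
      then have "sgn (g x - ?k n) = - 1" if "n \<ge> N" for n
        using that by (intro sgn_neg) simp
      then show "eventually (\<lambda>n. ?G n x \<bullet> grad w x = G x \<bullet> grad w x) sequentially"
        unfolding eventually_sequentially by (intro exI[of _ N]) (auto simp: scaleR_2[symmetric])
    qed
    show "AE x in lborel. norm (?G n x \<bullet> grad w x) \<le> \<bar>G x \<bullet> grad w x\<bar>" for n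
    proof (intro AE_I2)
      fix x
      have "?G n x \<bullet> grad w x = ((1 - sgn (g x - ?k n)) / 2) * (G x \<bullet> grad w x)"
        by (simp add: inner_diff_left algebra_simps)
      then have "norm (?G n x \<bullet> grad w x) = \<bar>(1 - sgn (g x - ?k n)) / 2\<bar> * \<bar>G x \<bullet> grad w x\<bar>"
        by (simp only: real_norm_def abs_mult)
      also have "\<dots> \<le> 1 * \<bar>G x \<bullet> grad w x\<bar>"
        by (intro mult_right_mono) (auto simp: sgn_real_def)
      finally show "norm (?G n x \<bullet> grad w x) \<le> \<bar>G x \<bullet> grad w x\<bar>" by simp
    qed
  qed (use sqint_inner[OF sG w(2)] in auto)
  then have lim: "(\<lambda>n. LINT x|lborel. min (g x) (?k n) * - lap w x) \<longlonglongrightarrow> ip G (grad w)"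
    unfolding gr .
  have "integrable lborel (\<lambda>x. g x * - lap w x) \<and> integral\<^sup>L lborel (\<lambda>x. g x * - lap w x) = ip G (grad w)"
  proof (intro conjI)
    have 1: "integrable lborel (\<lambda>x. min (g x) (?k n) * - lap w x)" for n
    proof (rule Bochner_Integration.integrable_bound)
      show "integrable lborel (\<lambda>x. ?k n * lap w x)" using w(3) by simp
      show "AE x in lborel. norm (min (g x) (?k n) * - lap w x) \<le> norm (?k n * lap w x)"
        using g0 by (intro AE_I2) (simp add: abs_mult mult_right_mono abs_of_nonneg)
    qed simp
    have 2: "AE x in lborel. mono (\<lambda>n. min (g x) (?k n) * - lap w x)"
      using w(4) by (intro AE_I2 monoI mult_right_mono) auto
    have 3: "AE x in lborel. (\<lambda>n. min (g x) (?k n) * - lap w x) \<longlonglongrightarrow> g x * - lap w x"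
    proof (intro AE_I2 tendsto_eventually)
      fix x
      obtain N :: nat where "g x \<le> real N" using real_arch_simple by blast
      then show "eventually (\<lambda>n. min (g x) (?k n) * - lap w x = g x * - lap w x) sequentially"
        unfolding eventually_sequentially by (intro exI[of _ N]) (auto simp: min_def)
    qed
    show "integrable lborel (\<lambda>x. g x * - lap w x)"
      by (rule integrable_monotone_convergence[OF 1 2 3 lim]) simp
    show "integral\<^sup>L lborel (\<lambda>x. g x * - lap w x) = ip G (grad w)"
      by (rule integral_monotone_convergence[OF 1 2 3 lim]) simp
  qed
  then show "integrable lborel (\<lambda>x. g x * lap w x)" "ip G (grad w) = - (LINT x|lborel. g x * lap w x)"
    by auto
qed

text \<open>The bubble is a smooth superharmonic substitute for the Newtonian kernel \<open>\<bar>x - a\<bar>\<^sup>2\<^sup>-\<^sup>d\<close>. Its negative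
  Laplacian, the bubble density, has a mass independent of \<open>e\<close> and concentrates at \<open>a\<close> as \<open>e\<close> tends to \<open>0\<close>.\<close>

definition bubble :: "real \<Rightarrow> real ^ 'n \<Rightarrow> real ^ 'n \<Rightarrow> real" where
  "bubble e a x = ((norm (x - a))\<^sup>2 + e\<^sup>2) powr (1 - real CARD('n) / 2)"

definition bubble_density :: "real \<Rightarrow> real ^ 'n \<Rightarrow> real" where
  "bubble_density e z = real CARD('n) * (real CARD('n) - 2) * e\<^sup>2 *
    ((norm z)\<^sup>2 + e\<^sup>2) powr (- 1 - real CARD('n) / 2)"

lemma pos_sq: "e > 0 \<Longrightarrow> (norm z)\<^sup>2 + e\<^sup>2 > 0" for e :: real
  by (simp add: add_nonneg_pos)

lemma smooth_sq: "smooth_on UNIV (\<lambda>x. (norm (x - a))\<^sup>2 + e\<^sup>2)"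
proof -
  have "smooth_on UNIV (\<lambda>x. (norm (- a + 1 *\<^sub>R x))\<^sup>2)"
    by (rule smooth_on_affine[OF smooth_on_power2_norm])
  then have "smooth_on UNIV (\<lambda>x. (norm (x - a))\<^sup>2)" by simp
  then show ?thesis by (intro smooth_on_add smooth_on_const)
qed

lemma bubble_smooth: "e > 0 \<Longrightarrow> smooth_on UNIV (bubble e a)"
  unfolding bubble_def[abs_def] by (intro smooth_on_powr smooth_sq pos_sq)

lemma GDERIV_sq_powr:
  fixes a :: "real ^ 'n"
  assumes "e > 0"
  shows "GDERIV (\<lambda>x. ((norm (x - a))\<^sup>2 + e\<^sup>2) powr p) x :>
    (2 * p * ((norm (x - a))\<^sup>2 + e\<^sup>2) powr (p - 1)) *\<^sub>R (x - a)"
proof -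
  have "((\<lambda>x. (x - a) \<bullet> (x - a) + e\<^sup>2) has_derivative (\<lambda>h. h \<bullet> (2 *\<^sub>R (x - a)))) (at x)"
    by (auto intro!: derivative_eq_intros simp: inner_commute)
  then have "GDERIV (\<lambda>x. (norm (x - a))\<^sup>2 + e\<^sup>2) x :> 2 *\<^sub>R (x - a)"
    by (simp add: GDERIV_has_derivative power2_norm_eq_inner)
  moreover have "((\<lambda>t. t powr p) has_real_derivative p * ((norm (x - a))\<^sup>2 + e\<^sup>2) powr (p - 1))
      (at ((norm (x - a))\<^sup>2 + e\<^sup>2))"
    by (rule has_real_derivative_powr[OF pos_sq[OF assms]])
  ultimately have "GDERIV (\<lambda>x. ((norm (x - a))\<^sup>2 + e\<^sup>2) powr p) x :>
      (p * ((norm (x - a))\<^sup>2 + e\<^sup>2) powr (p - 1)) *\<^sub>R (2 *\<^sub>R (x - a))"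
    by (rule GDERIV_DERIV_compose)
  then show ?thesis by (simp add: mult_ac)
qed

lemma pd_bubble:
  fixes a :: "real ^ 'n"
  assumes "e > 0"
  shows "pd i (bubble e a) x = (2 - real CARD('n)) * ((norm (x - a))\<^sup>2 + e\<^sup>2) powr (- (real CARD('n) / 2)) * (x - a) $ i"
  using pd_eqI[OF GDERIV_sq_powr[OF assms, of a "1 - real CARD('n) / 2" x], of i]
  unfolding bubble_def[abs_def] by (simp add: algebra_simps)

lemma lap_bubble:
  fixes a :: "real ^ 'n"
  assumes "e > 0"
  shows "lap (bubble e a) x = - bubble_density e (x - a)"
proof -
  let ?d = "real CARD('n)" and ?s = "(norm (x - a))\<^sup>2 + e\<^sup>2"
  have "pd i (pd i (bubble e a)) x = (2 - ?d) * (?s powr (- (?d / 2)) - ?d * ?s powr (- (?d / 2) - 1) * ((x - a) $ i)\<^sup>2)" for i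
  proof -
    have "GDERIV (\<lambda>x. (x - a) $ i) x :> axis i 1"
    proof -
      have "((\<lambda>x. (x - a) $ i) has_derivative (\<lambda>h. h $ i)) (at x)"
        by (rule bounded_linear.has_derivative[OF bounded_linear_vec_nth, THEN has_derivative_eq_rhs])
           (auto intro!: derivative_eq_intros)
      then show ?thesis by (simp add: GDERIV_has_derivative inner_axis)
    qed
    from GDERIV_mult[OF GDERIV_const[of "2 - ?d" x] GDERIV_mult[OF GDERIV_sq_powr[OF assms, of a "- (?d / 2)" x] this], THEN pd_eqI, of i]
    have "pd i (\<lambda>x. (2 - ?d) * (((norm (x - a))\<^sup>2 + e\<^sup>2) powr (- (?d / 2)) * (x - a) $ i)) x =
        (2 - ?d) * (?s powr (- (?d / 2)) - ?d * ?s powr (- (?d / 2) - 1) * ((x - a) $ i)\<^sup>2)"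
      by (simp add: power2_eq_square algebra_simps)
    moreover have "pd i (bubble e a) = (\<lambda>x. (2 - ?d) * (((norm (x - a))\<^sup>2 + e\<^sup>2) powr (- (?d / 2)) * (x - a) $ i))"
      by (simp add: fun_eq_iff pd_bubble[OF assms] mult.assoc)
    ultimately show ?thesis by simp
  qed
  then have "lap (bubble e a) x = (2 - ?d) * (?d * ?s powr (- (?d / 2)) -
      ?d * ?s powr (- (?d / 2) - 1) * (\<Sum>i\<in>UNIV. ((x - a) $ i)\<^sup>2))"
    by (simp add: lap_def sum_subtractf flip: sum_distrib_left)
  also have "(\<Sum>i\<in>UNIV. ((x - a) $ i)\<^sup>2) = (norm (x - a))\<^sup>2"
    unfolding power2_norm_eq_inner inner_vec_def by (simp add: power2_eq_square)
  \<comment> \<open>With a common power of \<open>?s\<close>, the two terms combine through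
    \<open>?s\<close> - \<bar>x - a\<bar>^2 = e^2, and the factor e^2 of the density
    appears.\<close>
  also have "?s powr (- (?d / 2)) = ?s powr (- (?d / 2) - 1) * ?s"
    using powr_add[of ?s "- (?d / 2) - 1" 1] pos_sq[OF assms, of "x - a"] by simp
  finally have L: "lap (bubble e a) x = (2 - ?d) * (?d * (?s powr (- (?d / 2) - 1) * ?s) -
      ?d * ?s powr (- (?d / 2) - 1) * (norm (x - a))\<^sup>2)" .
  have "- 1 - ?d / 2 = - (?d / 2) - 1" by simp
  then show ?thesis unfolding L bubble_density_def by (simp only:) (simp add: algebra_simps)
qed

text \<open>Reduces all widths to width 1 at the price of a constant, so that integrability is
  checked only for powers of 1 + \<bar>z\<bar>^2.\<close>

lemma sq_powr_le:
  assumes "e > 0" "p \<ge> 0"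
  shows "((norm z)\<^sup>2 + e\<^sup>2) powr - p \<le> (min 1 (e\<^sup>2)) powr - p * (1 + (norm z)\<^sup>2) powr - p"
proof -
  define m where "m = min 1 (e\<^sup>2)"
  have m: "m > 0" "m \<le> 1" "m \<le> e\<^sup>2" using assms by (auto simp: m_def)
  have "m * (1 + (norm z)\<^sup>2) \<le> (norm z)\<^sup>2 + e\<^sup>2"
    using m mult_right_mono[OF m(2), of "(norm z)\<^sup>2"] by (simp add: algebra_simps)
  then have "((norm z)\<^sup>2 + e\<^sup>2) powr - p \<le> (m * (1 + (norm z)\<^sup>2)) powr - p"
    using m assms(2) by (intro powr_mono2') (auto intro!: mult_pos_pos add_pos_nonneg)
  also have "\<dots> = m powr - p * (1 + (norm z)\<^sup>2) powr - p" using m by (simp add: powr_mult)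
  finally show ?thesis by (simp add: m_def)
qed

lemma bubble_density_nonneg: "CARD('n) \<ge> 3 \<Longrightarrow> bubble_density e (z :: real ^ 'n) \<ge> 0"
  and bubble_density_pos: "CARD('n) \<ge> 3 \<Longrightarrow> e > 0 \<Longrightarrow> bubble_density e (z :: real ^ 'n) > 0"
  using pos_sq[of e z] by (auto simp: bubble_density_def)

lemma bubble_density_borel [measurable]: "bubble_density e \<in> borel_measurable borel"
  unfolding bubble_density_def[abs_def] by measurable

lemma bubble_density_integrable:
  assumes "CARD('n) \<ge> 3" "e > 0"
  shows "integrable lborel (bubble_density e :: real ^ 'n \<Rightarrow> real)"
proof -
  let ?d = "real CARD('n)"
  define c where "c = ?d * (?d - 2) * e\<^sup>2 * (min 1 (e\<^sup>2)) powr - (1 + ?d / 2)"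
  have c: "c \<ge> 0" using assms by (simp add: c_def)
  have "integrable lborel (\<lambda>z :: real ^ 'n. c * (1 + (norm z)\<^sup>2) powr (- (?d + 2) / 2))"
    by (intro integrable_mult_right bessel_powr_integrable) simp
  then show ?thesis
  proof (rule Bochner_Integration.integrable_bound)
    have e: "- (?d + 2) / 2 = - (1 + ?d / 2)" "- 1 - ?d / 2 = - (1 + ?d / 2)" by auto
    have "bubble_density e z \<le> c * (1 + (norm z)\<^sup>2) powr (- (?d + 2) / 2)" for z :: "real ^ 'n"
      unfolding bubble_density_def c_def e mult.assoc
      using assms sq_powr_le[of e "1 + ?d / 2" z] by (intro mult_left_mono) auto
    then show "AE z in lborel. norm (bubble_density e (z :: real ^ 'n)) \<le> norm (c * (1 + (norm z)\<^sup>2) powr (- (?d + 2) / 2))"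
      using bubble_density_nonneg[OF assms(1)] c by (intro AE_I2) (simp add: abs_of_nonneg)
  qed simp
qed

lemma lap_bubble_integrable:
  assumes "CARD('n) \<ge> 3" "e > 0"
  shows "integrable lborel (lap (bubble e (a :: real ^ 'n)))"
proof -
  have eq: "lap (bubble e a) = (\<lambda>x. - bubble_density e (x + (- a)))"
    by (simp add: fun_eq_iff lap_bubble[OF assms(2)])
  show ?thesis unfolding eq
    using lborel_integrable_translate[OF bubble_density_integrable[OF assms], of "- a"] by simp
qed

lemma norm_grad_bubble:
  fixes a :: "real ^ 'n"
  assumes "CARD('n) \<ge> 3" "e > 0"
  shows "norm (grad (bubble e a) x) = (real CARD('n) - 2) * ((norm (x - a))\<^sup>2 + e\<^sup>2) powr (- (real CARD('n) / 2)) * norm (x - a)"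
proof -
  have "grad (bubble e a) x = ((2 - real CARD('n)) * ((norm (x - a))\<^sup>2 + e\<^sup>2) powr (- (real CARD('n) / 2))) *\<^sub>R (x - a)"
    by (simp add: grad_def vec_eq_iff pd_bubble[OF assms(2)])
  then show ?thesis using assms by (simp add: abs_mult)
qed

lemma norm_grad_bubble_sq_le:
  fixes a :: "real ^ 'n"
  assumes "CARD('n) \<ge> 3" "e > 0"
  shows "(norm (grad (bubble e a) x))\<^sup>2 \<le> (real CARD('n) - 2)\<^sup>2 * ((norm (x - a))\<^sup>2 + e\<^sup>2) powr (- (real CARD('n) - 1))"
proof -
  let ?d = "real CARD('n)" and ?s = "(norm (x - a))\<^sup>2 + e\<^sup>2"
  have s: "?s > 0" by (rule pos_sq[OF assms(2)])
  have "(norm (grad (bubble e a) x))\<^sup>2 = (?d - 2)\<^sup>2 * ((?s powr (- (?d / 2)))\<^sup>2 * (norm (x - a))\<^sup>2)"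
    unfolding norm_grad_bubble[OF assms] by (simp add: power_mult_distrib mult.assoc)
  also have "\<dots> \<le> (?d - 2)\<^sup>2 * ((?s powr (- (?d / 2)))\<^sup>2 * ?s)"
    by (intro mult_left_mono) auto
  also have "(?s powr (- (?d / 2)))\<^sup>2 = ?s powr (- ?d)"
    using s by (simp add: power2_eq_square flip: powr_add)
  also have "?s powr (- ?d) * ?s = ?s powr (- (?d - 1))"
    using s powr_add[of ?s "- ?d" 1] by simp
  finally show ?thesis .
qed

lemma bubble_D1_pair:
  fixes a :: "real ^ 'n"
  assumes d: "CARD('n) \<ge> 3" and e: "e > 0"
  shows "D1_pair (bubble e a) (grad (bubble e a))"
  unfolding D1_pair_def
proof (intro conjI allI impI)
  let ?d = "real CARD('n)"
  show w: "wgrad (bubble e a) (grad (bubble e a))" by (intro wgrad_grad bubble_smooth e)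
  note [measurable] = wgrad_borel(2)[OF w]
  \<comment> \<open>The squared gradient decays with exponent 2 (d - 1), which exceeds d precisely
    because d > 2.\<close>
  have eq: "- (?d - 1) = - (2 * (?d - 1)) / 2" by simp
  have "integrable lborel (\<lambda>z :: real ^ 'n. (1 + (norm z)\<^sup>2) powr - (?d - 1))"
    unfolding eq using d by (intro bessel_powr_integrable) simp
  from lborel_integrable_translate[OF this, of "- a"]
  have "integrable lborel (\<lambda>x. ((?d - 2)\<^sup>2 * (min 1 (e\<^sup>2)) powr - (?d - 1)) * (1 + (norm (x - a))\<^sup>2) powr - (?d - 1))"
    by simp
  then have "integrable lborel (\<lambda>x. (norm (grad (bubble e a) x))\<^sup>2)"
  proof (rule Bochner_Integration.integrable_bound)
    show "AE x in lborel. norm ((norm (grad (bubble e a) x))\<^sup>2) \<le>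
      norm (((?d - 2)\<^sup>2 * (min 1 (e\<^sup>2)) powr - (?d - 1)) * (1 + (norm (x - a))\<^sup>2) powr - (?d - 1))"
    proof (intro AE_I2)
      fix x
      have "(norm (grad (bubble e a) x))\<^sup>2 \<le> (?d - 2)\<^sup>2 * ((norm (x - a))\<^sup>2 + e\<^sup>2) powr (- (?d - 1))"
        by (rule norm_grad_bubble_sq_le[OF d e])
      also have "\<dots> \<le> (?d - 2)\<^sup>2 * ((min 1 (e\<^sup>2)) powr - (?d - 1) * (1 + (norm (x - a))\<^sup>2) powr - (?d - 1))"
        using d e by (intro mult_left_mono sq_powr_le) auto
      finally show "norm ((norm (grad (bubble e a) x))\<^sup>2) \<le>
          norm (((?d - 2)\<^sup>2 * (min 1 (e\<^sup>2)) powr - (?d - 1)) * (1 + (norm (x - a))\<^sup>2) powr - (?d - 1))"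
        by (simp add: mult.assoc)
    qed
  qed simp
  then show "sqint (grad (bubble e a))" by (simp add: sqint_def)
  fix c :: real assume c: "c > 0"
  \<comment> \<open>The solution of R powr (1 - d/2) = c. As the exponent is negative, the
    superlevel set lies where the squared distance plus e^2 is at most R.\<close>
  define R where "R = c powr (1 / (1 - ?d / 2))"
  have "bounded {x. \<bar>bubble e a x\<bar> > c}"
  proof (rule bounded_subset[of "cball a (sqrt R)"])
    show "{x. \<bar>bubble e a x\<bar> > c} \<subseteq> cball a (sqrt R)"
    proof safe
      fix x assume "\<bar>bubble e a x\<bar> > c"
      then have less: "c < ((norm (x - a))\<^sup>2 + e\<^sup>2) powr (1 - ?d / 2)" by (simp add: bubble_def)
      have "(norm (x - a))\<^sup>2 + e\<^sup>2 \<le> R"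
      proof (rule ccontr)
        assume "\<not> ?thesis"
        then have "R < (norm (x - a))\<^sup>2 + e\<^sup>2" by simp
        moreover have "R > 0" using c by (simp add: R_def)
        ultimately have "((norm (x - a))\<^sup>2 + e\<^sup>2) powr (1 - ?d / 2) \<le> R powr (1 - ?d / 2)"
          using d by (intro powr_mono2') auto
        also have "\<dots> = c" using c d by (simp add: R_def powr_powr)
        finally show False using less by simp
      qed
      then have "(norm (x - a))\<^sup>2 \<le> R" using zero_le_power2[of e] by linarith
      then have "norm (x - a) \<le> sqrt R" by (simp add: real_le_rsqrt)
      then show "x \<in> cball a (sqrt R)" by (simp add: dist_norm norm_minus_commute)
    qed
  qed simp
  then show "emeasure lborel {x. \<bar>bubble e a x\<bar> > c} < \<infinity>" by (rule emeasure_bounded_finite)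
qed

text \<open>Provides the decay hypothesis of Green's formula. Beyond radius 2 \<bar>a\<bar> + 1 the
  distance to the center is at least \<bar>x\<bar> / 2, which accounts for the power of 2.\<close>

lemma bubble_decay:
  fixes a :: "real ^ 'n"
  assumes d: "CARD('n) \<ge> 3" and e: "e > 0" and x: "norm x \<ge> 2 * norm a + 1"
  shows "\<bar>pd i (bubble e a) x\<bar> \<le> (real CARD('n) - 2) * 2 ^ (CARD('n) - 1) * (1 / norm x) ^ (CARD('n) - 1)"
proof -
  let ?d = "real CARD('n)" and ?s = "(norm (x - a))\<^sup>2 + e\<^sup>2"
  have xa: "norm (x - a) \<ge> norm x / 2" using x norm_triangle_ineq2[of x a] norm_ge_zero[of a] by linarith
  have x0: "norm x > 0" using x norm_ge_zero[of a] by linarith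
  then have p: "norm (x - a) > 0" using xa by linarith
  have "\<bar>pd i (bubble e a) x\<bar> \<le> norm (grad (bubble e a) x)"
    using component_le_norm_cart[of "grad (bubble e a) x" i] by (simp add: grad_def)
  also have "\<dots> = (?d - 2) * (?s powr (- (?d / 2)) * norm (x - a))" by (simp add: norm_grad_bubble[OF d e])
  also have "\<dots> \<le> (?d - 2) * (((norm (x - a))\<^sup>2) powr (- (?d / 2)) * norm (x - a))"
    using d p by (intro mult_left_mono mult_right_mono powr_mono2') auto
  also have "((norm (x - a))\<^sup>2) powr (- (?d / 2)) * norm (x - a) = norm (x - a) powr (1 - ?d)"
    using p by (simp add: powr_powr powr_diff powr_minus_divide flip: powr_numeral)
  also have "norm (x - a) powr (1 - ?d) \<le> (norm x / 2) powr (1 - ?d)"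
    using d xa x0 by (intro powr_mono2') auto
  also have "(norm x / 2) powr (1 - ?d) = (1 / (norm x / 2)) ^ (CARD('n) - 1)"
  proof -
    have "1 - ?d = - real (CARD('n) - 1)" using d by (simp add: of_nat_diff)
    then show ?thesis using x0 by (simp only: powr_minus powr_realpow) (simp add: power_divide powr_realpow field_simps)
  qed
  also have "1 / (norm x / 2) = 2 * (1 / norm x)" by simp
  finally show ?thesis using d by (simp only: power_mult_distrib mult.assoc) simp
qed

lemma green_bubble:
  fixes a :: "real ^ 'n"
  assumes d: "CARD('n) \<ge> 3" and e: "e > 0" and g: "D1_pair g G" "\<And>x. g x \<ge> 0"
  shows "integrable lborel (\<lambda>x. g x * bubble_density e (x - a))"
    and "ip G (grad (bubble e a)) = (LINT x|lborel. g x * bubble_density e (x - a))"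
proof -
  have "lap (bubble e a) x \<le> 0" for x
    using bubble_density_nonneg[OF d] by (simp add: lap_bubble[OF e])
  note * = green_nonneg[OF g bubble_smooth[OF e] D1_pairD(2)[OF bubble_D1_pair[OF d e]]
      lap_bubble_integrable[OF d e] this bubble_decay[OF d e]]
  show "integrable lborel (\<lambda>x. g x * bubble_density e (x - a))"
    using *(1) by (simp add: lap_bubble[OF e])
  show "ip G (grad (bubble e a)) = (LINT x|lborel. g x * bubble_density e (x - a))"
    using *(2) by (simp add: lap_bubble[OF e])
qed

text \<open>The densities are dilations of one another: the one of width e at e z is e^-d times the
  one of width 1 at z.\<close>

lemma bubble_density_mass:
  assumes "CARD('n) \<ge> 3" "e > 0"
  shows "(LINT z|lborel. bubble_density e (z :: real ^ 'n)) = (LINT z|lborel. bubble_density 1 (z :: real ^ 'n))"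
proof -
  let ?d = "real CARD('n)"
  have "bubble_density e (0 + e *\<^sub>R z) = (1 / e ^ CARD('n)) * bubble_density 1 z" for z :: "real ^ 'n"
  proof -
    have "(norm (e *\<^sub>R z))\<^sup>2 + e\<^sup>2 = e\<^sup>2 * ((norm z)\<^sup>2 + 1)" by (simp add: power_mult_distrib algebra_simps)
    then have "((norm (e *\<^sub>R z))\<^sup>2 + e\<^sup>2) powr (- 1 - ?d / 2) = (e\<^sup>2) powr (- 1 - ?d / 2) * ((norm z)\<^sup>2 + 1) powr (- 1 - ?d / 2)"
      using assms by (simp add: powr_mult)
    moreover have "(e\<^sup>2) powr (- 1 - ?d / 2) * e\<^sup>2 = 1 / e ^ CARD('n)"
    proof -
      have "(e\<^sup>2) powr (- 1 - ?d / 2) * e\<^sup>2 = (e\<^sup>2) powr (- (?d / 2))"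
        using assms powr_add[of "e\<^sup>2" "- 1 - ?d / 2" 1] by simp
      also have "\<dots> = e powr (- ?d)" using assms by (simp add: powr_powr flip: powr_numeral)
      also have "\<dots> = 1 / e ^ CARD('n)" using assms by (simp add: powr_minus_divide powr_realpow)
      finally show ?thesis .
    qed
    moreover have "bubble_density e (0 + e *\<^sub>R z) = ?d * (?d - 2) * (e\<^sup>2 * ((norm (e *\<^sub>R z))\<^sup>2 + e\<^sup>2) powr (- 1 - ?d / 2))"
      by (simp add: bubble_density_def)
    moreover have "bubble_density 1 z = ?d * (?d - 2) * ((norm z)\<^sup>2 + 1) powr (- 1 - ?d / 2)"
      by (simp add: bubble_density_def)
    moreover have "?d * (?d - 2) * (e\<^sup>2 * (E * Z)) = E * e\<^sup>2 * (?d * (?d - 2) * Z)" for E Z :: real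
      by (simp only: mult_ac)
    ultimately show ?thesis by (simp only:)
  qed
  then have "(LINT z|lborel. bubble_density e (z :: real ^ 'n)) =
      \<bar>e\<bar> ^ DIM(real ^ 'n) *\<^sub>R (LINT z|lborel. (1 / e ^ CARD('n)) * bubble_density 1 (z :: real ^ 'n))"
    using lborel_affine_integral[OF bubble_density_borel, of e e "0 :: real ^ 'n"] assms(2) by simp
  then show ?thesis using assms(2) by simp
qed

text \<open>Away from the origin \<bar>z\<bar>^2 + e^2 is at least a fixed multiple of 1 +
  \<bar>z\<bar>^2, uniformly in e. What remains is the prefactor e^2 times an integrable
  function.\<close>

lemma bubble_density_tail:
  assumes d: "CARD('n) \<ge> 3" and "r > 0"
  shows "(\<lambda>n. LINT z|lborel. indicator {z :: real ^ 'n. norm z > r} z * bubble_density (1 / real (Suc n)) z) \<longlonglongrightarrow> 0"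
proof (rule Lim_null_comparison)
  let ?d = "real CARD('n)"
  define c where "c = ?d * (?d - 2) * (min (1 / 2) (r\<^sup>2 / 2)) powr - (1 + ?d / 2)"
  let ?b = "\<lambda>z :: real ^ 'n. (1 + (norm z)\<^sup>2) powr (- (?d + 2) / 2)"
  have c: "c \<ge> 0" using d by (simp add: c_def)
  have ib: "integrable lborel ?b" by (intro bessel_powr_integrable) simp
  have le: "indicator {z :: real ^ 'n. norm z > r} z * bubble_density e z \<le> e\<^sup>2 * (c * ?b z)" if e: "e > 0" for e z
  proof (cases "norm z > r")
    case True
    define m where "m = min (1 / 2) (r\<^sup>2 / 2)"
    have m: "m > 0" "m \<le> 1 / 2" "2 * m \<le> r\<^sup>2" using assms by (auto simp: m_def)
    have eq: "- 1 - ?d / 2 = - (1 + ?d / 2)" "- (?d + 2) / 2 = - (1 + ?d / 2)" by auto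
    have rz: "r\<^sup>2 \<le> (norm z)\<^sup>2" using True assms by (intro power_mono) auto
    have "m * (1 + (norm z)\<^sup>2) \<le> (norm z)\<^sup>2 + e\<^sup>2"
    proof -
      have "m \<le> (norm z)\<^sup>2 / 2" using m rz by linarith
      moreover have "m * (norm z)\<^sup>2 \<le> 1 / 2 * (norm z)\<^sup>2" using m by (intro mult_right_mono) auto
      moreover have "m * (1 + (norm z)\<^sup>2) = m + m * (norm z)\<^sup>2" by (simp add: algebra_simps)
      ultimately show ?thesis using zero_le_power2[of e] by linarith
    qed
    then have "((norm z)\<^sup>2 + e\<^sup>2) powr - (1 + ?d / 2) \<le> (m * (1 + (norm z)\<^sup>2)) powr - (1 + ?d / 2)"
      using m by (intro powr_mono2') (auto intro!: mult_pos_pos add_pos_nonneg)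
    also have "\<dots> = m powr - (1 + ?d / 2) * (1 + (norm z)\<^sup>2) powr - (1 + ?d / 2)" using m by (simp add: powr_mult)
    finally have "?d * (?d - 2) * e\<^sup>2 * ((norm z)\<^sup>2 + e\<^sup>2) powr - (1 + ?d / 2) \<le>
        ?d * (?d - 2) * e\<^sup>2 * (m powr - (1 + ?d / 2) * (1 + (norm z)\<^sup>2) powr - (1 + ?d / 2))"
      using d by (intro mult_left_mono) auto
    then show ?thesis
      unfolding bubble_density_def c_def m_def[symmetric] eq using True by (simp add: mult_ac)
  qed (use c in auto)
  show "eventually (\<lambda>n. norm (LINT z|lborel. indicator {z :: real ^ 'n. norm z > r} z * bubble_density (1 / real (Suc n)) z) \<le>
      (1 / real (Suc n))\<^sup>2 * (c * integral\<^sup>L lborel ?b)) sequentially"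
  proof (intro always_eventually allI)
    fix n
    let ?e = "1 / real (Suc n)"
    have nn: "indicator {z :: real ^ 'n. norm z > r} z * bubble_density ?e z \<ge> 0" for z
      using bubble_density_nonneg[OF d] by (intro mult_nonneg_nonneg) auto
    have i: "integrable lborel (\<lambda>z :: real ^ 'n. indicator {z. norm z > r} z * bubble_density ?e z)"
      by (rule Bochner_Integration.integrable_bound[OF bubble_density_integrable[OF d, of ?e]])
         (auto simp: indicator_def)
    have "norm (LINT z|lborel. indicator {z :: real ^ 'n. norm z > r} z * bubble_density ?e z) =
        (LINT z|lborel. indicator {z :: real ^ 'n. norm z > r} z * bubble_density ?e z)"
      unfolding real_norm_def by (intro abs_of_nonneg integral_nonneg_AE AE_I2 nn)
    also have "\<dots> \<le> (LINT z|lborel. ?e\<^sup>2 * (c * ?b z))"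
      using ib by (intro integral_mono i le integrable_mult_right) auto
    also have "\<dots> = ?e\<^sup>2 * (c * integral\<^sup>L lborel ?b)" by simp
    finally show "norm (LINT z|lborel. indicator {z :: real ^ 'n. norm z > r} z * bubble_density ?e z) \<le>
      ?e\<^sup>2 * (c * integral\<^sup>L lborel ?b)" .
  qed
  have "(\<lambda>n. (1 / real (Suc n))\<^sup>2 * (c * integral\<^sup>L lborel ?b)) \<longlonglongrightarrow> 0\<^sup>2 * (c * integral\<^sup>L lborel ?b)"
    by (intro tendsto_intros LIMSEQ_Suc[OF lim_const_over_n])
  then show "(\<lambda>n. (1 / real (Suc n))\<^sup>2 * (c * integral\<^sup>L lborel ?b)) \<longlonglongrightarrow> 0" by simp
qed

section \<open>The variational problem\<close>

text \<open>By continuity a violation at one point would spread to a ball, which has positive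
  measure. This turns almost everywhere bounds for a minimizer into pointwise ones for its
  continuous representative.\<close>

lemma AE_le_imp_le:
  fixes f :: "real ^ 'n \<Rightarrow> real"
  assumes "continuous_on UNIV f" "AE x in lborel. f x \<le> c"
  shows "f x \<le> c"
proof (rule ccontr)
  assume "\<not> f x \<le> c"
  have "open {x. f x > c}" using assms(1) by (intro open_Collect_less continuous_intros)
  with \<open>\<not> f x \<le> c\<close> obtain r where r: "r > 0" "ball x r \<subseteq> {x. f x > c}"
    unfolding open_contains_ball by (auto simp: not_le)
  have "AE y in lborel. y \<notin> ball x r"
    using assms(2) by (rule eventually_mono) (use r(2) in \<open>auto simp: not_less[symmetric]\<close>)
  then have "measure lborel (ball x r) = 0"
    by (subst (asm) AE_iff_null_sets[symmetric]) (auto simp: measure_def null_sets_def)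
  then show False using content_ball_pos[OF r(1), of x] by simp
qed

text \<open>\<open>\<eta>\<close> stands for s \<mapsto> \<theta>((sqrt u + s)^2), with \<theta> the
  right-continuous modification. Minimizers will take values in [0, b], while competitors reach up
  to 2 b, where the lower slope \<open>cm\<close> is still available. The upper slope
  \<open>cp\<close> holds from base points in [0, b] to arbitrarily large arguments, across a
  possible jump. Regularity at small negative shifts, through \<open>\<tau>\<close>, is needed for
  variations of both signs.\<close>

locale variational =
  fixes \<eta> \<eta>' :: "real \<Rightarrow> real" and D :: "(real ^ 'n) set" and \<rho> \<beta> b cm cp L \<tau> :: real
  assumes dim: "CARD('n) \<ge> 3"
    and D_borel [measurable]: "D \<in> sets borel" and D_ball: "D \<subseteq> cball 0 \<rho>" and \<rho>: "\<rho> > 0"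
    and D_pos: "measure lborel D > 0"
    and \<beta>: "\<beta> > 0" and b: "b > 0" and cm: "cm > 0" and cp: "cp > 0" and L: "L \<ge> 0"
    and \<tau>: "\<tau> > 0" "\<tau> \<le> \<beta>"
    and \<eta>_mono: "\<And>s t. - \<beta> \<le> s \<Longrightarrow> s \<le> t \<Longrightarrow> \<eta> s \<le> \<eta> t"
    and \<eta>_bound: "\<And>t. 0 \<le> \<eta> t" "\<And>t. \<eta> t \<le> 1"
    and \<eta>_lower: "\<And>s t. 0 \<le> s \<Longrightarrow> s \<le> t \<Longrightarrow> t \<le> 2 * b \<Longrightarrow> cm * (t - s) \<le> \<eta> t - \<eta> s"
    and \<eta>_upper: "\<And>s t. 0 \<le> s \<Longrightarrow> s \<le> b \<Longrightarrow> s \<le> t \<Longrightarrow> \<eta> t - \<eta> s \<le> cp * (t - s)"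
    and \<eta>_deriv: "\<And>s. 0 \<le> s \<Longrightarrow> s \<le> b \<Longrightarrow> (\<eta> has_real_derivative \<eta>' s) (at s)"
    and \<eta>'_cont: "continuous_on {0..b} \<eta>'" and \<eta>'_lower: "\<And>s. 0 \<le> s \<Longrightarrow> s \<le> b \<Longrightarrow> \<eta>' s \<ge> cm"
    and \<eta>_lip: "\<And>s t. 0 \<le> s \<Longrightarrow> s \<le> b \<Longrightarrow> \<bar>t\<bar> \<le> \<tau> \<Longrightarrow> \<bar>\<eta> (s + t) - \<eta> s\<bar> \<le> L * \<bar>t\<bar>"
begin

definition constr :: "(real ^ 'n \<Rightarrow> real) \<Rightarrow> real" where
  "constr f = (LINT z|lborel. indicator D z * \<eta> (f z))"

text \<open>The Borel form of \<open>is_minimizer\<close>: nonnegative everywhere, the constraint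
  multiplied by the volume of D, and the energy without its constant factor.\<close>

definition minimizer :: "real \<Rightarrow> (real ^ 'n \<Rightarrow> real) \<Rightarrow> (real ^ 'n \<Rightarrow> real ^ 'n) \<Rightarrow> bool" where
  "minimizer \<nu> f F \<longleftrightarrow> D1_pair f F \<and> (\<forall>z. f z \<ge> 0) \<and> constr f \<ge> \<nu> * measure lborel D \<and>
    (\<forall>g G. D1_pair g G \<longrightarrow> (\<forall>z. g z \<ge> 0) \<longrightarrow> constr g \<ge> \<nu> * measure lborel D \<longrightarrow> energy F \<le> energy G)"

section \<open>The comparison function and its constants\<close>

definition cap :: "real ^ 'n \<Rightarrow> real" where "cap = bubble 1 0"
definition capE :: real where "capE = energy (grad cap)"
text \<open>\<open>m\<close> and \<open>qm\<close> are the values of the bubble and of its density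
  at distance \<open>\<rho>\<close> from the origin. Both functions decrease radially, so these are
  lower bounds on D.\<close>

definition m :: real where "m = (\<rho>\<^sup>2 + 1) powr (1 - real CARD('n) / 2)"
definition qm :: real where "qm = real CARD('n) * (real CARD('n) - 2) * (\<rho>\<^sup>2 + 1) powr (- 1 - real CARD('n) / 2)"
text \<open>Adding \<open>s * cap\<close> raises the constraint by at least
  \<open>cm * m * s * measure lborel D\<close>; the value \<open>s = A1 * J\<close> makes this equal
  to a loss of \<open>cp * J\<close>.\<close>

definition A1 :: real where "A1 = cp / (cm * m * measure lborel D)"
text \<open>\<open>K\<close> and \<open>\<delta>1\<close> are what the energy comparison in the proof of \<open>f_le_cap\<close> requires.\<close>

definition K :: real where "K = A1 * capE * (2 + A1 * capE / qm) / (2 * qm * cm * m) + 1"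
definition \<delta>1 :: real where
  "\<delta>1 = min (2 * b * cm * m) (min (b / K) (b * qm * cm * m / (A1 * capE + 1)))"

lemma cap_D1: "D1_pair cap (grad cap)"
  unfolding cap_def by (rule bubble_D1_pair[OF dim]) simp

lemma cap_pos: "cap z > 0" and cap_le_1: "cap z \<le> 1"
proof -
  show "cap z > 0" using pos_sq[of 1 z] by (simp add: cap_def bubble_def)
  have "((norm z)\<^sup>2 + 1) powr (1 - real CARD('n) / 2) \<le> ((norm z)\<^sup>2 + 1) powr 0"
    using dim by (intro powr_mono) auto
  then show "cap z \<le> 1" using pos_sq[of 1 z] by (simp add: cap_def bubble_def)
qed

lemma D_normD: "z \<in> D \<Longrightarrow> norm z \<le> \<rho>"
  using D_ball by auto

lemma D_norm: "z \<in> D \<Longrightarrow> (norm z)\<^sup>2 + 1 \<le> \<rho>\<^sup>2 + 1"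
  using D_ball by (auto intro!: power_mono)

lemma cap_ge: "z \<in> D \<Longrightarrow> m \<le> cap z"
  unfolding m_def cap_def bubble_def using dim D_norm[of z] pos_sq[of 1 z]
  by simp (intro powr_mono2', auto)

lemma density_ge: "z \<in> D \<Longrightarrow> qm \<le> bubble_density 1 z"
  unfolding qm_def bubble_density_def using dim D_norm[of z] pos_sq[of 1 z]
  by simp (intro mult_left_mono powr_mono2', auto)

lemma m_pos: "m > 0" and qm_pos: "qm > 0"
  using dim pos_sq[of 1 "\<rho>"] by (auto simp: m_def qm_def)

lemma A1_pos: "A1 > 0"
  using cp cm m_pos D_pos by (simp add: A1_def)

lemma capE_nonneg: "capE \<ge> 0"
  by (simp add: capE_def energy_nonneg)

lemma K_pos: "K > 0"
  unfolding K_def using A1_pos capE_nonneg qm_pos cm m_pos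
  by (intro add_nonneg_pos divide_nonneg_nonneg mult_nonneg_nonneg add_nonneg_nonneg) auto

lemma \<delta>1_pos: "\<delta>1 > 0"
  unfolding \<delta>1_def using b cm m_pos K_pos qm_pos A1_pos capE_nonneg
  by (auto intro!: divide_pos_pos mult_pos_pos add_nonneg_pos mult_nonneg_nonneg)

lemma \<eta>_comp_borel:
  assumes [measurable]: "f \<in> borel_measurable borel" and "\<And>z. f z \<ge> - \<beta>"
  shows "(\<lambda>z. \<eta> (f z)) \<in> borel_measurable borel"
proof -
  \<comment> \<open>\<open>\<eta>\<close> is monotone only from \<open>- \<beta>\<close> on;
    freezing it below gives a monotone, hence Borel, function with the same values on the range of
    f.\<close>
  have "mono (\<lambda>t. \<eta> (max (- \<beta>) t))" by (intro monoI \<eta>_mono) auto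
  then have [measurable]: "(\<lambda>t. \<eta> (max (- \<beta>) t)) \<in> borel_measurable borel" by (rule borel_measurable_mono)
  have "(\<lambda>z. (\<lambda>t. \<eta> (max (- \<beta>) t)) (f z)) \<in> borel_measurable borel" by measurable
  moreover have "(\<lambda>z. (\<lambda>t. \<eta> (max (- \<beta>) t)) (f z)) = (\<lambda>z. \<eta> (f z))"
    using assms(2) by (simp add: max_absorb2)
  ultimately show ?thesis by simp
qed

lemma D_integrable:
  fixes f :: "real ^ 'n \<Rightarrow> real"
  assumes [measurable]: "f \<in> borel_measurable borel" and "\<And>z. z \<in> D \<Longrightarrow> \<bar>f z\<bar> \<le> B"
  shows "integrable lborel (\<lambda>z. indicator D z * f z)"
proof (rule integrable_bounded_support[of _ "max B 0" \<rho>])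
  show "norm (indicator D z * f z) \<le> max B 0" for z
    using assms(2)[of z] by (auto simp: indicator_def)
  show "indicator D z * f z = 0" if "norm z > \<rho>" for z
    using that D_ball by (auto simp: indicator_def)
qed simp

lemma constr_integrable:
  assumes "f \<in> borel_measurable borel" "\<And>z. f z \<ge> - \<beta>"
  shows "integrable lborel (\<lambda>z. indicator D z * \<eta> (f z))"
  using \<eta>_bound by (intro D_integrable[of _ 1] \<eta>_comp_borel assms) (auto simp: abs_of_nonneg)

lemma D_ind_integrable: "integrable lborel (\<lambda>z. indicator D z :: real)"
  using D_integrable[of "\<lambda>_. 1" 1] by simp

lemma D1_loc_integrable:
  assumes "D1_pair f F"
  shows "integrable lborel (\<lambda>z. indicator D z * f z)"
proof -
  have [measurable]: "f \<in> borel_measurable borel" by (rule D1_pair_borel[OF assms])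
  show ?thesis
    by (rule Bochner_Integration.integrable_bound[OF loc_intD[OF wgrad_loc_int(1)[OF D1_pairD(1)[OF assms]], of \<rho>]])
       (use D_normD in \<open>auto simp: indicator_def\<close>)
qed

section \<open>A fixed minimizer: energy, upper bound and Euler-Lagrange equation\<close>

context
  fixes \<delta> :: real and f :: "real ^ 'n \<Rightarrow> real" and F :: "real ^ 'n \<Rightarrow> real ^ 'n"
  assumes \<delta>: "0 \<le> \<delta>" "\<delta> \<le> \<delta>1" and min: "minimizer (\<eta> 0 + \<delta>) f F"
begin

lemma f_D1: "D1_pair f F" and f_nonneg: "f z \<ge> 0"
  and f_constr: "constr f \<ge> (\<eta> 0 + \<delta>) * measure lborel D"
  and f_min: "D1_pair g G \<Longrightarrow> (\<And>z. g z \<ge> 0) \<Longrightarrow> constr g \<ge> (\<eta> 0 + \<delta>) * measure lborel D \<Longrightarrow> energy F \<le> energy G"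
  using min by (auto simp: minimizer_def)

lemma f_borel [measurable]: "f \<in> borel_measurable borel"
  by (rule D1_pair_borel[OF f_D1])

lemma F_sqint: "sqint F"
  by (rule D1_pairD(2)[OF f_D1])

lemma cap_sqint: "sqint (grad cap)"
  by (rule D1_pairD(2)[OF cap_D1])

text \<open>The multiple of \<open>cap\<close> that is admissible by the lower slope: on D it is at
  least \<open>s0 * m\<close>, which raises \<open>\<eta>\<close> by
  \<open>cm * m * s0 = \<delta>\<close>.\<close>

definition s0 :: real where "s0 = \<delta> / (cm * m)"

text \<open>The three terms of the minimum \<open>\<delta>1\<close> yield, in order,
  \<open>s0 \<le> 2 * b\<close>, \<open>K * \<delta> \<le> b\<close> and the bound on the repair
  coefficient. The \<open>+ 1\<close> in the last one keeps its denominator positive, as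
  \<open>capE\<close> is only known to be nonnegative.\<close>

lemma s0: "0 \<le> s0" "s0 \<le> 2 * b" "cm * m * s0 = \<delta>" "A1 * (s0 * capE / qm) \<le> b" "K * \<delta> \<le> b"
proof -
  have p: "cm * m > 0" using cm m_pos by simp
  show "0 \<le> s0" using \<delta> p by (simp add: s0_def)
  show "cm * m * s0 = \<delta>" using cm m_pos by (simp add: s0_def)
  show "s0 \<le> 2 * b" using \<delta> p by (simp add: s0_def \<delta>1_def field_simps)
  have "\<delta> \<le> b / K" using \<delta> by (simp add: \<delta>1_def)
  then show "K * \<delta> \<le> b" using K_pos by (simp add: field_simps)
  have ae: "A1 * capE \<ge> 0" using A1_pos capE_nonneg by simp
  have "\<delta> \<le> b * qm * cm * m / (A1 * capE + 1)" using \<delta> by (simp add: \<delta>1_def)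
  then have "\<delta> * (A1 * capE + 1) \<le> b * qm * cm * m" using ae by (simp add: pos_le_divide_eq)
  moreover have "\<delta> * (A1 * capE) \<le> \<delta> * (A1 * capE + 1)" using \<delta> by (intro mult_left_mono) auto
  ultimately have "\<delta> * (A1 * capE) \<le> b * (qm * (cm * m))" by (simp add: mult_ac)
  then have "\<delta> * (A1 * capE) / (qm * (cm * m)) \<le> b" using qm_pos p by (simp add: pos_divide_le_eq)
  moreover have "A1 * (s0 * capE / qm) = \<delta> * (A1 * capE) / (qm * (cm * m))" by (simp add: s0_def mult_ac)
  ultimately show "A1 * (s0 * capE / qm) \<le> b" by simp
qed

lemma energy_F_le: "energy F \<le> s0\<^sup>2 * capE"
proof -
  have [measurable]: "cap \<in> borel_measurable borel" by (rule D1_pair_borel[OF cap_D1])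
  have nn: "0 \<le> s0 * cap z" for z using s0(1) cap_pos[of z] by simp
  have i: "integrable lborel (\<lambda>z. indicator D z * \<eta> (s0 * cap z))"
    using nn \<beta> by (intro constr_integrable) (auto intro: order_trans[of _ 0])
  have "(\<eta> 0 + \<delta>) * measure lborel D = (LINT z|lborel. (\<eta> 0 + \<delta>) * indicator D z)" by simp
  also have "\<dots> \<le> constr (\<lambda>z. s0 * cap z)"
    unfolding constr_def
  proof (rule integral_mono)
    fix z
    have "\<eta> 0 + \<delta> \<le> \<eta> (s0 * cap z)" if z: "z \<in> D"
    proof -
      have "s0 * cap z \<le> 2 * b" using s0(1,2) cap_le_1[of z] mult_left_le[of "cap z" s0] by linarith
      then have "cm * (s0 * cap z - 0) \<le> \<eta> (s0 * cap z) - \<eta> 0" using nn by (intro \<eta>_lower) auto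
      moreover have "cm * (s0 * m) \<le> cm * (s0 * cap z)"
        using cm s0(1) cap_ge[OF z] by (intro mult_left_mono) auto
      ultimately show ?thesis using s0(3) by (simp add: mult_ac)
    qed
    then show "(\<eta> 0 + \<delta>) * indicator D z \<le> indicator D z * \<eta> (s0 * cap z)" by (auto simp: indicator_def)
  qed (use i D_ind_integrable in auto)
  finally have "energy F \<le> energy (\<lambda>z. s0 *\<^sub>R grad cap z)"
    using f_min[OF D1_pair_cmult[OF cap_D1, of s0]] nn by blast
  then show ?thesis by (simp add: energy_def capE_def power_mult_distrib)
qed

lemma green_cap:
  assumes "D1_pair g G" "\<And>z. g z \<ge> 0"
  shows "integrable lborel (\<lambda>z. g z * bubble_density 1 z)" "ip G (grad cap) = (LINT z|lborel. g z * bubble_density 1 z)"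
  using green_bubble[OF dim zero_less_one assms, of 0] by (simp_all add: cap_def)

text \<open>Superharmonicity of \<open>cap\<close> at work: pairing a gradient with that of
  \<open>cap\<close> integrates g against a nonnegative density, which is at least \<open>qm\<close>
  on D. So the pairing controls the L1 norm on D.\<close>

lemma density_D:
  assumes "D1_pair g G" "\<And>z. g z \<ge> 0"
  shows "qm * (LINT z|lborel. indicator D z * g z) \<le> ip G (grad cap)"
proof -
  have "qm * (LINT z|lborel. indicator D z * g z) = (LINT z|lborel. qm * (indicator D z * g z))" by simp
  also have "\<dots> \<le> (LINT z|lborel. g z * bubble_density 1 z)"
  proof (rule integral_mono)
    show "qm * (indicator D z * g z) \<le> g z * bubble_density 1 z" for z
      using mult_left_mono[OF density_ge[of z] assms(2)[of z]] bubble_density_nonneg[OF dim, of 1 z] assms(2)[of z]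
      by (auto simp: indicator_def mult.commute)
  qed (use green_cap(1)[OF assms] D1_loc_integrable[OF assms(1)] in auto)
  finally show ?thesis using green_cap(2)[OF assms] by simp
qed

text \<open>Linear in \<delta>, although the energy of the minimizer is only compared quadratically;
  this linearity lets the comparison in \<open>f_le_cap\<close> close.\<close>

lemma ip_F_cap: "ip F (grad cap) \<le> s0 * capE"
  unfolding capE_def using energy_F_le s0(1) by (intro ip_le F_sqint cap_sqint) (auto simp: capE_def)

text \<open>Replacing \<open>f\<close> by its minimum with \<open>w = K \<delta> cap\<close> costs \<open>cp\<close> times the integral of the excess \<open>h\<close> in
  the constraint; adding \<open>s cap\<close> makes up for it. Comparing energies forces \<open>h = 0\<close>.\<close>

lemma f_le_cap: "AE z in lborel. f z \<le> K * \<delta> * cap z"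
proof -
  define \<Lambda> where "\<Lambda> = K * \<delta>"
  have \<Lambda>: "0 \<le> \<Lambda>" "\<Lambda> \<le> b" using K_pos \<delta>(1) s0(5) by (auto simp: \<Lambda>_def)
  let ?w = "\<lambda>z. \<Lambda> * cap z" and ?W = "\<lambda>z. \<Lambda> *\<^sub>R grad cap z"
  have w: "0 \<le> ?w z" "?w z \<le> b" for z
    using \<Lambda> cap_pos[of z] cap_le_1[of z] mult_left_le[of "cap z" \<Lambda>] by auto
  have wD: "D1_pair ?w ?W" by (rule D1_pair_cmult[OF cap_D1])
  have [measurable]: "cap \<in> borel_measurable borel" by (rule D1_pair_borel[OF cap_D1])
  obtain P Q where P: "D1_pair (\<lambda>z. max (f z) (?w z)) P" and Q: "D1_pair (\<lambda>z. min (f z) (?w z)) Q"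
    and PQ: "energy P + energy Q \<le> energy F + energy ?W"
    by (rule D1_pair_max_min[OF f_D1 wD])
  let ?h = "\<lambda>z. max (f z) (?w z) - ?w z" and ?H = "\<lambda>z. P z - ?W z"
  have h: "D1_pair ?h ?H" by (rule D1_pair_diff[OF P wD])
  have h0: "?h z \<ge> 0" for z by simp
  have Q0: "min (f z) (?w z) \<ge> 0" for z using f_nonneg[of z] w(1)[of z] by simp
  define J where "J = (LINT z|lborel. indicator D z * ?h z)"
  have J0: "J \<ge> 0" unfolding J_def by (intro integral_nonneg_AE AE_I2) (auto simp: indicator_def)
  \<comment> \<open>The repair coefficient that compensates the largest possible loss
    \<open>cp * J\<close>. The bound on \<open>J\<close> below shows that it is itself of order
    \<delta>.\<close>
  define s where "s = A1 * J"
  have s_nn: "s \<ge> 0" using A1_pos J0 by (simp add: s_def)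
  have "J \<le> (LINT z|lborel. indicator D z * f z)"
    unfolding J_def
  proof (rule integral_mono[OF D1_loc_integrable[OF h] D1_loc_integrable[OF f_D1]])
    show "indicator D z * ?h z \<le> indicator D z * f z" for z
      using f_nonneg[of z] w(1)[of z] by (auto simp: indicator_def max_def)
  qed
  also have "\<dots> \<le> s0 * capE / qm"
    using density_D[OF f_D1 f_nonneg] ip_F_cap qm_pos by (simp add: field_simps)
  finally have "J \<le> s0 * capE / qm" .
  then have sJ: "s \<le> A1 * (s0 * capE / qm)" unfolding s_def using A1_pos by (intro mult_left_mono) auto
  then have sb: "s \<le> b" using s0(4) by linarith
  let ?g = "\<lambda>z. min (f z) (?w z) + s * cap z" and ?G = "\<lambda>z. Q z + s *\<^sub>R grad cap z"
  have g: "D1_pair ?g ?G" by (intro D1_pair_add Q D1_pair_cmult cap_D1)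
  have g0: "?g z \<ge> 0" for z using Q0[of z] s_nn cap_pos[of z] by (simp add: add_nonneg_nonneg)
  \<comment> \<open>The truncation loses at most \<open>cp\<close> times the excess, by the upper
    slope, whose base point is at most b while f is unrestricted. The repair gains at least
    \<open>cm * m * s\<close>: both summands of the competitor are at most b, so the lower slope
    applies up to 2 b.\<close>
  have pt: "\<eta> (f z) + cm * m * s - cp * ?h z \<le> \<eta> (?g z)" if z: "z \<in> D" for z
  proof -
    have "s * cap z \<le> b" using sb s_nn cap_le_1[of z] mult_left_le[of "cap z" s] by linarith
    moreover have mw: "min (f z) (?w z) \<le> b" using w(2)[of z] by simp
    ultimately have "cm * (?g z - min (f z) (?w z)) \<le> \<eta> (?g z) - \<eta> (min (f z) (?w z))"
      using Q0[of z] s_nn cap_pos[of z] by (intro \<eta>_lower) auto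
    moreover have "cm * (s * m) \<le> cm * (s * cap z)" using cm s_nn cap_ge[OF z] by (intro mult_left_mono) auto
    moreover have "\<eta> (f z) - \<eta> (min (f z) (?w z)) \<le> cp * (f z - min (f z) (?w z))"
      using Q0[of z] mw by (intro \<eta>_upper) auto
    moreover have "f z - min (f z) (?w z) = ?h z" by (simp add: min_def max_def)
    ultimately show ?thesis by (simp add: mult_ac)
  qed
  have "constr f = constr f + cm * m * s * measure lborel D - cp * J"
    using cm m_pos D_pos by (simp add: s_def A1_def)
  also have "\<dots> = (LINT z|lborel. indicator D z * \<eta> (f z) + cm * m * s * indicator D z - cp * (indicator D z * ?h z))"
  proof -
    have "integrable lborel (\<lambda>z. indicator D z * \<eta> (f z))"
      using f_nonneg \<beta> by (intro constr_integrable f_borel) (auto intro: order_trans[of _ 0])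
    then show ?thesis
      using D1_loc_integrable[OF h] D_ind_integrable by (simp add: constr_def J_def)
  qed
  also have "\<dots> \<le> constr ?g"
    unfolding constr_def
  proof (rule integral_mono)
    have "integrable lborel (\<lambda>z. indicator D z * \<eta> (f z))"
      using f_nonneg \<beta> by (intro constr_integrable f_borel) (auto intro: order_trans[of _ 0])
    then show "integrable lborel (\<lambda>z. indicator D z * \<eta> (f z) + cm * m * s * indicator D z - cp * (indicator D z * ?h z))"
      using D1_loc_integrable[OF h] D_ind_integrable by simp
    show "integrable lborel (\<lambda>z. indicator D z * \<eta> (?g z))"
      using g0 \<beta> D1_pair_borel[OF g] by (intro constr_integrable) (auto intro: order_trans[of _ 0])
    show "indicator D z * \<eta> (f z) + cm * m * s * indicator D z - cp * (indicator D z * ?h z) \<le> indicator D z * \<eta> (?g z)" for z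
      using pt[of z] by (cases "z \<in> D") simp_all
  qed
  finally have "energy F \<le> energy ?G" using f_min[OF g g0] f_constr by linarith
  also have "energy ?G = energy Q + 2 * s * ip Q (grad cap) + s\<^sup>2 * capE"
    unfolding capE_def by (rule sqint_add_scale(2)[OF D1_pairD(2)[OF Q] cap_sqint])
  finally have 1: "energy F \<le> energy Q + 2 * s * ip Q (grad cap) + s\<^sup>2 * capE" .
  \<comment> \<open>The maximum equals w + h and its energy is expanded about w. Adding
    \<open>PQ\<close> to the minimality inequality cancels the energies of f, of the minimum and of
    w, leaving only the energy of h and the pairings.\<close>
  have "energy P = energy ?W + 2 * ip ?W ?H + energy ?H"
    using sqint_add_scale(2)[OF D1_pairD(2)[OF wD] D1_pairD(2)[OF h], of 1] by simp
  moreover have "ip ?W ?H = \<Lambda> * ip ?H (grad cap)"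
    by (simp add: ip_def inner_commute)
  ultimately have 2: "energy ?H + 2 * (\<Lambda> * ip ?H (grad cap)) \<le> 2 * s * ip Q (grad cap) + s\<^sup>2 * capE"
    using 1 PQ by linarith
  have "qm * J \<le> ip ?H (grad cap)" unfolding J_def by (rule density_D[OF h h0])
  then have 3: "\<Lambda> * (qm * J) \<le> \<Lambda> * ip ?H (grad cap)" using \<Lambda> by (intro mult_left_mono)
  have "ip Q (grad cap) = (LINT z|lborel. min (f z) (?w z) * bubble_density 1 z)" by (rule green_cap(2)[OF Q Q0])
  also have "\<dots> \<le> (LINT z|lborel. f z * bubble_density 1 z)"
    using bubble_density_nonneg[OF dim]
    by (intro integral_mono green_cap(1)[OF Q Q0] green_cap(1)[OF f_D1 f_nonneg] mult_right_mono) auto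
  also have "\<dots> \<le> s0 * capE" using green_cap(2)[OF f_D1 f_nonneg] ip_F_cap by simp
  finally have 4: "2 * s * ip Q (grad cap) \<le> 2 * s * (s0 * capE)" using s_nn by (intro mult_left_mono) auto
  have 5: "s\<^sup>2 * capE \<le> s * (A1 * (s0 * capE / qm)) * capE"
    unfolding power2_eq_square using sJ s_nn capE_nonneg by (intro mult_right_mono mult_left_mono)
  \<comment> \<open>Both sides are multiples of \<delta> J, through \<open>s = A1 * J\<close> and
    \<open>s0 = \<delta> / (cm * m)\<close>. The first summand of \<open>K\<close> is the
    coefficient for which they agree.\<close>
  have 6: "2 * s * (s0 * capE) + s * (A1 * (s0 * capE / qm)) * capE \<le> 2 * (\<Lambda> * (qm * J))"
  proof -
    have "2 * s * (s0 * capE) + s * (A1 * (s0 * capE / qm)) * capE =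
        (A1 * capE * (2 + A1 * capE / qm)) * s0 * J" by (simp add: s_def algebra_simps)
    also have "\<dots> = 2 * ((A1 * capE * (2 + A1 * capE / qm) / (2 * qm * cm * m)) * \<delta> * (qm * J))"
      using qm_pos cm m_pos by (simp add: s0_def)
    also have "\<dots> \<le> 2 * (K * \<delta> * (qm * J))"
      using \<delta>(1) qm_pos J0 by (intro mult_left_mono mult_right_mono) (auto simp: K_def)
    finally show ?thesis by (simp add: \<Lambda>_def)
  qed
  have "energy ?H \<le> 0" using 2 3 4 5 6 by linarith
  from D1_pair_energy_0[OF h this] show ?thesis
    by eventually_elim (simp add: \<Lambda>_def max_def split: if_splits)
qed

lemma f_le_b: "AE z in lborel. f z \<le> b"
  using f_le_cap
proof eventually_elim
  case (elim z)
  have "K * \<delta> * cap z \<le> K * \<delta>" using K_pos \<delta>(1) cap_pos[of z] cap_le_1[of z] by (intro mult_left_le) auto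
  then show ?case using elim s0(5) by linarith
qed

text \<open>The derivative of the integrand of the constraint at f. Clamping at b changes it only on
  a null set and keeps the argument in the interval on which \<open>\<eta>'\<close> is continuous,
  so that the bounds hold everywhere.\<close>

definition dens :: "real ^ 'n \<Rightarrow> real" where
  "dens y = indicator D y * \<eta>' (min (f y) b)"

lemma clamp: "0 \<le> min (f y) b" "min (f y) b \<le> b"
  using f_nonneg[of y] b by auto

lemma dens_borel [measurable]: "dens \<in> borel_measurable borel"
proof -
  have "continuous_on UNIV (\<lambda>t. \<eta>' (max 0 (min t b)))"
    using b by (intro continuous_on_compose2[OF \<eta>'_cont] continuous_intros) auto
  then have [measurable]: "(\<lambda>t. \<eta>' (max 0 (min t b))) \<in> borel_measurable borel"
    by (rule borel_measurable_continuous_onI)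
  have "dens = (\<lambda>y. indicator D y * (\<lambda>t. \<eta>' (max 0 (min t b))) (f y))"
    using clamp by (simp add: dens_def fun_eq_iff max_absorb2)
  then show ?thesis by simp
qed

lemma dens_bound: "\<exists>M. \<forall>y. \<bar>dens y\<bar> \<le> M"
proof -
  have "compact (\<eta>' ` {0..b})" by (intro compact_continuous_image \<eta>'_cont) auto
  then obtain M where M: "M > 0" "\<forall>t\<in>\<eta>' ` {0..b}. norm t \<le> M" using compact_imp_bounded bounded_pos by metis
  have "\<bar>dens y\<bar> \<le> M" for y
    using M clamp[of y] by (auto simp: dens_def indicator_def)
  then show ?thesis by blast
qed

lemma dens_integrable:
  assumes [measurable]: "h \<in> borel_measurable borel" and "\<And>z. \<bar>h z\<bar> \<le> B"
  shows "integrable lborel (\<lambda>y. dens y * h y)"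
proof -
  obtain M where M: "\<And>y. \<bar>dens y\<bar> \<le> M" using dens_bound by blast
  have M0: "M \<ge> 0" using order_trans[OF abs_ge_zero M] .
  have "integrable lborel (\<lambda>y. indicator D y * (dens y * h y))"
  proof (rule D_integrable)
    show "\<bar>dens z * h z\<bar> \<le> M * B" for z unfolding abs_mult using M assms(2) M0 by (intro mult_mono) auto
  qed simp
  moreover have "indicator D y * (dens y * h y) = dens y * h y" for y by (simp add: dens_def indicator_def)
  ultimately show ?thesis by simp
qed

text \<open>The variation \<open>\<bar>f + t h\<bar>\<close> stays nonnegative without increasing the energy, so that no sign
  condition on \<open>h\<close> is needed.\<close>

lemma first_variation:
  assumes h: "D1_pair h H" and B: "\<And>z. \<bar>h z\<bar> \<le> B" and pos: "(LINT y|lborel. dens y * h y) > 0"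
  shows "ip F H \<ge> 0"
proof -
  have [measurable]: "h \<in> borel_measurable borel" by (rule D1_pair_borel[OF h])
  have B0: "B \<ge> 0" using order_trans[OF abs_ge_zero B] .
  \<comment> \<open>Scaled so that \<open>\<bar>t n * h z\<bar> \<le> \<tau>\<close> for all n and
    z, which keeps the variation in the range of the Lipschitz bound and above
    \<open>- \<beta>\<close>.\<close>
  define t where "t n = (\<tau> / (B + 1)) * (1 / real (Suc n))" for n
  have t0: "t n > 0" for n using \<tau> B0 by (simp add: t_def)
  have tB: "t n * B \<le> \<tau>" for n
  proof -
    have "t n * B \<le> (\<tau> / (B + 1)) * 1 * B"
      unfolding t_def using \<tau> B0 by (intro mult_right_mono mult_left_mono) auto
    also have "\<dots> \<le> \<tau>" using \<tau> B0 by (simp add: field_simps)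
    finally show ?thesis .
  qed
  have tlim: "t \<longlonglongrightarrow> 0"
    using tendsto_mult_right_zero[OF LIMSEQ_Suc[OF lim_const_over_n[of 1]], of "\<tau> / (B + 1)"]
    by (simp only: t_def[abs_def])
  have th: "\<bar>t n * h z\<bar> \<le> \<tau>" for n z
  proof -
    have "\<bar>t n * h z\<bar> = t n * \<bar>h z\<bar>" using t0[of n] by (simp add: abs_mult)
    also have "\<dots> \<le> t n * B" using t0[of n] B by (intro mult_left_mono) auto
    finally show ?thesis using tB[of n] by linarith
  qed
  have low: "f z + t n * h z \<ge> - \<beta>" for n z
    using th[of n z] f_nonneg[of z] \<tau>(2) by linarith
  have i0: "integrable lborel (\<lambda>z. indicator D z * \<eta> (f z))"
    using f_nonneg \<beta> by (intro constr_integrable f_borel) (auto intro: order_trans[of _ 0])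
  have it: "integrable lborel (\<lambda>z. indicator D z * \<eta> (f z + t n * h z))" for n
    by (intro constr_integrable low) simp
  let ?q = "\<lambda>n z. (indicator D z * \<eta> (f z + t n * h z) - indicator D z * \<eta> (f z)) / t n"
  have "(\<lambda>n. LINT z|lborel. ?q n z) \<longlonglongrightarrow> (LINT y|lborel. dens y * h y)"
  proof (rule integral_dominated_convergence[where w = "\<lambda>z. (L * B) * indicator D z"])
    show "integrable lborel (\<lambda>z. (L * B) * indicator D z)" by (intro integrable_mult_right D_ind_integrable)
    show "AE z in lborel. norm (?q n z) \<le> (L * B) * indicator D z" for n
      using f_le_b
    proof eventually_elim
      case (elim z)
      have "\<bar>\<eta> (f z + t n * h z) - \<eta> (f z)\<bar> \<le> L * \<bar>t n * h z\<bar>"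
        using elim f_nonneg th by (intro \<eta>_lip) auto
      also have "\<dots> = L * \<bar>h z\<bar> * t n" using t0[of n] by (simp add: abs_mult)
      also have "\<dots> \<le> L * B * t n" using L B t0[of n] by (intro mult_right_mono mult_left_mono) auto
      finally have "\<bar>\<eta> (f z + t n * h z) - \<eta> (f z)\<bar> / t n \<le> L * B" using t0[of n] by (simp add: pos_divide_le_eq)
      then show ?case using t0[of n] by (cases "z \<in> D") (auto simp: abs_divide)
    qed
    show "AE z in lborel. (\<lambda>n. ?q n z) \<longlonglongrightarrow> dens z * h z"
      using f_le_b
    proof eventually_elim
      case (elim z)
      show ?case
      proof (cases "z \<in> D \<and> h z \<noteq> 0")
        case False
        then show ?thesis by (auto simp: dens_def)
      next
        case True
        have "((\<lambda>s. (\<eta> (f z + s) - \<eta> (f z)) / s) \<longlongrightarrow> \<eta>' (f z)) (at 0)"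
          using \<eta>_deriv[OF f_nonneg elim] by (simp add: DERIV_def)
        moreover have "filterlim (\<lambda>n. t n * h z) (at 0) sequentially"
          using True t0 tendsto_mult_left_zero[OF tlim, of "h z"]
          by (auto simp: filterlim_at less_imp_neq[symmetric])
        ultimately have "(\<lambda>n. (\<eta> (f z + t n * h z) - \<eta> (f z)) / (t n * h z)) \<longlonglongrightarrow> \<eta>' (f z)"
          by (rule filterlim_compose)
        from tendsto_mult_right[OF this, of "h z"]
        have "(\<lambda>n. (\<eta> (f z + t n * h z) - \<eta> (f z)) / (t n * h z) * h z) \<longlonglongrightarrow> \<eta>' (f z) * h z" .
        moreover have "(\<eta> (f z + t n * h z) - \<eta> (f z)) / (t n * h z) * h z = ?q n z" for n
          using True by simp
        moreover have "dens z = \<eta>' (f z)" using True elim by (simp add: dens_def min_absorb1)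
        ultimately show ?thesis by simp
      qed
    qed
  qed (use i0 it in auto)
  then have "eventually (\<lambda>n. (LINT z|lborel. ?q n z) > 0) sequentially"
    using pos by (rule order_tendstoD)
  \<comment> \<open>A positive derivative of the constraint makes the variation admissible for small
    parameters; minimality then bounds the energy increment from below, and it is divided by the
    parameter before the limit.\<close>
  then have "eventually (\<lambda>n. 2 * ip F H + t n * energy H \<ge> 0) sequentially"
  proof eventually_elim
    case (elim n)
    have "(LINT z|lborel. ?q n z) = (constr (\<lambda>z. f z + t n * h z) - constr f) / t n"
      using i0 it[of n] by (simp add: constr_def)
    then have "constr f < constr (\<lambda>z. f z + t n * h z)"
      using elim t0[of n] by (simp add: zero_less_divide_iff not_less_iff_gr_or_eq)
    moreover have "constr (\<lambda>z. f z + t n * h z) \<le> constr (\<lambda>z. \<bar>f z + t n * h z\<bar>)"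
      unfolding constr_def
    proof (rule integral_mono[OF it])
      show "integrable lborel (\<lambda>z. indicator D z * \<eta> \<bar>f z + t n * h z\<bar>)"
        using \<beta> by (intro constr_integrable) (auto intro: order_trans[of _ 0])
      show "indicator D z * \<eta> (f z + t n * h z) \<le> indicator D z * \<eta> \<bar>f z + t n * h z\<bar>" for z
        using low[where n = n and z = z] by (intro mult_left_mono \<eta>_mono) auto
    qed
    ultimately have adm: "constr (\<lambda>z. \<bar>f z + t n * h z\<bar>) \<ge> (\<eta> 0 + \<delta>) * measure lborel D"
      using f_constr by linarith
    have D: "D1_pair (\<lambda>z. f z + t n * h z) (\<lambda>z. F z + t n *\<^sub>R H z)"
      by (intro D1_pair_add D1_pair_cmult f_D1 h)
    have "energy F \<le> energy (\<lambda>z. F z + t n *\<^sub>R H z)"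
      using f_min[OF D1_pair_abs(1)[OF D] _ adm] D1_pair_abs(2)[OF D] by force
    also have "\<dots> = energy F + 2 * t n * ip F H + (t n)\<^sup>2 * energy H"
      by (rule sqint_add_scale(2)[OF F_sqint D1_pairD(2)[OF h]])
    finally have "0 \<le> t n * (2 * ip F H + t n * energy H)" by (simp add: power2_eq_square algebra_simps)
    then show ?case using t0[of n] by (simp add: zero_le_mult_iff)
  qed
  moreover have "(\<lambda>n. 2 * ip F H + t n * energy H) \<longlonglongrightarrow> 2 * ip F H + 0 * energy H"
    by (intro tendsto_intros tlim)
  ultimately have "0 \<le> 2 * ip F H + 0 * energy H"
    by (intro tendsto_lowerbound[where F = sequentially]) auto
  then show ?thesis by simp
qed

text \<open>The Lagrange multiplier, read off from the test function \<open>cap\<close>, for which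
  the derivative of the constraint is strictly positive by \<open>cap_dens_pos\<close>.\<close>

definition mult :: real where
  "mult = ip F (grad cap) / (LINT y|lborel. dens y * cap y)"

lemma cap_dens_pos: "(LINT y|lborel. dens y * cap y) > 0"
proof -
  have [measurable]: "cap \<in> borel_measurable borel" by (rule D1_pair_borel[OF cap_D1])
  have "0 < cm * m * measure lborel D" using cm m_pos D_pos by simp
  also have "\<dots> = (LINT y|lborel. (cm * m) * indicator D y)" by simp
  also have "\<dots> \<le> (LINT y|lborel. dens y * cap y)"
  proof (rule integral_mono)
    show "integrable lborel (\<lambda>y. cm * m * indicator D y)" by (intro integrable_mult_right D_ind_integrable)
    show "integrable lborel (\<lambda>y. dens y * cap y)"
      using cap_pos cap_le_1 by (intro dens_integrable[of _ 1]) (auto simp: abs_of_pos)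
    show "cm * m * indicator D y \<le> dens y * cap y" for y
      using cm m_pos cap_ge[of y] \<eta>'_lower[OF clamp[of y]]
      by (auto simp: dens_def indicator_def intro!: mult_mono)
  qed
  finally show ?thesis .
qed

text \<open>\<open>first_variation\<close> yields an inequality only for directions that strictly
  raise the constraint. A multiple of \<open>cap\<close> corrects any bounded h to such a direction
  with arbitrarily small derivative; the limit gives one inequality for h, and - h gives the
  other.\<close>

lemma euler_lagrange:
  assumes h: "D1_pair h H" and B: "\<And>z. \<bar>h z\<bar> \<le> B"
  shows "ip F H = mult * (LINT y|lborel. dens y * h y)"
proof -
  let ?l = "\<lambda>h. LINT y|lborel. dens y * h y"
  have [measurable]: "cap \<in> borel_measurable borel" by (rule D1_pair_borel[OF cap_D1])
  have ge: "ip F H \<ge> mult * ?l h" if h: "D1_pair h H" and B: "\<And>z. \<bar>h z\<bar> \<le> B" for h H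
  proof (rule field_le_epsilon)
    fix e :: real assume e: "e > 0"
    define r where "r = e / (\<bar>ip F (grad cap)\<bar> + 1)"
    have r: "r > 0" using e by (simp add: r_def add_nonneg_pos)
    \<comment> \<open>Subtracting the quotient would make the derivative of the constraint zero; the
      surplus r makes it \<open>r * ?l cap\<close>. The size of r ensures that the surplus changes
      the pairing by at most e.\<close>
    define c where "c = - (?l h / ?l cap - r)"
    have [measurable]: "h \<in> borel_measurable borel" by (rule D1_pair_borel[OF h])
    have g: "D1_pair (\<lambda>z. h z + c * cap z) (\<lambda>z. H z + c *\<^sub>R grad cap z)"
      by (intro D1_pair_add D1_pair_cmult h cap_D1)
    have gB: "\<bar>h z + c * cap z\<bar> \<le> B + \<bar>c\<bar>" for z
    proof -
      have "\<bar>c * cap z\<bar> \<le> \<bar>c\<bar>" using cap_pos[of z] cap_le_1[of z] by (simp add: abs_mult mult_left_le)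
      then show ?thesis using B[of z] abs_triangle_ineq[of "h z" "c * cap z"] by linarith
    qed
    have "(LINT y|lborel. dens y * (h y + c * cap y)) = ?l h + c * ?l cap"
    proof -
      have "integrable lborel (\<lambda>y. dens y * h y)" by (rule dens_integrable[OF _ B]) simp
      moreover have "integrable lborel (\<lambda>y. dens y * cap y)"
        using cap_pos cap_le_1 by (intro dens_integrable[of _ 1]) (auto simp: abs_of_pos)
      ultimately show ?thesis by (simp add: distrib_left mult.left_commute)
    qed
    also have "\<dots> = r * ?l cap" using cap_dens_pos by (simp add: c_def field_simps)
    finally have "(LINT y|lborel. dens y * (h y + c * cap y)) > 0" using r cap_dens_pos by simp
    from first_variation[OF g gB this] have "0 \<le> ip F H + c * ip F (grad cap)"
      using ip_add_right[OF D1_pairD(2)[OF h] cap_sqint F_sqint, of c] by simp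
    also have "c * ip F (grad cap) = - (mult * ?l h) + r * ip F (grad cap)"
      by (simp add: c_def mult_def algebra_simps)
    also have "r * ip F (grad cap) \<le> e"
    proof -
      have "r * ip F (grad cap) \<le> r * (\<bar>ip F (grad cap)\<bar> + 1)" using r by (intro mult_left_mono) auto
      also have "\<dots> = e" by (simp add: r_def)
      finally show ?thesis .
    qed
    finally show "mult * ?l h \<le> ip F H + e" by simp
  qed
  have "ip F (\<lambda>z. - 1 *\<^sub>R H z) \<ge> mult * ?l (\<lambda>z. - 1 * h z)"
    using B by (intro ge D1_pair_cmult h) simp
  then have "ip F H \<le> mult * ?l h" by (simp add: ip_def)
  with ge[OF h B] show ?thesis by linarith
qed

text \<open>Testing the Euler-Lagrange equation with the bubbles centered at \<open>x\<close> represents the convolution of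
  \<open>f\<close> with an approximate identity; in the limit the bubbles become the Newtonian kernel.\<close>

lemma bubble_equation:
  assumes e: "e > 0"
  shows "(LINT z|lborel. min (f (x - z)) b * bubble_density e z) = mult * (LINT y|lborel. dens y * bubble e x y)"
proof -
  have B: "\<bar>bubble e x z\<bar> \<le> (e\<^sup>2) powr (1 - real CARD('n) / 2)" for z
    unfolding bubble_def using e dim by (auto intro!: powr_mono2')
  have eq: "(\<lambda>y. min (f y) b * bubble_density e (y - x)) \<in> borel_measurable borel"
    by measurable
  have "mult * (LINT y|lborel. dens y * bubble e x y) = ip F (grad (bubble e x))"
    by (rule euler_lagrange[OF bubble_D1_pair[OF dim e] B, symmetric])
  also have "\<dots> = (LINT y|lborel. f y * bubble_density e (y - x))"
    by (rule green_bubble(2)[OF dim e f_D1 f_nonneg])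
  \<comment> \<open>The bounded function \<open>min f b\<close>, equal to f almost everywhere, makes
    the convolution converge absolutely at every point and supplies the uniform bound for
    \<open>approximate_identity\<close>.\<close>
  also have "\<dots> = (LINT y|lborel. min (f y) b * bubble_density e (y - x))"
  proof (rule integral_cong_AE)
    show "AE y in lborel. f y * bubble_density e (y - x) = min (f y) b * bubble_density e (y - x)"
      using f_le_b by eventually_elim (simp add: min_absorb1)
  qed simp_all
  also have "\<dots> = (LINT z|lborel. min (f (x - z)) b * bubble_density e (x - z - x))"
    using lborel_integral_reflect[OF eq, of x] by simp
  also have "\<dots> = (LINT z|lborel. min (f (x - z)) b * bubble_density e z)"
    by (simp add: bubble_density_def)
  finally show ?thesis by simp
qed

lemma newton_density_dens: "\<exists>M. newton_density dens M \<rho> (real CARD('n))"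
proof -
  obtain M where "\<And>y. \<bar>dens y\<bar> \<le> M" using dens_bound by blast
  then have "newton_density dens M \<rho> (real CARD('n))"
  proof unfold_locales
    fix y :: "real ^ 'n" assume "norm y > \<rho>"
    then have "y \<notin> D" using D_normD[of y] by auto
    then show "dens y = 0" by (simp add: dens_def)
  qed (use dim in auto)
  then show ?thesis by blast
qed

section \<open>From bubbles to the Newtonian potential\<close>

definition mass :: real where
  "mass = (LINT z|lborel. bubble_density 1 (z :: real ^ 'n))"

lemma mass_pos: "mass > 0"
proof -
  have "0 < qm * measure lborel D" using qm_pos D_pos by simp
  also have "\<dots> = (LINT z|lborel. qm * indicator D z)" by simp
  also have "\<dots> \<le> mass"
    unfolding mass_def
  proof (rule integral_mono)
    show "qm * indicator D z \<le> bubble_density 1 z" for z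
      using density_ge[of z] bubble_density_nonneg[OF dim, of 1 z] by (auto simp: indicator_def)
  qed (use D_ind_integrable bubble_density_integrable[OF dim] in auto)
  finally show ?thesis .
qed

text \<open>Every bubble lies below the Newtonian kernel with the same center and converges to it
  off the center, so the integrable potential kernel itself dominates.\<close>

lemma bubbles_tendsto_newton:
  assumes "newton_density dens M \<rho> (real CARD('n))"
  shows "(\<lambda>n. LINT y|lborel. dens y * bubble (1 / real (Suc n)) x y) \<longlonglongrightarrow> newton_density.newton dens (real CARD('n)) x"
proof -
  interpret N: newton_density dens M \<rho> "real CARD('n)" by fact
  let ?e = "\<lambda>n. 1 / real (Suc n)"
  have sq: "((norm (y - x))\<^sup>2) powr (1 - real CARD('n) / 2) = norm (x - y) powr (2 - real CARD('n))" if "y \<noteq> x" for y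
    using that by (simp add: powr_powr norm_minus_commute algebra_simps flip: powr_numeral)
  have ne: "AE y in lborel. y \<noteq> x"
    using AE_lborel_singleton[of x] by auto
  show ?thesis
    unfolding N.newton_def
  proof (rule integral_dominated_convergence[where w = "\<lambda>y. \<bar>dens y * norm (x - y) powr (2 - real CARD('n))\<bar>"])
    show "AE y in lborel. (\<lambda>n. dens y * bubble (?e n) x y) \<longlonglongrightarrow> dens y * norm (x - y) powr (2 - real CARD('n))"
      using ne
    proof eventually_elim
      case (elim y)
      have "(\<lambda>n. ((norm (y - x))\<^sup>2 + (?e n)\<^sup>2) powr (1 - real CARD('n) / 2)) \<longlonglongrightarrow>
          ((norm (y - x))\<^sup>2 + 0\<^sup>2) powr (1 - real CARD('n) / 2)"
        using elim by (intro tendsto_intros LIMSEQ_Suc[OF lim_const_over_n]) auto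
      then show ?case
        using elim by (intro tendsto_intros) (simp add: bubble_def sq)
    qed
    show "AE y in lborel. norm (dens y * bubble (?e n) x y) \<le> \<bar>dens y * norm (x - y) powr (2 - real CARD('n))\<bar>" for n
      using ne
    proof eventually_elim
      case (elim y)
      have "((norm (y - x))\<^sup>2 + (?e n)\<^sup>2) powr (1 - real CARD('n) / 2) \<le> ((norm (y - x))\<^sup>2) powr (1 - real CARD('n) / 2)"
        using elim dim by (intro powr_mono2') auto
      then have "bubble (?e n) x y \<le> norm (x - y) powr (2 - real CARD('n))"
        unfolding bubble_def sq[OF elim] .
      moreover have "bubble (?e n) x y \<ge> 0" by (simp add: bubble_def)
      ultimately show ?case by (simp add: abs_mult mult_left_mono)
    qed
    show "integrable lborel (\<lambda>y. \<bar>dens y * norm (x - y) powr (2 - real CARD('n))\<bar>)"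
      using N.newton_integrable by simp
    show "(\<lambda>y. dens y * bubble (?e n) x y) \<in> borel_measurable lborel" for n
      unfolding bubble_def by simp
  qed simp
qed

text \<open>The convolutions of the minimizer with the bubble densities have two limits: by
  \<open>approximate_identity\<close> they tend to \<open>mass\<close> times the function in L1 on
  balls, and by \<open>bubble_equation\<close> they tend pointwise to \<open>mult\<close> times the
  potential. Fatou's lemma forces the two limits to agree almost everywhere.\<close>

lemma newton_representation:
  assumes N: "newton_density dens M \<rho> (real CARD('n))"
  shows "AE x in lborel. f x = mult / mass * newton_density.newton dens (real CARD('n)) x"
proof -
  define v where "v = newton_density.newton dens (real CARD('n))"
  let ?e = "\<lambda>n. 1 / real (Suc n)"
  let ?g = "\<lambda>x. min (f x) b"
  let ?r = "\<lambda>n x. LINT z|lborel. ?g (x - z) * bubble_density (?e n) z"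
  have g: "loc_int ?g"
    using clamp b by (intro loc_intI_bounded) (auto simp: abs_of_nonneg intro!: exI[of _ b])
  have gi: "integrable lborel (\<lambda>z. ?g (x - z) * bubble_density (?e n) z)" for n x
  proof (rule Bochner_Integration.integrable_bound)
    show "integrable lborel (\<lambda>z :: real ^ 'n. b * bubble_density (?e n) z)"
      using bubble_density_integrable[OF dim, of "?e n"] by simp
    show "AE z in lborel. norm (?g (x - z) * bubble_density (?e n) z) \<le> norm (b * bubble_density (?e n) z)"
      using clamp b bubble_density_nonneg[OF dim] by (intro AE_I2) (simp add: abs_mult abs_of_nonneg mult_right_mono)
  qed simp
  have "(\<integral>\<^sup>+x. indicator (cball 0 R) x * ennreal \<bar>mult * v x - mass * ?g x\<bar> \<partial>lborel) = 0" for R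
  proof -
    have lim: "(\<lambda>n. \<integral>\<^sup>+x. indicator (cball 0 R) x * ennreal \<bar>?r n x - mass * ?g x\<bar> \<partial>lborel) \<longlonglongrightarrow> 0"
    proof (rule approximate_identity[OF g _ _ _ _ gi])
      show "integrable lborel (bubble_density (?e n) :: real ^ 'n \<Rightarrow> real)" for n
        by (rule bubble_density_integrable[OF dim]) simp
      show "bubble_density (?e n) z \<ge> 0" for n and z :: "real ^ 'n" by (rule bubble_density_nonneg[OF dim])
      show "(LINT z|lborel. bubble_density (?e n) (z :: real ^ 'n)) = mass" for n
        unfolding mass_def by (rule bubble_density_mass[OF dim]) simp
      show "(\<lambda>n. LINT z|lborel. indicator {z :: real ^ 'n. norm z > r} z * bubble_density (?e n) z) \<longlonglongrightarrow> 0" if "r > 0" for r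
        by (rule bubble_density_tail[OF dim that])
      fix z :: "real ^ 'n"
      have "(\<integral>\<^sup>+x. indicator (cball 0 R) x * ennreal \<bar>?g (x - z) - ?g x\<bar> \<partial>lborel) \<le>
          (\<integral>\<^sup>+x. ennreal b * indicator (cball 0 R) x \<partial>(lborel :: (real ^ 'n) measure))"
      proof (rule nn_integral_mono)
        fix x
        have "\<bar>?g (x - z) - ?g x\<bar> \<le> b" using clamp[of x] clamp[of "x - z"] by linarith
        then show "indicator (cball 0 R) x * ennreal \<bar>?g (x - z) - ?g x\<bar> \<le> ennreal b * indicator (cball 0 R) x"
          by (auto simp: indicator_def intro: ennreal_leI)
      qed
      also have "\<dots> = ennreal b * emeasure lborel (cball (0 :: real ^ 'n) R)" by (simp add: nn_integral_cmult_indicator)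
      also have "\<dots> = ennreal (b * measure lborel (cball (0 :: real ^ 'n) R))"
      proof -
        have "emeasure lborel (cball (0 :: real ^ 'n) R) \<noteq> \<infinity>"
          using emeasure_bounded_finite[OF bounded_cball, of "0 :: real ^ 'n" R] by auto
        then have "emeasure lborel (cball (0 :: real ^ 'n) R) = ennreal (measure lborel (cball (0 :: real ^ 'n) R))"
          by (intro emeasure_eq_ennreal_measure) simp
        then show ?thesis by (simp only: ennreal_mult''[OF measure_nonneg])
      qed
      finally show "(\<integral>\<^sup>+x. indicator (cball 0 R) x * ennreal \<bar>?g (x - z) - ?g x\<bar> \<partial>lborel) \<le>
          ennreal (b * measure lborel (cball (0 :: real ^ 'n) R))" .
    qed
    have rm: "(\<lambda>x. ?r n x) \<in> borel_measurable borel" for n by measurable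
    have pt: "(\<lambda>n. indicator (cball 0 R) x * ennreal \<bar>?r n x - mass * ?g x\<bar>) \<longlonglongrightarrow>
        indicator (cball 0 R) x * ennreal \<bar>mult * v x - mass * ?g x\<bar>" for x
    proof -
      have "(\<lambda>n. ?r n x) \<longlonglongrightarrow> mult * v x"
        using tendsto_mult_left[OF bubbles_tendsto_newton[OF N, of x], of mult]
        by (simp add: bubble_equation v_def del: of_nat_Suc)
      then have "(\<lambda>n. ennreal \<bar>?r n x - mass * ?g x\<bar>) \<longlonglongrightarrow> ennreal \<bar>mult * v x - mass * ?g x\<bar>"
        by (intro tendsto_intros)
      then show ?thesis by (cases "x \<in> cball 0 R") auto
    qed
    have "(\<integral>\<^sup>+x. indicator (cball 0 R) x * ennreal \<bar>mult * v x - mass * ?g x\<bar> \<partial>lborel) =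
        (\<integral>\<^sup>+x. liminf (\<lambda>n. indicator (cball 0 R) x * ennreal \<bar>?r n x - mass * ?g x\<bar>) \<partial>lborel)"
      using lim_imp_Liminf[OF sequentially_bot pt] by (intro nn_integral_cong) simp
    also have "\<dots> \<le> liminf (\<lambda>n. \<integral>\<^sup>+x. indicator (cball 0 R) x * ennreal \<bar>?r n x - mass * ?g x\<bar> \<partial>lborel)"
      using rm by (intro nn_integral_liminf) simp
    also have "\<dots> = 0" by (rule lim_imp_Liminf[OF sequentially_bot lim])
    finally show ?thesis by simp
  qed
  moreover have vm [measurable]: "v \<in> borel_measurable borel"
  proof -
    interpret N: newton_density dens M \<rho> "real CARD('n)" by fact
    show ?thesis unfolding v_def by (rule borel_measurable_continuous_onI[OF N.newton_continuous])
  qed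
  ultimately have "AE x in lborel. indicator (cball 0 R) x * ennreal \<bar>mult * v x - mass * ?g x\<bar> = 0" for R
    by (subst (asm) nn_integral_0_iff_AE) auto
  then have "AE x in lborel. \<forall>n :: nat. indicator (cball 0 (real n)) x * ennreal \<bar>mult * v x - mass * ?g x\<bar> = 0"
    unfolding AE_all_countable by blast
  with f_le_b show ?thesis
  proof eventually_elim
    case (elim x)
    obtain n :: nat where "norm x \<le> real n" using real_arch_simple by blast
    then have "mult * v x = mass * ?g x" using elim(2)[THEN spec, of n] by (simp add: ennreal_eq_0_iff)
    then show ?case using elim(1) mass_pos by (simp add: v_def field_simps)
  qed
qed

lemma minimizer_regular:
  "\<exists>f'. (AE z in lborel. f z = f' z) \<and> (\<forall>\<alpha>. 0 < \<alpha> \<and> \<alpha> < 1 \<longrightarrow> C1_holder \<alpha> f') \<and>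
    (\<forall>z. 0 \<le> f' z \<and> f' z \<le> min (K * \<delta>) b)"
proof -
  obtain M where N: "newton_density dens M \<rho> (real CARD('n))" using newton_density_dens by blast
  interpret N: newton_density dens M \<rho> "real CARD('n)" by fact
  define f' where "f' z = mult / mass * N.newton z" for z
  have eq: "AE z in lborel. f z = f' z" unfolding f'_def by (rule newton_representation[OF N])
  have c: "continuous_on UNIV f'" unfolding f'_def[abs_def] by (intro continuous_intros N.newton_continuous)
  have "AE z in lborel. f' z \<le> K * \<delta>"
    using eq f_le_cap
  proof eventually_elim
    case (elim z)
    have "K * \<delta> * cap z \<le> K * \<delta>" using K_pos \<delta>(1) cap_pos[of z] cap_le_1[of z] by (intro mult_left_le) auto
    then show ?case using elim by linarith
  qed
  then have up: "f' z \<le> K * \<delta>" for z by (rule AE_le_imp_le[OF c])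
  have "AE z in lborel. - f' z \<le> 0"
    using eq by eventually_elim (use f_nonneg in \<open>metis neg_le_0_iff_le\<close>)
  then have "- f' z \<le> 0" for z by (rule AE_le_imp_le[OF continuous_on_minus[OF c]])
  then have "\<forall>z. 0 \<le> f' z \<and> f' z \<le> min (K * \<delta>) b" using up s0(5) by (auto intro: order_trans)
  with eq show ?thesis
    using N.newton_C1_holder[of _ "mult / mass"] by (auto simp: f'_def[abs_def])
qed

end

end

section \<open>Minimizers for the percolation function\<close>

lemma right_cont_mod_mono:
  assumes "\<And>x y. 0 \<le> x \<Longrightarrow> x \<le> y \<Longrightarrow> \<theta> x \<le> \<theta> y" "\<And>x. \<theta> x \<le> 1" "0 \<le> x" "x \<le> y"
  shows "right_cont_mod \<theta> us x \<le> right_cont_mod \<theta> us y"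
  using assms by (auto simp: right_cont_mod_def)

lemma domain_properties:
  assumes "smooth_bounded_domain U \<or> open_sup_ball U"
  shows "open U" "bounded U"
proof -
  have *: "open {x :: real ^ 'a. infnorm (x - c) < r} \<and> bounded {x. infnorm (x - c) < r}" for c r
  proof
    have "continuous_on UNIV (\<lambda>x :: real ^ 'a. infnorm (x - c))"
      unfolding continuous_on_def by (auto intro!: tendsto_infnorm tendsto_intros)
    then show "open {x :: real ^ 'a. infnorm (x - c) < r}"
      by (intro open_Collect_less continuous_on_const)
    have "{x. infnorm (x - c) < r} \<subseteq> cball c (sqrt DIM(real ^ 'a) * r)"
    proof safe
      fix x assume x: "infnorm (x - c) < r"
      have "norm (x - c) \<le> sqrt DIM(real ^ 'a) * infnorm (x - c)" by (rule norm_le_infnorm)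
      also have "\<dots> \<le> sqrt DIM(real ^ 'a) * r" using x by (intro mult_left_mono) auto
      finally show "x \<in> cball c (sqrt DIM(real ^ 'a) * r)" by (simp add: dist_norm norm_minus_commute)
    qed
    then show "bounded {x. infnorm (x - c) < r}" using bounded_cball bounded_subset by blast
  qed
  show "open U" "bounded U"
    using assms * by (auto simp: smooth_bounded_domain_def open_sup_ball_def)
qed

lemma continuous_compact_bounds:
  fixes g :: "real \<Rightarrow> real"
  assumes "continuous_on {p..q} g" "p \<le> q"
  obtains x y where "x \<in> {p..q}" "y \<in> {p..q}" "\<And>z. z \<in> {p..q} \<Longrightarrow> g x \<le> g z" "\<And>z. z \<in> {p..q} \<Longrightarrow> g z \<le> g y"
proof -
  have ne: "{p..q} \<noteq> {}" "compact {p..q}" using assms(2) by auto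
  obtain x where x: "x \<in> {p..q}" "\<forall>z\<in>{p..q}. g x \<le> g z"
    using continuous_attains_inf[OF ne(2,1) assms(1)] by blast
  obtain y where "y \<in> {p..q}" "\<forall>z\<in>{p..q}. g z \<le> g y"
    using continuous_attains_sup[OF ne(2,1) assms(1)] by blast
  with x that show ?thesis by blast
qed

context variational
begin

text \<open>Competitors in the Borel formulation are admissible in the original one, so minimality
  transfers; the minimizer itself has to be replaced by a Borel representative that is nonnegative
  at every point.\<close>

lemma dirichlet_minimizer:
  fixes \<theta> :: "real \<Rightarrow> real" and u :: real
  assumes \<eta>: "\<And>s. \<eta> s = \<theta> ((sqrt u + s)\<^sup>2)" and mono: "mono_on {0..} \<theta>"
    and \<phi>: "is_minimizer \<theta> u D \<nu> \<phi>"
  obtains f F where "minimizer \<nu> f F" "AE z in lborel. \<phi> z = f z"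
proof -
  \<comment> \<open>\<theta> is monotone on the nonnegative half-line only. It is evaluated at
    squares, so freezing it on negative arguments leaves \<open>\<eta>\<close> unchanged.\<close>
  have "mono (\<lambda>x. \<theta> (max 0 x))" using mono by (auto intro!: monoI elim!: mono_onD)
  then have [measurable]: "(\<lambda>x. \<theta> (max 0 x)) \<in> borel_measurable borel" by (rule borel_measurable_mono)
  have "(\<lambda>s. (\<lambda>x. \<theta> (max 0 x)) ((sqrt u + s)\<^sup>2)) \<in> borel_measurable borel" by measurable
  then have \<eta>_borel [measurable]: "\<eta> \<in> borel_measurable borel" by (simp add: \<eta>[abs_def])
  have mD: "measure lebesgue D = measure lborel D"
    by (simp add: measure_def main_part_sets)
  have adm: "(1 / measure lebesgue D * (LINT z:D|lebesgue. \<theta> ((sqrt u + \<psi> z)\<^sup>2)) \<ge> \<nu>) \<longleftrightarrow>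
      constr g \<ge> \<nu> * measure lborel D"
    if g: "g \<in> borel_measurable borel" "AE z in lborel. \<psi> z = g z" "\<psi> \<in> borel_measurable lebesgue" for \<psi> g
  proof -
    note [measurable] = g(1)
    have "(LINT z:D|lebesgue. \<theta> ((sqrt u + \<psi> z)\<^sup>2)) = (LINT z|lebesgue. indicator D z * \<eta> (\<psi> z))"
      by (simp add: set_lebesgue_integral_def \<eta>)
    also have "\<dots> = (LINT z|lebesgue. indicator D z * \<eta> (g z))"
    proof (rule integral_cong_AE)
      show "AE z in lebesgue. indicator D z * \<eta> (\<psi> z) = indicator D z * \<eta> (g z)"
        using g(2) unfolding AE_lebesgue_iff by (auto elim: eventually_mono)
      show "(\<lambda>z. indicator D z * \<eta> (\<psi> z)) \<in> borel_measurable lebesgue"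
        by (rule borel_measurable_times[OF borel_imp_lebesgue[OF borel_measurable_indicator]
              measurable_compose[OF g(3) \<eta>_borel]]) simp
      show "(\<lambda>z. indicator D z * \<eta> (g z)) \<in> borel_measurable lebesgue"
        by (rule borel_imp_lebesgue) simp
    qed
    also have "\<dots> = constr g" unfolding constr_def by (rule LINT_lebesgue_borel) simp
    finally show ?thesis unfolding mD using D_pos by (simp add: field_simps)
  qed
  from \<phi> have \<phi>D: "\<phi> \<in> D1_space" and \<phi>0: "AE z in lborel. 0 \<le> \<phi> z"
    and \<phi>a: "1 / measure lebesgue D * (LINT z:D|lebesgue. \<theta> ((sqrt u + \<phi> z)\<^sup>2)) \<ge> \<nu>"
    and \<phi>m: "\<And>\<psi>. \<psi> \<in> admissible \<theta> u D \<nu> \<Longrightarrow> dirichlet_energy \<phi> \<le> dirichlet_energy \<psi>"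
    by (auto simp: is_minimizer_def admissible_def AE_lebesgue_iff)
  obtain f0 G where f0: "D1_pair f0 G" "AE x in lborel. \<phi> x = f0 x"
    "dirichlet_energy \<phi> = 1 / (2 * real CARD('n)) * energy G"
    using D1_space_representative[OF \<phi>D] .
  \<comment> \<open>The representative is nonnegative only almost everywhere. Its absolute value is
    nonnegative everywhere, agrees with it almost everywhere and has no more energy.\<close>
  let ?f = "\<lambda>x. \<bar>f0 x\<bar>" and ?F = "\<lambda>x. sgn (f0 x) *\<^sub>R G x"
  note fD = D1_pair_abs[OF f0(1)]
  have eq: "AE z in lborel. \<phi> z = ?f z" using f0(2) \<phi>0 by eventually_elim simp
  have \<phi>_meas: "\<phi> \<in> borel_measurable lebesgue" using \<phi>D by (simp add: D1_space_def locally_integrable_def)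
  have "minimizer \<nu> ?f ?F"
    unfolding minimizer_def
  proof (intro conjI allI impI)
    show "constr ?f \<ge> \<nu> * measure lborel D"
      using adm[OF D1_pair_borel[OF fD(1)] eq \<phi>_meas] \<phi>a by blast
    fix g G' assume g: "D1_pair g G'" "\<forall>z. 0 \<le> g z" "constr g \<ge> \<nu> * measure lborel D"
    note b = D1_pair_borel[OF g(1)]
    have "g \<in> admissible \<theta> u D \<nu>"
      unfolding admissible_def using D1_pair_imp_D1_space(1)[OF g(1)] g(2,3) adm[OF b _ borel_imp_lebesgue[OF b]]
      by auto
    then have "energy G \<le> energy G'"
      using \<phi>m[of g] f0(3) D1_pair_imp_D1_space(2)[OF g(1)] by (simp add: divide_right_mono field_simps)
    with fD(2) show "energy ?F \<le> energy G'" by linarith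
  qed (use fD in auto)
  with eq that show ?thesis by blast
qed

end

theorem theorem0p3:
  fixes M :: "'a measure"
    and \<I> :: "real \<Rightarrow> 'a \<Rightarrow> (int ^ 'n) set"
    and \<theta> :: "real \<Rightarrow> real"
    and us u0 u :: real
    and D U :: "(real ^ 'n) set"
  assumes "CARD('n) \<ge> 3"
    and "random_interlacements M \<I>"
    and "\<theta> = perc_fun M \<I>"
    and "is_critical_level \<theta> us"
    and "smooth_bounded_domain U \<or> open_sup_ball U"
    and "0 \<in> U"
    and "D = closure U"
    and "0 < u0" and "u0 < us"
    and "\<exists>V. open V \<and> {0..u0} \<subseteq> V \<and> C1_real_on (V \<inter> {0..}) \<theta>"
    and "0 < u" and "u < u0"
  shows "\<exists>c1 c2. 0 < c1 \<and> c1 < \<theta> us - \<theta> u \<and> 0 < c2 \<and>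
    (\<forall>\<nu>\<in>{\<theta> u..\<theta> u + c1}. \<forall>\<phi>. is_minimizer (right_cont_mod \<theta> us) u D \<nu> \<phi> \<longrightarrow>
      (\<exists>\<phi>'. (AE z in lebesgue. \<phi> z = \<phi>' z) \<and>
        (\<forall>\<alpha>. 0 < \<alpha> \<and> \<alpha> < 1 \<longrightarrow> C1_holder \<alpha> \<phi>') \<and>
        (\<forall>z. 0 \<le> \<phi>' z \<and> \<phi>' z \<le> min (c2 * (\<nu> - \<theta> u)) (sqrt u0 - sqrt u)))) \<and>
    sqrt u0 - sqrt u < sqrt us - sqrt u"
proof -
  interpret I: interlacements M \<I> by unfold_locales (rule assms(2))
  note \<theta> = assms(3)
  have \<theta>_mono: "\<theta> x \<le> \<theta> y" if "0 \<le> x" "x \<le> y" for x y using I.perc_fun_mono that by (simp add: \<theta>)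
  have \<theta>_le: "\<theta> x \<le> 1" and \<theta>_ge: "0 \<le> \<theta> x" for x using I.perc_fun_le_1 I.perc_fun_nonneg by (simp_all add: \<theta>)
  let ?t = "right_cont_mod \<theta> us"
  have t_mono: "mono_on {0..} ?t"
    by (rule mono_onI) (use right_cont_mod_mono[of \<theta>] \<theta>_mono \<theta>_le in auto)
  obtain V \<theta>' where V: "open V" "{0..u0} \<subseteq> V"
    "\<And>x. x \<in> V \<inter> {0..} \<Longrightarrow> (\<theta> has_real_derivative \<theta>' x) (at x within V \<inter> {0..})"
    "continuous_on (V \<inter> {0..}) \<theta>'"
    using assms(10) by (auto simp: C1_real_on_def)
  have \<theta>_deriv: "(\<theta> has_real_derivative \<theta>' x) (at x)" if "0 < x" "x \<le> u0" for x
  proof -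
    have x: "x \<in> V \<inter> {0<..}" using V(2) that by auto
    have "(\<theta> has_real_derivative \<theta>' x) (at x within V \<inter> {0<..})"
      using V(3)[of x] x by (auto intro: DERIV_subset)
    moreover have "open (V \<inter> {0<..})" using V(1) by (intro open_Int) auto
    ultimately show ?thesis using x by (metis at_within_open)
  qed
  have \<theta>'_pos: "\<theta>' x > 0" if "0 < x" "x \<le> u0" for x
    using I.perc_fun_deriv_pos[of us x "\<theta>' x"] \<theta>_deriv[OF that] assms(4,9) that by (simp add: \<theta>)
  define r where "r = sqrt u"
  \<comment> \<open>Half of the available range: minimizers stay in [0, b], while a truncated
    function plus its repair may reach 2 b, which corresponds to the level
    \<open>u0\<close>.\<close>
  define b where "b = (sqrt u0 - r) / 2"
  have r: "r > 0" "r\<^sup>2 = u" using assms(11) by (simp_all add: r_def)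
  have b: "b > 0" "sqrt u0 = r + 2 * b" using assms(11,12) by (simp_all add: b_def r_def field_simps)
  define \<eta> where "\<eta> s = ?t ((r + s)\<^sup>2)" for s
  define \<eta>' where "\<eta>' s = \<theta>' ((r + s)\<^sup>2) * (2 * (r + s))" for s
  \<comment> \<open>The margin down to \<open>- r / 2\<close> serves variations that become slightly
    negative; the argument of \<theta> stays strictly positive, where derivatives are
    two-sided.\<close>
  have arg: "0 < (r + s)\<^sup>2" "(r + s)\<^sup>2 \<le> u0" if "- r / 2 \<le> s" "s \<le> 2 * b" for s
  proof -
    have rs: "0 < r + s" "r + s \<le> sqrt u0" using that r b by auto
    then show "0 < (r + s)\<^sup>2" by simp
    have "(r + s)\<^sup>2 \<le> (sqrt u0)\<^sup>2" using rs by (intro power_mono) auto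
    then show "(r + s)\<^sup>2 \<le> u0" using assms(8) by simp
  qed
  have \<eta>_deriv: "(\<eta> has_real_derivative \<eta>' s) (at s)" if s: "- r / 2 \<le> s" "s \<le> 2 * b" for s
  proof -
    have "((\<lambda>s. (r + s)\<^sup>2) has_real_derivative 2 * (r + s)) (at s)"
      by (auto intro!: derivative_eq_intros)
    from DERIV_chain2[OF \<theta>_deriv[OF arg[OF s]] this]
    have d: "((\<lambda>s. \<theta> ((r + s)\<^sup>2)) has_real_derivative \<eta>' s) (at s)" by (simp add: \<eta>'_def)
    \<comment> \<open>Below \<open>us\<close> the modification coincides with \<theta>; since this
      region of s is open, the derivative carries over.\<close>
    have "open {s. (r + s)\<^sup>2 < us}" by (intro open_Collect_less continuous_intros)
    moreover have "s \<in> {s. (r + s)\<^sup>2 < us}" using arg[OF s] assms(9) by simp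
    ultimately have "eventually (\<lambda>s. s \<in> {s. (r + s)\<^sup>2 < us}) (nhds s)" by (rule eventually_nhds_in_open)
    then have "eventually (\<lambda>s. \<eta> s = \<theta> ((r + s)\<^sup>2)) (nhds s)"
      by eventually_elim (simp add: \<eta>_def right_cont_mod_def)
    with d show ?thesis by (subst DERIV_cong_ev[OF refl _ refl])
  qed
  have \<eta>'_cont: "continuous_on {- r / 2..2 * b} \<eta>'"
    unfolding \<eta>'_def
  proof (intro continuous_intros continuous_on_compose2[OF V(4)])
    show "(\<lambda>s. (r + s)\<^sup>2) ` {- r / 2..2 * b} \<subseteq> V \<inter> {0..}" using arg V(2) by force
  qed
  have \<eta>'_pos: "\<eta>' s > 0" if s: "- r / 2 \<le> s" "s \<le> 2 * b" for s
    using \<theta>'_pos[OF arg[OF s]] s r by (simp add: \<eta>'_def)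
  have le: "- r / 2 \<le> 2 * b" using r b by simp
  obtain x y where xy: "x \<in> {- r / 2..2 * b}" "y \<in> {- r / 2..2 * b}"
    "\<And>z. z \<in> {- r / 2..2 * b} \<Longrightarrow> \<eta>' x \<le> \<eta>' z" "\<And>z. z \<in> {- r / 2..2 * b} \<Longrightarrow> \<eta>' z \<le> \<eta>' y"
    using continuous_compact_bounds[OF \<eta>'_cont le] by blast
  define cm where "cm = \<eta>' x"
  define L where "L = \<eta>' y"
  have cm: "cm > 0" and L: "L > 0" using \<eta>'_pos xy(1,2) by (auto simp: cm_def L_def)
  have slope: "cm * (t - s) \<le> \<eta> t - \<eta> s \<and> \<eta> t - \<eta> s \<le> L * (t - s)"
    if "- r / 2 \<le> s" "s \<le> t" "t \<le> 2 * b" for s t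
  proof (cases "s = t")
    case False
    then have "s < t" using that by simp
    have "\<exists>z>s. z < t \<and> \<eta> t - \<eta> s = (t - s) * \<eta>' z"
      by (rule MVT2[OF \<open>s < t\<close>]) (use \<eta>_deriv that in auto)
    then obtain z where z: "s < z" "z < t" "\<eta> t - \<eta> s = (t - s) * \<eta>' z" by blast
    have "cm \<le> \<eta>' z" "\<eta>' z \<le> L" using xy(3,4) z that by (auto simp: cm_def L_def)
    then show ?thesis using z(3) \<open>s < t\<close> by (simp add: mult.commute)
  qed simp
  \<comment> \<open>Shifting a point of [0, b] by at most this amount stays within the interval from
    \<open>- r / 2\<close> to \<open>2 * b\<close>.\<close>
  define \<tau> where "\<tau> = min (r / 2) b"
  \<comment> \<open>\<open>L\<close> is the slope up to 2 b. For t > 2 b and s \<le> b the distance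
    exceeds b while \<open>\<eta>\<close> rises by at most 1, which gives the slope 1 / b across any
    jump.\<close>
  define cp where "cp = L + 1 / b"
  have U: "open U" "bounded U" using domain_properties[OF assms(5)] .
  have Dc: "compact D" using U(2) assms(7) by (simp add: compact_closure)
  obtain \<rho> where "\<rho> > 0" "\<forall>x\<in>D. norm x \<le> \<rho>"
    using compact_imp_bounded[OF Dc] unfolding bounded_pos by blast
  then have \<rho>: "\<rho> > 0" "D \<subseteq> cball 0 \<rho>" by auto
  obtain e where e: "e > 0" "ball 0 e \<subseteq> U" using U(1) assms(6) openE by blast
  have D_pos: "measure lborel D > 0"
  proof -
    have "0 < measure lborel (ball (0 :: real ^ 'n) e)" using e(1) by (rule content_ball_pos)
    also have "\<dots> \<le> measure lborel D"
    proof (rule measure_mono_fmeasurable)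
      show "ball 0 e \<subseteq> D" using e(2) closure_subset assms(7) by blast
      show "D \<in> fmeasurable lborel" using Dc by (rule fmeasurable_compact)
    qed simp
    finally show ?thesis .
  qed
  \<comment> \<open>The monotonicity range is r = sqrt u, because the square of r + s increases in s
    from s = - r on. The same \<open>L\<close> serves as Lipschitz constant.\<close>
  interpret Q: variational \<eta> \<eta>' D \<rho> r b cm cp L \<tau>
  proof unfold_locales
    show "CARD('n) \<ge> 3" by fact
    show "D \<in> sets borel" using Dc by (simp add: compact_imp_closed)
    show "\<eta> s \<le> \<eta> t" if "- r \<le> s" "s \<le> t" for s t
      unfolding \<eta>_def using that by (intro mono_onD[OF t_mono] power_mono) auto
    show "0 \<le> \<eta> t" "\<eta> t \<le> 1" for t using \<theta>_ge \<theta>_le by (auto simp: \<eta>_def right_cont_mod_def)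
    show "cm * (t - s) \<le> \<eta> t - \<eta> s" if "0 \<le> s" "s \<le> t" "t \<le> 2 * b" for s t
      using slope[of s t] that r by simp
    show "\<eta> t - \<eta> s \<le> cp * (t - s)" if "0 \<le> s" "s \<le> b" "s \<le> t" for s t
    proof (cases "t \<le> 2 * b")
      case True
      then have "\<eta> t - \<eta> s \<le> L * (t - s)" using slope[of s t] that r by simp
      also have "\<dots> \<le> cp * (t - s)" using that b by (intro mult_right_mono) (auto simp: cp_def)
      finally show ?thesis .
    next
      case False
      have "0 \<le> \<eta> s" "\<eta> t \<le> 1" using \<theta>_ge \<theta>_le by (auto simp: \<eta>_def right_cont_mod_def)
      then have "\<eta> t - \<eta> s \<le> 1" by simp
      also have "1 \<le> 1 / b * (t - s)" using False that b by (simp add: field_simps)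
      also have "\<dots> \<le> cp * (t - s)" using that L by (intro mult_right_mono) (auto simp: cp_def)
      finally show ?thesis .
    qed
    show "(\<eta> has_real_derivative \<eta>' s) (at s)" if "0 \<le> s" "s \<le> b" for s
      using that r b by (intro \<eta>_deriv) auto
    show "continuous_on {0..b} \<eta>'" using r b by (intro continuous_on_subset[OF \<eta>'_cont]) auto
    show "cm \<le> \<eta>' s" if "0 \<le> s" "s \<le> b" for s using xy(3)[of s] that r b by (simp add: cm_def)
    show "\<bar>\<eta> (s + t) - \<eta> s\<bar> \<le> L * \<bar>t\<bar>" if "0 \<le> s" "s \<le> b" "\<bar>t\<bar> \<le> \<tau>" for s t
    proof (cases "t \<ge> 0")
      case True
      then have "cm * t \<le> \<eta> (s + t) - \<eta> s" "\<eta> (s + t) - \<eta> s \<le> L * t"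
        using slope[of s "s + t"] that r by (auto simp: \<tau>_def)
      moreover have "cm * t \<ge> 0" using cm True by simp
      ultimately show ?thesis using True by simp
    next
      case False
      then have "cm * - t \<le> \<eta> s - \<eta> (s + t)" "\<eta> s - \<eta> (s + t) \<le> L * - t"
        using slope[of "s + t" s] that b by (auto simp: \<tau>_def)
      moreover have "cm * - t \<ge> 0" using cm False by (intro mult_nonneg_nonneg) auto
      ultimately show ?thesis using False by simp
    qed
  qed (use \<rho> D_pos r b cm L in \<open>auto simp: \<tau>_def cp_def intro: add_pos_pos\<close>)
  have \<eta>0: "\<eta> 0 = \<theta> u" using r(2) assms(9,12) by (simp add: \<eta>_def right_cont_mod_def)
  have less: "\<theta> u < \<theta> us"
  proof -
    have "\<eta> (2 * b) = \<theta> u0"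
      using b(2)[symmetric] assms(8,9) by (simp add: \<eta>_def right_cont_mod_def)
    moreover have "cm * (2 * b - 0) \<le> \<eta> (2 * b) - \<eta> 0" using slope[of 0 "2 * b"] r b by simp
    moreover have "cm * (2 * b - 0) > 0" using cm b by simp
    ultimately have "\<theta> u < \<theta> u0" using \<eta>0 by linarith
    also have "\<theta> u0 \<le> \<theta> us" using assms(8,9) by (intro \<theta>_mono) auto
    finally show ?thesis .
  qed
  \<comment> \<open>Half of the gap makes the required inequality strict; the gap is positive
    because \<open>\<eta>\<close> has slope at least \<open>cm\<close> up to the level
    \<open>u0\<close>.\<close>
  define c1 where "c1 = min Q.\<delta>1 ((\<theta> us - \<theta> u) / 2)"
  show ?thesis
  proof (rule exI[of _ c1], rule exI[of _ Q.K], intro conjI ballI allI impI)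
    show "0 < c1" using Q.\<delta>1_pos less by (simp add: c1_def)
    show "c1 < \<theta> us - \<theta> u" using less by (auto simp: c1_def min_def)
    show "0 < Q.K" by (rule Q.K_pos)
    show "sqrt u0 - sqrt u < sqrt us - sqrt u" using assms(9) by simp
    fix \<nu> \<phi> assume \<nu>: "\<nu> \<in> {\<theta> u..\<theta> u + c1}" and \<phi>: "is_minimizer ?t u D \<nu> \<phi>"
    obtain f F where f: "Q.minimizer \<nu> f F" "AE z in lborel. \<phi> z = f z"
      using Q.dirichlet_minimizer[OF _ t_mono \<phi>] by (auto simp: \<eta>_def r_def)
    have "0 \<le> \<nu> - \<theta> u" "\<nu> - \<theta> u \<le> Q.\<delta>1" using \<nu> by (auto simp: c1_def)
    from Q.minimizer_regular[OF this, of f F] f(1) obtain \<phi>' where \<phi>': "AE z in lborel. f z = \<phi>' z"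
      "\<forall>\<alpha>. 0 < \<alpha> \<and> \<alpha> < 1 \<longrightarrow> C1_holder \<alpha> \<phi>'" "\<forall>z. 0 \<le> \<phi>' z \<and> \<phi>' z \<le> min (Q.K * (\<nu> - \<theta> u)) b"
      by (auto simp: \<eta>0)
    have "AE z in lebesgue. \<phi> z = \<phi>' z"
      unfolding AE_lebesgue_iff using f(2) \<phi>'(1) by eventually_elim simp
    moreover have "b \<le> sqrt u0 - sqrt u" using b by (simp add: r_def)
    ultimately show "\<exists>\<phi>'. (AE z in lebesgue. \<phi> z = \<phi>' z) \<and> (\<forall>\<alpha>. 0 < \<alpha> \<and> \<alpha> < 1 \<longrightarrow> C1_holder \<alpha> \<phi>') \<and>
        (\<forall>z. 0 \<le> \<phi>' z \<and> \<phi>' z \<le> min (Q.K * (\<nu> - \<theta> u)) (sqrt u0 - sqrt u))"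
      using \<phi>'(2,3) by (intro exI[of _ \<phi>'] conjI) (auto intro: order_trans)
  qed
qed

end
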